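(* Let $\mathcal G$ be a locally compact Hausdorff groupoid with unit space $X$ and let $Y$ be a locally compact Hausdorff left $\mathcal G$-space with anchor map $\rho:Y\to X$. Let $A$ and $B$ be $\mathcal G\ltimes Y$-Banach algebras and let $(E,T)\in\mathbb E^{\mathrm{ban}}_{\mathcal G\ltimes Y}(A,B)$. Then $(\rho_*E,\rho_*T)\in\mathbb E^{\mathrm{ban}}_{\mathcal G}(\rho_*A,\rho_*B)$.
   Context: All Banach spaces and algebras are complex; algebras need not be unital. \textbf{Fields.} A u.s.c. field of Banach spaces over a locally compact Hausdorff space $X$ is a family $E=(E_x)_{x\in X}$ of Banach spaces with a set of sections $\Gamma(X,E)\subseteq\prod_xE_x$ such that (C1) it is a linear subspace; (C2) $\{\xi(x):\xi\in\Gamma(X,E)\}$ is dense in $E_x$ for all $x$; (C3) $x\mapsto\|\xi(x)\|$ is upper semi-continuous for all $\xi\in\Gamma(X,E)$; (C4) if $\xi\in\prod_xE_x$ and for all $x$ and $\varepsilon>0$ there are a neighbourhood $U$ of $x$ and $\xi'\in\Gamma(X,E)$ with $\|\xi-\xi'\|\le\varepsilon$ on $U$, then $\xi\in\Gamma(X,E)$. A set satisfying (C1)–(C3) is contained in a unique set satisfying (C1)–(C4), the structure it generates. $\Gamma_0(X,E)$ denotes the sections in $\Gamma(X,E)$ vanishing at infinity. For continuous $f:Y\to X$, $f^*E$ has fibres $E_{f(y)}$ and structure generated by the $\xi\circ f$. A continuous field of linear maps $T:E\to F$ is a family $T_x:E_x\to F_x$ of bounded linear maps sending $\Gamma(X,E)$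 into $\Gamma(X,F)$; it is bounded if $\|T\|:=\sup_x\|T_x\|<\infty$. Fields of bilinear maps are treated likewise. \textbf{Groupoids, pairs.} Let $\mathcal G$ be a locally compact Hausdorff groupoid with unit space $X$, range $r$, source $s$. A $\mathcal G$-Banach space is a u.s.c. field $E$ over $X$ with a continuous field of isometric isomorphisms $s^*E\to r^*E$, written $E_{s(\gamma)}\to E_{r(\gamma)},e\mapsto\gamma e$, with $(\gamma\gamma')e=\gamma(\gamma'e)$. A $\mathcal G$-Banach algebra is a $\mathcal G$-Banach space with an equivariant continuous field of associative products of norm $\le1$; $\mathcal G$-Banach modules are defined likewise, and are non-degenerate if products span a dense subspace of each fibre. A $\mathcal G$-Banach $B$-pair is $E=(E^<,E^>)$, with $E^<$ a left and $E^>$ a right $\mathcal G$-Banach $B$-module, and an equivariant continuous field of brackets $\langle\cdot,\cdot\rangle:E^<\times_XE^>\to B$ of norm $\le1$, left $B$-linear in the first and right $B$-linear in the second variable. $\mathrm L_B(E,F)$ is the set of pairs $T=(T^<,T^>)$ of bounded continuous fields of $B$-linear maps $T^>:E^>\to F^>$, $T^<:F^<\to E^<$ with $\langle T^<\eta,\xi\rangle=\langle\eta,T^>\xi\rangle$. For $\xi^<\in\Gamma_0(X,E^<)$, $\eta^>\in\Gamma_0(X,F^>)$, $|\eta^>\rangle\langle\xi^<|$ is the operator $\xi\mapsto\eta^>\langle\xi^<,\xi\rangle$ on $E^>$, $\eta\mapsto\langle\eta,\eta^>\rangle\xi^<$ on $F^<$; $\mathrm K_B(E,F)$ is the closed linear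 span of these, and $\mathrm K_B(E)=\mathrm K_B(E,E)$. A $\mathcal G$-Banach $A$-$B$-pair is a $\mathcal G$-Banach $B$-pair for which $E^>$ is an $A$-$B$-bimodule and $E^<$ a $B$-$A$-bimodule (equivariantly) with $\langle\xi a,\eta\rangle=\langle\xi,a\eta\rangle$. \textbf{Cycles.} $\mathbb E^{\mathrm{ban}}_{\mathcal G}(A,B)$ is the class of pairs $(E,T)$, where $E$ is a $\mathbb Z/2$-graded non-degenerate $\mathcal G$-Banach $A$-$B$-pair (gradings preserved by $\mathcal G$, $A$, $B$, the bracket being even, $A,B$ trivially graded) and $T\in\mathrm L_B(E,E)$ is odd, such that $[a,T]$ and $a(T^2-1)$ lie in $\mathrm K_B(E)$ for all $a\in\Gamma_0(X,A)$, and $\tilde a\,(\gamma T_{s(\gamma)}\gamma^{-1}-T_{r(\gamma)})_{\gamma\in\mathcal G}\in\mathrm K_{r^*B}(r^*E)$ for all $\tilde a\in\Gamma_0(\mathcal G,r^*A)$. \textbf{Transformation groupoid.} For a left $\mathcal G$-space $Y$ with anchor map $\rho:Y\to X$, $\mathcal G\ltimes Y=\{(\gamma,y)\in\mathcal G\times Y:r(\gamma)=\rho(y)\}$ has unit space $Y$, range $(\gamma,y)\mapsto y$ and source $(\gamma,y)\mapsto\gamma^{-1}y$. \textbf{Pushforward.} Let $Y_x=\rho^{-1}(x)$. For a $\mathcal G\ltimes Y$-Banach space $E$, $\rho_*E$ is the $\mathcal G$-Banach space with fibres $(\rho_*E)_x=\Gamma_0(Y_x,E|_{Y_x})$ (zero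 if $Y_x=\emptyset$; sup norm), structure generated by the sections $\rho_*\xi:x\mapsto\xi|_{Y_x}$, $\xi\in\Gamma_0(Y,E)$, and action $(\gamma\xi)(y)=(\gamma,y)(\xi(\gamma^{-1}y))$ for $y\in Y_{r(\gamma)}$, $\xi\in(\rho_*E)_{s(\gamma)}$. Bounded continuous fields of linear or bilinear maps over $Y$ are pushed forward by applying them pointwise: $(\rho_*T)_x(\xi)(y)=T_y(\xi(y))$. So $\rho_*$ takes $\mathcal G\ltimes Y$-Banach algebras, modules, pairs $\rho_*E=(\rho_*E^<,\rho_*E^>)$ and operators $\rho_*T=(\rho_*T^<,\rho_*T^>)$ to the corresponding objects over $\mathcal G$. *)

theory Defs
  imports "HOL-Analysis.Analysis" "HOL-Algebra.Module"
begin

section \<open>Banach spaces with explicit carrier\<close>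

definition complex_ring :: "complex ring" where
  "complex_ring = \<lparr>carrier = UNIV, mult = (*), one = 1, zero = 0, add = (+)\<rparr>"

text \<open>
  The fibres of a field vary with the base point, so normed spaces carry their own carrier.
  The record of modules from HOL-Algebra has a multiplication and a unit, inherited from rings.
  No axiom below constrains the unit. The multiplication is used only as the product of the fibres
  of a field of Banach algebras.
\<close>

record 'e nspace = "(complex, 'e) module" +
  nrm :: "'e \<Rightarrow> real"

definition ndist :: "'e nspace \<Rightarrow> 'e \<Rightarrow> 'e \<Rightarrow> real" where
  "ndist V u v =
     (if u \<in> carrier V \<and> v \<in> carrier V then nrm V (u \<ominus>\<^bsub>V\<^esub> v) else 0)"

definition ntop :: "'e nspace \<Rightarrow> 'e topology" where
  "ntop V = Metric_space.mtopology (carrier V) (ndist V)"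

definition banach_space :: "'e nspace \<Rightarrow> bool" where
  "banach_space V \<longleftrightarrow>
     module complex_ring V \<and>
     (\<forall>u\<in>carrier V. 0 \<le> nrm V u \<and> (nrm V u = 0 \<longleftrightarrow> u = \<zero>\<^bsub>V\<^esub>)) \<and>
     (\<forall>u\<in>carrier V. \<forall>v\<in>carrier V. nrm V (u \<oplus>\<^bsub>V\<^esub> v) \<le> nrm V u + nrm V v) \<and>
     (\<forall>c. \<forall>u\<in>carrier V. nrm V (c \<odot>\<^bsub>V\<^esub> u) = cmod c * nrm V u) \<and>
     Metric_space.mcomplete (carrier V) (ndist V)"

definition lspan :: "'e nspace \<Rightarrow> 'e set \<Rightarrow> 'e set" where
  "lspan V S = (\<lambda>W. submodule W complex_ring V) hull S"

definition linear_map :: "'e nspace \<Rightarrow> 'f nspace \<Rightarrow> ('e \<Rightarrow> 'f) \<Rightarrow> bool" where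
  "linear_map V W t \<longleftrightarrow>
     t \<in> carrier V \<rightarrow> carrier W \<and>
     (\<forall>u\<in>carrier V. \<forall>v\<in>carrier V. t (u \<oplus>\<^bsub>V\<^esub> v) = t u \<oplus>\<^bsub>W\<^esub> t v) \<and>
     (\<forall>c. \<forall>u\<in>carrier V. t (c \<odot>\<^bsub>V\<^esub> u) = c \<odot>\<^bsub>W\<^esub> t u)"

definition bounded_linear_map :: "'e nspace \<Rightarrow> 'f nspace \<Rightarrow> ('e \<Rightarrow> 'f) \<Rightarrow> bool" where
  "bounded_linear_map V W t \<longleftrightarrow>
     linear_map V W t \<and> (\<exists>C. \<forall>u\<in>carrier V. nrm W (t u) \<le> C * nrm V u)"


section \<open>Upper semi-continuous fields of Banach spaces\<close>

text \<open>
  A field over a topological space has fibres \<open>fib E x\<close>, relevant only for points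
  \<open>x\<close> of the space, and a set \<open>sec E\<close> of sections, which are extensional functions.
  The base spaces are locally compact Hausdorff; this is required where the spaces are introduced
  (groupoids and their spaces, below) and not repeated for each field.
\<close>

record ('x, 'e) bfield =
  fib :: "'x \<Rightarrow> 'e nspace"
  sec :: "('x \<Rightarrow> 'e) set"

definition all_sections :: "'x topology \<Rightarrow> ('x \<Rightarrow> 'e nspace) \<Rightarrow> ('x \<Rightarrow> 'e) set" where
  "all_sections X V = (\<Pi>\<^sub>E x\<in>topspace X. carrier (V x))"

definition linear_subspace :: "'x topology \<Rightarrow> ('x \<Rightarrow> 'e nspace) \<Rightarrow> ('x \<Rightarrow> 'e) set \<Rightarrow> bool" where
  "linear_subspace X V \<Gamma> \<longleftrightarrow>
     \<Gamma> \<subseteq> all_sections X V \<and>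
     (\<lambda>x\<in>topspace X. \<zero>\<^bsub>V x\<^esub>) \<in> \<Gamma> \<and>
     (\<forall>\<xi>\<in>\<Gamma>. \<forall>\<eta>\<in>\<Gamma>. (\<lambda>x\<in>topspace X. \<xi> x \<oplus>\<^bsub>V x\<^esub> \<eta> x) \<in> \<Gamma>) \<and>
     (\<forall>c. \<forall>\<xi>\<in>\<Gamma>. (\<lambda>x\<in>topspace X. c \<odot>\<^bsub>V x\<^esub> \<xi> x) \<in> \<Gamma>)"

definition locally_approximable ::
  "'x topology \<Rightarrow> ('x \<Rightarrow> 'e nspace) \<Rightarrow> ('x \<Rightarrow> 'e) set \<Rightarrow> ('x \<Rightarrow> 'e) \<Rightarrow> bool" where
  "locally_approximable X V \<Gamma> \<xi> \<longleftrightarrow>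
     (\<forall>x\<in>topspace X. \<forall>\<epsilon>>0. \<exists>U \<xi>'. openin X U \<and> x \<in> U \<and> \<xi>' \<in> \<Gamma> \<and>
        (\<forall>z\<in>U. nrm (V z) (\<xi> z \<ominus>\<^bsub>V z\<^esub> \<xi>' z) \<le> \<epsilon>))"

definition usc_structure :: "'x topology \<Rightarrow> ('x \<Rightarrow> 'e nspace) \<Rightarrow> ('x \<Rightarrow> 'e) set \<Rightarrow> bool" where
  "usc_structure X V \<Gamma> \<longleftrightarrow>
     linear_subspace X V \<Gamma> \<and>
     (\<forall>x\<in>topspace X. ntop (V x) closure_of ((\<lambda>\<xi>. \<xi> x) ` \<Gamma>) = carrier (V x)) \<and>
     (\<forall>\<xi>\<in>\<Gamma>. \<forall>c. openin X {x \<in> topspace X. nrm (V x) (\<xi> x) < c}) \<and>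
     (\<forall>\<xi>\<in>all_sections X V. locally_approximable X V \<Gamma> \<xi> \<longrightarrow> \<xi> \<in> \<Gamma>)"

definition usc_field :: "'x topology \<Rightarrow> ('x, 'e, 'm) bfield_scheme \<Rightarrow> bool" where
  "usc_field X E \<longleftrightarrow>
     (\<forall>x\<in>topspace X. banach_space (fib E x)) \<and> usc_structure X (fib E) (sec E)"

definition generated_structure ::
  "'x topology \<Rightarrow> ('x \<Rightarrow> 'e nspace) \<Rightarrow> ('x \<Rightarrow> 'e) set \<Rightarrow> ('x \<Rightarrow> 'e) set" where
  "generated_structure X V \<Gamma> = (THE \<Delta>. \<Gamma> \<subseteq> \<Delta> \<and> usc_structure X V \<Delta>)"

definition sections0 :: "'x topology \<Rightarrow> ('x, 'e, 'm) bfield_scheme \<Rightarrow> ('x \<Rightarrow> 'e) set" where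
  "sections0 X E =
     {\<xi> \<in> sec E. \<forall>\<epsilon>>0. \<exists>K. compactin X K \<and>
        (\<forall>x\<in>topspace X - K. nrm (fib E x) (\<xi> x) < \<epsilon>)}"

definition pullback ::
  "'y topology \<Rightarrow> ('y \<Rightarrow> 'x) \<Rightarrow> ('x, 'e, 'm) bfield_scheme \<Rightarrow> ('y, 'e) bfield" where
  "pullback Y f E =
     \<lparr>fib = (\<lambda>y. fib E (f y)),
      sec = generated_structure Y (\<lambda>y. fib E (f y)) ((\<lambda>\<xi>. \<lambda>y\<in>topspace Y. \<xi> (f y)) ` sec E)\<rparr>"

definition linear_field ::
  "'x topology \<Rightarrow> ('x, 'e, 'm) bfield_scheme \<Rightarrow> ('x, 'f, 'n) bfield_scheme
     \<Rightarrow> ('x \<Rightarrow> 'e \<Rightarrow> 'f) \<Rightarrow> bool" where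
  "linear_field X E F T \<longleftrightarrow>
     (\<forall>x\<in>topspace X. bounded_linear_map (fib E x) (fib F x) (T x)) \<and>
     (\<forall>\<xi>\<in>sec E. (\<lambda>x\<in>topspace X. T x (\<xi> x)) \<in> sec F)"

text \<open>The assertion \<open>\<parallel>T\<parallel> \<le> C\<close> for the supremum of the fibrewise operator norms.\<close>

definition norm_le ::
  "'x topology \<Rightarrow> ('x, 'e, 'm) bfield_scheme \<Rightarrow> ('x, 'f, 'n) bfield_scheme
     \<Rightarrow> ('x \<Rightarrow> 'e \<Rightarrow> 'f) \<Rightarrow> real \<Rightarrow> bool" where
  "norm_le X E F T C \<longleftrightarrow>
     (\<forall>x\<in>topspace X. \<forall>e\<in>carrier (fib E x). nrm (fib F x) (T x e) \<le> C * nrm (fib E x) e)"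

definition bounded_linear_field ::
  "'x topology \<Rightarrow> ('x, 'e, 'm) bfield_scheme \<Rightarrow> ('x, 'f, 'n) bfield_scheme
     \<Rightarrow> ('x \<Rightarrow> 'e \<Rightarrow> 'f) \<Rightarrow> bool" where
  "bounded_linear_field X E F T \<longleftrightarrow> linear_field X E F T \<and> (\<exists>C. norm_le X E F T C)"

definition contractive_bilinear_field ::
  "'x topology \<Rightarrow> ('x, 'e, 'm) bfield_scheme \<Rightarrow> ('x, 'f, 'n) bfield_scheme
     \<Rightarrow> ('x, 'h, 'k) bfield_scheme \<Rightarrow> ('x \<Rightarrow> 'e \<Rightarrow> 'f \<Rightarrow> 'h) \<Rightarrow> bool" where
  "contractive_bilinear_field X E F H \<mu> \<longleftrightarrow>
     (\<forall>x\<in>topspace X.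
        (\<forall>e\<in>carrier (fib E x). linear_map (fib F x) (fib H x) (\<mu> x e)) \<and>
        (\<forall>f\<in>carrier (fib F x). linear_map (fib E x) (fib H x) (\<lambda>e. \<mu> x e f)) \<and>
        (\<forall>e\<in>carrier (fib E x). \<forall>f\<in>carrier (fib F x).
           nrm (fib H x) (\<mu> x e f) \<le> nrm (fib E x) e * nrm (fib F x) f)) \<and>
     (\<forall>\<xi>\<in>sec E. \<forall>\<eta>\<in>sec F. (\<lambda>x\<in>topspace X. \<mu> x (\<xi> x) (\<eta> x)) \<in> sec H)"


section \<open>Groupoids and their spaces\<close>

text \<open>
  The unit space is a space of its own, embedded in the space of arrows by \<open>unt\<close>.
  The product \<open>gmult G \<gamma> \<gamma>'\<close> is meaningful if \<open>src G \<gamma> = rng G \<gamma>'\<close>.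
  That the unit space is locally compact Hausdorff follows from the other axioms, since \<open>unt\<close>
  embeds it as a closed subspace.
\<close>

record ('g, 'x) groupoid =
  arr :: "'g topology"
  obj :: "'x topology"
  rng :: "'g \<Rightarrow> 'x"
  src :: "'g \<Rightarrow> 'x"
  unt :: "'x \<Rightarrow> 'g"
  gmult :: "'g \<Rightarrow> 'g \<Rightarrow> 'g"
  ginv :: "'g \<Rightarrow> 'g"

definition composable :: "('g, 'x) groupoid \<Rightarrow> ('g \<times> 'g) set" where
  "composable G =
     {(\<gamma>, \<gamma>') \<in> topspace (arr G) \<times> topspace (arr G). src G \<gamma> = rng G \<gamma>'}"

definition lch_groupoid :: "('g, 'x) groupoid \<Rightarrow> bool" where
  "lch_groupoid G \<longleftrightarrow>
     Hausdorff_space (arr G) \<and> locally_compact_space (arr G) \<and>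
     Hausdorff_space (obj G) \<and> locally_compact_space (obj G) \<and>
     continuous_map (arr G) (obj G) (rng G) \<and>
     continuous_map (arr G) (obj G) (src G) \<and>
     continuous_map (obj G) (arr G) (unt G) \<and>
     continuous_map (arr G) (arr G) (ginv G) \<and>
     continuous_map (subtopology (prod_topology (arr G) (arr G)) (composable G)) (arr G)
       (\<lambda>(\<gamma>, \<gamma>'). gmult G \<gamma> \<gamma>') \<and>
     (\<forall>x\<in>topspace (obj G). rng G (unt G x) = x \<and> src G (unt G x) = x) \<and>
     (\<forall>(\<gamma>, \<gamma>')\<in>composable G.
        rng G (gmult G \<gamma> \<gamma>') = rng G \<gamma> \<and> src G (gmult G \<gamma> \<gamma>') = src G \<gamma>') \<and>
     (\<forall>\<gamma> \<gamma>' \<gamma>''. (\<gamma>, \<gamma>') \<in> composable G \<and> (\<gamma>', \<gamma>'') \<in> composable G \<longrightarrow>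
        gmult G (gmult G \<gamma> \<gamma>') \<gamma>'' = gmult G \<gamma> (gmult G \<gamma>' \<gamma>'')) \<and>
     (\<forall>\<gamma>\<in>topspace (arr G).
        gmult G (unt G (rng G \<gamma>)) \<gamma> = \<gamma> \<and> gmult G \<gamma> (unt G (src G \<gamma>)) = \<gamma> \<and>
        rng G (ginv G \<gamma>) = src G \<gamma> \<and> src G (ginv G \<gamma>) = rng G \<gamma> \<and>
        gmult G \<gamma> (ginv G \<gamma>) = unt G (rng G \<gamma>) \<and>
        gmult G (ginv G \<gamma>) \<gamma> = unt G (src G \<gamma>))"

record ('g, 'x, 'y) gspace =
  spc :: "'y topology"
  anchor :: "'y \<Rightarrow> 'x"
  act :: "'g \<Rightarrow> 'y \<Rightarrow> 'y"

definition lch_gspace :: "('g, 'x) groupoid \<Rightarrow> ('g, 'x, 'y) gspace \<Rightarrow> bool" where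
  "lch_gspace G Y \<longleftrightarrow>
     Hausdorff_space (spc Y) \<and> locally_compact_space (spc Y) \<and>
     continuous_map (spc Y) (obj G) (anchor Y) \<and>
     continuous_map
       (subtopology (prod_topology (arr G) (spc Y)) {(\<gamma>, y). src G \<gamma> = anchor Y y}) (spc Y)
       (\<lambda>(\<gamma>, y). act Y \<gamma> y) \<and>
     (\<forall>\<gamma>\<in>topspace (arr G). \<forall>y\<in>topspace (spc Y). src G \<gamma> = anchor Y y \<longrightarrow>
        anchor Y (act Y \<gamma> y) = rng G \<gamma>) \<and>
     (\<forall>y\<in>topspace (spc Y). act Y (unt G (anchor Y y)) y = y) \<and>
     (\<forall>(\<gamma>, \<gamma>')\<in>composable G. \<forall>y\<in>topspace (spc Y). src G \<gamma>' = anchor Y y \<longrightarrow>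
        act Y (gmult G \<gamma> \<gamma>') y = act Y \<gamma> (act Y \<gamma>' y))"

definition transformation_groupoid ::
  "('g, 'x) groupoid \<Rightarrow> ('g, 'x, 'y) gspace \<Rightarrow> ('g \<times> 'y, 'y) groupoid" where
  "transformation_groupoid G Y =
     \<lparr>arr = subtopology (prod_topology (arr G) (spc Y)) {(\<gamma>, y). rng G \<gamma> = anchor Y y},
      obj = spc Y,
      rng = (\<lambda>(\<gamma>, y). y),
      src = (\<lambda>(\<gamma>, y). act Y (ginv G \<gamma>) y),
      unt = (\<lambda>y. (unt G (anchor Y y), y)),
      gmult = (\<lambda>(\<gamma>, y) (\<gamma>', y'). (gmult G \<gamma> \<gamma>', y)),
      ginv = (\<lambda>(\<gamma>, y). (ginv G \<gamma>, act Y (ginv G \<gamma>) y))\<rparr>"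


section \<open>Equivariant Banach spaces, algebras, modules and pairs\<close>

definition g_banach_space ::
  "('g, 'x) groupoid \<Rightarrow> ('x, 'e, 'm) bfield_scheme \<Rightarrow> ('g \<Rightarrow> 'e \<Rightarrow> 'e) \<Rightarrow> bool" where
  "g_banach_space G E \<alpha> \<longleftrightarrow>
     usc_field (obj G) E \<and>
     linear_field (arr G) (pullback (arr G) (src G) E) (pullback (arr G) (rng G) E) \<alpha> \<and>
     (\<forall>\<gamma>\<in>topspace (arr G).
        bij_betw (\<alpha> \<gamma>) (carrier (fib E (src G \<gamma>))) (carrier (fib E (rng G \<gamma>))) \<and>
        (\<forall>e\<in>carrier (fib E (src G \<gamma>)).
           nrm (fib E (rng G \<gamma>)) (\<alpha> \<gamma> e) = nrm (fib E (src G \<gamma>)) e)) \<and>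
     (\<forall>(\<gamma>, \<gamma>')\<in>composable G. \<forall>e\<in>carrier (fib E (src G \<gamma>')).
        \<alpha> (gmult G \<gamma> \<gamma>') e = \<alpha> \<gamma> (\<alpha> \<gamma>' e))"

definition equivariant_linear ::
  "('g, 'x) groupoid \<Rightarrow> ('x, 'e, 'm) bfield_scheme \<Rightarrow> ('g \<Rightarrow> 'e \<Rightarrow> 'e) \<Rightarrow> ('g \<Rightarrow> 'f \<Rightarrow> 'f)
     \<Rightarrow> ('x \<Rightarrow> 'e \<Rightarrow> 'f) \<Rightarrow> bool" where
  "equivariant_linear G E \<alpha> \<beta> T \<longleftrightarrow>
     (\<forall>\<gamma>\<in>topspace (arr G). \<forall>e\<in>carrier (fib E (src G \<gamma>)).
        \<beta> \<gamma> (T (src G \<gamma>) e) = T (rng G \<gamma>) (\<alpha> \<gamma> e))"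

definition equivariant_bilinear ::
  "('g, 'x) groupoid \<Rightarrow> ('x, 'e, 'm) bfield_scheme \<Rightarrow> ('g \<Rightarrow> 'e \<Rightarrow> 'e)
     \<Rightarrow> ('x, 'f, 'n) bfield_scheme \<Rightarrow> ('g \<Rightarrow> 'f \<Rightarrow> 'f) \<Rightarrow> ('g \<Rightarrow> 'h \<Rightarrow> 'h)
     \<Rightarrow> ('x \<Rightarrow> 'e \<Rightarrow> 'f \<Rightarrow> 'h) \<Rightarrow> bool" where
  "equivariant_bilinear G E \<alpha> F \<beta> \<delta> \<mu> \<longleftrightarrow>
     (\<forall>\<gamma>\<in>topspace (arr G). \<forall>e\<in>carrier (fib E (src G \<gamma>)). \<forall>f\<in>carrier (fib F (src G \<gamma>)).
        \<delta> \<gamma> (\<mu> (src G \<gamma>) e f) = \<mu> (rng G \<gamma>) (\<alpha> \<gamma> e) (\<beta> \<gamma> f))"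

record ('g, 'x, 'e) gfield = "('x, 'e) bfield" +
  gact :: "'g \<Rightarrow> 'e \<Rightarrow> 'e"

definition g_banach_algebra :: "('g, 'x) groupoid \<Rightarrow> ('g, 'x, 'a) gfield \<Rightarrow> bool" where
  "g_banach_algebra G A \<longleftrightarrow>
     g_banach_space G A (gact A) \<and>
     contractive_bilinear_field (obj G) A A A (\<lambda>x a b. a \<otimes>\<^bsub>fib A x\<^esub> b) \<and>
     (\<forall>x\<in>topspace (obj G). \<forall>a\<in>carrier (fib A x). \<forall>b\<in>carrier (fib A x). \<forall>c\<in>carrier (fib A x).
        (a \<otimes>\<^bsub>fib A x\<^esub> b) \<otimes>\<^bsub>fib A x\<^esub> c = a \<otimes>\<^bsub>fib A x\<^esub> (b \<otimes>\<^bsub>fib A x\<^esub> c)) \<and>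
     equivariant_bilinear G A (gact A) A (gact A) (gact A) (\<lambda>x a b. a \<otimes>\<^bsub>fib A x\<^esub> b)"

definition left_g_module ::
  "('g, 'x) groupoid \<Rightarrow> ('g, 'x, 'a) gfield \<Rightarrow> ('x, 'e) bfield \<Rightarrow> ('g \<Rightarrow> 'e \<Rightarrow> 'e)
     \<Rightarrow> ('x \<Rightarrow> 'a \<Rightarrow> 'e \<Rightarrow> 'e) \<Rightarrow> bool" where
  "left_g_module G A E \<alpha> \<mu> \<longleftrightarrow>
     g_banach_space G E \<alpha> \<and>
     contractive_bilinear_field (obj G) A E E \<mu> \<and>
     (\<forall>x\<in>topspace (obj G). \<forall>a\<in>carrier (fib A x). \<forall>b\<in>carrier (fib A x). \<forall>e\<in>carrier (fib E x).
        \<mu> x (a \<otimes>\<^bsub>fib A x\<^esub> b) e = \<mu> x a (\<mu> x b e)) \<and>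
     equivariant_bilinear G A (gact A) E \<alpha> \<alpha> \<mu>"

definition right_g_module ::
  "('g, 'x) groupoid \<Rightarrow> ('g, 'x, 'a) gfield \<Rightarrow> ('x, 'e) bfield \<Rightarrow> ('g \<Rightarrow> 'e \<Rightarrow> 'e)
     \<Rightarrow> ('x \<Rightarrow> 'e \<Rightarrow> 'a \<Rightarrow> 'e) \<Rightarrow> bool" where
  "right_g_module G A E \<alpha> \<mu> \<longleftrightarrow>
     g_banach_space G E \<alpha> \<and>
     contractive_bilinear_field (obj G) E A E \<mu> \<and>
     (\<forall>x\<in>topspace (obj G). \<forall>e\<in>carrier (fib E x). \<forall>a\<in>carrier (fib A x). \<forall>b\<in>carrier (fib A x).
        \<mu> x e (a \<otimes>\<^bsub>fib A x\<^esub> b) = \<mu> x (\<mu> x e a) b) \<and>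
     equivariant_bilinear G E \<alpha> A (gact A) \<alpha> \<mu>"

text \<open>The values of \<open>\<mu>\<close> span a dense subspace of each fibre of \<open>H\<close>.\<close>

definition nondegenerate ::
  "'x topology \<Rightarrow> ('x, 'e, 'm) bfield_scheme \<Rightarrow> ('x, 'f, 'n) bfield_scheme
     \<Rightarrow> ('x, 'h, 'k) bfield_scheme \<Rightarrow> ('x \<Rightarrow> 'e \<Rightarrow> 'f \<Rightarrow> 'h) \<Rightarrow> bool" where
  "nondegenerate X E F H \<mu> \<longleftrightarrow>
     (\<forall>x\<in>topspace X.
        ntop (fib H x) closure_of
          lspan (fib H x) {\<mu> x e f |e f. e \<in> carrier (fib E x) \<and> f \<in> carrier (fib F x)}
        = carrier (fib H x))"

text \<open>
  The data of a pair of fields over \<open>B\<close> without group action: \<open>lft\<close> is \<open>E\<^sup><\<close>,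
  \<open>rgt\<close> is \<open>E\<^sup>>\<close>, \<open>lB\<close> is the left action of \<open>B\<close> on \<open>E\<^sup><\<close> and \<open>rB\<close> the right action
  of \<open>B\<close> on \<open>E\<^sup>>\<close>.
\<close>

record ('x, 'b, 'l, 'r) bpair =
  lft :: "('x, 'l) bfield"
  rgt :: "('x, 'r) bfield"
  brk :: "'x \<Rightarrow> 'l \<Rightarrow> 'r \<Rightarrow> 'b"
  lB :: "'x \<Rightarrow> 'b \<Rightarrow> 'l \<Rightarrow> 'l"
  rB :: "'x \<Rightarrow> 'r \<Rightarrow> 'b \<Rightarrow> 'r"

text \<open>
  The groupoid acts by \<open>lact\<close> on \<open>E\<^sup><\<close> and by \<open>ract\<close> on \<open>E\<^sup>>\<close>; \<open>A\<close> acts from the right on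
  \<open>E\<^sup><\<close> by \<open>lA\<close> and from the left on \<open>E\<^sup>>\<close> by \<open>rA\<close>; \<open>lgr\<close> and \<open>rgr\<close> are the grading
  involutions of \<open>E\<^sup><\<close> and \<open>E\<^sup>>\<close>.
\<close>

record ('g, 'x, 'a, 'b, 'l, 'r) abpair = "('x, 'b, 'l, 'r) bpair" +
  lact :: "'g \<Rightarrow> 'l \<Rightarrow> 'l"
  ract :: "'g \<Rightarrow> 'r \<Rightarrow> 'r"
  lA :: "'x \<Rightarrow> 'l \<Rightarrow> 'a \<Rightarrow> 'l"
  rA :: "'x \<Rightarrow> 'a \<Rightarrow> 'r \<Rightarrow> 'r"
  lgr :: "'x \<Rightarrow> 'l \<Rightarrow> 'l"
  rgr :: "'x \<Rightarrow> 'r \<Rightarrow> 'r"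

definition g_banach_pair ::
  "('g, 'x) groupoid \<Rightarrow> ('g, 'x, 'b) gfield \<Rightarrow> ('g, 'x, 'a, 'b, 'l, 'r) abpair \<Rightarrow> bool" where
  "g_banach_pair G B E \<longleftrightarrow>
     left_g_module G B (lft E) (lact E) (lB E) \<and>
     right_g_module G B (rgt E) (ract E) (rB E) \<and>
     contractive_bilinear_field (obj G) (lft E) (rgt E) B (brk E) \<and>
     equivariant_bilinear G (lft E) (lact E) (rgt E) (ract E) (gact B) (brk E) \<and>
     (\<forall>x\<in>topspace (obj G). \<forall>b\<in>carrier (fib B x).
        \<forall>\<eta>\<in>carrier (fib (lft E) x). \<forall>\<xi>\<in>carrier (fib (rgt E) x).
          brk E x (lB E x b \<eta>) \<xi> = b \<otimes>\<^bsub>fib B x\<^esub> brk E x \<eta> \<xi> \<and>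
          brk E x \<eta> (rB E x \<xi> b) = brk E x \<eta> \<xi> \<otimes>\<^bsub>fib B x\<^esub> b)"

definition g_banach_ab_pair ::
  "('g, 'x) groupoid \<Rightarrow> ('g, 'x, 'a) gfield \<Rightarrow> ('g, 'x, 'b) gfield
     \<Rightarrow> ('g, 'x, 'a, 'b, 'l, 'r) abpair \<Rightarrow> bool" where
  "g_banach_ab_pair G A B E \<longleftrightarrow>
     g_banach_pair G B E \<and>
     right_g_module G A (lft E) (lact E) (lA E) \<and>
     left_g_module G A (rgt E) (ract E) (rA E) \<and>
     (\<forall>x\<in>topspace (obj G). \<forall>a\<in>carrier (fib A x). \<forall>b\<in>carrier (fib B x).
        (\<forall>\<eta>\<in>carrier (fib (lft E) x). lA E x (lB E x b \<eta>) a = lB E x b (lA E x \<eta> a)) \<and>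
        (\<forall>\<xi>\<in>carrier (fib (rgt E) x). rB E x (rA E x a \<xi>) b = rA E x a (rB E x \<xi> b))) \<and>
     (\<forall>x\<in>topspace (obj G). \<forall>a\<in>carrier (fib A x).
        \<forall>\<eta>\<in>carrier (fib (lft E) x). \<forall>\<xi>\<in>carrier (fib (rgt E) x).
          brk E x (lA E x \<eta> a) \<xi> = brk E x \<eta> (rA E x a \<xi>))"

text \<open>
  A grading is given by the involution that is the identity on the even and minus the identity on
  the odd part. It is a bounded field, so that it can be pushed forward.
\<close>

definition graded_field ::
  "('g, 'x) groupoid \<Rightarrow> ('x, 'e) bfield \<Rightarrow> ('g \<Rightarrow> 'e \<Rightarrow> 'e) \<Rightarrow> ('x \<Rightarrow> 'e \<Rightarrow> 'e) \<Rightarrow> bool" where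
  "graded_field G E \<alpha> \<sigma> \<longleftrightarrow>
     bounded_linear_field (obj G) E E \<sigma> \<and>
     (\<forall>x\<in>topspace (obj G). \<forall>e\<in>carrier (fib E x). \<sigma> x (\<sigma> x e) = e) \<and>
     equivariant_linear G E \<alpha> \<alpha> \<sigma>"

text \<open>
  Since \<open>A\<close> and \<open>B\<close> are trivially graded, evenness of the actions means that they commute
  with the involutions, and evenness of the bracket that it is invariant under them.
\<close>

definition graded_pair ::
  "('g, 'x) groupoid \<Rightarrow> ('g, 'x, 'a) gfield \<Rightarrow> ('g, 'x, 'b) gfield
     \<Rightarrow> ('g, 'x, 'a, 'b, 'l, 'r) abpair \<Rightarrow> bool" where
  "graded_pair G A B E \<longleftrightarrow>
     graded_field G (lft E) (lact E) (lgr E) \<and>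
     graded_field G (rgt E) (ract E) (rgr E) \<and>
     (\<forall>x\<in>topspace (obj G).
        (\<forall>\<eta>\<in>carrier (fib (lft E) x).
           (\<forall>a\<in>carrier (fib A x). lgr E x (lA E x \<eta> a) = lA E x (lgr E x \<eta>) a) \<and>
           (\<forall>b\<in>carrier (fib B x). lgr E x (lB E x b \<eta>) = lB E x b (lgr E x \<eta>))) \<and>
        (\<forall>\<xi>\<in>carrier (fib (rgt E) x).
           (\<forall>a\<in>carrier (fib A x). rgr E x (rA E x a \<xi>) = rA E x a (rgr E x \<xi>)) \<and>
           (\<forall>b\<in>carrier (fib B x). rgr E x (rB E x \<xi> b) = rB E x (rgr E x \<xi>) b)) \<and>
        (\<forall>\<eta>\<in>carrier (fib (lft E) x). \<forall>\<xi>\<in>carrier (fib (rgt E) x).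
           brk E x (lgr E x \<eta>) (rgr E x \<xi>) = brk E x \<eta> \<xi>))"

text \<open>
  The flag covers both usages of the term non-degenerate for an \<open>A\<close>-\<open>B\<close>-pair:
  if \<open>ndA\<close> is false, only the actions of \<open>B\<close> are required to be non-degenerate, otherwise the
  actions of \<open>A\<close> as well.
\<close>

definition nondegenerate_pair ::
  "bool \<Rightarrow> ('g, 'x) groupoid \<Rightarrow> ('g, 'x, 'a) gfield \<Rightarrow> ('g, 'x, 'b) gfield
     \<Rightarrow> ('g, 'x, 'a, 'b, 'l, 'r) abpair \<Rightarrow> bool" where
  "nondegenerate_pair ndA G A B E \<longleftrightarrow>
     nondegenerate (obj G) B (lft E) (lft E) (lB E) \<and>
     nondegenerate (obj G) (rgt E) B (rgt E) (rB E) \<and>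
     (ndA \<longrightarrow> nondegenerate (obj G) (lft E) A (lft E) (lA E) \<and>
             nondegenerate (obj G) A (rgt E) (rgt E) (rA E))"


section \<open>Operators between pairs\<close>

text \<open>An operator \<open>T\<close> from \<open>E\<close> to \<open>F\<close> is the pair \<open>(T\<^sup><, T\<^sup>>)\<close>; only values on the
  carriers of the fibres are relevant.\<close>

type_synonym ('x, 'l, 'r, 'l1, 'r1) bop = "('x \<Rightarrow> 'l1 \<Rightarrow> 'l) \<times> ('x \<Rightarrow> 'r \<Rightarrow> 'r1)"

definition L_op ::
  "'x topology \<Rightarrow> ('x, 'b, 'm) bfield_scheme \<Rightarrow> ('x, 'b, 'l, 'r, 'n) bpair_scheme
     \<Rightarrow> ('x, 'b, 'l1, 'r1, 'k) bpair_scheme \<Rightarrow> ('x, 'l, 'r, 'l1, 'r1) bop set" where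
  "L_op X B E F =
     {(Tl, Tr).
        bounded_linear_field X (lft F) (lft E) Tl \<and>
        bounded_linear_field X (rgt E) (rgt F) Tr \<and>
        (\<forall>x\<in>topspace X. \<forall>b\<in>carrier (fib B x).
           (\<forall>\<eta>\<in>carrier (fib (lft F) x). Tl x (lB F x b \<eta>) = lB E x b (Tl x \<eta>)) \<and>
           (\<forall>\<xi>\<in>carrier (fib (rgt E) x). Tr x (rB E x \<xi> b) = rB F x (Tr x \<xi>) b)) \<and>
        (\<forall>x\<in>topspace X. \<forall>\<eta>\<in>carrier (fib (lft F) x). \<forall>\<xi>\<in>carrier (fib (rgt E) x).
           brk E x (Tl x \<eta>) \<xi> = brk F x \<eta> (Tr x \<xi>))}"

definition op_zero ::
  "('x, 'b, 'l, 'r, 'n) bpair_scheme \<Rightarrow> ('x, 'b, 'l1, 'r1, 'k) bpair_scheme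
     \<Rightarrow> ('x, 'l, 'r, 'l1, 'r1) bop" where
  "op_zero E F = ((\<lambda>x \<eta>. \<zero>\<^bsub>fib (lft E) x\<^esub>), (\<lambda>x \<xi>. \<zero>\<^bsub>fib (rgt F) x\<^esub>))"

definition op_add ::
  "('x, 'b, 'l, 'r, 'n) bpair_scheme \<Rightarrow> ('x, 'b, 'l1, 'r1, 'k) bpair_scheme
     \<Rightarrow> ('x, 'l, 'r, 'l1, 'r1) bop \<Rightarrow> ('x, 'l, 'r, 'l1, 'r1) bop
     \<Rightarrow> ('x, 'l, 'r, 'l1, 'r1) bop" where
  "op_add E F S T =
     ((\<lambda>x \<eta>. fst S x \<eta> \<oplus>\<^bsub>fib (lft E) x\<^esub> fst T x \<eta>),
      (\<lambda>x \<xi>. snd S x \<xi> \<oplus>\<^bsub>fib (rgt F) x\<^esub> snd T x \<xi>))"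

definition op_smult ::
  "('x, 'b, 'l, 'r, 'n) bpair_scheme \<Rightarrow> ('x, 'b, 'l1, 'r1, 'k) bpair_scheme
     \<Rightarrow> complex \<Rightarrow> ('x, 'l, 'r, 'l1, 'r1) bop \<Rightarrow> ('x, 'l, 'r, 'l1, 'r1) bop" where
  "op_smult E F c T =
     ((\<lambda>x \<eta>. c \<odot>\<^bsub>fib (lft E) x\<^esub> fst T x \<eta>), (\<lambda>x \<xi>. c \<odot>\<^bsub>fib (rgt F) x\<^esub> snd T x \<xi>))"

definition op_diff ::
  "('x, 'b, 'l, 'r, 'n) bpair_scheme \<Rightarrow> ('x, 'b, 'l1, 'r1, 'k) bpair_scheme
     \<Rightarrow> ('x, 'l, 'r, 'l1, 'r1) bop \<Rightarrow> ('x, 'l, 'r, 'l1, 'r1) bop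
     \<Rightarrow> ('x, 'l, 'r, 'l1, 'r1) bop" where
  "op_diff E F S T =
     ((\<lambda>x \<eta>. fst S x \<eta> \<ominus>\<^bsub>fib (lft E) x\<^esub> fst T x \<eta>),
      (\<lambda>x \<xi>. snd S x \<xi> \<ominus>\<^bsub>fib (rgt F) x\<^esub> snd T x \<xi>))"

definition op_id :: "('x, 'l, 'r, 'l, 'r) bop" where
  "op_id = ((\<lambda>x \<eta>. \<eta>), (\<lambda>x \<xi>. \<xi>))"

text \<open>The product \<open>S T\<close>; the first components compose in the opposite order.\<close>

definition op_comp ::
  "('x, 'l1, 'r1, 'l2, 'r2) bop \<Rightarrow> ('x, 'l, 'r, 'l1, 'r1) bop
     \<Rightarrow> ('x, 'l, 'r, 'l2, 'r2) bop" where
  "op_comp S T = ((\<lambda>x \<eta>. fst T x (fst S x \<eta>)), (\<lambda>x \<xi>. snd S x (snd T x \<xi>)))"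

definition rank_one ::
  "('x, 'b, 'l, 'r, 'n) bpair_scheme \<Rightarrow> ('x, 'b, 'l1, 'r1, 'k) bpair_scheme
     \<Rightarrow> ('x \<Rightarrow> 'r1) \<Rightarrow> ('x \<Rightarrow> 'l) \<Rightarrow> ('x, 'l, 'r, 'l1, 'r1) bop" where
  "rank_one E F \<eta> \<xi> =
     ((\<lambda>x \<zeta>. lB E x (brk F x \<zeta> (\<eta> x)) (\<xi> x)), (\<lambda>x \<zeta>. rB F x (\<eta> x) (brk E x (\<xi> x) \<zeta>)))"

inductive_set finite_rank ::
  "'x topology \<Rightarrow> ('x, 'b, 'l, 'r, 'n) bpair_scheme \<Rightarrow> ('x, 'b, 'l1, 'r1, 'k) bpair_scheme
     \<Rightarrow> ('x, 'l, 'r, 'l1, 'r1) bop set" for X E F where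
  zero: "op_zero E F \<in> finite_rank X E F"
| add: "S \<in> finite_rank X E F \<Longrightarrow> \<eta> \<in> sections0 X (rgt F) \<Longrightarrow> \<xi> \<in> sections0 X (lft E) \<Longrightarrow>
    op_add E F S (op_smult E F c (rank_one E F \<eta> \<xi>)) \<in> finite_rank X E F"

definition K_op ::
  "'x topology \<Rightarrow> ('x, 'b, 'm) bfield_scheme \<Rightarrow> ('x, 'b, 'l, 'r, 'n) bpair_scheme
     \<Rightarrow> ('x, 'b, 'l1, 'r1, 'k) bpair_scheme \<Rightarrow> ('x, 'l, 'r, 'l1, 'r1) bop set" where
  "K_op X B E F =
     {T \<in> L_op X B E F. \<forall>\<epsilon>>0. \<exists>S\<in>finite_rank X E F.
        norm_le X (lft F) (lft E) (fst (op_diff E F T S)) \<epsilon> \<and>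
        norm_le X (rgt E) (rgt F) (snd (op_diff E F T S)) \<epsilon>}"

definition pullback_pair ::
  "'z topology \<Rightarrow> ('z \<Rightarrow> 'x) \<Rightarrow> ('x, 'b, 'l, 'r, 'n) bpair_scheme \<Rightarrow> ('z, 'b, 'l, 'r) bpair"
  where
  "pullback_pair Z f E =
     \<lparr>lft = pullback Z f (lft E), rgt = pullback Z f (rgt E),
      brk = (\<lambda>z. brk E (f z)), lB = (\<lambda>z. lB E (f z)), rB = (\<lambda>z. rB E (f z))\<rparr>"


section \<open>Cycles\<close>

text \<open>The operator given by a section \<open>a\<close> of \<open>f\<^sup>* A\<close> acting on \<open>f\<^sup>* E\<close>.\<close>

definition op_of ::
  "('g, 'x, 'a, 'b, 'l, 'r) abpair \<Rightarrow> ('z \<Rightarrow> 'x) \<Rightarrow> ('z \<Rightarrow> 'a) \<Rightarrow> ('z, 'l, 'r, 'l, 'r) bop" where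
  "op_of E f a = ((\<lambda>z \<eta>. lA E (f z) \<eta> (a z)), (\<lambda>z \<xi>. rA E (f z) (a z) \<xi>))"

text \<open>The family \<open>\<gamma> T\<^bsub>s(\<gamma>)\<^esub> \<gamma>\<^sup>-\<^sup>1\<close> over the arrows.\<close>

definition op_conj ::
  "('g, 'x) groupoid \<Rightarrow> ('g, 'x, 'a, 'b, 'l, 'r) abpair \<Rightarrow> ('x, 'l, 'r, 'l, 'r) bop
     \<Rightarrow> ('g, 'l, 'r, 'l, 'r) bop" where
  "op_conj G E T =
     ((\<lambda>\<gamma> \<eta>. lact E \<gamma> (fst T (src G \<gamma>) (lact E (ginv G \<gamma>) \<eta>))),
      (\<lambda>\<gamma> \<xi>. ract E \<gamma> (snd T (src G \<gamma>) (ract E (ginv G \<gamma>) \<xi>))))"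

definition op_pullback ::
  "('z \<Rightarrow> 'x) \<Rightarrow> ('x, 'l, 'r, 'l1, 'r1) bop \<Rightarrow> ('z, 'l, 'r, 'l1, 'r1) bop" where
  "op_pullback f T = ((\<lambda>z. fst T (f z)), (\<lambda>z. snd T (f z)))"

definition odd_op ::
  "'x topology \<Rightarrow> ('g, 'x, 'a, 'b, 'l, 'r) abpair \<Rightarrow> ('x, 'l, 'r, 'l, 'r) bop \<Rightarrow> bool" where
  "odd_op X E T \<longleftrightarrow>
     (\<forall>x\<in>topspace X.
        (\<forall>\<eta>\<in>carrier (fib (lft E) x).
           fst T x (lgr E x \<eta>) = \<ominus>\<^bsub>fib (lft E) x\<^esub> lgr E x (fst T x \<eta>)) \<and>
        (\<forall>\<xi>\<in>carrier (fib (rgt E) x).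
           snd T x (rgr E x \<xi>) = \<ominus>\<^bsub>fib (rgt E) x\<^esub> rgr E x (snd T x \<xi>)))"

definition KK_cycles ::
  "bool \<Rightarrow> ('g, 'x) groupoid \<Rightarrow> ('g, 'x, 'a) gfield \<Rightarrow> ('g, 'x, 'b) gfield
     \<Rightarrow> (('g, 'x, 'a, 'b, 'l, 'r) abpair \<times> ('x, 'l, 'r, 'l, 'r) bop) set" where
  "KK_cycles ndA G A B =
     {(E, T).
        g_banach_algebra G A \<and> g_banach_algebra G B \<and>
        g_banach_ab_pair G A B E \<and> nondegenerate_pair ndA G A B E \<and> graded_pair G A B E \<and>
        T \<in> L_op (obj G) B E E \<and> odd_op (obj G) E T \<and>
        (\<forall>a\<in>sections0 (obj G) A.
           op_diff E E (op_comp (op_of E id a) T) (op_comp T (op_of E id a))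
             \<in> K_op (obj G) B E E \<and>
           op_comp (op_of E id a) (op_diff E E (op_comp T T) op_id) \<in> K_op (obj G) B E E) \<and>
        (\<forall>a\<in>sections0 (arr G) (pullback (arr G) (rng G) A).
           op_comp (op_of E (rng G) a)
             (op_diff (pullback_pair (arr G) (rng G) E) (pullback_pair (arr G) (rng G) E)
               (op_conj G E T) (op_pullback (rng G) T))
           \<in> K_op (arr G) (pullback (arr G) (rng G) B)
               (pullback_pair (arr G) (rng G) E) (pullback_pair (arr G) (rng G) E))}"


section \<open>Pushforward along the anchor map\<close>

definition anchor_fibre :: "('g, 'x, 'y) gspace \<Rightarrow> 'x \<Rightarrow> 'y set" where
  "anchor_fibre Y x = {y \<in> topspace (spc Y). anchor Y y = x}"

definition restrict_field ::
  "'y topology \<Rightarrow> 'y set \<Rightarrow> ('y, 'e, 'm) bfield_scheme \<Rightarrow> ('y, 'e) bfield" where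
  "restrict_field Y S E = pullback (subtopology Y S) id E"

text \<open>
  If the fibre of the anchor map is empty, then the only section is the function that is undefined
  everywhere, so the space is zero; inserting \<open>0\<close> makes the supremum \<open>0\<close> in this case.
\<close>

definition push_fibre ::
  "('g, 'x, 'y) gspace \<Rightarrow> ('y, 'e, 'm) bfield_scheme \<Rightarrow> 'x \<Rightarrow> ('y \<Rightarrow> 'e) nspace" where
  "push_fibre Y E x =
     \<lparr>carrier = sections0 (subtopology (spc Y) (anchor_fibre Y x))
                  (restrict_field (spc Y) (anchor_fibre Y x) E),
      mult = (\<lambda>\<xi> \<eta>. \<lambda>y\<in>anchor_fibre Y x. \<xi> y \<otimes>\<^bsub>fib E y\<^esub> \<eta> y),
      one = (\<lambda>y\<in>anchor_fibre Y x. \<one>\<^bsub>fib E y\<^esub>),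
      zero = (\<lambda>y\<in>anchor_fibre Y x. \<zero>\<^bsub>fib E y\<^esub>),
      add = (\<lambda>\<xi> \<eta>. \<lambda>y\<in>anchor_fibre Y x. \<xi> y \<oplus>\<^bsub>fib E y\<^esub> \<eta> y),
      smult = (\<lambda>c \<xi>. \<lambda>y\<in>anchor_fibre Y x. c \<odot>\<^bsub>fib E y\<^esub> \<xi> y),
      nrm = (\<lambda>\<xi>. Sup (insert 0 ((\<lambda>y. nrm (fib E y) (\<xi> y)) ` anchor_fibre Y x)))\<rparr>"

definition push_field ::
  "('g, 'x) groupoid \<Rightarrow> ('g, 'x, 'y) gspace \<Rightarrow> ('y, 'e, 'm) bfield_scheme
     \<Rightarrow> ('x, 'y \<Rightarrow> 'e) bfield" where
  "push_field G Y E =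
     \<lparr>fib = push_fibre Y E,
      sec = generated_structure (obj G) (push_fibre Y E)
        ((\<lambda>\<xi>. \<lambda>x\<in>topspace (obj G). restrict \<xi> (anchor_fibre Y x)) ` sections0 (spc Y) E)\<rparr>"

definition push_action ::
  "('g, 'x) groupoid \<Rightarrow> ('g, 'x, 'y) gspace \<Rightarrow> ('g \<times> 'y \<Rightarrow> 'e \<Rightarrow> 'e)
     \<Rightarrow> 'g \<Rightarrow> ('y \<Rightarrow> 'e) \<Rightarrow> ('y \<Rightarrow> 'e)" where
  "push_action G Y \<alpha> \<gamma> \<xi> =
     (\<lambda>y\<in>anchor_fibre Y (rng G \<gamma>). \<alpha> (\<gamma>, y) (\<xi> (act Y (ginv G \<gamma>) y)))"

definition push_linear ::
  "('g, 'x, 'y) gspace \<Rightarrow> ('y \<Rightarrow> 'e \<Rightarrow> 'f) \<Rightarrow> 'x \<Rightarrow> ('y \<Rightarrow> 'e) \<Rightarrow> ('y \<Rightarrow> 'f)" where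
  "push_linear Y T x \<xi> = (\<lambda>y\<in>anchor_fibre Y x. T y (\<xi> y))"

definition push_bilinear ::
  "('g, 'x, 'y) gspace \<Rightarrow> ('y \<Rightarrow> 'e \<Rightarrow> 'f \<Rightarrow> 'h)
     \<Rightarrow> 'x \<Rightarrow> ('y \<Rightarrow> 'e) \<Rightarrow> ('y \<Rightarrow> 'f) \<Rightarrow> ('y \<Rightarrow> 'h)" where
  "push_bilinear Y \<mu> x \<xi> \<eta> = (\<lambda>y\<in>anchor_fibre Y x. \<mu> y (\<xi> y) (\<eta> y))"

definition push_algebra ::
  "('g, 'x) groupoid \<Rightarrow> ('g, 'x, 'y) gspace \<Rightarrow> ('g \<times> 'y, 'y, 'a) gfield
     \<Rightarrow> ('g, 'x, 'y \<Rightarrow> 'a) gfield" where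
  "push_algebra G Y A =
     \<lparr>fib = fib (push_field G Y A), sec = sec (push_field G Y A),
      gact = push_action G Y (gact A)\<rparr>"

definition push_pair ::
  "('g, 'x) groupoid \<Rightarrow> ('g, 'x, 'y) gspace \<Rightarrow> ('g \<times> 'y, 'y, 'a, 'b, 'l, 'r) abpair
     \<Rightarrow> ('g, 'x, 'y \<Rightarrow> 'a, 'y \<Rightarrow> 'b, 'y \<Rightarrow> 'l, 'y \<Rightarrow> 'r) abpair" where
  "push_pair G Y E =
     \<lparr>lft = push_field G Y (lft E), rgt = push_field G Y (rgt E),
      brk = push_bilinear Y (brk E),
      lB = push_bilinear Y (lB E), rB = push_bilinear Y (rB E),
      lact = push_action G Y (lact E), ract = push_action G Y (ract E),
      lA = push_bilinear Y (lA E), rA = push_bilinear Y (rA E),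
      lgr = push_linear Y (lgr E), rgr = push_linear Y (rgr E)\<rparr>"

definition push_op ::
  "('g, 'x, 'y) gspace \<Rightarrow> ('y, 'l, 'r, 'l1, 'r1) bop
     \<Rightarrow> ('x, 'y \<Rightarrow> 'l, 'y \<Rightarrow> 'r, 'y \<Rightarrow> 'l1, 'y \<Rightarrow> 'r1) bop" where
  "push_op Y T = (push_linear Y (fst T), push_linear Y (snd T))"

end

theory Submission
  imports Defs
begin

text \<open>
  Sections of \<open>\<rho>\<^sub>* E\<close> over \<open>X\<close> are the same as sections of \<open>E\<close> over \<open>Y\<close> whose norm vanishes at
  infinity locally over \<open>X\<close>; in particular \<open>\<Gamma>\<^sub>0(X, \<rho>\<^sub>* E) = \<Gamma>\<^sub>0(Y, E)\<close>, so rank one operators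
  push forward to rank one operators and, the norm of fields being a supremum over \<open>Y\<close>, compact
  operators push forward to compact operators. The same holds after base change along a continuous
  map \<open>f : W \<rightarrow> X\<close>: the pullback \<open>f\<^sup>* \<rho>\<^sub>* E\<close> is the pushforward to \<open>W\<close> of the pullback of
  \<open>E\<close> to the fibre product \<open>W \<times>\<^sub>X Y\<close>. For the range and source maps of \<open>\<G>\<close> this fibre
  product is the space of arrows of \<open>\<G> \<ltimes> Y\<close>, which gives the continuity of the action and
  the compactness of \<open>\<gamma> T \<gamma>\<^sup>-\<^sup>1 - T\<close> over \<open>\<G>\<close>. Density of fibre values of sections, and
  non-degeneracy, come from an approximation lemma for sections closed under local convex
  combinations.
\<close>
section \<open>Normed spaces with explicit carrier\<close>

text \<open>Structures of sections are given by definite descriptions, so nothing is known about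
  sections of a pullback or pushforward until (C1)-(C3) hold for the generators and unique existence
  is proved. For the pushforward the obstacle is density: an element of the fibre over x is a
  section on Y_x, and no extension to Y is available. Statements about arbitrary elements of a fibre
  are therefore proved for restrictions from \<Gamma>_0(Y,E) and carried over by uniform limits.
  Upper semi-continuity and the passage from sections over a fibre product back to sections of a
  pushforward rest on one compactness argument: the points violating an estimate lie in a compact
  set, whose image in the Hausdorff base is closed, so the estimate persists on a neighbourhood.
  Local compactness of the base makes the exceptional compact set uniform over such a neighbourhood.
  A second constraint is formal: identities between operators hold only on carriers, because the
  difference in a pushed fibre is pointwise only there. Hence operators over the base are compared
  with operators over the fibre product by a relation on carriers, and membership in carriers is
  tracked throughout.\<close>

lemma complex_ring_simps [simp]:
  "carrier complex_ring = UNIV" "mult complex_ring = (*)" "one complex_ring = 1"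
  "zero complex_ring = 0" "add complex_ring = (+)"
  by (simp_all add: complex_ring_def)

lemma cring_complex_ring: "cring complex_ring"
proof (rule cringI)
  show "abelian_group complex_ring"
    by (rule abelian_groupI) (auto simp: algebra_simps intro: exI[of _ "- x" for x])
  show "comm_monoid complex_ring"
    by (rule comm_monoidI) auto
qed (simp add: algebra_simps)

text \<open>Completeness is kept apart: spans, density and all estimates need only a norm, and
  completeness is invoked solely when a Cauchy sequence has to converge.\<close>

locale normed =
  fixes V :: "'e nspace" (structure)
  assumes module: "module complex_ring V"
    and nrm_ge0: "u \<in> carrier V \<Longrightarrow> 0 \<le> nrm V u"
    and nrm_eq0: "u \<in> carrier V \<Longrightarrow> nrm V u = 0 \<longleftrightarrow> u = \<zero>"
    and nrm_add: "u \<in> carrier V \<Longrightarrow> v \<in> carrier V \<Longrightarrow> nrm V (u \<oplus> v) \<le> nrm V u + nrm V v"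
    and nrm_smult: "u \<in> carrier V \<Longrightarrow> nrm V (c \<odot> u) = cmod c * nrm V u"
begin

sublocale module complex_ring V
  by (rule module)

lemma smult_mem [simp, intro]: "u \<in> carrier V \<Longrightarrow> c \<odot> u \<in> carrier V"
  by simp

lemma smult_add_left: "u \<in> carrier V \<Longrightarrow> (c + d) \<odot> u = c \<odot> u \<oplus> d \<odot> u"
  using smult_l_distr by simp

lemma smult_add_right: "u \<in> carrier V \<Longrightarrow> v \<in> carrier V \<Longrightarrow> c \<odot> (u \<oplus> v) = c \<odot> u \<oplus> c \<odot> v"
  using smult_r_distr by simp

lemma smult_mult: "u \<in> carrier V \<Longrightarrow> (c * d) \<odot> u = c \<odot> (d \<odot> u)"
  using smult_assoc1 by simp

lemma smult_1: "u \<in> carrier V \<Longrightarrow> 1 \<odot> u = u"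
  using smult_one by simp

lemma smult_0: "u \<in> carrier V \<Longrightarrow> 0 \<odot> u = \<zero>"
  using smult_l_null by simp

text \<open>Linear maps and linear subspaces are axiomatised by sums and scalar multiples only, so
  every fact about differences is reduced to the scalar -1.\<close>

lemma neg_eq_smult: "u \<in> carrier V \<Longrightarrow> \<ominus> u = (- 1) \<odot> u"
  using smult_add_left[of u "-1" 1] smult_0[of u] smult_1[of u] M.minus_equality[of "(-1) \<odot> u" u]
  by simp

lemma diff_eq_smult: "u \<in> carrier V \<Longrightarrow> v \<in> carrier V \<Longrightarrow> u \<ominus> v = u \<oplus> (- 1) \<odot> v"
  by (simp add: a_minus_def neg_eq_smult)

lemma diff_mem [simp, intro]: "u \<in> carrier V \<Longrightarrow> v \<in> carrier V \<Longrightarrow> u \<ominus> v \<in> carrier V"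
  by simp

lemma nrm_neg: "u \<in> carrier V \<Longrightarrow> nrm V (\<ominus> u) = nrm V u"
  by (simp add: neg_eq_smult nrm_smult)

lemma nrm_zero [simp]: "nrm V \<zero> = 0"
  by (simp add: nrm_eq0)

lemma diff_self [simp]: "u \<in> carrier V \<Longrightarrow> u \<ominus> u = \<zero>"
  by (simp add: a_minus_def M.r_neg)

lemma diff_eq0: "u \<in> carrier V \<Longrightarrow> v \<in> carrier V \<Longrightarrow> u \<ominus> v = \<zero> \<longleftrightarrow> u = v"
  by (metis M.add.inv_solve_right' M.l_zero M.zero_closed a_minus_def)

lemma nrm_diff_commute: "u \<in> carrier V \<Longrightarrow> v \<in> carrier V \<Longrightarrow> nrm V (u \<ominus> v) = nrm V (v \<ominus> u)"
  using nrm_neg[of "u \<ominus> v"] by (simp add: a_minus_def M.minus_add M.a_comm)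

lemma diff_via: 
  assumes "u \<in> carrier V" "v \<in> carrier V" "w \<in> carrier V"
  shows "u \<ominus> v = (u \<ominus> w) \<oplus> (w \<ominus> v)"
  using assms by (simp add: a_minus_def M.a_assoc M.r_neg1)

lemma nrm_triangle:
  assumes "u \<in> carrier V" "v \<in> carrier V" "w \<in> carrier V"
  shows "nrm V (u \<ominus> v) \<le> nrm V (u \<ominus> w) + nrm V (w \<ominus> v)"
  unfolding diff_via[OF assms] using assms nrm_add by simp

lemma nrm_diff_zero [simp]: "u \<in> carrier V \<Longrightarrow> nrm V (u \<ominus> \<zero>) = nrm V u"
  by (simp add: diff_eq_smult)

lemma nrm_le_diff: "u \<in> carrier V \<Longrightarrow> v \<in> carrier V \<Longrightarrow> nrm V u \<le> nrm V v + nrm V (u \<ominus> v)"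
  using nrm_triangle[of u \<zero> v] by simp

lemma nrm_diff_le: "u \<in> carrier V \<Longrightarrow> v \<in> carrier V \<Longrightarrow> nrm V (u \<ominus> v) \<le> nrm V u + nrm V v"
  using nrm_triangle[of u v \<zero>] nrm_diff_commute[of v \<zero>] by simp

lemma add_diff_add:
  assumes "u \<in> carrier V" "v \<in> carrier V" "u' \<in> carrier V" "v' \<in> carrier V"
  shows "(u \<oplus> v) \<ominus> (u' \<oplus> v') = (u \<ominus> u') \<oplus> (v \<ominus> v')"
  using assms by (simp add: a_minus_def M.minus_add M.a_ac)

lemma nrm_add_diff_add:
  assumes "u \<in> carrier V" "v \<in> carrier V" "u' \<in> carrier V" "v' \<in> carrier V"
  shows "nrm V ((u \<oplus> v) \<ominus> (u' \<oplus> v')) \<le> nrm V (u \<ominus> u') + nrm V (v \<ominus> v')"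
  using assms by (simp add: add_diff_add nrm_add)

lemma smult_diff_right:
  "u \<in> carrier V \<Longrightarrow> v \<in> carrier V \<Longrightarrow> c \<odot> (u \<ominus> v) = c \<odot> u \<ominus> c \<odot> v"
  by (simp add: diff_eq_smult smult_add_right smult_mult[symmetric] mult.commute)

lemma smult_diff_left: "u \<in> carrier V \<Longrightarrow> (c - d) \<odot> u = c \<odot> u \<ominus> d \<odot> u"
  using smult_add_left[of u c "- d"] smult_mult[of u "-1" d] by (simp add: diff_eq_smult)

text \<open>Writing h as (1-t)h + th turns the error into the same convex combination of h-g and
  h-s. This is the estimate behind patching \<open>s\<close> into \<open>g\<close> by a cut-off with
  value t.\<close>

lemma nrm_convex_combination:
  assumes "h \<in> carrier V" "g \<in> carrier V" "s \<in> carrier V" "0 \<le> t" "t \<le> 1"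
  shows "nrm V (h \<ominus> (complex_of_real (1 - t) \<odot> g \<oplus> complex_of_real t \<odot> s))
    \<le> (1 - t) * nrm V (h \<ominus> g) + t * nrm V (h \<ominus> s)"
proof -
  have "h = complex_of_real (1 - t) \<odot> h \<oplus> complex_of_real t \<odot> h"
    using smult_add_left[of h "complex_of_real (1 - t)" "complex_of_real t"] smult_1[of h] assms
    by simp
  then have "h \<ominus> (complex_of_real (1 - t) \<odot> g \<oplus> complex_of_real t \<odot> s)
    = complex_of_real (1 - t) \<odot> (h \<ominus> g) \<oplus> complex_of_real t \<odot> (h \<ominus> s)"
    using assms by (metis add_diff_add smult_diff_right smult_mem)
  moreover have "cmod (complex_of_real (1 - t)) = 1 - t" "cmod (complex_of_real t) = t"
    using assms by (simp_all only: norm_of_real)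
  ultimately show ?thesis
    using nrm_add[of "complex_of_real (1 - t) \<odot> (h \<ominus> g)" "complex_of_real t \<odot> (h \<ominus> s)"] assms
    by (simp add: nrm_smult del: of_real_diff)
qed

lemma Metric_space: "Metric_space (carrier V) (ndist V)"
proof
  show "0 \<le> ndist V x y" for x y
    by (simp add: ndist_def nrm_ge0)
  show "ndist V x y = ndist V y x" for x y
    by (simp add: ndist_def nrm_diff_commute)
  show "x \<in> carrier V \<Longrightarrow> y \<in> carrier V \<Longrightarrow> (ndist V x y = 0) = (x = y)" for x y
    by (simp add: ndist_def nrm_eq0 diff_eq0)
  show "x \<in> carrier V \<Longrightarrow> y \<in> carrier V \<Longrightarrow> z \<in> carrier V \<Longrightarrow> ndist V x z \<le> ndist V x y + ndist V y z" for x y z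
    by (simp add: ndist_def nrm_triangle)
qed

lemma dense_iff:
  assumes "S \<subseteq> carrier V"
  shows "ntop V closure_of S = carrier V \<longleftrightarrow>
    (\<forall>u\<in>carrier V. \<forall>\<epsilon>>0. \<exists>s\<in>S. nrm V (u \<ominus> s) < \<epsilon>)"
proof -
  interpret M: Metric_space "carrier V" "ndist V"
    by (rule Metric_space)
  show ?thesis
  proof -
    have "(\<exists>y\<in>S. y \<in> M.mball u r) \<longleftrightarrow> (\<exists>s\<in>S. nrm V (u \<ominus> s) < r)" if "u \<in> carrier V" for u r
      using that assms by (auto simp: ndist_def subset_iff)
    then show ?thesis
      unfolding ntop_def M.metric_closure_of by blast
  qed
qed

lemma mcomplete_iff:
  "Metric_space.mcomplete (carrier V) (ndist V) \<longleftrightarrow>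
    (\<forall>u :: nat \<Rightarrow> 'e. (\<forall>n. u n \<in> carrier V) \<and>
      (\<forall>\<epsilon>>0. \<exists>N. \<forall>n\<ge>N. \<forall>m\<ge>N. nrm V (u n \<ominus> u m) < \<epsilon>) \<longrightarrow>
      (\<exists>l\<in>carrier V. \<forall>\<epsilon>>0. \<exists>N. \<forall>n\<ge>N. nrm V (u n \<ominus> l) < \<epsilon>))"
proof -
  interpret M: Metric_space "carrier V" "ndist V"
    by (rule Metric_space)
  have *: "M.MCauchy u \<longleftrightarrow> (\<forall>n. u n \<in> carrier V) \<and>
    (\<forall>\<epsilon>>0. \<exists>N. \<forall>n\<ge>N. \<forall>m\<ge>N. nrm V (u n \<ominus> u m) < \<epsilon>)" for u
    unfolding M.MCauchy_def by (auto simp: ndist_def image_subset_iff; metis)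
  have **: "limitin M.mtopology u l sequentially \<longleftrightarrow>
    l \<in> carrier V \<and> (\<forall>\<epsilon>>0. \<exists>N. \<forall>n\<ge>N. nrm V (u n \<ominus> l) < \<epsilon>)" if "\<forall>n. u n \<in> carrier V" for u l
    unfolding M.limit_metric_sequentially using that by (auto simp: ndist_def)
  show ?thesis
    unfolding M.mcomplete_def * using ** by (simp add: Bex_def cong: conj_cong imp_cong)
qed

lemma lspan_subset: "S \<subseteq> carrier V \<Longrightarrow> lspan V S \<subseteq> carrier V"
  unfolding lspan_def
  using hull_minimal[of S "carrier V" "\<lambda>W. submodule W complex_ring V"] carrier_is_submodule by blast

lemma lspan_zero: "\<zero> \<in> lspan V S"
  unfolding lspan_def hull_def using submodule.axioms(1)[THEN subgroup.one_closed] by fastforce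

lemma lspan_add: "u \<in> lspan V S \<Longrightarrow> v \<in> lspan V S \<Longrightarrow> u \<oplus> v \<in> lspan V S"
  unfolding lspan_def hull_def using submoduleE(5) by blast

lemma lspan_smult: "u \<in> lspan V S \<Longrightarrow> c \<odot> u \<in> lspan V S"
  unfolding lspan_def hull_def using submoduleE(4) by fastforce

lemma lspan_subsetI:
  assumes "S \<subseteq> W" "W \<subseteq> carrier V" "\<zero> \<in> W"
    and "\<And>u v. u \<in> W \<Longrightarrow> v \<in> W \<Longrightarrow> u \<oplus> v \<in> W" "\<And>c u. u \<in> W \<Longrightarrow> c \<odot> u \<in> W"
  shows "lspan V S \<subseteq> W"
  unfolding lspan_def
proof (rule hull_minimal[OF assms(1) submoduleI])
  show "\<ominus> a \<in> W" if "a \<in> W" for a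
    using that assms(2,5) by (metis neg_eq_smult subsetD)
qed (use assms in auto)

end

section \<open>Completeness, linear maps and a bilinear estimate\<close>

lemma banach_space_iff:
  "banach_space V \<longleftrightarrow> normed V \<and> Metric_space.mcomplete (carrier V) (ndist V)"
  unfolding banach_space_def normed_def by auto

lemma banach_space_normed: "banach_space V \<Longrightarrow> normed V"
  by (simp add: banach_space_iff)

lemma banach_space_limit:
  fixes u :: "nat \<Rightarrow> 'e"
  assumes "banach_space V" "\<And>n. u n \<in> carrier V"
    and "\<And>\<epsilon>. \<epsilon> > 0 \<Longrightarrow> \<exists>N. \<forall>n\<ge>N. \<forall>m\<ge>N. nrm V (u n \<ominus>\<^bsub>V\<^esub> u m) < \<epsilon>"
  shows "\<exists>l\<in>carrier V. \<forall>\<epsilon>>0. \<exists>N. \<forall>n\<ge>N. nrm V (u n \<ominus>\<^bsub>V\<^esub> l) < \<epsilon>"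
  using assms normed.mcomplete_iff[of V] unfolding banach_space_iff by blast

lemma linear_map_mem: "linear_map V W t \<Longrightarrow> u \<in> carrier V \<Longrightarrow> t u \<in> carrier W"
  by (auto simp: linear_map_def)

lemma linear_map_diff:
  assumes "normed V" "normed W" "linear_map V W t" "u \<in> carrier V" "v \<in> carrier V"
  shows "t (u \<ominus>\<^bsub>V\<^esub> v) = t u \<ominus>\<^bsub>W\<^esub> t v"
proof -
  interpret V: normed V by fact
  interpret W: normed W by fact
  show ?thesis
    using assms(3-5) linear_map_mem[OF assms(3)]
    by (simp add: V.diff_eq_smult W.diff_eq_smult linear_map_def)
qed

text \<open>Split m a b - m a' b' at m a' b. The bound involves the norm of \<open>b\<close> but
  that of the approximant \<open>a'\<close>; hence, wherever this is used, \<open>a'\<close> is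
  chosen first and the tolerance for \<open>b'\<close> depends on it.\<close>

lemma bilinear_estimate:
  assumes n: "normed V1" "normed V2" "normed V3"
    and l: "\<And>e. e \<in> carrier V1 \<Longrightarrow> linear_map V2 V3 (m e)" "\<And>g. g \<in> carrier V2 \<Longrightarrow> linear_map V1 V3 (\<lambda>e. m e g)"
    and le: "\<And>e g. e \<in> carrier V1 \<Longrightarrow> g \<in> carrier V2 \<Longrightarrow> nrm V3 (m e g) \<le> nrm V1 e * nrm V2 g"
    and a: "a \<in> carrier V1" "a' \<in> carrier V1" and b: "b \<in> carrier V2" "b' \<in> carrier V2"
  shows "nrm V3 (m a b \<ominus>\<^bsub>V3\<^esub> m a' b') \<le> nrm V1 (a \<ominus>\<^bsub>V1\<^esub> a') * nrm V2 b + nrm V1 a' * nrm V2 (b \<ominus>\<^bsub>V2\<^esub> b')"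
proof -
  have mem: "m e g \<in> carrier V3" if "e \<in> carrier V1" "g \<in> carrier V2" for e g
    using linear_map_mem[OF l(1)[OF that(1)] that(2)] .
  have "nrm V3 (m a b \<ominus>\<^bsub>V3\<^esub> m a' b') \<le> nrm V3 (m a b \<ominus>\<^bsub>V3\<^esub> m a' b) + nrm V3 (m a' b \<ominus>\<^bsub>V3\<^esub> m a' b')"
    by (rule normed.nrm_triangle[OF n(3)]) (auto intro: mem a b)
  also have "nrm V3 (m a b \<ominus>\<^bsub>V3\<^esub> m a' b) \<le> nrm V1 (a \<ominus>\<^bsub>V1\<^esub> a') * nrm V2 b"
    using linear_map_diff[OF n(1,3) l(2)[OF b(1)] a] le[OF normed.diff_mem[OF n(1) a] b(1)] by simp
  also have "nrm V3 (m a' b \<ominus>\<^bsub>V3\<^esub> m a' b') \<le> nrm V1 a' * nrm V2 (b \<ominus>\<^bsub>V2\<^esub> b')"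
    using linear_map_diff[OF n(2,3) l(1)[OF a(2)] b] le[OF a(2) normed.diff_mem[OF n(2) b]] by simp
  finally show ?thesis
    by simp
qed

section \<open>Upper semi-continuous fields\<close>

lemma all_sections_mem: "\<xi> \<in> all_sections X V \<Longrightarrow> x \<in> topspace X \<Longrightarrow> \<xi> x \<in> carrier (V x)"
  by (auto simp: all_sections_def PiE_iff)

text \<open>Closing up under local approximation is idempotent, by halving the tolerance on an
  intersection of two neighbourhoods. This yields (C4) for generated structures.\<close>

lemma locally_approximable_trans:
  assumes V: "\<And>x. x \<in> topspace X \<Longrightarrow> normed (V x)"
    and sub: "\<Gamma> \<subseteq> all_sections X V" "\<Delta> \<subseteq> all_sections X V" "\<xi> \<in> all_sections X V"
    and \<Gamma>: "\<And>\<xi>'. \<xi>' \<in> \<Gamma> \<Longrightarrow> locally_approximable X V \<Delta> \<xi>'"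
    and \<xi>: "locally_approximable X V \<Gamma> \<xi>"
  shows "locally_approximable X V \<Delta> \<xi>"
  unfolding locally_approximable_def
proof (intro ballI allI impI)
  fix x \<epsilon> assume x: "x \<in> topspace X" and \<epsilon>: "(0::real) < \<epsilon>"
  obtain U \<xi>' where U: "openin X U" "x \<in> U" "\<xi>' \<in> \<Gamma>"
    "\<forall>z\<in>U. nrm (V z) (\<xi> z \<ominus>\<^bsub>V z\<^esub> \<xi>' z) \<le> \<epsilon> / 2"
    using \<xi> x half_gt_zero[OF \<epsilon>] unfolding locally_approximable_def by meson
  obtain U' \<xi>'' where U': "openin X U'" "x \<in> U'" "\<xi>'' \<in> \<Delta>"
    "\<forall>z\<in>U'. nrm (V z) (\<xi>' z \<ominus>\<^bsub>V z\<^esub> \<xi>'' z) \<le> \<epsilon> / 2"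
    using \<Gamma>[OF U(3)] x half_gt_zero[OF \<epsilon>] unfolding locally_approximable_def by meson
  have "nrm (V z) (\<xi> z \<ominus>\<^bsub>V z\<^esub> \<xi>'' z) \<le> \<epsilon>" if z: "z \<in> U \<inter> U'" for z
  proof -
    have zX: "z \<in> topspace X"
      using z U(1) openin_subset by blast
    then show ?thesis
      using normed.nrm_triangle[OF V[OF zX], of "\<xi> z" "\<xi>'' z" "\<xi>' z"] z U(4) U'(4)
        all_sections_mem[OF sub(3) zX] all_sections_mem[OF subsetD[OF sub(1) U(3)] zX]
        all_sections_mem[OF subsetD[OF sub(2) U'(3)] zX] by (fastforce simp: subset_iff)
  qed
  then show "\<exists>U \<xi>'. openin X U \<and> x \<in> U \<and> \<xi>' \<in> \<Delta> \<and>
      (\<forall>z\<in>U. nrm (V z) (\<xi> z \<ominus>\<^bsub>V z\<^esub> \<xi>' z) \<le> \<epsilon>)"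
    using U U' by (intro exI[of _ "U \<inter> U'"] exI[of _ \<xi>'']) auto
qed

text \<open>The candidate is the set of all locally approximable sections. Any structure containing
  \<Gamma> contains it by (C4). Conversely a section of such a structure is close to some generator
  at a given point by density, and (C3) for their difference spreads the estimate to a
  neighbourhood.\<close>

lemma generated_structure:
  assumes V: "\<And>x. x \<in> topspace X \<Longrightarrow> normed (V x)"
    and lin: "linear_subspace X V \<Gamma>"
    and dense: "\<And>x e \<epsilon>. x \<in> topspace X \<Longrightarrow> e \<in> carrier (V x) \<Longrightarrow> \<epsilon> > 0 \<Longrightarrow>
      \<exists>\<xi>\<in>\<Gamma>. nrm (V x) (e \<ominus>\<^bsub>V x\<^esub> \<xi> x) < \<epsilon>"
    and usc: "\<And>\<xi> c. \<xi> \<in> \<Gamma> \<Longrightarrow> openin X {x \<in> topspace X. nrm (V x) (\<xi> x) < c}"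
  shows "generated_structure X V \<Gamma> = {\<xi> \<in> all_sections X V. locally_approximable X V \<Gamma> \<xi>}" (is "_ = ?\<Delta>")
    and "usc_structure X V (generated_structure X V \<Gamma>)"
proof -
  have \<Gamma>: "\<Gamma> \<subseteq> all_sections X V"
    using lin by (simp add: linear_subspace_def)
  have self: "locally_approximable X V \<Gamma> \<xi>" if "\<xi> \<in> \<Gamma>" for \<xi>
    unfolding locally_approximable_def
  proof (intro ballI allI impI)
    fix x \<epsilon> assume "x \<in> topspace X" "(0::real) < \<epsilon>"
    then show "\<exists>U \<xi>'. openin X U \<and> x \<in> U \<and> \<xi>' \<in> \<Gamma> \<and>
        (\<forall>z\<in>U. nrm (V z) (\<xi> z \<ominus>\<^bsub>V z\<^esub> \<xi>' z) \<le> \<epsilon>)"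
      using that \<Gamma> all_sections_mem[of \<xi> X V] V
      by (intro exI[of _ "topspace X"] exI[of _ \<xi>])
        (auto simp: normed.diff_self normed.nrm_zero subset_iff)
  qed
  have sub: "\<Gamma> \<subseteq> ?\<Delta>"
    using \<Gamma> self by blast
  have \<Delta>D: "\<exists>U \<xi>'. openin X U \<and> x \<in> U \<and> \<xi>' \<in> \<Gamma> \<and>
      (\<forall>z\<in>U. nrm (V z) (\<xi> z \<ominus>\<^bsub>V z\<^esub> \<xi>' z) \<le> \<epsilon>)" if "\<xi> \<in> ?\<Delta>" "x \<in> topspace X" "\<epsilon> > 0" for \<xi> x \<epsilon>
    using that by (auto simp: locally_approximable_def)
  have mem: "\<xi> x \<in> carrier (V x)" if "\<xi> \<in> ?\<Delta>" "x \<in> topspace X" for \<xi> x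
    using that all_sections_mem[of \<xi> X V] by simp
  have "usc_structure X V ?\<Delta>"
    unfolding usc_structure_def
  proof (intro conjI ballI allI impI)
    show "linear_subspace X V ?\<Delta>"
      unfolding linear_subspace_def
    proof (intro conjI ballI allI)
      show "(\<lambda>x\<in>topspace X. \<zero>\<^bsub>V x\<^esub>) \<in> ?\<Delta>"
        using lin sub by (auto simp: linear_subspace_def)
      fix \<xi> assume \<xi>: "\<xi> \<in> ?\<Delta>"
      show "(\<lambda>x\<in>topspace X. \<xi> x \<oplus>\<^bsub>V x\<^esub> \<eta> x) \<in> ?\<Delta>" (is "?s \<in> _") if \<eta>: "\<eta> \<in> ?\<Delta>" for \<eta>
      proof (intro CollectI conjI)
        show "?s \<in> all_sections X V"
          using mem[OF \<xi>] mem[OF \<eta>] V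
          by (auto simp: all_sections_def intro!: abelian_monoid.a_closed abelian_group.axioms(1)
            module.axioms(2) normed.module)
        show "locally_approximable X V \<Gamma> ?s"
          unfolding locally_approximable_def
        proof (intro ballI allI impI)
          fix x \<epsilon> assume x: "x \<in> topspace X" and \<epsilon>: "(0::real) < \<epsilon>"
          obtain U \<xi>' where U: "openin X U" "x \<in> U" "\<xi>' \<in> \<Gamma>"
            "\<forall>z\<in>U. nrm (V z) (\<xi> z \<ominus>\<^bsub>V z\<^esub> \<xi>' z) \<le> \<epsilon> / 2"
            using \<Delta>D[OF \<xi> x half_gt_zero[OF \<epsilon>]] by blast
          obtain U' \<eta>' where U': "openin X U'" "x \<in> U'" "\<eta>' \<in> \<Gamma>"
            "\<forall>z\<in>U'. nrm (V z) (\<eta> z \<ominus>\<^bsub>V z\<^esub> \<eta>' z) \<le> \<epsilon> / 2"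
            using \<Delta>D[OF \<eta> x half_gt_zero[OF \<epsilon>]] by blast
          have "\<forall>z\<in>U \<inter> U'. nrm (V z) (?s z \<ominus>\<^bsub>V z\<^esub> (\<lambda>x\<in>topspace X. \<xi>' x \<oplus>\<^bsub>V x\<^esub> \<eta>' x) z) \<le> \<epsilon>"
          proof
            fix z assume z: "z \<in> U \<inter> U'"
            have zX: "z \<in> topspace X"
              using z U(1) openin_subset by blast
            have "nrm (V z) (\<xi> z \<ominus>\<^bsub>V z\<^esub> \<xi>' z) \<le> \<epsilon> / 2" "nrm (V z) (\<eta> z \<ominus>\<^bsub>V z\<^esub> \<eta>' z) \<le> \<epsilon> / 2"
              using z U(4) U'(4) by auto
            then show "nrm (V z) (?s z \<ominus>\<^bsub>V z\<^esub> (\<lambda>x\<in>topspace X. \<xi>' x \<oplus>\<^bsub>V x\<^esub> \<eta>' x) z) \<le> \<epsilon>"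
              using normed.nrm_add_diff_add[OF V[OF zX] mem[OF \<xi> zX] mem[OF \<eta> zX], of "\<xi>' z" "\<eta>' z"]
                mem[OF subsetD[OF sub U(3)] zX] mem[OF subsetD[OF sub U'(3)] zX] zX by simp
          qed
          moreover have "(\<lambda>x\<in>topspace X. \<xi>' x \<oplus>\<^bsub>V x\<^esub> \<eta>' x) \<in> \<Gamma>"
            using lin U(3) U'(3) by (simp add: linear_subspace_def)
          ultimately show "\<exists>U \<xi>'. openin X U \<and> x \<in> U \<and> \<xi>' \<in> \<Gamma> \<and>
              (\<forall>z\<in>U. nrm (V z) (?s z \<ominus>\<^bsub>V z\<^esub> \<xi>' z) \<le> \<epsilon>)"
            using U(1,2) U'(1,2)
            by (intro exI[of _ "U \<inter> U'"] exI[of _ "\<lambda>x\<in>topspace X. \<xi>' x \<oplus>\<^bsub>V x\<^esub> \<eta>' x"] conjI openin_Int IntI)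
        qed
      qed
      show "(\<lambda>x\<in>topspace X. c \<odot>\<^bsub>V x\<^esub> \<xi> x) \<in> ?\<Delta>" (is "?s \<in> _") for c
      proof (intro CollectI conjI)
        show "?s \<in> all_sections X V"
          using mem[OF \<xi>] V by (auto simp: all_sections_def intro: normed.smult_mem)
        show "locally_approximable X V \<Gamma> ?s"
          unfolding locally_approximable_def
        proof (intro ballI allI impI)
          fix x \<epsilon> assume x: "x \<in> topspace X" and \<epsilon>: "(0::real) < \<epsilon>"
          \<comment> \<open>The summand 1 covers c = 0.\<close>
          have pos: "\<epsilon> / (cmod c + 1) > 0"
            using \<epsilon> by (intro divide_pos_pos) (auto intro: add_nonneg_pos)
          obtain U \<xi>' where U: "openin X U" "x \<in> U" "\<xi>' \<in> \<Gamma>"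
            "\<forall>z\<in>U. nrm (V z) (\<xi> z \<ominus>\<^bsub>V z\<^esub> \<xi>' z) \<le> \<epsilon> / (cmod c + 1)"
            using \<Delta>D[OF \<xi> x pos] by blast
          have "\<forall>z\<in>U. nrm (V z) (?s z \<ominus>\<^bsub>V z\<^esub> (\<lambda>x\<in>topspace X. c \<odot>\<^bsub>V x\<^esub> \<xi>' x) z) \<le> \<epsilon>"
          proof
            fix z assume z: "z \<in> U"
            have zX: "z \<in> topspace X"
              using z U(1) openin_subset by blast
            interpret normed "V z"
              by (rule V[OF zX])
            have m: "\<xi> z \<in> carrier (V z)" "\<xi>' z \<in> carrier (V z)"
              using mem[OF \<xi> zX] mem[OF subsetD[OF sub U(3)] zX] .
            have "cmod c * nrm (V z) (\<xi> z \<ominus>\<^bsub>V z\<^esub> \<xi>' z) \<le> (cmod c + 1) * (\<epsilon> / (cmod c + 1))"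
              using U(4) z nrm_ge0[OF diff_mem[OF m]] by (intro mult_mono) auto
            also have "\<dots> = \<epsilon>"
              using norm_ge_zero[of c] by (simp add: add_nonneg_eq_0_iff)
            finally show "nrm (V z) (?s z \<ominus>\<^bsub>V z\<^esub> (\<lambda>x\<in>topspace X. c \<odot>\<^bsub>V x\<^esub> \<xi>' x) z) \<le> \<epsilon>"
              using zX m by (simp add: smult_diff_right[symmetric] nrm_smult)
          qed
          moreover have "(\<lambda>x\<in>topspace X. c \<odot>\<^bsub>V x\<^esub> \<xi>' x) \<in> \<Gamma>"
            using lin U(3) by (simp add: linear_subspace_def)
          ultimately show "\<exists>U \<xi>'. openin X U \<and> x \<in> U \<and> \<xi>' \<in> \<Gamma> \<and>
              (\<forall>z\<in>U. nrm (V z) (?s z \<ominus>\<^bsub>V z\<^esub> \<xi>' z) \<le> \<epsilon>)"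
            using U(1,2)
            by (intro exI[of _ U] exI[of _ "\<lambda>x\<in>topspace X. c \<odot>\<^bsub>V x\<^esub> \<xi>' x"] conjI)
        qed
      qed
    qed auto
  next
    fix x assume x: "x \<in> topspace X"
    have sub': "(\<lambda>\<xi>. \<xi> x) ` ?\<Delta> \<subseteq> carrier (V x)"
      using mem x by auto
    then show "ntop (V x) closure_of ((\<lambda>\<xi>. \<xi> x) ` ?\<Delta>) = carrier (V x)"
      using dense[OF x] sub unfolding normed.dense_iff[OF V[OF x] sub']
      by (meson image_eqI subsetD)
  next
    fix \<xi> c assume \<xi>: "\<xi> \<in> ?\<Delta>"
    show "openin X {x \<in> topspace X. nrm (V x) (\<xi> x) < c}"
    proof (subst openin_subopen, intro ballI)
      fix x assume "x \<in> {x \<in> topspace X. nrm (V x) (\<xi> x) < c}"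
      then have x: "x \<in> topspace X" and lt: "nrm (V x) (\<xi> x) < c"
        by auto
      \<comment> \<open>A third of the gap: one \<delta> is spent on replacing \<xi> by \<xi>' at x,
        one on returning to \<xi> at nearby points, and one keeps the inequality strict.\<close>
      define \<delta> where "\<delta> = (c - nrm (V x) (\<xi> x)) / 3"
      have \<delta>: "\<delta> > 0"
        using lt by (simp add: \<delta>_def)
      obtain U \<xi>' where U: "openin X U" "x \<in> U" "\<xi>' \<in> \<Gamma>"
        "\<forall>z\<in>U. nrm (V z) (\<xi> z \<ominus>\<^bsub>V z\<^esub> \<xi>' z) \<le> \<delta>"
        using \<Delta>D[OF \<xi> x \<delta>] by blast
      have m: "\<xi> z \<in> carrier (V z)" "\<xi>' z \<in> carrier (V z)" if "z \<in> topspace X" for z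
        using mem[OF \<xi> that] mem[OF subsetD[OF sub U(3)] that] .
      let ?U = "U \<inter> {z \<in> topspace X. nrm (V z) (\<xi>' z) < c - \<delta>}"
      have "nrm (V x) (\<xi>' x) \<le> nrm (V x) (\<xi> x) + \<delta>"
        using normed.nrm_le_diff[OF V[OF x], of "\<xi>' x" "\<xi> x"] m[OF x] U(2,4)
          normed.nrm_diff_commute[OF V[OF x] m[OF x]] by force
      also have "\<dots> < c - \<delta>"
        using lt by (simp add: \<delta>_def field_simps)
      finally have "x \<in> ?U"
        using U(2) x by simp
      moreover have "nrm (V z) (\<xi> z) < c" if "z \<in> ?U" for z
        using that normed.nrm_le_diff[OF V, of z "\<xi> z" "\<xi>' z"] m[of z] U(4) by force
      moreover have "openin X ?U"
        using usc[OF U(3)] U(1) by blast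
      ultimately show "\<exists>T. openin X T \<and> x \<in> T \<and> T \<subseteq> {x \<in> topspace X. nrm (V x) (\<xi> x) < c}"
        by (intro exI[of _ ?U]) auto
    qed
  next
    fix \<xi> assume "\<xi> \<in> all_sections X V" "locally_approximable X V ?\<Delta> \<xi>"
    then show "\<xi> \<in> ?\<Delta>"
      using locally_approximable_trans[OF V, where \<Gamma> = ?\<Delta> and \<Delta> = \<Gamma>] \<Gamma> by auto
  qed
  note usc\<Delta> = this
  have uniq: "\<Delta>' = ?\<Delta>" if \<Delta>': "\<Gamma> \<subseteq> \<Delta>'" "usc_structure X V \<Delta>'" for \<Delta>'
  proof
    have *: "linear_subspace X V \<Delta>'"
      using \<Delta>' by (simp add: usc_structure_def)
    then have all: "\<Delta>' \<subseteq> all_sections X V"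
      by (simp add: linear_subspace_def)
    show "?\<Delta> \<subseteq> \<Delta>'"
    proof
      fix \<xi> assume \<xi>: "\<xi> \<in> ?\<Delta>"
      then have "locally_approximable X V \<Delta>' \<xi>"
        using \<Delta>'(1) unfolding locally_approximable_def by blast
      then show "\<xi> \<in> \<Delta>'"
        using \<Delta>'(2) \<xi> by (simp add: usc_structure_def)
    qed
    show "\<Delta>' \<subseteq> ?\<Delta>"
    proof
      fix \<xi> assume \<xi>: "\<xi> \<in> \<Delta>'"
      have "locally_approximable X V \<Gamma> \<xi>"
        unfolding locally_approximable_def
      proof (intro ballI allI impI)
        fix x \<epsilon> assume x: "x \<in> topspace X" and \<epsilon>: "(0::real) < \<epsilon>"
        have m: "\<zeta> z \<in> carrier (V z)" if "\<zeta> \<in> \<Delta>'" "z \<in> topspace X" for \<zeta> z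
          using all_sections_mem[OF subsetD[OF all that(1)] that(2)] .
        obtain \<xi>' where \<xi>': "\<xi>' \<in> \<Gamma>" "nrm (V x) (\<xi> x \<ominus>\<^bsub>V x\<^esub> \<xi>' x) < \<epsilon>"
          using dense[OF x m[OF \<xi> x] \<epsilon>] by blast
        \<comment> \<open>The difference \<xi> - \<xi>' is spelled out by a sum and the scalar -1,
          so that linearity puts it into \<Delta>' and (C3) of \<Delta>' applies to it.\<close>
        let ?d = "\<lambda>x\<in>topspace X. \<xi> x \<oplus>\<^bsub>V x\<^esub> (\<lambda>x\<in>topspace X. (-1) \<odot>\<^bsub>V x\<^esub> \<xi>' x) x"
        have "?d \<in> \<Delta>'"
          using * \<xi> \<xi>'(1) \<Delta>'(1) unfolding linear_subspace_def by blast
        then have o: "openin X {z \<in> topspace X. nrm (V z) (?d z) < \<epsilon>}"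
          using \<Delta>'(2) unfolding usc_structure_def by blast
        have d: "?d z = \<xi> z \<ominus>\<^bsub>V z\<^esub> \<xi>' z" if "z \<in> topspace X" for z
          using that normed.diff_eq_smult[OF V[OF that]] m[OF \<xi> that] m[OF subsetD[OF \<Delta>'(1) \<xi>'(1)] that]
          by simp
        show "\<exists>U \<xi>'. openin X U \<and> x \<in> U \<and> \<xi>' \<in> \<Gamma> \<and>
            (\<forall>z\<in>U. nrm (V z) (\<xi> z \<ominus>\<^bsub>V z\<^esub> \<xi>' z) \<le> \<epsilon>)"
          using o \<xi>' x d by (intro exI[of _ "{z \<in> topspace X. nrm (V z) (?d z) < \<epsilon>}"] exI[of _ \<xi>']) auto
      qed
      then show "\<xi> \<in> ?\<Delta>"
        using \<xi> all by blast
    qed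
  qed
  show eq: "generated_structure X V \<Gamma> = ?\<Delta>"
    unfolding generated_structure_def
  proof (rule the_equality)
    show "\<Gamma> \<subseteq> ?\<Delta> \<and> usc_structure X V ?\<Delta>"
      using sub usc\<Delta> by (rule conjI)
  qed (elim conjE, rule uniq)
  show "usc_structure X V (generated_structure X V \<Gamma>)"
    unfolding eq by (rule usc\<Delta>)
qed

definition ccomb ::
  "'x topology \<Rightarrow> ('x, 'e, 'm) bfield_scheme \<Rightarrow> ('x \<Rightarrow> real) \<Rightarrow> ('x \<Rightarrow> 'e) \<Rightarrow> ('x \<Rightarrow> 'e) \<Rightarrow> 'x \<Rightarrow> 'e" where
  "ccomb X E \<phi> g s = (\<lambda>x\<in>topspace X.
    complex_of_real (1 - \<phi> x) \<odot>\<^bsub>fib E x\<^esub> g x \<oplus>\<^bsub>fib E x\<^esub> complex_of_real (\<phi> x) \<odot>\<^bsub>fib E x\<^esub> s x)"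

section \<open>Calculus of sections of a fixed field\<close>

locale field_over =
  fixes X :: "'x topology" and E :: "('x, 'e, 'm) bfield_scheme"
  assumes usc_field: "usc_field X E"
begin

lemma banach: "x \<in> topspace X \<Longrightarrow> banach_space (fib E x)"
  using usc_field by (simp add: usc_field_def)

lemma normed: "x \<in> topspace X \<Longrightarrow> normed (fib E x)"
  using banach banach_space_normed by blast

lemma sec_all: "\<xi> \<in> sec E \<Longrightarrow> \<xi> \<in> all_sections X (fib E)"
  using usc_field by (auto simp: usc_field_def usc_structure_def linear_subspace_def)

lemma sec_mem: "\<xi> \<in> sec E \<Longrightarrow> x \<in> topspace X \<Longrightarrow> \<xi> x \<in> carrier (fib E x)"
  using all_sections_mem[OF sec_all] .

lemma sec_zero: "(\<lambda>x\<in>topspace X. \<zero>\<^bsub>fib E x\<^esub>) \<in> sec E"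
  using usc_field by (simp add: usc_field_def usc_structure_def linear_subspace_def)

lemma sec_add: "\<xi> \<in> sec E \<Longrightarrow> \<eta> \<in> sec E \<Longrightarrow> (\<lambda>x\<in>topspace X. \<xi> x \<oplus>\<^bsub>fib E x\<^esub> \<eta> x) \<in> sec E"
  using usc_field by (simp add: usc_field_def usc_structure_def linear_subspace_def)

lemma sec_smult: "\<xi> \<in> sec E \<Longrightarrow> (\<lambda>x\<in>topspace X. c \<odot>\<^bsub>fib E x\<^esub> \<xi> x) \<in> sec E"
  using usc_field by (simp add: usc_field_def usc_structure_def linear_subspace_def)

lemma sec_diff:
  assumes "\<xi> \<in> sec E" "\<eta> \<in> sec E"
  shows "(\<lambda>x\<in>topspace X. \<xi> x \<ominus>\<^bsub>fib E x\<^esub> \<eta> x) \<in> sec E"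
proof -
  have "(\<lambda>x\<in>topspace X. \<xi> x \<ominus>\<^bsub>fib E x\<^esub> \<eta> x)
    = (\<lambda>x\<in>topspace X. \<xi> x \<oplus>\<^bsub>fib E x\<^esub> (\<lambda>x\<in>topspace X. (-1) \<odot>\<^bsub>fib E x\<^esub> \<eta> x) x)"
    by (rule restrict_ext) (simp add: normed.diff_eq_smult[OF normed] sec_mem assms)
  then show ?thesis
    using sec_add[OF assms(1) sec_smult[OF assms(2)]] by simp
qed

lemma sec_dense:
  assumes "x \<in> topspace X" "e \<in> carrier (fib E x)" "\<epsilon> > 0"
  obtains \<xi> where "\<xi> \<in> sec E" "nrm (fib E x) (e \<ominus>\<^bsub>fib E x\<^esub> \<xi> x) < \<epsilon>"
proof -
  have "(\<lambda>\<xi>. \<xi> x) ` sec E \<subseteq> carrier (fib E x)"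
    using sec_mem assms(1) by auto
  then have "\<exists>s\<in>(\<lambda>\<xi>. \<xi> x) ` sec E. nrm (fib E x) (e \<ominus>\<^bsub>fib E x\<^esub> s) < \<epsilon>"
    using normed.dense_iff[OF normed[OF assms(1)]] usc_field assms
    by (auto simp: usc_field_def usc_structure_def)
  then show ?thesis
    using that by blast
qed

lemma sec_usc: "\<xi> \<in> sec E \<Longrightarrow> openin X {x \<in> topspace X. nrm (fib E x) (\<xi> x) < c}"
  using usc_field by (simp add: usc_field_def usc_structure_def)

lemma sec_usc_diff:
  assumes "\<xi> \<in> sec E" "\<eta> \<in> sec E"
  shows "openin X {x \<in> topspace X. nrm (fib E x) (\<xi> x \<ominus>\<^bsub>fib E x\<^esub> \<eta> x) < c}"
  using sec_usc[OF sec_diff[OF assms], of c] by (simp cong: conj_cong)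

lemma sec_localI:
  assumes "\<xi> \<in> all_sections X (fib E)"
    and "\<And>x \<epsilon>. x \<in> topspace X \<Longrightarrow> \<epsilon> > 0 \<Longrightarrow> \<exists>U \<xi>'. openin X U \<and> x \<in> U \<and> \<xi>' \<in> sec E \<and>
        (\<forall>z\<in>U. nrm (fib E z) (\<xi> z \<ominus>\<^bsub>fib E z\<^esub> \<xi>' z) \<le> \<epsilon>)"
  shows "\<xi> \<in> sec E"
proof -
  have "locally_approximable X (fib E) (sec E) \<xi>"
    unfolding locally_approximable_def using assms(2) by blast
  then show ?thesis
    using usc_field assms(1) by (simp add: usc_field_def usc_structure_def)
qed

text \<open>Multiplication by continuous functions is not among the axioms; it comes from (C4). Near
  x the section \<phi>\<xi> is approximated by the constant multiple \<phi>(x)\<xi>, because \<phi>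
  varies little and the norm of \<xi> is locally bounded by upper semi-continuity.\<close>

lemma sec_real_mult:
  assumes \<xi>: "\<xi> \<in> sec E" and \<phi>: "continuous_map X euclideanreal \<phi>"
  shows "(\<lambda>x\<in>topspace X. complex_of_real (\<phi> x) \<odot>\<^bsub>fib E x\<^esub> \<xi> x) \<in> sec E" (is "?s \<in> _")
proof (rule sec_localI)
  show "?s \<in> all_sections X (fib E)"
    using sec_mem[OF \<xi>] normed by (auto simp: all_sections_def intro: normed.smult_mem)
  fix x \<epsilon> assume x: "x \<in> topspace X" and \<epsilon>: "(0::real) < \<epsilon>"
  \<comment> \<open>Any number above the norm at x bounds the norm on a neighbourhood; adding 1 also
    makes it positive.\<close>
  define M where "M = nrm (fib E x) (\<xi> x) + 1"
  have M: "M > 0"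
    using normed.nrm_ge0[OF normed[OF x] sec_mem[OF \<xi> x]] by (simp add: M_def)
  let ?U = "{z \<in> topspace X. nrm (fib E z) (\<xi> z) < M} \<inter> {z \<in> topspace X. \<phi> z \<in> ball (\<phi> x) (\<epsilon> / M)}"
  let ?s' = "\<lambda>z\<in>topspace X. complex_of_real (\<phi> x) \<odot>\<^bsub>fib E z\<^esub> \<xi> z"
  have "nrm (fib E z) (?s z \<ominus>\<^bsub>fib E z\<^esub> ?s' z) \<le> \<epsilon>" if z: "z \<in> ?U" for z
  proof -
    have zX: "z \<in> topspace X"
      using z by simp
    interpret normed "fib E z"
      by (rule normed[OF zX])
    have "nrm (fib E z) (?s z \<ominus>\<^bsub>fib E z\<^esub> ?s' z) = \<bar>\<phi> z - \<phi> x\<bar> * nrm (fib E z) (\<xi> z)"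
      using zX sec_mem[OF \<xi> zX] smult_diff_left[of "\<xi> z" "complex_of_real (\<phi> z)" "complex_of_real (\<phi> x)", symmetric]
      by (simp add: nrm_smult flip: of_real_diff)
    also have "\<dots> \<le> (\<epsilon> / M) * M"
      using z M \<epsilon> nrm_ge0[OF sec_mem[OF \<xi> zX]]
      by (intro mult_mono) (auto simp: dist_real_def)
    finally show ?thesis
      using M by simp
  qed
  moreover have "openin X ?U"
    using sec_usc[OF \<xi>] openin_continuous_map_preimage[OF \<phi>, of "ball (\<phi> x) (\<epsilon> / M)"]
    by (intro openin_Int) auto
  moreover have "x \<in> ?U"
    using x \<epsilon> M by (simp add: M_def)
  ultimately show "\<exists>U \<xi>'. openin X U \<and> x \<in> U \<and> \<xi>' \<in> sec E \<and>
      (\<forall>z\<in>U. nrm (fib E z) (?s z \<ominus>\<^bsub>fib E z\<^esub> \<xi>' z) \<le> \<epsilon>)"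
    using sec_smult[OF \<xi>] by blast
qed

lemma sections0_sec: "\<xi> \<in> sections0 X E \<Longrightarrow> \<xi> \<in> sec E"
  by (simp add: sections0_def)

lemma sections0_mem: "\<xi> \<in> sections0 X E \<Longrightarrow> x \<in> topspace X \<Longrightarrow> \<xi> x \<in> carrier (fib E x)"
  using sections0_sec sec_mem by blast

lemma sections0_vanish:
  assumes "\<xi> \<in> sections0 X E" "\<epsilon> > 0"
  obtains K where "compactin X K" "\<And>x. x \<in> topspace X \<Longrightarrow> x \<notin> K \<Longrightarrow> nrm (fib E x) (\<xi> x) < \<epsilon>"
  using assms by (auto simp: sections0_def)

text \<open>A single domination criterion serves sums, scalar multiples and products with bounded
  functions; for one dominating section the other is taken to be zero.\<close>

lemma sections0_dominated:
  assumes \<zeta>: "\<zeta> \<in> sec E" and g: "g \<in> sections0 X E" and s: "s \<in> sections0 X E"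
    and le: "\<And>x. x \<in> topspace X \<Longrightarrow>
      nrm (fib E x) (\<zeta> x) \<le> C * (nrm (fib E x) (g x) + nrm (fib E x) (s x))"
  shows "\<zeta> \<in> sections0 X E"
  unfolding sections0_def
proof (intro CollectI conjI allI impI \<zeta>)
  fix \<epsilon> :: real assume \<epsilon>: "\<epsilon> > 0"
  \<comment> \<open>The factor 2 accounts for the two dominating sections; no sign of
    \<open>C\<close> is assumed, hence the absolute value.\<close>
  define \<delta> where "\<delta> = \<epsilon> / (2 * (\<bar>C\<bar> + 1))"
  have \<delta>: "\<delta> > 0"
    using \<epsilon> by (simp add: \<delta>_def)
  obtain K where K: "compactin X K" "\<And>x. x \<in> topspace X \<Longrightarrow> x \<notin> K \<Longrightarrow> nrm (fib E x) (g x) < \<delta>"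
    using sections0_vanish[OF g \<delta>] by metis
  obtain L where L: "compactin X L" "\<And>x. x \<in> topspace X \<Longrightarrow> x \<notin> L \<Longrightarrow> nrm (fib E x) (s x) < \<delta>"
    using sections0_vanish[OF s \<delta>] by metis
  have "nrm (fib E x) (\<zeta> x) < \<epsilon>" if x: "x \<in> topspace X - (K \<union> L)" for x
  proof -
    let ?t = "nrm (fib E x) (g x) + nrm (fib E x) (s x)"
    have "0 \<le> ?t" "?t < 2 * \<delta>"
      using K(2)[of x] L(2)[of x] x normed.nrm_ge0[OF normed sections0_mem] g s
      by (auto intro!: add_nonneg_nonneg)
    then have "C * ?t \<le> (\<bar>C\<bar> + 1) * ?t" "(\<bar>C\<bar> + 1) * ?t < (\<bar>C\<bar> + 1) * (2 * \<delta>)"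
      by (auto intro!: mult_right_mono mult_strict_left_mono)
    moreover have "(\<bar>C\<bar> + 1) * (2 * \<delta>) = \<epsilon>"
      using abs_ge_zero[of C] unfolding \<delta>_def by (simp add: divide_simps)
    ultimately show ?thesis
      using le[of x] x by simp
  qed
  then show "\<exists>K. compactin X K \<and> (\<forall>x\<in>topspace X - K. nrm (fib E x) (\<zeta> x) < \<epsilon>)"
    using compactin_Un[OF K(1) L(1)] by blast
qed

lemma sections0_zero: "(\<lambda>x\<in>topspace X. \<zero>\<^bsub>fib E x\<^esub>) \<in> sections0 X E"
  using sec_zero normed.nrm_zero[OF normed] by (auto simp: sections0_def intro!: exI[of _ "{}"])

lemma sections0_add:
  assumes "\<xi> \<in> sections0 X E" "\<eta> \<in> sections0 X E"
  shows "(\<lambda>x\<in>topspace X. \<xi> x \<oplus>\<^bsub>fib E x\<^esub> \<eta> x) \<in> sections0 X E"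
  by (rule sections0_dominated[OF sec_add assms, where C = 1])
    (use assms sections0_sec sections0_mem in \<open>auto intro: normed.nrm_add[OF normed]\<close>)

lemma sections0_smult:
  assumes "\<xi> \<in> sections0 X E"
  shows "(\<lambda>x\<in>topspace X. c \<odot>\<^bsub>fib E x\<^esub> \<xi> x) \<in> sections0 X E"
  by (rule sections0_dominated[OF sec_smult assms sections0_zero, where C = "cmod c"])
    (use assms sections0_sec sections0_mem in \<open>auto simp: normed.nrm_smult[OF normed] normed.nrm_zero[OF normed]\<close>)

lemma sections0_real_mult:
  assumes "\<xi> \<in> sections0 X E" "continuous_map X euclideanreal \<phi>" "\<And>x. x \<in> topspace X \<Longrightarrow> \<bar>\<phi> x\<bar> \<le> 1"
  shows "(\<lambda>x\<in>topspace X. complex_of_real (\<phi> x) \<odot>\<^bsub>fib E x\<^esub> \<xi> x) \<in> sections0 X E"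
  by (rule sections0_dominated[OF sec_real_mult assms(1) sections0_zero, where C = 1])
    (use assms sections0_sec sections0_mem normed.nrm_ge0[OF normed] in
      \<open>auto simp: normed.nrm_smult[OF normed] normed.nrm_zero[OF normed] mult_left_le_one_le\<close>)

lemma sections0_ccomb:
  assumes g: "g \<in> sections0 X E" and s: "s \<in> sections0 X E"
    and \<phi>: "continuous_map X euclideanreal \<phi>" "\<And>x. x \<in> topspace X \<Longrightarrow> 0 \<le> \<phi> x \<and> \<phi> x \<le> 1"
  shows "ccomb X E \<phi> g s \<in> sections0 X E"
proof -
  have "continuous_map X euclideanreal (\<lambda>x. 1 - \<phi> x)"
    by (intro continuous_intros \<phi>(1))
  then show ?thesis
    using sections0_add[OF sections0_real_mult[OF g, of "\<lambda>x. 1 - \<phi> x"] sections0_real_mult[OF s \<phi>(1)]] \<phi>(2)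
    by (simp add: ccomb_def abs_le_iff cong: restrict_cong)
qed

text \<open>An upper semi-continuous function is bounded above on a compact set: the open sets where
  the norm is below n cover it. Off the compact set the norm is below 1.\<close>

lemma sections0_bounded:
  assumes \<xi>: "\<xi> \<in> sections0 X E"
  obtains M where "M > 0" "\<And>x. x \<in> topspace X \<Longrightarrow> nrm (fib E x) (\<xi> x) \<le> M"
proof -
  obtain K where K: "compactin X K" "\<And>x. x \<in> topspace X \<Longrightarrow> x \<notin> K \<Longrightarrow> nrm (fib E x) (\<xi> x) < 1"
    using sections0_vanish[OF \<xi>, of 1] by auto
  let ?U = "\<lambda>n::nat. {x \<in> topspace X. nrm (fib E x) (\<xi> x) < real n}"
  have "K \<subseteq> (\<Union>n. ?U n)"
    using compactin_subset_topspace[OF K(1)] reals_Archimedean2 by fastforce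
  then obtain \<F> where \<F>: "finite \<F>" "\<F> \<subseteq> range ?U" "K \<subseteq> \<Union>\<F>"
    using compactinD[OF K(1), of "range ?U"] sec_usc[OF sections0_sec[OF \<xi>]] by blast
  then obtain N where N: "finite N" "\<F> = ?U ` N"
    by (meson finite_subset_image)
  \<comment> \<open>The inserted 1 handles the points off \<open>K\<close>, and makes the bound
    positive even if \<open>N\<close> is empty.\<close>
  define n where "n = Max (insert 1 N)"
  have n: "m \<le> n" if "m \<in> insert 1 N" for m
    unfolding n_def using that N(1) by (intro Max_ge) auto
  have "nrm (fib E x) (\<xi> x) \<le> real n" if x: "x \<in> topspace X" for x
  proof (cases "x \<in> K")
    case True
    then obtain m where "m \<in> N" "nrm (fib E x) (\<xi> x) < real m"
      using \<F>(3) N(2) by auto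
    then show ?thesis
      using n[of m] by simp
  next
    case False
    then show ?thesis
      using K(2)[OF x] n[of 1] by simp
  qed
  then show ?thesis
    using that[of "real n"] n[of 1] by simp
qed

text \<open>This is (C4) with the whole space as neighbourhood, plus the usual argument at infinity.
  It gives completeness of the pushed fibres, and it shows that maps defined pointwise take values
  in them once this is known on a dense set.\<close>

lemma sections0_uniform_limit:
  assumes \<xi>: "\<xi> \<in> all_sections X (fib E)"
    and lim: "\<And>\<epsilon>. \<epsilon> > 0 \<Longrightarrow> \<exists>\<xi>'\<in>sections0 X E. \<forall>x\<in>topspace X. nrm (fib E x) (\<xi> x \<ominus>\<^bsub>fib E x\<^esub> \<xi>' x) \<le> \<epsilon>"
  shows "\<xi> \<in> sections0 X E"
  unfolding sections0_def
proof (intro CollectI conjI allI impI)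
  show "\<xi> \<in> sec E"
  proof (rule sec_localI[OF \<xi>])
    fix x \<epsilon> assume x: "x \<in> topspace X" and "(0::real) < \<epsilon>"
    then obtain \<xi>' where "\<xi>' \<in> sections0 X E" "\<forall>x\<in>topspace X. nrm (fib E x) (\<xi> x \<ominus>\<^bsub>fib E x\<^esub> \<xi>' x) \<le> \<epsilon>"
      using lim by blast
    then show "\<exists>U \<xi>'. openin X U \<and> x \<in> U \<and> \<xi>' \<in> sec E \<and>
        (\<forall>z\<in>U. nrm (fib E z) (\<xi> z \<ominus>\<^bsub>fib E z\<^esub> \<xi>' z) \<le> \<epsilon>)"
      using x sections0_sec by (intro exI[of _ "topspace X"] exI[of _ \<xi>']) auto
  qed
  fix \<epsilon> :: real assume \<epsilon>: "\<epsilon> > 0"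
  obtain \<xi>' where \<xi>': "\<xi>' \<in> sections0 X E"
    "\<And>x. x \<in> topspace X \<Longrightarrow> nrm (fib E x) (\<xi> x \<ominus>\<^bsub>fib E x\<^esub> \<xi>' x) \<le> \<epsilon> / 2"
    using lim[OF half_gt_zero[OF \<epsilon>]] by blast
  obtain K where K: "compactin X K" "\<And>x. x \<in> topspace X \<Longrightarrow> x \<notin> K \<Longrightarrow> nrm (fib E x) (\<xi>' x) < \<epsilon> / 2"
    using sections0_vanish[OF \<xi>'(1) half_gt_zero[OF \<epsilon>]] by metis
  have "nrm (fib E x) (\<xi> x) < \<epsilon>" if x: "x \<in> topspace X - K" for x
    using K(2)[of x] \<xi>'(2)[of x] x normed.nrm_le_diff[OF normed, of x "\<xi> x" "\<xi>' x"]
      all_sections_mem[OF \<xi>] sections0_mem[OF \<xi>'(1)] by fastforce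
  then show "\<exists>K. compactin X K \<and> (\<forall>x\<in>topspace X - K. nrm (fib E x) (\<xi> x) < \<epsilon>)"
    using K(1) by blast
qed

end

text \<open>Sections of pullbacks are characterised by local approximation, which is more convenient than
  the description of the generated structure by a definite description.\<close>

definition is_pullback ::
  "'z topology \<Rightarrow> ('z \<Rightarrow> 'x) \<Rightarrow> ('x, 'e, 'm) bfield_scheme \<Rightarrow> ('z, 'e, 'n) bfield_scheme \<Rightarrow> bool" where
  "is_pullback Z q E F \<longleftrightarrow>
     (\<forall>z\<in>topspace Z. fib F z = fib E (q z)) \<and>
     (\<forall>\<xi>. \<xi> \<in> sec F \<longleftrightarrow> \<xi> \<in> (\<Pi>\<^sub>E z\<in>topspace Z. carrier (fib E (q z))) \<and>
       (\<forall>z\<in>topspace Z. \<forall>\<epsilon>>0. \<exists>U \<xi>0. openin Z U \<and> z \<in> U \<and> \<xi>0 \<in> sec E \<and>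
          (\<forall>z'\<in>U. nrm (fib E (q z')) (\<xi> z' \<ominus>\<^bsub>fib E (q z')\<^esub> \<xi>0 (q z')) \<le> \<epsilon>)))"

lemma is_pullbackI:
  assumes "\<And>z. z \<in> topspace Z \<Longrightarrow> fib F z = fib E (q z)"
    and "\<And>\<xi>. \<xi> \<in> sec F \<Longrightarrow> \<xi> \<in> (\<Pi>\<^sub>E z\<in>topspace Z. carrier (fib E (q z)))"
    and "\<And>\<xi> z \<epsilon>. \<xi> \<in> sec F \<Longrightarrow> z \<in> topspace Z \<Longrightarrow> \<epsilon> > 0 \<Longrightarrow>
      \<exists>U \<xi>0. openin Z U \<and> z \<in> U \<and> \<xi>0 \<in> sec E \<and>
          (\<forall>z'\<in>U. nrm (fib E (q z')) (\<xi> z' \<ominus>\<^bsub>fib E (q z')\<^esub> \<xi>0 (q z')) \<le> \<epsilon>)"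
    and "\<And>\<xi>. \<xi> \<in> (\<Pi>\<^sub>E z\<in>topspace Z. carrier (fib E (q z))) \<Longrightarrow>
      (\<And>z \<epsilon>. z \<in> topspace Z \<Longrightarrow> \<epsilon> > 0 \<Longrightarrow> \<exists>U \<xi>0. openin Z U \<and> z \<in> U \<and> \<xi>0 \<in> sec E \<and>
          (\<forall>z'\<in>U. nrm (fib E (q z')) (\<xi> z' \<ominus>\<^bsub>fib E (q z')\<^esub> \<xi>0 (q z')) \<le> \<epsilon>)) \<Longrightarrow> \<xi> \<in> sec F"
  shows "is_pullback Z q E F"
  unfolding is_pullback_def
proof (intro conjI ballI allI iffI impI)
  fix \<xi> assume "\<xi> \<in> (\<Pi>\<^sub>E z\<in>topspace Z. carrier (fib E (q z))) \<and>
       (\<forall>z\<in>topspace Z. \<forall>\<epsilon>>0. \<exists>U \<xi>0. openin Z U \<and> z \<in> U \<and> \<xi>0 \<in> sec E \<and>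
          (\<forall>z'\<in>U. nrm (fib E (q z')) (\<xi> z' \<ominus>\<^bsub>fib E (q z')\<^esub> \<xi>0 (q z')) \<le> \<epsilon>))"
  then show "\<xi> \<in> sec F"
    by (intro assms(4)) blast+
next
  fix \<xi> assume \<xi>: "\<xi> \<in> sec F"
  show "\<xi> \<in> (\<Pi>\<^sub>E z\<in>topspace Z. carrier (fib E (q z)))"
    by (rule assms(2)[OF \<xi>])
  fix z \<epsilon> assume "z \<in> topspace Z" "(0::real) < \<epsilon>"
  then show "\<exists>U \<xi>0. openin Z U \<and> z \<in> U \<and> \<xi>0 \<in> sec E \<and>
          (\<forall>z'\<in>U. nrm (fib E (q z')) (\<xi> z' \<ominus>\<^bsub>fib E (q z')\<^esub> \<xi>0 (q z')) \<le> \<epsilon>)"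
    by (rule assms(3)[OF \<xi>])
qed (rule assms(1))

lemma is_pullback_fib: "is_pullback Z q E F \<Longrightarrow> z \<in> topspace Z \<Longrightarrow> fib F z = fib E (q z)"
  by (simp add: is_pullback_def)

lemma is_pullback_approx:
  assumes "is_pullback Z q E F" "\<xi> \<in> sec F" "z \<in> topspace Z" "\<epsilon> > 0"
  obtains U \<xi>0 where "openin Z U" "z \<in> U" "\<xi>0 \<in> sec E"
    "\<And>z'. z' \<in> U \<Longrightarrow> nrm (fib E (q z')) (\<xi> z' \<ominus>\<^bsub>fib E (q z')\<^esub> \<xi>0 (q z')) \<le> \<epsilon>"
  using assms unfolding is_pullback_def by meson

lemma is_pullback_mem:
  "is_pullback Z q E F \<Longrightarrow> \<xi> \<in> sec F \<Longrightarrow> \<xi> \<in> (\<Pi>\<^sub>E z\<in>topspace Z. carrier (fib E (q z)))"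
  unfolding is_pullback_def by blast

lemma is_pullback_secI:
  assumes "is_pullback Z q E F" "\<xi> \<in> (\<Pi>\<^sub>E z\<in>topspace Z. carrier (fib E (q z)))"
    and "\<And>z \<epsilon>. z \<in> topspace Z \<Longrightarrow> \<epsilon> > 0 \<Longrightarrow> \<exists>U \<xi>0. openin Z U \<and> z \<in> U \<and> \<xi>0 \<in> sec E \<and>
          (\<forall>z'\<in>U. nrm (fib E (q z')) (\<xi> z' \<ominus>\<^bsub>fib E (q z')\<^esub> \<xi>0 (q z')) \<le> \<epsilon>)"
  shows "\<xi> \<in> sec F"
  using assms unfolding is_pullback_def by blast

context field_over
begin

text \<open>Makes every field its own pullback along the identity, so that the pushforward itself is
  the case of trivial base change, with no need to compare \<open>pullback X id E\<close> with
  \<open>E\<close>.\<close>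

lemma is_pullback_id: "is_pullback X id E E"
proof (rule is_pullbackI; (unfold id_apply)?)
  fix \<xi> z \<epsilon> assume *: "\<xi> \<in> sec E" "z \<in> topspace X" "(0::real) < \<epsilon>"
  show "\<exists>U \<xi>0. openin X U \<and> z \<in> U \<and> \<xi>0 \<in> sec E \<and> (\<forall>z'\<in>U. nrm (fib E z') (\<xi> z' \<ominus>\<^bsub>fib E z'\<^esub> \<xi>0 z') \<le> \<epsilon>)"
    using * normed.nrm_zero[OF normed] normed.diff_self[OF normed] sec_mem
    by (intro exI[of _ "topspace X"] exI[of _ \<xi>]) auto
qed (use sec_all in \<open>auto simp: all_sections_def intro: sec_localI\<close>)

text \<open>Composites with f satisfy (C1)-(C3): density is inherited at f(z), and sublevel sets of
  norms are preimages of open sets. The abstract structure can thus be replaced by local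
  approximation.\<close>

lemma pullback:
  assumes f: "continuous_map Z X f"
  shows "usc_field Z (pullback Z f E)" "is_pullback Z f E (pullback Z f E)"
proof -
  let ?V = "\<lambda>z. fib E (f z)"
  let ?\<Gamma> = "(\<lambda>\<xi>. \<lambda>z\<in>topspace Z. \<xi> (f z)) ` sec E"
  have fX: "f z \<in> topspace X" if "z \<in> topspace Z" for z
    using f that by (simp add: continuous_map_def Pi_iff)
  note g = generated_structure[of Z ?V ?\<Gamma>]
  have lin: "linear_subspace Z ?V ?\<Gamma>"
    unfolding linear_subspace_def
  proof (intro conjI ballI allI)
    show "?\<Gamma> \<subseteq> all_sections Z ?V"
      using sec_mem fX by (auto simp: all_sections_def)
    show "(\<lambda>z\<in>topspace Z. \<zero>\<^bsub>fib E (f z)\<^esub>) \<in> ?\<Gamma>"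
      by (rule image_eqI[OF _ sec_zero]) (auto simp: fX)
    fix \<xi> assume "\<xi> \<in> ?\<Gamma>"
    then obtain \<xi>' where \<xi>': "\<xi>' \<in> sec E" "\<xi> = (\<lambda>z\<in>topspace Z. \<xi>' (f z))"
      by blast
    show "(\<lambda>z\<in>topspace Z. c \<odot>\<^bsub>fib E (f z)\<^esub> \<xi> z) \<in> ?\<Gamma>" for c
      by (rule image_eqI[OF _ sec_smult[OF \<xi>'(1), of c]]) (auto simp: fX \<xi>'(2))
    fix \<eta> assume "\<eta> \<in> ?\<Gamma>"
    then obtain \<eta>' where \<eta>': "\<eta>' \<in> sec E" "\<eta> = (\<lambda>z\<in>topspace Z. \<eta>' (f z))"
      by blast
    show "(\<lambda>z\<in>topspace Z. \<xi> z \<oplus>\<^bsub>fib E (f z)\<^esub> \<eta> z) \<in> ?\<Gamma>"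
      by (rule image_eqI[OF _ sec_add[OF \<xi>'(1) \<eta>'(1)]]) (auto simp: fX \<xi>'(2) \<eta>'(2))
  qed
  have dense: "\<exists>\<xi>\<in>?\<Gamma>. nrm (?V z) (e \<ominus>\<^bsub>?V z\<^esub> \<xi> z) < \<epsilon>"
    if z: "z \<in> topspace Z" "e \<in> carrier (?V z)" "\<epsilon> > 0" for z e \<epsilon>
  proof -
    obtain \<xi>' where "\<xi>' \<in> sec E" "nrm (?V z) (e \<ominus>\<^bsub>?V z\<^esub> \<xi>' (f z)) < \<epsilon>"
      using sec_dense[OF fX[OF z(1)] z(2,3)] .
    then show ?thesis
      using z(1) by (intro bexI[of _ "\<lambda>z\<in>topspace Z. \<xi>' (f z)"]) auto
  qed
  have usc: "openin Z {z \<in> topspace Z. nrm (?V z) (\<xi> z) < c}" if \<xi>: "\<xi> \<in> ?\<Gamma>" for \<xi> c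
  proof -
    obtain \<xi>' where \<xi>': "\<xi>' \<in> sec E" "\<xi> = (\<lambda>z\<in>topspace Z. \<xi>' (f z))"
      using \<xi> by blast
    have "{z \<in> topspace Z. nrm (?V z) (\<xi> z) < c}
      = {z \<in> topspace Z. f z \<in> {x \<in> topspace X. nrm (fib E x) (\<xi>' x) < c}}"
      using fX by (auto simp: \<xi>'(2))
    then show ?thesis
      using openin_continuous_map_preimage[OF f sec_usc[OF \<xi>'(1)]] by simp
  qed
  note gs = generated_structure[of Z ?V ?\<Gamma>, OF normed[OF fX] lin dense usc]
  show "usc_field Z (pullback Z f E)"
    using gs(2) banach fX by (simp add: usc_field_def pullback_def)
  have la: "locally_approximable Z ?V ?\<Gamma> \<xi> \<longleftrightarrow>
    (\<forall>z\<in>topspace Z. \<forall>\<epsilon>>0. \<exists>U \<xi>0. openin Z U \<and> z \<in> U \<and> \<xi>0 \<in> sec E \<and>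
      (\<forall>z'\<in>U. nrm (?V z') (\<xi> z' \<ominus>\<^bsub>?V z'\<^esub> \<xi>0 (f z')) \<le> \<epsilon>))" for \<xi>
  proof -
    have "(\<exists>\<xi>'. openin Z U \<and> z \<in> U \<and> \<xi>' \<in> ?\<Gamma> \<and> (\<forall>z\<in>U. nrm (?V z) (\<xi> z \<ominus>\<^bsub>?V z\<^esub> \<xi>' z) \<le> \<epsilon>)) \<longleftrightarrow>
      (\<exists>\<xi>0. openin Z U \<and> z \<in> U \<and> \<xi>0 \<in> sec E \<and>
      (\<forall>z'\<in>U. nrm (?V z') (\<xi> z' \<ominus>\<^bsub>?V z'\<^esub> \<xi>0 (f z')) \<le> \<epsilon>))" for U z \<epsilon>
    proof -
      have *: "(\<lambda>z\<in>topspace Z. \<xi>0 (f z)) z' = \<xi>0 (f z')" if "openin Z U" "z' \<in> U" for \<xi>0 :: "'x \<Rightarrow> 'e" and z'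
        using openin_subset[OF that(1)] that(2) by auto
      show ?thesis
      proof (intro iffI; elim exE conjE imageE)
        fix \<xi>' \<xi>0 assume "openin Z U" "z \<in> U" "\<forall>z\<in>U. nrm (?V z) (\<xi> z \<ominus>\<^bsub>?V z\<^esub> \<xi>' z) \<le> \<epsilon>"
          "\<xi>' = (\<lambda>z\<in>topspace Z. \<xi>0 (f z))" "\<xi>0 \<in> sec E"
        then show "\<exists>\<xi>0. openin Z U \<and> z \<in> U \<and> \<xi>0 \<in> sec E \<and>
            (\<forall>z'\<in>U. nrm (?V z') (\<xi> z' \<ominus>\<^bsub>?V z'\<^esub> \<xi>0 (f z')) \<le> \<epsilon>)"
          using * by (intro exI[of _ \<xi>0]) simp
      next
        fix \<xi>0 assume "openin Z U" "z \<in> U" "\<xi>0 \<in> sec E"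
          "\<forall>z'\<in>U. nrm (?V z') (\<xi> z' \<ominus>\<^bsub>?V z'\<^esub> \<xi>0 (f z')) \<le> \<epsilon>"
        then show "\<exists>\<xi>'. openin Z U \<and> z \<in> U \<and> \<xi>' \<in> ?\<Gamma> \<and> (\<forall>z\<in>U. nrm (?V z) (\<xi> z \<ominus>\<^bsub>?V z\<^esub> \<xi>' z) \<le> \<epsilon>)"
          using * by (intro exI[of _ "\<lambda>z\<in>topspace Z. \<xi>0 (f z)"]) simp
      qed
    qed
    then show ?thesis
      unfolding locally_approximable_def by simp
  qed
  show "is_pullback Z f E (pullback Z f E)"
    unfolding is_pullback_def pullback_def using gs(1) la by (simp add: all_sections_def)
qed

end

lemma is_pullback_section:
  assumes E: "usc_field X E" and F: "is_pullback Z q E F" and q: "continuous_map Z X q" and \<xi>: "\<xi> \<in> sec E"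
  shows "(\<lambda>z\<in>topspace Z. \<xi> (q z)) \<in> sec F"
proof -
  interpret field_over X E by unfold_locales fact
  have qX: "q z \<in> topspace X" if "z \<in> topspace Z" for z
    using q that by (simp add: continuous_map_def Pi_iff)
  show ?thesis
  proof (rule is_pullback_secI[OF F])
    fix z \<epsilon> assume *: "z \<in> topspace Z" "(0::real) < \<epsilon>"
    show "\<exists>U \<xi>0. openin Z U \<and> z \<in> U \<and> \<xi>0 \<in> sec E \<and> (\<forall>z'\<in>U.
      nrm (fib E (q z')) ((\<lambda>z\<in>topspace Z. \<xi> (q z)) z' \<ominus>\<^bsub>fib E (q z')\<^esub> \<xi>0 (q z')) \<le> \<epsilon>)"
      using * \<xi> qX normed.nrm_zero[OF normed] normed.diff_self[OF normed] sec_mem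
      by (intro exI[of _ "topspace Z"] exI[of _ \<xi>]) auto
  qed (use \<xi> qX sec_mem in auto)
qed

text \<open>Pullback in stages along q \<circ> h = r. It is applied with h the embedding of one
  fibre of the anchor map into a fibre product.\<close>

lemma is_pullback_comp:
  assumes F: "is_pullback Z q E F" and h: "continuous_map V Z h" and F': "is_pullback V r E F'"
    and r: "\<And>v. v \<in> topspace V \<Longrightarrow> q (h v) = r v" and \<eta>: "\<eta> \<in> sec F"
  shows "(\<lambda>v\<in>topspace V. \<eta> (h v)) \<in> sec F'"
proof (rule is_pullback_secI[OF F'])
  have hZ: "h v \<in> topspace Z" if "v \<in> topspace V" for v
    using h that by (simp add: continuous_map_def Pi_iff)
  show "(\<lambda>v\<in>topspace V. \<eta> (h v)) \<in> (\<Pi>\<^sub>E v\<in>topspace V. carrier (fib E (r v)))"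
  proof (rule restrict_PiE_iff[THEN iffD2], rule ballI)
    fix v assume v: "v \<in> topspace V"
    show "\<eta> (h v) \<in> carrier (fib E (r v))"
      using PiE_mem[OF is_pullback_mem[OF F \<eta>] hZ[OF v]] by (simp add: r[OF v])
  qed
  fix v \<epsilon> assume v: "v \<in> topspace V" and \<epsilon>: "(0::real) < \<epsilon>"
  obtain U \<xi> where U: "openin Z U" "h v \<in> U" "\<xi> \<in> sec E"
    "\<And>z'. z' \<in> U \<Longrightarrow> nrm (fib E (q z')) (\<eta> z' \<ominus>\<^bsub>fib E (q z')\<^esub> \<xi> (q z')) \<le> \<epsilon>"
    using is_pullback_approx[OF F \<eta> hZ[OF v] \<epsilon>] by metis
  then show "\<exists>U \<xi>0. openin V U \<and> v \<in> U \<and> \<xi>0 \<in> sec E \<and> (\<forall>z'\<in>U.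
      nrm (fib E (r z')) ((\<lambda>v\<in>topspace V. \<eta> (h v)) z' \<ominus>\<^bsub>fib E (r z')\<^esub> \<xi>0 (r z')) \<le> \<epsilon>)"
    using openin_continuous_map_preimage[OF h U(1)] v
    by (intro exI[of _ "{v \<in> topspace V. h v \<in> U}"] exI[of _ \<xi>]) (auto simp flip: r)
qed

section \<open>Uniform density of sections\<close>

text \<open>Replacing an approximant \<open>g\<close> by \<open>(1 - \<phi>) g + \<phi> s\<close> for bump functions \<open>\<phi>\<close> supported where
  \<open>s\<close> is close to \<open>h\<close> improves the approximation locally without spoiling it elsewhere; this makes
  partitions of unity unnecessary.\<close>

lemma (in field_over) sections0_dense:
  assumes S: "S \<subseteq> sections0 X E" "(\<lambda>x\<in>topspace X. \<zero>\<^bsub>fib E x\<^esub>) \<in> S"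
    and comb: "\<And>g s \<phi>. g \<in> S \<Longrightarrow> s \<in> S \<Longrightarrow> \<phi> \<in> \<Phi> \<Longrightarrow> ccomb X E \<phi> g s \<in> S"
    and \<Phi>: "\<And>\<phi> x. \<phi> \<in> \<Phi> \<Longrightarrow> x \<in> topspace X \<Longrightarrow> 0 \<le> \<phi> x \<and> \<phi> x \<le> (1::real)"
    and sep: "\<And>x U. openin X U \<Longrightarrow> x \<in> U \<Longrightarrow>
      \<exists>\<phi>\<in>\<Phi>. \<exists>V. openin X V \<and> x \<in> V \<and> (\<forall>z\<in>V. \<phi> z = 1) \<and> (\<forall>z\<in>topspace X - U. \<phi> z = 0)"
    and pt: "\<And>x e \<epsilon>. x \<in> topspace X \<Longrightarrow> e \<in> carrier (fib E x) \<Longrightarrow> \<epsilon> > 0 \<Longrightarrow>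
      \<exists>s\<in>S. nrm (fib E x) (e \<ominus>\<^bsub>fib E x\<^esub> s x) < \<epsilon>"
    and h: "h \<in> sections0 X E" and \<epsilon>: "\<epsilon> > 0"
  shows "\<exists>g\<in>S. \<forall>x\<in>topspace X. nrm (fib E x) (h x \<ominus>\<^bsub>fib E x\<^esub> g x) \<le> \<epsilon>"
proof -
  have m: "s x \<in> carrier (fib E x)" if "s \<in> S" "x \<in> topspace X" for s x
    using sections0_mem S that by blast
  note hm = sections0_mem[OF h]
  obtain K where K: "compactin X K" "\<And>x. x \<in> topspace X \<Longrightarrow> x \<notin> K \<Longrightarrow> nrm (fib E x) (h x) < \<epsilon>"
    using sections0_vanish[OF h \<epsilon>] by metis
  have KX: "K \<subseteq> topspace X"
    using K(1) by (rule compactin_subset_topspace)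
  \<comment> \<open>The cut-off vanishes wherever \<open>s\<close> misses \<open>h\<close> by more
    than \<epsilon>, so mixing in \<open>s\<close> never introduces an error beyond
    \<epsilon>.\<close>
  define P where "P x s \<phi> V \<longleftrightarrow> s \<in> S \<and> \<phi> \<in> \<Phi> \<and> openin X V \<and> x \<in> V \<and> (\<forall>z\<in>V. \<phi> z = 1) \<and>
    (\<forall>z\<in>topspace X. \<phi> z = 0 \<or> nrm (fib E z) (h z \<ominus>\<^bsub>fib E z\<^esub> s z) \<le> \<epsilon>)" for x s \<phi> V
  have "\<exists>s \<phi> V. P x s \<phi> V" if x: "x \<in> K" for x
  proof -
    have xX: "x \<in> topspace X"
      using x KX by blast
    obtain s where s: "s \<in> S" "nrm (fib E x) (h x \<ominus>\<^bsub>fib E x\<^esub> s x) < \<epsilon>"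
      using pt[OF xX hm[OF xX] \<epsilon>] by blast
    let ?U = "{z \<in> topspace X. nrm (fib E z) (h z \<ominus>\<^bsub>fib E z\<^esub> s z) < \<epsilon>}"
    have "openin X ?U"
      using sec_usc_diff[of h s] sections0_sec h s(1) S(1) by blast
    moreover have "x \<in> ?U"
      using xX s(2) by simp
    ultimately have "\<exists>\<phi>\<in>\<Phi>. \<exists>V. openin X V \<and> x \<in> V \<and> (\<forall>z\<in>V. \<phi> z = 1) \<and> (\<forall>z\<in>topspace X - ?U. \<phi> z = 0)"
      by (rule sep)
    then obtain \<phi> V where "\<phi> \<in> \<Phi>" "openin X V" "x \<in> V" "\<forall>z\<in>V. \<phi> z = 1" "\<forall>z\<in>topspace X - ?U. \<phi> z = 0"
      by (elim bexE exE conjE)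
    then show ?thesis
      using s(1) unfolding P_def by (intro exI[of _ s] exI[of _ \<phi>] exI[of _ V]) force
  qed
  then obtain s \<phi> V where "\<And>x. x \<in> K \<Longrightarrow> P x (s x) (\<phi> x) (V x)"
    by metis
  note sel = this[unfolded P_def]
  obtain \<F> where \<F>: "finite \<F>" "\<F> \<subseteq> V ` K" "K \<subseteq> \<Union>\<F>"
    using compactinD[OF K(1), of "V ` K"] sel by blast
  then obtain F where F: "finite F" "F \<subseteq> K" "\<F> = V ` F"
    by (meson finite_subset_image)
  \<comment> \<open>The invariant of the patching. The start g = 0 has error the norm of h; at the
    end the maximum is \<epsilon> off \<open>K\<close>, since h is small there, and \<open>K\<close>
    itself is covered.\<close>
  have "\<exists>g\<in>S. \<forall>z\<in>topspace X. nrm (fib E z) (h z \<ominus>\<^bsub>fib E z\<^esub> g z) \<le> max \<epsilon> (nrm (fib E z) (h z)) \<and>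
    (z \<in> (\<Union>x\<in>F. V x) \<longrightarrow> nrm (fib E z) (h z \<ominus>\<^bsub>fib E z\<^esub> g z) \<le> \<epsilon>)"
    using F(1,2)
  proof (induction F)
    case empty
    show ?case
      using S(2) normed.nrm_diff_zero[OF normed hm] by (intro bexI[OF _ S(2)]) auto
  next
    case (insert x F)
    then obtain g where g: "g \<in> S" "\<And>z. z \<in> topspace X \<Longrightarrow> nrm (fib E z) (h z \<ominus>\<^bsub>fib E z\<^esub> g z) \<le> max \<epsilon> (nrm (fib E z) (h z))"
       "\<And>z. z \<in> topspace X \<Longrightarrow> z \<in> (\<Union>x\<in>F. V x) \<Longrightarrow> nrm (fib E z) (h z \<ominus>\<^bsub>fib E z\<^esub> g z) \<le> \<epsilon>"
      by auto
    have x: "s x \<in> S" "\<phi> x \<in> \<Phi>" "\<And>z. z \<in> V x \<Longrightarrow> \<phi> x z = 1"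
      "\<And>z. z \<in> topspace X \<Longrightarrow> \<phi> x z = 0 \<or> nrm (fib E z) (h z \<ominus>\<^bsub>fib E z\<^esub> s x z) \<le> \<epsilon>"
      using sel[of x] insert.prems by auto
    let ?g = "ccomb X E (\<phi> x) g (s x)"
    have "nrm (fib E z) (h z \<ominus>\<^bsub>fib E z\<^esub> ?g z) \<le> max \<epsilon> (nrm (fib E z) (h z)) \<and>
      (z \<in> (\<Union>x\<in>insert x F. V x) \<longrightarrow> nrm (fib E z) (h z \<ominus>\<^bsub>fib E z\<^esub> ?g z) \<le> \<epsilon>)" if z: "z \<in> topspace X" for z
    proof -
      let ?a = "nrm (fib E z) (h z \<ominus>\<^bsub>fib E z\<^esub> g z)" and ?b = "nrm (fib E z) (h z \<ominus>\<^bsub>fib E z\<^esub> s x z)"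
      have t: "0 \<le> \<phi> x z" "\<phi> x z \<le> 1"
        using \<Phi>[OF x(2) z] by auto
      have le: "nrm (fib E z) (h z \<ominus>\<^bsub>fib E z\<^esub> ?g z) \<le> (1 - \<phi> x z) * ?a + \<phi> x z * ?b"
        using normed.nrm_convex_combination[OF normed[OF z] hm[OF z] m[OF g(1) z] m[OF x(1) z] t] z
        by (simp add: ccomb_def)
      \<comment> \<open>Taken with the maximum as c this preserves the global bound, and with c =
        \<epsilon> it preserves the good bound on the part already treated. On \<open>V x\<close>
        the cut-off is 1 and only \<open>s x\<close> counts.\<close>
      have *: "(1 - \<phi> x z) * ?a + \<phi> x z * ?b \<le> c" if "?a \<le> c" "\<epsilon> \<le> c" for c
      proof -
        have "\<phi> x z * ?b \<le> \<phi> x z * c"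
          using x(4)[OF z] t that(2) by (auto intro: mult_left_mono)
        moreover have "(1 - \<phi> x z) * ?a \<le> (1 - \<phi> x z) * c"
          using t that(1) by (intro mult_left_mono) auto
        ultimately show ?thesis
          by (simp add: algebra_simps)
      qed
      have "(1 - \<phi> x z) * ?a + \<phi> x z * ?b \<le> \<epsilon>" if "z \<in> V x"
        using x(3)[OF that] x(4)[OF z] by auto
      then show ?thesis
        using le *[OF g(2)[OF z]] *[OF g(3)[OF z]] by fastforce
    qed
    then show ?case
      using comb[OF g(1) x(1,2)] by blast
  qed
  then obtain g where g: "g \<in> S" "\<And>z. z \<in> topspace X \<Longrightarrow> nrm (fib E z) (h z \<ominus>\<^bsub>fib E z\<^esub> g z) \<le> max \<epsilon> (nrm (fib E z) (h z)) \<and>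
    (z \<in> (\<Union>x\<in>F. V x) \<longrightarrow> nrm (fib E z) (h z \<ominus>\<^bsub>fib E z\<^esub> g z) \<le> \<epsilon>)"
    by blast
  have "nrm (fib E z) (h z \<ominus>\<^bsub>fib E z\<^esub> g z) \<le> \<epsilon>" if "z \<in> topspace X" for z
    using g(2)[OF that] K(2)[OF that] \<F>(3) F(3) by (cases "z \<in> K") auto
  then show ?thesis
    using g(1) by blast
qed

text \<open>Locally compact Hausdorff spaces are completely regular.\<close>

lemma bump_function:
  assumes X: "locally_compact_space X" "Hausdorff_space X" and U: "openin X U" "x \<in> U"
  obtains \<phi> V where "continuous_map X euclideanreal \<phi>" "\<And>z. z \<in> topspace X \<Longrightarrow> 0 \<le> \<phi> z \<and> \<phi> z \<le> 1"
    "openin X V" "x \<in> V" "\<And>z. z \<in> V \<Longrightarrow> \<phi> z = 1" "\<And>z. z \<in> topspace X - U \<Longrightarrow> \<phi> z = 0"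
proof -
  have "completely_regular_space X"
    using X locally_compact_regular_imp_completely_regular_space by blast
  then obtain f where f: "continuous_map X euclideanreal f" "f x = 0" "f ` (topspace X - U) \<subseteq> {1::real}"
    using U unfolding completely_regular_space_alt' by blast
  \<comment> \<open>Complete regularity prescribes the value only at x, whereas \<phi> must be 1
    near x. The rescaling is 1 where f is at most 1/2 and 0 where f is 1.\<close>
  define \<phi> where "\<phi> = (\<lambda>z. min 1 (max 0 (2 - 2 * f z)))"
  show ?thesis
  proof (rule that)
    show "continuous_map X euclideanreal \<phi>"
      unfolding \<phi>_def by (intro continuous_intros f(1))
    show "openin X {z \<in> topspace X. f z \<in> {..<1/2}}"
      by (rule openin_continuous_map_preimage[OF f(1)]) auto
  qed (use f U openin_subset[OF U(1)] in \<open>auto simp: \<phi>_def\<close>)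
qed

section \<open>The pushforward of a field\<close>

text \<open>A section from (C2) is multiplied by a cut-off that is 1 at x and supported in a compact
  neighbourhood, so \<Gamma>_0 has dense values as well.\<close>

lemma (in field_over) sections0_pointwise_dense:
  assumes X: "locally_compact_space X" "Hausdorff_space X"
    and x: "x \<in> topspace X" and e: "e \<in> carrier (fib E x)" and \<epsilon>: "\<epsilon> > 0"
  obtains \<xi> where "\<xi> \<in> sections0 X E" "nrm (fib E x) (e \<ominus>\<^bsub>fib E x\<^esub> \<xi> x) < \<epsilon>"
proof -
  obtain \<xi> where \<xi>: "\<xi> \<in> sec E" "nrm (fib E x) (e \<ominus>\<^bsub>fib E x\<^esub> \<xi> x) < \<epsilon>"
    using sec_dense[OF x e \<epsilon>] .
  obtain U K where U: "openin X U" "compactin X K" "x \<in> U" "U \<subseteq> K"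
    using X(1) x unfolding locally_compact_space_def by blast
  obtain \<phi> V where \<phi>: "continuous_map X euclideanreal \<phi>" "\<And>z. z \<in> topspace X \<Longrightarrow> 0 \<le> \<phi> z \<and> \<phi> z \<le> 1"
    "openin X V" "x \<in> V" "\<And>z. z \<in> V \<Longrightarrow> \<phi> z = 1" "\<And>z. z \<in> topspace X - U \<Longrightarrow> \<phi> z = 0"
    using bump_function[OF X U(1,3)] by metis
  let ?s = "\<lambda>x\<in>topspace X. complex_of_real (\<phi> x) \<odot>\<^bsub>fib E x\<^esub> \<xi> x"
  have "nrm (fib E z) (?s z) = 0" if "z \<in> topspace X - K" for z
  proof -
    have "\<phi> z = 0"
      using that \<phi>(6) U(4) by blast
    then show ?thesis
      using that sec_mem[OF \<xi>(1)] by (simp add: normed.smult_0[OF normed] normed.nrm_zero[OF normed])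
  qed
  then have "?s \<in> sections0 X E"
    using sec_real_mult[OF \<xi>(1) \<phi>(1)] U(2) by (auto simp: sections0_def intro!: exI[of _ K])
  moreover have "?s x = \<xi> x"
    using x \<phi>(4,5) sec_mem[OF \<xi>(1)] by (simp add: normed.smult_1[OF normed])
  ultimately show ?thesis
    using \<xi>(2) by (intro that[of ?s]) auto
qed

lemma push_fibre_simps:
  "carrier (push_fibre Y E x) = sections0 (subtopology (spc Y) (anchor_fibre Y x))
     (restrict_field (spc Y) (anchor_fibre Y x) E)"
  "mult (push_fibre Y E x) = (\<lambda>\<xi> \<eta>. \<lambda>y\<in>anchor_fibre Y x. \<xi> y \<otimes>\<^bsub>fib E y\<^esub> \<eta> y)"
  "zero (push_fibre Y E x) = (\<lambda>y\<in>anchor_fibre Y x. \<zero>\<^bsub>fib E y\<^esub>)"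
  "add (push_fibre Y E x) = (\<lambda>\<xi> \<eta>. \<lambda>y\<in>anchor_fibre Y x. \<xi> y \<oplus>\<^bsub>fib E y\<^esub> \<eta> y)"
  "smult (push_fibre Y E x) = (\<lambda>c \<xi>. \<lambda>y\<in>anchor_fibre Y x. c \<odot>\<^bsub>fib E y\<^esub> \<xi> y)"
  "nrm (push_fibre Y E x) = (\<lambda>\<xi>. Sup (insert 0 ((\<lambda>y. nrm (fib E y) (\<xi> y)) ` anchor_fibre Y x)))"
  by (simp_all add: push_fibre_def)

lemma anchor_fibre_iff: "y \<in> anchor_fibre Y x \<longleftrightarrow> y \<in> topspace (spc Y) \<and> anchor Y y = x"
  by (auto simp: anchor_fibre_def)

lemma topspace_Int_fibre [simp]: "topspace (spc Y) \<inter> anchor_fibre Y x = anchor_fibre Y x"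
  by (auto simp: anchor_fibre_iff)

text \<open>The condition 0 \<le> c reflects the 0 inserted into the supremum for empty
  fibres.\<close>

lemma push_nrm_le:
  "0 \<le> c \<Longrightarrow> (\<And>y. y \<in> anchor_fibre Y x \<Longrightarrow> nrm (fib E y) (\<xi> y) \<le> c) \<Longrightarrow> nrm (push_fibre Y E x) \<xi> \<le> c"
  unfolding push_fibre_simps by (rule cSup_least) auto

locale gspace_over =
  fixes G :: "('g, 'x) groupoid" and Y :: "('g, 'x, 'y) gspace"
  assumes G: "lch_groupoid G" and Y: "lch_gspace G Y"
begin

abbreviation "\<Gamma>0 E \<equiv> sections0 (spc Y) E"
abbreviation "Yf \<equiv> anchor_fibre Y"
abbreviation "Q x \<equiv> subtopology (spc Y) (anchor_fibre Y x)"
abbreviation "R E x \<equiv> restrict_field (spc Y) (anchor_fibre Y x) E"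

lemma lcY: "locally_compact_space (spc Y)" and hausY: "Hausdorff_space (spc Y)"
  and anchor: "continuous_map (spc Y) (obj G) (anchor Y)"
  using Y by (simp_all add: lch_gspace_def)

lemma lcX: "locally_compact_space (obj G)" and hausX: "Hausdorff_space (obj G)"
  using G by (simp_all add: lch_groupoid_def)

lemma closedin_fibre: "x \<in> topspace (obj G) \<Longrightarrow> closedin (spc Y) (Yf x)"
  unfolding anchor_fibre_def
  using closedin_continuous_map_preimage[OF anchor, of "{x}"] closedin_Hausdorff_singleton[OF hausX]
  by simp

lemma incl: "continuous_map (Q x) (spc Y) id"
  by (simp add: continuous_map_from_subtopology)

lemma compactin_fibre: "x \<in> topspace (obj G) \<Longrightarrow> compactin (spc Y) K \<Longrightarrow> compactin (Q x) (Yf x \<inter> K)"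
  using closed_Int_compactin[OF closedin_fibre] by (auto simp: compactin_subtopology)

context
  fixes E :: "('y, 'e, 'm) bfield_scheme"
  assumes E: "usc_field (spc Y) E"
begin

interpretation E: field_over "spc Y" E
  by unfold_locales (rule E)

lemma restricted_field: "field_over (Q x) (R E x)" "is_pullback (Q x) id E (R E x)" "fib (R E x) y = fib E y"
proof -
  show "field_over (Q x) (R E x)" 
    unfolding restrict_field_def by (intro field_over.intro E.pullback incl)
  show "is_pullback (Q x) id E (R E x)"
    unfolding restrict_field_def by (intro E.pullback incl)
qed (simp add: restrict_field_def pullback_def)

section \<open>The Banach space over one point of the base\<close>

lemma push_mem: "\<xi> \<in> carrier (push_fibre Y E x) \<Longrightarrow> y \<in> Yf x \<Longrightarrow> \<xi> y \<in> carrier (fib E y)"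
  using field_over.sections0_mem[OF restricted_field(1)] restricted_field(3) by (simp add: push_fibre_simps)

lemma push_ext: "\<xi> \<in> carrier (push_fibre Y E x) \<Longrightarrow> \<xi> \<in> extensional (Yf x)"
  using field_over.sec_all[OF restricted_field(1) field_over.sections0_sec[OF restricted_field(1)]]
  by (simp add: push_fibre_simps all_sections_def PiE_iff)

lemma push_eqI:
  assumes "\<xi> \<in> extensional (Yf x)" "\<eta> \<in> extensional (Yf x)" "\<And>y. y \<in> Yf x \<Longrightarrow> \<xi> y = \<eta> y"
  shows "\<xi> = \<eta>"
  using extensionalityI[OF assms] .

lemma normed_fib: "y \<in> Yf x \<Longrightarrow> normed (fib E y)"
  using E.normed by (simp add: anchor_fibre_iff)

lemma push_bdd:
  assumes "\<xi> \<in> carrier (push_fibre Y E x)"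
  shows "bdd_above (insert 0 ((\<lambda>y. nrm (fib E y) (\<xi> y)) ` Yf x))"
proof -
  obtain M where "M > 0" "\<And>y. y \<in> Yf x \<Longrightarrow> nrm (fib E y) (\<xi> y) \<le> M"
    using field_over.sections0_bounded[OF restricted_field(1), of \<xi> x] assms
    by (auto simp: push_fibre_simps restricted_field(3))
  then show ?thesis
    by (intro bdd_aboveI[of _ M]) auto
qed

lemma push_nrm_ge: "\<xi> \<in> carrier (push_fibre Y E x) \<Longrightarrow> y \<in> Yf x \<Longrightarrow> nrm (fib E y) (\<xi> y) \<le> nrm (push_fibre Y E x) \<xi>"
  unfolding push_fibre_simps(6) by (rule cSup_upper) (use push_bdd in auto)

lemma push_nrm_ge0: "\<xi> \<in> carrier (push_fibre Y E x) \<Longrightarrow> 0 \<le> nrm (push_fibre Y E x) \<xi>"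
  unfolding push_fibre_simps(6) by (rule cSup_upper) (use push_bdd in auto)

text \<open>All algebraic axioms hold pointwise, and elements are extensional, so pointwise equality
  on the fibre of the anchor map is equality.\<close>

lemma normed_push: "normed (push_fibre Y E x)" (is "normed ?V")
proof -
  interpret R: field_over "Q x" "R E x" by (rule restricted_field(1))
  have add: "\<xi> \<oplus>\<^bsub>?V\<^esub> \<eta> \<in> carrier ?V" if "\<xi> \<in> carrier ?V" "\<eta> \<in> carrier ?V" for \<xi> \<eta>
    using R.sections0_add[of \<xi> \<eta>] that by (simp add: push_fibre_simps restricted_field(3))
  have smult: "c \<odot>\<^bsub>?V\<^esub> \<xi> \<in> carrier ?V" if "\<xi> \<in> carrier ?V" for c \<xi>
    using R.sections0_smult[of \<xi> c] that by (simp add: push_fibre_simps restricted_field(3))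
  have zero: "\<zero>\<^bsub>?V\<^esub> \<in> carrier ?V"
    using R.sections0_zero by (simp add: push_fibre_simps restricted_field(3))
  have ext: "\<xi> \<oplus>\<^bsub>?V\<^esub> \<eta> \<in> extensional (Yf x)" "c \<odot>\<^bsub>?V\<^esub> \<xi> \<in> extensional (Yf x)" "\<zero>\<^bsub>?V\<^esub> \<in> extensional (Yf x)" for \<xi> \<eta> c
    by (simp_all add: push_fibre_simps)
  have at: "(\<xi> \<oplus>\<^bsub>?V\<^esub> \<eta>) y = \<xi> y \<oplus>\<^bsub>fib E y\<^esub> \<eta> y" "(c \<odot>\<^bsub>?V\<^esub> \<xi>) y = c \<odot>\<^bsub>fib E y\<^esub> \<xi> y" "\<zero>\<^bsub>?V\<^esub> y = \<zero>\<^bsub>fib E y\<^esub>"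
    if "y \<in> Yf x" for \<xi> \<eta> c y
    using that by (simp_all add: push_fibre_simps)
  have am: "abelian_group (fib E y)" "abelian_monoid (fib E y)" if "y \<in> Yf x" for y
    using normed.module[OF normed_fib[OF that]] module.axioms(2) abelian_group.axioms(1) by blast+
  note pm = push_mem[where x = x] and pe = push_ext[where x = x] and nf = normed_fib[where x = x]
  have ab: "abelian_group ?V"
    proof (rule abelian_groupI)
      fix \<xi> \<eta> \<zeta> assume m: "\<xi> \<in> carrier ?V" "\<eta> \<in> carrier ?V" "\<zeta> \<in> carrier ?V"
      show "\<xi> \<oplus>\<^bsub>?V\<^esub> \<eta> \<oplus>\<^bsub>?V\<^esub> \<zeta> = \<xi> \<oplus>\<^bsub>?V\<^esub> (\<eta> \<oplus>\<^bsub>?V\<^esub> \<zeta>)"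
        by (rule push_eqI[where x = x]) (simp_all add: ext at m pm abelian_monoid.a_assoc[OF am(2)])
    next
      fix \<xi> \<eta> assume m: "\<xi> \<in> carrier ?V" "\<eta> \<in> carrier ?V"
      show "\<xi> \<oplus>\<^bsub>?V\<^esub> \<eta> = \<eta> \<oplus>\<^bsub>?V\<^esub> \<xi>"
        by (rule push_eqI[where x = x]) (simp_all add: ext at m pm abelian_monoid.a_comm[OF am(2)])
    next
      fix \<xi> assume m: "\<xi> \<in> carrier ?V"
      show "\<zero>\<^bsub>?V\<^esub> \<oplus>\<^bsub>?V\<^esub> \<xi> = \<xi>"
        by (rule push_eqI[where x = x]) (simp_all add: ext at m pm pe abelian_monoid.l_zero[OF am(2)])
      have "(-1) \<odot>\<^bsub>?V\<^esub> \<xi> \<oplus>\<^bsub>?V\<^esub> \<xi> = \<zero>\<^bsub>?V\<^esub>"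
        by (rule push_eqI[where x = x])
          (simp_all add: ext at m pm normed.neg_eq_smult[OF nf, symmetric] abelian_group.l_neg[OF am(1)])
      then show "\<exists>\<eta>\<in>carrier ?V. \<eta> \<oplus>\<^bsub>?V\<^esub> \<xi> = \<zero>\<^bsub>?V\<^esub>"
        using smult[OF m] by blast
    qed (use add zero in auto)
  show ?thesis
  proof (rule normed.intro)
    show "module complex_ring ?V"
      by (rule moduleI[OF cring_complex_ring ab])
        (simp add: smult | rule push_eqI[where x = x]; simp add: ext at pm pe add smult
          normed.smult_add_left[OF nf] normed.smult_add_right[OF nf] normed.smult_mult[OF nf] normed.smult_1[OF nf])+
  next
    fix u v assume u: "u \<in> carrier ?V"
    show "0 \<le> nrm ?V u"
      by (rule push_nrm_ge0[OF u])
    show "nrm ?V u = 0 \<longleftrightarrow> u = \<zero>\<^bsub>?V\<^esub>"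
    proof
      assume "nrm ?V u = 0"
      then have "nrm (fib E y) (u y) = 0" if "y \<in> Yf x" for y
        using push_nrm_ge[OF u that] normed.nrm_ge0[OF normed_fib[OF that] push_mem[OF u that]] by simp
      then show "u = \<zero>\<^bsub>?V\<^esub>"
        by (intro push_eqI[OF push_ext[OF u] ext(3)]) (simp add: at normed.nrm_eq0[OF nf push_mem[OF u]])
    next
      assume "u = \<zero>\<^bsub>?V\<^esub>"
      then have "nrm ?V u \<le> 0"
        by (intro push_nrm_le) (simp_all add: at normed.nrm_zero[OF nf])
      then show "nrm ?V u = 0"
        using push_nrm_ge0[OF u] by simp
    qed
    show "nrm ?V (c \<odot>\<^bsub>?V\<^esub> u) = cmod c * nrm ?V u" for c
    proof (rule antisym)
      show "nrm ?V (c \<odot>\<^bsub>?V\<^esub> u) \<le> cmod c * nrm ?V u"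
        using push_nrm_ge[OF u] push_nrm_ge0[OF u]
        by (intro push_nrm_le) (auto simp: at normed.nrm_smult[OF nf push_mem[OF u]] mult_left_mono)
      show "cmod c * nrm ?V u \<le> nrm ?V (c \<odot>\<^bsub>?V\<^esub> u)"
      \<comment> \<open>The lower bound for the norm of c u is obtained by dividing by the modulus
        of c.\<close>
      proof (cases "c = 0")
        case True
        then show ?thesis
          using push_nrm_ge0[OF smult[OF u]] by simp
      next
        case False
        have "nrm ?V u \<le> nrm ?V (c \<odot>\<^bsub>?V\<^esub> u) / cmod c"
        proof (rule push_nrm_le)
          show "0 \<le> nrm ?V (c \<odot>\<^bsub>?V\<^esub> u) / cmod c"
            using push_nrm_ge0[OF smult[OF u]] by simp
          show "nrm (fib E y) (u y) \<le> nrm ?V (c \<odot>\<^bsub>?V\<^esub> u) / cmod c" if "y \<in> Yf x" for y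
            using push_nrm_ge[OF smult[OF u] that, of c] that False
            by (simp add: at normed.nrm_smult[OF nf push_mem[OF u]] field_simps)
        qed
        then show ?thesis
          using False by (simp add: field_simps)
      qed
    qed
    assume v: "v \<in> carrier ?V"
    show "nrm ?V (u \<oplus>\<^bsub>?V\<^esub> v) \<le> nrm ?V u + nrm ?V v"
    proof (rule push_nrm_le)
      show "nrm (fib E y) ((u \<oplus>\<^bsub>?V\<^esub> v) y) \<le> nrm ?V u + nrm ?V v" if y: "y \<in> Yf x" for y
        using normed.nrm_add[OF normed_fib[OF y] push_mem[OF u y] push_mem[OF v y]] push_nrm_ge[OF u y] push_nrm_ge[OF v y]
        by (simp add: at y)
    qed (use push_nrm_ge0 u v in simp)
  qed
qed

lemma push_diff:
  assumes "\<xi> \<in> carrier (push_fibre Y E x)" "\<eta> \<in> carrier (push_fibre Y E x)" "y \<in> Yf x"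
  shows "(\<xi> \<ominus>\<^bsub>push_fibre Y E x\<^esub> \<eta>) y = \<xi> y \<ominus>\<^bsub>fib E y\<^esub> \<eta> y"
  using assms
  by (simp add: normed.diff_eq_smult[OF normed_push] normed.diff_eq_smult[OF normed_fib] push_mem)
    (simp add: push_fibre_simps)

lemma push_neg:
  assumes "\<xi> \<in> carrier (push_fibre Y E x)" "y \<in> Yf x"
  shows "(\<ominus>\<^bsub>push_fibre Y E x\<^esub> \<xi>) y = \<ominus>\<^bsub>fib E y\<^esub> \<xi> y"
  using assms
  by (simp add: normed.neg_eq_smult[OF normed_push] normed.neg_eq_smult[OF normed_fib] push_mem)
    (simp add: push_fibre_simps)

text \<open>The interface through which the supremum norm is traded for estimates at the points of
  Y. Only the non-strict inequality is equivalent to its pointwise form, which is why tolerances are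
  halved where a strict bound is wanted.\<close>

lemma push_nrm_diff_le_iff:
  assumes "\<xi> \<in> carrier (push_fibre Y E x)" "\<eta> \<in> carrier (push_fibre Y E x)" "0 \<le> c"
  shows "nrm (push_fibre Y E x) (\<xi> \<ominus>\<^bsub>push_fibre Y E x\<^esub> \<eta>) \<le> c \<longleftrightarrow>
    (\<forall>y\<in>Yf x. nrm (fib E y) (\<xi> y \<ominus>\<^bsub>fib E y\<^esub> \<eta> y) \<le> c)"
proof
  assume le: "nrm (push_fibre Y E x) (\<xi> \<ominus>\<^bsub>push_fibre Y E x\<^esub> \<eta>) \<le> c"
  show "\<forall>y\<in>Yf x. nrm (fib E y) (\<xi> y \<ominus>\<^bsub>fib E y\<^esub> \<eta> y) \<le> c"
    using push_nrm_ge[OF normed.diff_mem[OF normed_push assms(1,2)]] le push_diff[OF assms(1,2)] by fastforce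
qed (use assms push_diff in \<open>auto intro: push_nrm_le\<close>)

text \<open>Pointwise limits exist in the complete fibres, the uniform Cauchy condition makes the
  convergence uniform, and uniform limits of sections vanishing at infinity are again such
  sections.\<close>

lemma banach_push: "banach_space (push_fibre Y E x)" (is "banach_space ?V")
  unfolding banach_space_iff normed.mcomplete_iff[OF normed_push]
proof (intro conjI normed_push allI impI; elim conjE)
  fix u :: "nat \<Rightarrow> 'y \<Rightarrow> 'e"
  assume u: "\<forall>n. u n \<in> carrier ?V"
    and C: "\<forall>\<epsilon>>0. \<exists>N. \<forall>n\<ge>N. \<forall>m\<ge>N. nrm ?V (u n \<ominus>\<^bsub>?V\<^esub> u m) < \<epsilon>"
  have um: "u n \<in> carrier ?V" for n
    using u by blast
  have Cy: "\<exists>N. \<forall>n\<ge>N. \<forall>m\<ge>N. \<forall>y\<in>Yf x. nrm (fib E y) (u n y \<ominus>\<^bsub>fib E y\<^esub> u m y) \<le> \<epsilon>" if "\<epsilon> > 0" for \<epsilon>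
    using C that push_nrm_diff_le_iff[OF um um] less_imp_le by meson
  have "\<exists>l\<in>carrier (fib E y). \<forall>\<epsilon>>0. \<exists>N. \<forall>n\<ge>N. nrm (fib E y) (u n y \<ominus>\<^bsub>fib E y\<^esub> l) < \<epsilon>" if y: "y \<in> Yf x" for y
  proof (rule banach_space_limit)
    show "banach_space (fib E y)"
      using y E.banach by (simp add: anchor_fibre_iff)
    show "u n y \<in> carrier (fib E y)" for n
      using push_mem[OF um y] .
    show "\<exists>N. \<forall>n\<ge>N. \<forall>m\<ge>N. nrm (fib E y) (u n y \<ominus>\<^bsub>fib E y\<^esub> u m y) < \<epsilon>" if "\<epsilon> > 0" for \<epsilon>
      using Cy[OF half_gt_zero[OF that]] y that by fastforce
  qed
  then obtain l where l: "\<And>y. y \<in> Yf x \<Longrightarrow> l y \<in> carrier (fib E y)"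
    "\<And>y \<epsilon>. y \<in> Yf x \<Longrightarrow> \<epsilon> > 0 \<Longrightarrow> \<exists>N. \<forall>n\<ge>N. nrm (fib E y) (u n y \<ominus>\<^bsub>fib E y\<^esub> l y) < \<epsilon>"
    by metis
  have unif: "\<exists>N. \<forall>n\<ge>N. \<forall>y\<in>Yf x. nrm (fib E y) (u n y \<ominus>\<^bsub>fib E y\<^esub> l y) \<le> \<epsilon>" if \<epsilon>: "\<epsilon> > 0" for \<epsilon>
  proof -
    obtain N where N: "\<And>n m y. n \<ge> N \<Longrightarrow> m \<ge> N \<Longrightarrow> y \<in> Yf x \<Longrightarrow> nrm (fib E y) (u n y \<ominus>\<^bsub>fib E y\<^esub> u m y) \<le> \<epsilon> / 2"
      using Cy[OF half_gt_zero[OF \<epsilon>]] by blast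
    have "nrm (fib E y) (u n y \<ominus>\<^bsub>fib E y\<^esub> l y) \<le> \<epsilon>" if n: "n \<ge> N" and y: "y \<in> Yf x" for n y
    proof -
      \<comment> \<open>\<open>M\<close> depends on y. Comparing through an index beyond both
        \<open>M\<close> and \<open>N\<close> leaves a bound valid from \<open>N\<close> on,
        uniformly in y.\<close>
      obtain M where M: "\<And>m. m \<ge> M \<Longrightarrow> nrm (fib E y) (u m y \<ominus>\<^bsub>fib E y\<^esub> l y) < \<epsilon> / 2"
        using l(2)[OF y half_gt_zero[OF \<epsilon>]] by blast
      show ?thesis
        using normed.nrm_triangle[OF normed_fib[OF y] push_mem[OF um y] l(1)[OF y] push_mem[OF um y], of n "max M N"]
          N[OF n _ y, of "max M N"] M[of "max M N"] by simp
    qed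
    then show ?thesis
      by blast
  qed
  interpret R: field_over "Q x" "R E x" by (rule restricted_field(1))
  let ?l = "\<lambda>y\<in>Yf x. l y"
  have lm: "?l \<in> carrier ?V"
    unfolding push_fibre_simps
  proof (rule R.sections0_uniform_limit)
    show "?l \<in> all_sections (Q x) (fib (R E x))"
      using l(1) by (auto simp: all_sections_def restricted_field(3))
    fix \<epsilon> :: real assume \<epsilon>: "\<epsilon> > 0"
    obtain N where N: "\<forall>n\<ge>N. \<forall>y\<in>Yf x. nrm (fib E y) (u n y \<ominus>\<^bsub>fib E y\<^esub> l y) \<le> \<epsilon>"
      using unif[OF \<epsilon>] by blast
    then show "\<exists>\<xi>'\<in>sections0 (Q x) (R E x). \<forall>y\<in>topspace (Q x).
        nrm (fib (R E x) y) (?l y \<ominus>\<^bsub>fib (R E x) y\<^esub> \<xi>' y) \<le> \<epsilon>"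
      using um[of N] l(1) push_mem[OF um[of N]] normed.nrm_diff_commute[OF normed_fib, of _ x]
      by (intro bexI[of _ "u N"]) (auto simp: push_fibre_simps(1) restricted_field(3))
  qed
  have "\<exists>N. \<forall>n\<ge>N. nrm ?V (u n \<ominus>\<^bsub>?V\<^esub> ?l) < \<epsilon>" if \<epsilon>: "\<epsilon> > 0" for \<epsilon>
  proof -
    obtain N where "\<forall>n\<ge>N. \<forall>y\<in>Yf x. nrm (fib E y) (u n y \<ominus>\<^bsub>fib E y\<^esub> l y) \<le> \<epsilon> / 2"
      using unif[OF half_gt_zero[OF \<epsilon>]] by blast
    then have "nrm ?V (u n \<ominus>\<^bsub>?V\<^esub> ?l) \<le> \<epsilon> / 2" if "n \<ge> N" for n
      using that \<epsilon> by (subst push_nrm_diff_le_iff[OF um lm]) auto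
    then show ?thesis
      using \<epsilon> by (intro exI[of _ N]) force
  qed
  then show "\<exists>l\<in>carrier ?V. \<forall>\<epsilon>>0. \<exists>N. \<forall>n\<ge>N. nrm ?V (u n \<ominus>\<^bsub>?V\<^esub> l) < \<epsilon>"
    using lm by blast
qed

section \<open>From sections over Y to the field over the base\<close>

lemma push_restrict:
  assumes x: "x \<in> topspace (obj G)" and \<xi>: "\<xi> \<in> \<Gamma>0 E"
  shows "restrict \<xi> (Yf x) \<in> carrier (push_fibre Y E x)"
  unfolding push_fibre_simps sections0_def
proof (intro CollectI conjI allI impI)
  show "restrict \<xi> (Yf x) \<in> sec (R E x)"
    using is_pullback_section[OF E restricted_field(2) incl E.sections0_sec[OF \<xi>]] by simp
  fix \<epsilon> :: real assume "\<epsilon> > 0"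
  then obtain K where K: "compactin (spc Y) K" "\<And>y. y \<in> topspace (spc Y) \<Longrightarrow> y \<notin> K \<Longrightarrow> nrm (fib E y) (\<xi> y) < \<epsilon>"
    using E.sections0_vanish[OF \<xi>] by metis
  \<comment> \<open>The fibre is closed, since points of the Hausdorff base are closed; hence it
    meets \<open>K\<close> in a compact set.\<close>
  then show "\<exists>K. compactin (Q x) K \<and> (\<forall>y\<in>topspace (Q x) - K. nrm (fib (R E x) y) (restrict \<xi> (Yf x) y) < \<epsilon>)"
    using compactin_fibre[OF x K(1)] by (intro exI[of _ "Yf x \<inter> K"]) (auto simp: restricted_field(3) anchor_fibre_iff)
qed

text \<open>The cut-offs on the fibre are restrictions of functions on all of Y. This is what makes
  restrictions of global sections stable under the patching.\<close>

lemma fibre_bump: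
  assumes "openin (Q x) U" "y \<in> U"
  shows "\<exists>\<phi>\<in>{\<phi>. continuous_map (spc Y) euclideanreal \<phi> \<and> (\<forall>y\<in>topspace (spc Y). 0 \<le> \<phi> y \<and> \<phi> y \<le> 1)}.
    \<exists>V. openin (Q x) V \<and> y \<in> V \<and> (\<forall>z\<in>V. \<phi> z = 1) \<and> (\<forall>z\<in>topspace (Q x) - U. \<phi> z = 0)"
proof -
  obtain U' where U': "openin (spc Y) U'" "U = U' \<inter> Yf x"
    using assms(1) by (auto simp: openin_subtopology)
  obtain \<phi> V where \<phi>: "continuous_map (spc Y) euclideanreal \<phi>"
    "\<And>z. z \<in> topspace (spc Y) \<Longrightarrow> 0 \<le> \<phi> z \<and> \<phi> z \<le> 1"
    "openin (spc Y) V" "y \<in> V" "\<And>z. z \<in> V \<Longrightarrow> \<phi> z = 1" "\<And>z. z \<in> topspace (spc Y) - U' \<Longrightarrow> \<phi> z = 0"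
    using bump_function[OF lcY hausY U'(1), of y] assms(2) U'(2) by (metis (no_types) IntD1)
  then show ?thesis
    using assms(2) U'(2)
    by (intro bexI[of _ \<phi>] exI[of _ "V \<inter> Yf x"]) (auto simp: openin_subtopology anchor_fibre_iff)
qed

text \<open>The substitute for an extension theorem: the patching argument on Y_x, applied to the
  restrictions of \<Gamma>_0(Y,E). At single points they approximate because \<Gamma>_0(Y,E) has
  dense values.\<close>

lemma push_dense:
  assumes x: "x \<in> topspace (obj G)" and \<xi>: "\<xi> \<in> carrier (push_fibre Y E x)" and \<epsilon>: "\<epsilon> > 0"
  obtains \<xi>0 where "\<xi>0 \<in> \<Gamma>0 E" "\<And>y. y \<in> Yf x \<Longrightarrow> nrm (fib E y) (\<xi> y \<ominus>\<^bsub>fib E y\<^esub> \<xi>0 y) \<le> \<epsilon>"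
proof -
  interpret R: field_over "Q x" "R E x" by (rule restricted_field(1))
  let ?S = "(\<lambda>\<xi>0. restrict \<xi>0 (Yf x)) ` \<Gamma>0 E"
  let ?\<Phi> = "{\<phi>. continuous_map (spc Y) euclideanreal \<phi> \<and> (\<forall>y\<in>topspace (spc Y). 0 \<le> \<phi> y \<and> \<phi> y \<le> 1)}"
  have sub: "z \<in> topspace (spc Y)" if "z \<in> Yf x" for z
    using that by (simp add: anchor_fibre_iff)
  have "\<exists>g\<in>?S. \<forall>y\<in>topspace (Q x). nrm (fib (R E x) y) (\<xi> y \<ominus>\<^bsub>fib (R E x) y\<^esub> g y) \<le> \<epsilon>"
  proof (rule R.sections0_dense[where \<Phi> = ?\<Phi>])
    show "?S \<subseteq> sections0 (Q x) (R E x)"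
      using push_restrict[OF x] by (auto simp: push_fibre_simps)
    show "(\<lambda>y\<in>topspace (Q x). \<zero>\<^bsub>fib (R E x) y\<^esub>) \<in> ?S"
      by (rule image_eqI[OF _ E.sections0_zero]) (auto simp: restricted_field(3) sub)
    show "ccomb (Q x) (R E x) \<phi> g s \<in> ?S" if gs: "g \<in> ?S" "s \<in> ?S" "\<phi> \<in> ?\<Phi>" for g s \<phi>
    proof -
      obtain g' s' where *: "g' \<in> \<Gamma>0 E" "s' \<in> \<Gamma>0 E" "g = restrict g' (Yf x)" "s = restrict s' (Yf x)"
        using gs(1,2) by auto
      show ?thesis
        using gs(3) *
        by (intro image_eqI[OF _ E.sections0_ccomb[OF *(1,2), of \<phi>]]) (auto simp: ccomb_def restricted_field(3) sub)
    qed
    show "\<exists>s\<in>?S. nrm (fib (R E x) y) (e \<ominus>\<^bsub>fib (R E x) y\<^esub> s y) < \<epsilon>"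
      if y: "y \<in> topspace (Q x)" and e: "e \<in> carrier (fib (R E x) y)" and \<epsilon>: "\<epsilon> > 0" for y e \<epsilon>
    proof -
      obtain \<xi>0 where "\<xi>0 \<in> \<Gamma>0 E" "nrm (fib E y) (e \<ominus>\<^bsub>fib E y\<^esub> \<xi>0 y) < \<epsilon>"
        using E.sections0_pointwise_dense[OF lcY hausY, of y e \<epsilon>] y e \<epsilon> sub by (auto simp: restricted_field(3))
      then show ?thesis
        using y by (auto simp: restricted_field(3))
    qed
    show "\<xi> \<in> sections0 (Q x) (R E x)"
      using \<xi> by (simp add: push_fibre_simps)
  qed (use fibre_bump sub \<epsilon> in auto)
  then obtain \<xi>0 where "\<xi>0 \<in> \<Gamma>0 E" "\<forall>y\<in>Yf x. nrm (fib E y) (\<xi> y \<ominus>\<^bsub>fib E y\<^esub> \<xi>0 y) \<le> \<epsilon>"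
    by (auto simp: restricted_field(3))
  then show ?thesis
    by (intro that) auto
qed

text \<open>(C2) is the density of restrictions. For (C3), the points where the norm of \<xi>' is
  not below a given positive level form a compact set, so their image in the base is closed; off
  that image the supremum is at most the level.\<close>

lemma push_field_generated:
  shows usc_push: "usc_field (obj G) (push_field G Y E)"
    and sec_push_iff: "\<zeta> \<in> sec (push_field G Y E) \<longleftrightarrow>
      \<zeta> \<in> (\<Pi>\<^sub>E x\<in>topspace (obj G). carrier (push_fibre Y E x)) \<and>
      (\<forall>x\<in>topspace (obj G). \<forall>\<epsilon>>0. \<exists>U \<xi>0. openin (obj G) U \<and> x \<in> U \<and> \<xi>0 \<in> \<Gamma>0 E \<and>
        (\<forall>x'\<in>U. \<forall>y\<in>Yf x'. nrm (fib E y) (\<zeta> x' y \<ominus>\<^bsub>fib E y\<^esub> \<xi>0 y) \<le> \<epsilon>))"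
proof -
  let ?\<rho> = "\<lambda>\<xi>. \<lambda>x\<in>topspace (obj G). restrict \<xi> (Yf x)"
  let ?\<Gamma> = "?\<rho> ` \<Gamma>0 E"
  let ?V = "push_fibre Y E"
  have sub: "z \<in> topspace (spc Y)" if "z \<in> Yf x" for z x
    using that by (simp add: anchor_fibre_iff)
  have lin: "linear_subspace (obj G) ?V ?\<Gamma>"
    unfolding linear_subspace_def
  proof (intro conjI ballI allI)
    show "?\<Gamma> \<subseteq> all_sections (obj G) ?V"
      using push_restrict by (auto simp: all_sections_def)
    show "(\<lambda>x\<in>topspace (obj G). \<zero>\<^bsub>?V x\<^esub>) \<in> ?\<Gamma>"
      by (rule image_eqI[OF _ E.sections0_zero]) (auto simp: push_fibre_simps sub intro!: restrict_ext)
    fix \<xi> assume "\<xi> \<in> ?\<Gamma>"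
    then obtain \<xi>' where \<xi>': "\<xi>' \<in> \<Gamma>0 E" "\<xi> = ?\<rho> \<xi>'"
      by blast
    show "(\<lambda>x\<in>topspace (obj G). c \<odot>\<^bsub>?V x\<^esub> \<xi> x) \<in> ?\<Gamma>" for c
      by (rule image_eqI[OF _ E.sections0_smult[OF \<xi>'(1), of c]])
        (auto simp: \<xi>'(2) push_fibre_simps sub intro!: restrict_ext)
    fix \<eta> assume "\<eta> \<in> ?\<Gamma>"
    then obtain \<eta>' where \<eta>': "\<eta>' \<in> \<Gamma>0 E" "\<eta> = ?\<rho> \<eta>'"
      by blast
    show "(\<lambda>x\<in>topspace (obj G). \<xi> x \<oplus>\<^bsub>?V x\<^esub> \<eta> x) \<in> ?\<Gamma>"
      by (rule image_eqI[OF _ E.sections0_add[OF \<xi>'(1) \<eta>'(1)]])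
        (auto simp: \<xi>'(2) \<eta>'(2) push_fibre_simps sub intro!: restrict_ext)
  qed
  have dense: "\<exists>\<xi>\<in>?\<Gamma>. nrm (?V x) (e \<ominus>\<^bsub>?V x\<^esub> \<xi> x) < \<epsilon>"
    if x: "x \<in> topspace (obj G)" and e: "e \<in> carrier (?V x)" and \<epsilon>: "\<epsilon> > 0" for x e \<epsilon>
  proof -
    obtain \<xi>0 where \<xi>0: "\<xi>0 \<in> \<Gamma>0 E" "\<And>y. y \<in> Yf x \<Longrightarrow> nrm (fib E y) (e y \<ominus>\<^bsub>fib E y\<^esub> \<xi>0 y) \<le> \<epsilon> / 2"
      using push_dense[OF x e half_gt_zero[OF \<epsilon>]] by metis
    have "nrm (?V x) (e \<ominus>\<^bsub>?V x\<^esub> ?\<rho> \<xi>0 x) \<le> \<epsilon> / 2"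
      using \<xi>0 x \<epsilon> push_nrm_diff_le_iff[OF e push_restrict[OF x \<xi>0(1)], of "\<epsilon> / 2"] by simp
    then show ?thesis
      using \<xi>0(1) \<epsilon> by (intro bexI[of _ "?\<rho> \<xi>0"]) auto
  qed
  have usc: "openin (obj G) {x \<in> topspace (obj G). nrm (?V x) (\<xi> x) < c}" if \<xi>: "\<xi> \<in> ?\<Gamma>" for \<xi> c
  proof (subst openin_subopen, intro ballI)
    fix x assume "x \<in> {x \<in> topspace (obj G). nrm (?V x) (\<xi> x) < c}"
    then have x: "x \<in> topspace (obj G)" and lt: "nrm (?V x) (\<xi> x) < c"
      by auto
    obtain \<xi>' where \<xi>': "\<xi>' \<in> \<Gamma>0 E" "\<xi> = ?\<rho> \<xi>'"
      using \<xi> by blast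
    have m: "\<xi> x \<in> carrier (?V x)" if "x \<in> topspace (obj G)" for x
      using push_restrict[OF that \<xi>'(1)] that \<xi>'(2) by simp
    \<comment> \<open>A pointwise bound below c would give only \<le> c for the supremum, so a level
      strictly between the two values is used.\<close>
    define c' where "c' = (nrm (?V x) (\<xi> x) + c) / 2"
    have c': "nrm (?V x) (\<xi> x) < c'" "c' < c"
      using lt by (simp_all add: c'_def)
    have "c' > 0"
      using c'(1) push_nrm_ge0[OF m[OF x]] by simp
    obtain K where K: "compactin (spc Y) K" "\<And>y. y \<in> topspace (spc Y) \<Longrightarrow> y \<notin> K \<Longrightarrow> nrm (fib E y) (\<xi>' y) < c'"
      using E.sections0_vanish[OF \<xi>'(1) \<open>c' > 0\<close>] by metis
    \<comment> \<open>Every point of \<open>?C\<close> lies in \<open>K\<close>, so the intersection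
      taken next loses nothing.\<close>
    let ?C = "topspace (spc Y) - {y \<in> topspace (spc Y). nrm (fib E y) (\<xi>' y) < c'}"
    have "closedin (spc Y) ?C"
      using E.sec_usc[OF E.sections0_sec[OF \<xi>'(1)]] by blast
    then have "compactin (spc Y) (?C \<inter> K)"
      using K(1) by (rule closed_Int_compactin)
    then have "closedin (obj G) (anchor Y ` (?C \<inter> K))"
      using image_compactin[OF _ anchor] compactin_imp_closedin[OF hausX] by blast
    then have o: "openin (obj G) (topspace (obj G) - anchor Y ` (?C \<inter> K))" (is "openin _ ?U")
      by blast
    have "x \<in> ?U"
    proof (intro DiffI x notI)
      assume "x \<in> anchor Y ` (?C \<inter> K)"
      then obtain y where "y \<in> Yf x" "\<not> nrm (fib E y) (\<xi>' y) < c'"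
        by (auto simp: anchor_fibre_iff)
      then show False
        using push_nrm_ge[OF m[OF x], of y] c'(1) \<xi>'(2) x by simp
    qed
    moreover have "nrm (?V z) (\<xi> z) < c" if z: "z \<in> ?U" for z
    proof -
      have "nrm (?V z) (\<xi> z) \<le> c'"
      proof (rule push_nrm_le)
        fix y assume y: "y \<in> Yf z"
        then have "y \<notin> ?C \<inter> K"
          using z by (auto simp: anchor_fibre_iff)
        then show "nrm (fib E y) (\<xi> z y) \<le> c'"
          using K(2)[of y] y z by (force simp: \<xi>'(2) anchor_fibre_iff)
      qed (use \<open>c' > 0\<close> in simp)
      then show ?thesis
        using c'(2) by simp
    qed
    ultimately show "\<exists>T. openin (obj G) T \<and> x \<in> T \<and> T \<subseteq> {x \<in> topspace (obj G). nrm (?V x) (\<xi> x) < c}"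
      using o by (intro exI[of _ ?U]) blast
  qed
  note gs = generated_structure[of "obj G" ?V ?\<Gamma>, OF normed_push lin dense usc]
  show "usc_field (obj G) (push_field G Y E)"
    using gs(2) banach_push by (simp add: usc_field_def push_field_def)
  have "locally_approximable (obj G) ?V ?\<Gamma> \<zeta> \<longleftrightarrow>
     (\<forall>x\<in>topspace (obj G). \<forall>\<epsilon>>0. \<exists>U \<xi>0. openin (obj G) U \<and> x \<in> U \<and> \<xi>0 \<in> \<Gamma>0 E \<and>
        (\<forall>x'\<in>U. \<forall>y\<in>Yf x'. nrm (fib E y) (\<zeta> x' y \<ominus>\<^bsub>fib E y\<^esub> \<xi>0 y) \<le> \<epsilon>))"
    if \<zeta>: "\<zeta> \<in> all_sections (obj G) ?V"
  proof -
    have *: "nrm (?V z) (\<zeta> z \<ominus>\<^bsub>?V z\<^esub> ?\<rho> \<xi>0 z) \<le> \<epsilon> \<longleftrightarrow> (\<forall>y\<in>Yf z. nrm (fib E y) (\<zeta> z y \<ominus>\<^bsub>fib E y\<^esub> \<xi>0 y) \<le> \<epsilon>)"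
      if "openin (obj G) U" "z \<in> U" "\<xi>0 \<in> \<Gamma>0 E" "\<epsilon> > 0" for U z \<xi>0 \<epsilon>
    proof -
      have z: "z \<in> topspace (obj G)"
        using that openin_subset by blast
      show ?thesis
        using push_nrm_diff_le_iff[OF all_sections_mem[OF \<zeta> z] push_restrict[OF z that(3)], of \<epsilon>] that(4) z by simp
    qed
    have "(\<exists>\<xi>'. openin (obj G) U \<and> x \<in> U \<and> \<xi>' \<in> ?\<Gamma> \<and> (\<forall>z\<in>U. nrm (?V z) (\<zeta> z \<ominus>\<^bsub>?V z\<^esub> \<xi>' z) \<le> \<epsilon>)) \<longleftrightarrow>
      (\<exists>\<xi>0. openin (obj G) U \<and> x \<in> U \<and> \<xi>0 \<in> \<Gamma>0 E \<and>
        (\<forall>x'\<in>U. \<forall>y\<in>Yf x'. nrm (fib E y) (\<zeta> x' y \<ominus>\<^bsub>fib E y\<^esub> \<xi>0 y) \<le> \<epsilon>))" if "\<epsilon> > 0" for U x \<epsilon>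
    proof (intro iffI; elim exE conjE imageE)
      fix \<xi>' \<xi>0 assume "openin (obj G) U" "x \<in> U" "\<forall>z\<in>U. nrm (?V z) (\<zeta> z \<ominus>\<^bsub>?V z\<^esub> \<xi>' z) \<le> \<epsilon>"
        "\<xi>' = ?\<rho> \<xi>0" "\<xi>0 \<in> \<Gamma>0 E"
      then show "\<exists>\<xi>0. openin (obj G) U \<and> x \<in> U \<and> \<xi>0 \<in> \<Gamma>0 E \<and>
        (\<forall>x'\<in>U. \<forall>y\<in>Yf x'. nrm (fib E y) (\<zeta> x' y \<ominus>\<^bsub>fib E y\<^esub> \<xi>0 y) \<le> \<epsilon>)"
        using *[of U _ \<xi>0 \<epsilon>] that by (intro exI[of _ \<xi>0]) blast
    next
      fix \<xi>0 assume "openin (obj G) U" "x \<in> U" "\<xi>0 \<in> \<Gamma>0 E"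
        "\<forall>x'\<in>U. \<forall>y\<in>Yf x'. nrm (fib E y) (\<zeta> x' y \<ominus>\<^bsub>fib E y\<^esub> \<xi>0 y) \<le> \<epsilon>"
      then show "\<exists>\<xi>'. openin (obj G) U \<and> x \<in> U \<and> \<xi>' \<in> ?\<Gamma> \<and> (\<forall>z\<in>U. nrm (?V z) (\<zeta> z \<ominus>\<^bsub>?V z\<^esub> \<xi>' z) \<le> \<epsilon>)"
        using *[of U _ \<xi>0 \<epsilon>] that by (intro exI[of _ "?\<rho> \<xi>0"]) blast
    qed
    then show ?thesis
      unfolding locally_approximable_def by simp
  qed
  moreover have "\<zeta> \<in> sec (push_field G Y E) \<longleftrightarrow>
    \<zeta> \<in> all_sections (obj G) ?V \<and> locally_approximable (obj G) ?V ?\<Gamma> \<zeta>"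
    using gs(1) by (simp add: push_field_def)
  ultimately show "\<zeta> \<in> sec (push_field G Y E) \<longleftrightarrow>
      \<zeta> \<in> (\<Pi>\<^sub>E x\<in>topspace (obj G). carrier (push_fibre Y E x)) \<and>
      (\<forall>x\<in>topspace (obj G). \<forall>\<epsilon>>0. \<exists>U \<xi>0. openin (obj G) U \<and> x \<in> U \<and> \<xi>0 \<in> \<Gamma>0 E \<and>
        (\<forall>x'\<in>U. \<forall>y\<in>Yf x'. nrm (fib E y) (\<zeta> x' y \<ominus>\<^bsub>fib E y\<^esub> \<xi>0 y) \<le> \<epsilon>))"
    unfolding all_sections_def by blast
qed

end

end

section \<open>Base change for the pushforward\<close>

lemma fib_push_field [simp]: "fib (push_field G Y E) = push_fibre Y E"
  by (simp add: push_field_def)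

text \<open>The exceptional set \<open>K\<close> is compact in the total space and serves the whole
  neighbourhood \<open>U\<close> at once. Vanishing at infinity on each fibre separately would not
  give a continuous family.\<close>

definition locally_vanishing ::
  "'w topology \<Rightarrow> 'z topology \<Rightarrow> ('z \<Rightarrow> 'w) \<Rightarrow> ('z, 'e, 'm) bfield_scheme \<Rightarrow> ('z \<Rightarrow> 'e) \<Rightarrow> bool" where
  "locally_vanishing W Z p F \<eta> \<longleftrightarrow>
     (\<forall>w\<in>topspace W. \<forall>\<epsilon>>0. \<exists>U K. openin W U \<and> w \<in> U \<and> compactin Z K \<and>
        (\<forall>z\<in>topspace Z. p z \<in> U \<and> z \<notin> K \<longrightarrow> nrm (fib F z) (\<eta> z) < \<epsilon>))"

text \<open>The companion for products: if one factor is locally vanishing and the other is bounded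
  locally over the base, the product is locally vanishing.\<close>

definition locally_bounded ::
  "'w topology \<Rightarrow> 'z topology \<Rightarrow> ('z \<Rightarrow> 'w) \<Rightarrow> ('z, 'e, 'm) bfield_scheme \<Rightarrow> ('z \<Rightarrow> 'e) \<Rightarrow> bool" where
  "locally_bounded W Z p F \<eta> \<longleftrightarrow>
     (\<forall>w\<in>topspace W. \<exists>U M. openin W U \<and> w \<in> U \<and> M > 0 \<and>
        (\<forall>z\<in>topspace Z. p z \<in> U \<longrightarrow> nrm (fib F z) (\<eta> z) \<le> M))"

lemma locally_vanishingD:
  assumes "locally_vanishing W Z p F \<eta>" "w \<in> topspace W" "\<epsilon> > 0"
  obtains U K where "openin W U" "w \<in> U" "compactin Z K"
    "\<And>z. z \<in> topspace Z \<Longrightarrow> p z \<in> U \<Longrightarrow> z \<notin> K \<Longrightarrow> nrm (fib F z) (\<eta> z) < \<epsilon>"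
  using assms unfolding locally_vanishing_def by meson

lemma locally_boundedD:
  assumes "locally_bounded W Z p F \<eta>" "w \<in> topspace W"
  obtains U M where "openin W U" "w \<in> U" "M > 0"
    "\<And>z. z \<in> topspace Z \<Longrightarrow> p z \<in> U \<Longrightarrow> nrm (fib F z) (\<eta> z) \<le> M"
  using assms unfolding locally_bounded_def by meson

lemma locally_vanishing_mult:
  assumes \<eta>: "locally_vanishing W Z p F \<eta>" and \<theta>: "locally_bounded W Z p F' \<theta>"
    and nonneg: "\<And>z. z \<in> topspace Z \<Longrightarrow> 0 \<le> nrm (fib F z) (\<eta> z)" "\<And>z. z \<in> topspace Z \<Longrightarrow> 0 \<le> nrm (fib F' z) (\<theta> z)"
    and le: "\<And>z. z \<in> topspace Z \<Longrightarrow> nrm (fib F'' z) (\<zeta> z) \<le> nrm (fib F z) (\<eta> z) * nrm (fib F' z) (\<theta> z)"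
  shows "locally_vanishing W Z p F'' \<zeta>"
  unfolding locally_vanishing_def
proof (intro ballI allI impI)
  fix w \<epsilon> assume w: "w \<in> topspace W" and \<epsilon>: "(0::real) < \<epsilon>"
  obtain U M where U: "openin W U" "w \<in> U" "M > 0"
    "\<And>z. z \<in> topspace Z \<Longrightarrow> p z \<in> U \<Longrightarrow> nrm (fib F' z) (\<theta> z) \<le> M"
    using locally_boundedD[OF \<theta> w] by metis
  have "\<epsilon> / M > 0"
    using \<epsilon> U(3) by simp
  then obtain U' K where U': "openin W U'" "w \<in> U'" "compactin Z K"
    "\<And>z. z \<in> topspace Z \<Longrightarrow> p z \<in> U' \<Longrightarrow> z \<notin> K \<Longrightarrow> nrm (fib F z) (\<eta> z) < \<epsilon> / M"
    using locally_vanishingD[OF \<eta> w] by metis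
  have "nrm (fib F'' z) (\<zeta> z) < \<epsilon>" if z: "z \<in> topspace Z" "p z \<in> U \<inter> U'" "z \<notin> K" for z
  proof -
    have "nrm (fib F z) (\<eta> z) * nrm (fib F' z) (\<theta> z) \<le> nrm (fib F z) (\<eta> z) * M"
      using z U(4)[of z] nonneg(1)[of z] by (intro mult_left_mono) auto
    also have "\<dots> < \<epsilon>"
      using U'(4)[of z] z U(3) by (simp add: field_simps)
    finally show ?thesis
      using le[OF z(1)] by simp
  qed
  then show "\<exists>U K. openin W U \<and> w \<in> U \<and> compactin Z K \<and>
      (\<forall>z\<in>topspace Z. p z \<in> U \<and> z \<notin> K \<longrightarrow> nrm (fib F'' z) (\<zeta> z) < \<epsilon>)"
    using U(1,2) U'(1-3) by (intro exI[of _ "U \<inter> U'"] exI[of _ K]) auto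
qed

text \<open>\<open>Z\<close> is the fibre product of \<open>W\<close> and the space \<open>Y\<close> over the unit space, with projections \<open>p\<close>
  and \<open>q\<close>; \<open>j w y\<close> is the point of \<open>Z\<close> over \<open>w\<close> and \<open>y\<close>.\<close>

locale base_change = gspace_over G Y
  for G :: "('g, 'x) groupoid" and Y :: "('g, 'x, 'y) gspace" +
  fixes W :: "'w topology" and f :: "'w \<Rightarrow> 'x"
    and Z :: "'z topology" and p :: "'z \<Rightarrow> 'w" and q :: "'z \<Rightarrow> 'y" and j :: "'w \<Rightarrow> 'y \<Rightarrow> 'z"
  assumes hausW: "Hausdorff_space W" and lcW: "locally_compact_space W"
    and cont_f: "continuous_map W (obj G) f"
    and cont_p: "continuous_map Z W p" and cont_q: "continuous_map Z (spc Y) q"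
    and square: "z \<in> topspace Z \<Longrightarrow> anchor Y (q z) = f (p z)"
    and j: "w \<in> topspace W \<Longrightarrow> y \<in> anchor_fibre Y (f w) \<Longrightarrow> j w y \<in> topspace Z \<and> p (j w y) = w \<and> q (j w y) = y"
    and j_pq: "z \<in> topspace Z \<Longrightarrow> j (p z) (q z) = z"
    and cont_j: "w \<in> topspace W \<Longrightarrow> continuous_map (subtopology (spc Y) (anchor_fibre Y (f w))) Z (j w)"
    and proper: "compactin W L \<Longrightarrow> compactin (spc Y) K \<Longrightarrow> compactin Z {z \<in> topspace Z. p z \<in> L \<and> q z \<in> K}"
begin

lemma f_mem: "w \<in> topspace W \<Longrightarrow> f w \<in> topspace (obj G)"
  using cont_f by (simp add: continuous_map_def Pi_iff)

lemma p_mem: "z \<in> topspace Z \<Longrightarrow> p z \<in> topspace W"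
  using cont_p by (simp add: continuous_map_def Pi_iff)

lemma q_mem: "z \<in> topspace Z \<Longrightarrow> q z \<in> topspace (spc Y)"
  using cont_q by (simp add: continuous_map_def Pi_iff)

lemma q_fibre: "z \<in> topspace Z \<Longrightarrow> q z \<in> Yf (f (p z))"
  by (simp add: anchor_fibre_iff q_mem square)

context
  fixes E :: "('y, 'e, 'm) bfield_scheme" and F :: "('z, 'e, 'n) bfield_scheme"
    and H :: "('w, 'y \<Rightarrow> 'e, 'k) bfield_scheme"
  assumes E: "usc_field (spc Y) E"
    and F: "usc_field Z F" "is_pullback Z q E F"
    and H: "usc_field W H" "is_pullback W f (push_field G Y E) H"
begin

interpretation E: field_over "spc Y" E
  by unfold_locales (rule E)

interpretation F: field_over Z F
  by unfold_locales (rule F)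

interpretation H: field_over W H
  by unfold_locales (rule H)

lemma fib_F: "z \<in> topspace Z \<Longrightarrow> fib F z = fib E (q z)"
  using is_pullback_fib[OF F(2)] .

lemma fib_H: "w \<in> topspace W \<Longrightarrow> fib H w = push_fibre Y E (f w)"
  using is_pullback_fib[OF H(2)] by simp

lemma H_mem: "\<zeta> \<in> sec H \<Longrightarrow> w \<in> topspace W \<Longrightarrow> \<zeta> w \<in> carrier (push_fibre Y E (f w))"
  using H.sec_mem[of \<zeta> w] by (simp add: fib_H)

text \<open>A section of the pullback is locally close to a section of the pushforward, which is
  locally close to one from \<Gamma>_0(Y,E). Merging the two steps gives one \<xi>0 that works on
  all fibres over a neighbourhood.\<close>

lemma H_approx:
  assumes \<zeta>: "\<zeta> \<in> sec H" and w: "w \<in> topspace W" and \<epsilon>: "\<epsilon> > 0"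
  obtains U \<xi>0 where "openin W U" "w \<in> U" "\<xi>0 \<in> \<Gamma>0 E"
    "\<And>w' y. w' \<in> U \<Longrightarrow> y \<in> Yf (f w') \<Longrightarrow> nrm (fib E y) (\<zeta> w' y \<ominus>\<^bsub>fib E y\<^esub> \<xi>0 y) \<le> \<epsilon>"
proof -
  obtain U \<theta> where U: "openin W U" "w \<in> U" "\<theta> \<in> sec (push_field G Y E)"
    "\<And>w'. w' \<in> U \<Longrightarrow> nrm (push_fibre Y E (f w')) (\<zeta> w' \<ominus>\<^bsub>push_fibre Y E (f w')\<^esub> \<theta> (f w')) \<le> \<epsilon> / 2"
    using is_pullback_approx[OF H(2) \<zeta> w half_gt_zero[OF \<epsilon>]] by auto
  obtain U' \<xi>0 where U': "openin (obj G) U'" "f w \<in> U'" "\<xi>0 \<in> \<Gamma>0 E"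
    "\<forall>x'\<in>U'. \<forall>y\<in>Yf x'. nrm (fib E y) (\<theta> x' y \<ominus>\<^bsub>fib E y\<^esub> \<xi>0 y) \<le> \<epsilon> / 2"
    using U(3) half_gt_zero[OF \<epsilon>] f_mem[OF w] unfolding sec_push_iff[OF E] by blast
  have \<theta>m: "\<theta> x \<in> carrier (push_fibre Y E x)" if "x \<in> topspace (obj G)" for x
    using U(3) that unfolding sec_push_iff[OF E] by blast
  show ?thesis
  proof (rule that)
    let ?U = "U \<inter> {w \<in> topspace W. f w \<in> U'}"
    show "openin W ?U" "w \<in> ?U" "\<xi>0 \<in> \<Gamma>0 E"
      using U(1,2) U'(2,3) openin_continuous_map_preimage[OF cont_f U'(1)] w by auto
    fix w' y assume w': "w' \<in> ?U" and y: "y \<in> Yf (f w')"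
    have m: "\<zeta> w' \<in> carrier (push_fibre Y E (f w'))" "\<theta> (f w') \<in> carrier (push_fibre Y E (f w'))"
      using H_mem[OF \<zeta>] \<theta>m f_mem w' by auto
    have "nrm (fib E y) (\<zeta> w' y \<ominus>\<^bsub>fib E y\<^esub> \<theta> (f w') y) \<le> \<epsilon> / 2"
      using U(4)[of w'] w' y \<epsilon> push_nrm_diff_le_iff[OF E m, of "\<epsilon> / 2"] by auto
    moreover have "nrm (fib E y) (\<theta> (f w') y \<ominus>\<^bsub>fib E y\<^esub> \<xi>0 y) \<le> \<epsilon> / 2"
      using U'(4) w' y by blast
    moreover have "\<xi>0 y \<in> carrier (fib E y)"
      using E.sections0_mem[OF U'(3)] y by (simp add: anchor_fibre_iff)
    ultimately show "nrm (fib E y) (\<zeta> w' y \<ominus>\<^bsub>fib E y\<^esub> \<xi>0 y) \<le> \<epsilon>"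
      using normed.nrm_triangle[OF normed_fib[OF E y] push_mem[OF E m(1) y] _ push_mem[OF E m(2) y], of "\<xi>0 y"]
      by linarith
  qed
qed

text \<open>Converse of the merged approximation: \<xi>0 itself defines a section of the
  pushforward, by restriction to the fibres.\<close>

lemma H_secI:
  assumes \<zeta>: "\<zeta> \<in> (\<Pi>\<^sub>E w\<in>topspace W. carrier (push_fibre Y E (f w)))"
    and approx: "\<And>w \<epsilon>. w \<in> topspace W \<Longrightarrow> \<epsilon> > 0 \<Longrightarrow> \<exists>U \<xi>0. openin W U \<and> w \<in> U \<and> \<xi>0 \<in> \<Gamma>0 E \<and>
      (\<forall>w'\<in>U. \<forall>y\<in>Yf (f w'). nrm (fib E y) (\<zeta> w' y \<ominus>\<^bsub>fib E y\<^esub> \<xi>0 y) \<le> \<epsilon>)"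
  shows "\<zeta> \<in> sec H"
proof (rule is_pullback_secI[OF H(2)])
  show "\<zeta> \<in> (\<Pi>\<^sub>E w\<in>topspace W. carrier (fib (push_field G Y E) (f w)))"
    using \<zeta> by simp
  fix w \<epsilon> assume w: "w \<in> topspace W" and \<epsilon>: "(0::real) < \<epsilon>"
  obtain U \<xi>0 where U: "openin W U" "w \<in> U" "\<xi>0 \<in> \<Gamma>0 E"
    "\<forall>w'\<in>U. \<forall>y\<in>Yf (f w'). nrm (fib E y) (\<zeta> w' y \<ominus>\<^bsub>fib E y\<^esub> \<xi>0 y) \<le> \<epsilon>"
    using approx[OF w \<epsilon>] by blast
  let ?\<rho> = "\<lambda>x\<in>topspace (obj G). restrict \<xi>0 (Yf x)"
  have "?\<rho> \<in> sec (push_field G Y E)"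
    unfolding sec_push_iff[OF E]
  proof (intro conjI ballI allI impI)
    show "?\<rho> \<in> (\<Pi>\<^sub>E x\<in>topspace (obj G). carrier (push_fibre Y E x))"
      using push_restrict[OF E _ U(3)] by auto
    fix x \<delta> assume "x \<in> topspace (obj G)" "(0::real) < \<delta>"
    then show "\<exists>U \<xi>'. openin (obj G) U \<and> x \<in> U \<and> \<xi>' \<in> \<Gamma>0 E \<and>
      (\<forall>x'\<in>U. \<forall>y\<in>Yf x'. nrm (fib E y) (?\<rho> x' y \<ominus>\<^bsub>fib E y\<^esub> \<xi>' y) \<le> \<delta>)"
      using U(3) E.sections0_mem[OF U(3)]
      by (intro exI[of _ "topspace (obj G)"] exI[of _ \<xi>0])
        (auto simp: anchor_fibre_iff normed.diff_self[OF E.normed] normed.nrm_zero[OF E.normed])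
  qed
  moreover have "nrm (push_fibre Y E (f w')) (\<zeta> w' \<ominus>\<^bsub>push_fibre Y E (f w')\<^esub> ?\<rho> (f w')) \<le> \<epsilon>" if "w' \<in> U" for w'
  proof -
    have w': "w' \<in> topspace W"
      using that openin_subset[OF U(1)] by blast
    show ?thesis
      using push_nrm_diff_le_iff[OF E PiE_mem[OF \<zeta> w'] push_restrict[OF E f_mem[OF w'] U(3)], of \<epsilon>]
        \<epsilon> U(4) that f_mem[OF w'] by simp
  qed
  ultimately show "\<exists>U \<theta>. openin W U \<and> w \<in> U \<and> \<theta> \<in> sec (push_field G Y E) \<and>
      (\<forall>w'\<in>U. nrm (fib (push_field G Y E) (f w')) (\<zeta> w' \<ominus>\<^bsub>fib (push_field G Y E) (f w')\<^esub> \<theta> (f w')) \<le> \<epsilon>)"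
    using U(1,2) by (intro exI[of _ U] exI[of _ ?\<rho>]) auto
qed

text \<open>This rests on local compactness of W: over a neighbourhood inside a compact
  \<open>L\<close>, the points where the pulled back section is not small project into
  \<open>L\<close> and into a compact \<open>K\<close> of Y, and such points form a compact set by
  \<open>proper\<close>.\<close>

lemma pullback_section0:
  assumes \<xi>: "\<xi> \<in> \<Gamma>0 E"
  shows "(\<lambda>z\<in>topspace Z. \<xi> (q z)) \<in> sec F"
    and "locally_vanishing W Z p F (\<lambda>z\<in>topspace Z. \<xi> (q z))"
    and "locally_bounded W Z p F (\<lambda>z\<in>topspace Z. \<xi> (q z))"
proof -
  show "(\<lambda>z\<in>topspace Z. \<xi> (q z)) \<in> sec F"
    by (rule is_pullback_section[OF E F(2) cont_q E.sections0_sec[OF \<xi>]])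
  show "locally_vanishing W Z p F (\<lambda>z\<in>topspace Z. \<xi> (q z))"
    unfolding locally_vanishing_def
  proof (intro ballI allI impI)
    fix w \<epsilon> assume w: "w \<in> topspace W" and \<epsilon>: "(0::real) < \<epsilon>"
    obtain K where K: "compactin (spc Y) K" "\<And>y. y \<in> topspace (spc Y) \<Longrightarrow> y \<notin> K \<Longrightarrow> nrm (fib E y) (\<xi> y) < \<epsilon>"
      using E.sections0_vanish[OF \<xi> \<epsilon>] by metis
    obtain U L where U: "openin W U" "compactin W L" "w \<in> U" "U \<subseteq> L"
      using lcW w unfolding locally_compact_space_def by blast
    then show "\<exists>U K. openin W U \<and> w \<in> U \<and> compactin Z K \<and>
      (\<forall>z\<in>topspace Z. p z \<in> U \<and> z \<notin> K \<longrightarrow> nrm (fib F z) ((\<lambda>z\<in>topspace Z. \<xi> (q z)) z) < \<epsilon>)"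
      using proper[OF U(2) K(1)] K(2) q_mem
      by (intro exI[of _ U] exI[of _ "{z \<in> topspace Z. p z \<in> L \<and> q z \<in> K}"]) (auto simp: fib_F)
  qed
  obtain M where "M > 0" "\<And>y. y \<in> topspace (spc Y) \<Longrightarrow> nrm (fib E y) (\<xi> y) \<le> M"
    using E.sections0_bounded[OF \<xi>] by metis
  then show "locally_bounded W Z p F (\<lambda>z\<in>topspace Z. \<xi> (q z))"
    unfolding locally_bounded_def using q_mem
    by (intro ballI exI[of _ "topspace W"] exI[of _ M]) (auto simp: fib_F)
qed

text \<open>All three properties are inherited from the local approximants \<xi>0, for which they
  are known, up to an error uniform on the fibres over a neighbourhood.\<close>

lemma uncurry_section:
  assumes \<zeta>: "\<zeta> \<in> sec H"
  shows "(\<lambda>z\<in>topspace Z. \<zeta> (p z) (q z)) \<in> sec F" (is "?\<eta> \<in> _")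
    and "locally_vanishing W Z p F (\<lambda>z\<in>topspace Z. \<zeta> (p z) (q z))"
    and "locally_bounded W Z p F (\<lambda>z\<in>topspace Z. \<zeta> (p z) (q z))"
proof -
  have m: "\<zeta> (p z) (q z) \<in> carrier (fib E (q z))" if "z \<in> topspace Z" for z
    using push_mem[OF E H_mem[OF \<zeta> p_mem[OF that]] q_fibre[OF that]] .
  have le: "nrm (fib E (q z)) (\<zeta> (p z) (q z)) \<le> nrm (fib E (q z)) (\<xi>0 (q z)) + \<epsilon>"
    if "z \<in> topspace Z" "p z \<in> U" "\<xi>0 \<in> \<Gamma>0 E"
    "\<And>w' y. w' \<in> U \<Longrightarrow> y \<in> Yf (f w') \<Longrightarrow> nrm (fib E y) (\<zeta> w' y \<ominus>\<^bsub>fib E y\<^esub> \<xi>0 y) \<le> \<epsilon>" for z U \<xi>0 \<epsilon>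
    using normed.nrm_le_diff[OF E.normed[OF q_mem[OF that(1)]] m[OF that(1)] E.sections0_mem[OF that(3) q_mem[OF that(1)]]]
      that(4)[OF that(2) q_fibre[OF that(1)]] by simp
  show "?\<eta> \<in> sec F"
  proof (rule is_pullback_secI[OF F(2)])
    show "?\<eta> \<in> (\<Pi>\<^sub>E z\<in>topspace Z. carrier (fib E (q z)))"
      using m by auto
    fix z \<epsilon> assume z: "z \<in> topspace Z" and \<epsilon>: "(0::real) < \<epsilon>"
    obtain U \<xi>0 where U: "openin W U" "p z \<in> U" "\<xi>0 \<in> \<Gamma>0 E"
      "\<And>w' y. w' \<in> U \<Longrightarrow> y \<in> Yf (f w') \<Longrightarrow> nrm (fib E y) (\<zeta> w' y \<ominus>\<^bsub>fib E y\<^esub> \<xi>0 y) \<le> \<epsilon>"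
      using H_approx[OF \<zeta> p_mem[OF z] \<epsilon>] by metis
    then show "\<exists>U \<xi>0. openin Z U \<and> z \<in> U \<and> \<xi>0 \<in> sec E \<and>
      (\<forall>z'\<in>U. nrm (fib E (q z')) (?\<eta> z' \<ominus>\<^bsub>fib E (q z')\<^esub> \<xi>0 (q z')) \<le> \<epsilon>)"
      using openin_continuous_map_preimage[OF cont_p U(1)] z q_fibre E.sections0_sec
      by (intro exI[of _ "{z \<in> topspace Z. p z \<in> U}"] exI[of _ \<xi>0]) auto
  qed
  show "locally_vanishing W Z p F ?\<eta>"
    unfolding locally_vanishing_def
  proof (intro ballI allI impI)
    fix w \<epsilon> assume w: "w \<in> topspace W" and \<epsilon>: "(0::real) < \<epsilon>"
    obtain U \<xi>0 where U: "openin W U" "w \<in> U" "\<xi>0 \<in> \<Gamma>0 E"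
      "\<And>w' y. w' \<in> U \<Longrightarrow> y \<in> Yf (f w') \<Longrightarrow> nrm (fib E y) (\<zeta> w' y \<ominus>\<^bsub>fib E y\<^esub> \<xi>0 y) \<le> \<epsilon> / 2"
      using H_approx[OF \<zeta> w half_gt_zero[OF \<epsilon>]] by metis
    obtain U' K where U': "openin W U'" "w \<in> U'" "compactin Z K"
      "\<And>z. z \<in> topspace Z \<Longrightarrow> p z \<in> U' \<Longrightarrow> z \<notin> K \<Longrightarrow> nrm (fib F z) ((\<lambda>z\<in>topspace Z. \<xi>0 (q z)) z) < \<epsilon> / 2"
      using locally_vanishingD[OF pullback_section0(2)[OF U(3)] w half_gt_zero[OF \<epsilon>]] by metis
    have "nrm (fib F z) (?\<eta> z) < \<epsilon>" if z: "z \<in> topspace Z" "p z \<in> U \<inter> U'" "z \<notin> K" for z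
    proof -
      have "p z \<in> U"
        using z(2) by simp
      then show ?thesis
        using le[OF z(1) \<open>p z \<in> U\<close> U(3,4)] U'(4)[OF z(1) _ z(3)] z(1,2) by (simp add: fib_F)
    qed
    then show "\<exists>U K. openin W U \<and> w \<in> U \<and> compactin Z K \<and>
      (\<forall>z\<in>topspace Z. p z \<in> U \<and> z \<notin> K \<longrightarrow> nrm (fib F z) (?\<eta> z) < \<epsilon>)"
      using U(1,2) U'(1-3) by (intro exI[of _ "U \<inter> U'"] exI[of _ K]) auto
  qed
  show "locally_bounded W Z p F ?\<eta>"
    unfolding locally_bounded_def
  proof
    fix w assume w: "w \<in> topspace W"
    obtain U \<xi>0 where U: "openin W U" "w \<in> U" "\<xi>0 \<in> \<Gamma>0 E"
      "\<And>w' y. w' \<in> U \<Longrightarrow> y \<in> Yf (f w') \<Longrightarrow> nrm (fib E y) (\<zeta> w' y \<ominus>\<^bsub>fib E y\<^esub> \<xi>0 y) \<le> 1"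
      using H_approx[OF \<zeta> w zero_less_one] by metis
    obtain M where M: "M > 0" "\<And>y. y \<in> topspace (spc Y) \<Longrightarrow> nrm (fib E y) (\<xi>0 y) \<le> M"
      using E.sections0_bounded[OF U(3)] by metis
    have "nrm (fib F z) (?\<eta> z) \<le> M + 1" if z: "z \<in> topspace Z" "p z \<in> U" for z
      using le[OF z U(3,4)] M(2)[OF q_mem[OF z(1)]] z by (auto simp: fib_F)
    then show "\<exists>U M. openin W U \<and> w \<in> U \<and> M > 0 \<and>
        (\<forall>z\<in>topspace Z. p z \<in> U \<longrightarrow> nrm (fib F z) (?\<eta> z) \<le> M)"
      using U(1,2) M(1) by (intro exI[of _ U] exI[of _ "M + 1"]) auto
  qed
qed

text \<open>Continuity is pullback along the embedding \<open>j w\<close>. At infinity, the compact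
  exceptional set in Z projects to a compact set in Y, whose intersection with the closed fibre is
  compact.\<close>

lemma restrict_to_fibre:
  assumes \<eta>: "\<eta> \<in> sec F" "locally_vanishing W Z p F \<eta>" and w: "w \<in> topspace W"
  shows "(\<lambda>y\<in>Yf (f w). \<eta> (j w y)) \<in> carrier (push_fibre Y E (f w))"
  unfolding push_fibre_simps sections0_def
proof (intro CollectI conjI allI impI)
  have "(\<lambda>y\<in>topspace (Q (f w)). \<eta> (j w y)) \<in> sec (R E (f w))"
    by (rule is_pullback_comp[OF F(2) cont_j[OF w] restricted_field(2)[OF E] _ \<eta>(1)]) (use j[OF w] in auto)
  then show "(\<lambda>y\<in>Yf (f w). \<eta> (j w y)) \<in> sec (R E (f w))"
    by simp
  fix \<epsilon> :: real assume \<epsilon>: "\<epsilon> > 0"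
  obtain U K where U: "openin W U" "w \<in> U" "compactin Z K"
    "\<And>z. z \<in> topspace Z \<Longrightarrow> p z \<in> U \<Longrightarrow> z \<notin> K \<Longrightarrow> nrm (fib F z) (\<eta> z) < \<epsilon>"
    using locally_vanishingD[OF \<eta>(2) w \<epsilon>] by metis
  have "compactin (Q (f w)) (Yf (f w) \<inter> q ` K)"
    by (rule compactin_fibre[OF f_mem[OF w] image_compactin[OF U(3) cont_q]])
  moreover have "nrm (fib E y) (\<eta> (j w y)) < \<epsilon>" if y: "y \<in> Yf (f w)" "y \<notin> q ` K" for y
  proof -
    have "j w y \<in> topspace Z" "p (j w y) = w" "q (j w y) = y"
      using j[OF w y(1)] by auto
    moreover from this have "j w y \<notin> K"
      using y(2) by (metis image_eqI)
    ultimately show ?thesis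
      using U(2) U(4)[of "j w y"] by (simp add: fib_F)
  qed
  ultimately show "\<exists>K. compactin (Q (f w)) K \<and> (\<forall>y\<in>topspace (Q (f w)) - K.
      nrm (fib (R E (f w)) y) ((\<lambda>y\<in>Yf (f w). \<eta> (j w y)) y) < \<epsilon>)"
    by (intro exI[of _ "Yf (f w) \<inter> q ` K"]) (auto simp: restricted_field(3)[OF E])
qed

text \<open>On the fibre over w, the section is close to some \<xi> from \<Gamma>_0(Y,E) by density.
  The points of Z where the estimate by \<epsilon> fails lie, over a neighbourhood of w, in a
  compact set that misses the fibre over w; removing its image from the neighbourhood makes the
  estimate hold on all remaining fibres.\<close>

lemma curry_section:
  assumes \<eta>: "\<eta> \<in> sec F" "locally_vanishing W Z p F \<eta>"
  shows "(\<lambda>w\<in>topspace W. \<lambda>y\<in>Yf (f w). \<eta> (j w y)) \<in> sec H"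
proof (rule H_secI)
  note rf = restrict_to_fibre[OF \<eta>]
  show "(\<lambda>w\<in>topspace W. \<lambda>y\<in>Yf (f w). \<eta> (j w y)) \<in> (\<Pi>\<^sub>E w\<in>topspace W. carrier (push_fibre Y E (f w)))"
    using rf by auto
  fix w \<epsilon> assume w: "w \<in> topspace W" and \<epsilon>: "(0::real) < \<epsilon>"
  obtain \<xi> where \<xi>: "\<xi> \<in> \<Gamma>0 E" "\<And>y. y \<in> Yf (f w) \<Longrightarrow> nrm (fib E y) ((\<lambda>y\<in>Yf (f w). \<eta> (j w y)) y \<ominus>\<^bsub>fib E y\<^esub> \<xi> y) \<le> \<epsilon> / 2"
    using push_dense[OF E f_mem[OF w] rf[OF w] half_gt_zero[OF \<epsilon>]] by metis
  let ?\<xi> = "\<lambda>z\<in>topspace Z. \<xi> (q z)"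
  obtain U K where U: "openin W U" "w \<in> U" "compactin Z K"
    "\<And>z. z \<in> topspace Z \<Longrightarrow> p z \<in> U \<Longrightarrow> z \<notin> K \<Longrightarrow> nrm (fib F z) (\<eta> z) < \<epsilon> / 2"
    using locally_vanishingD[OF \<eta>(2) w half_gt_zero[OF \<epsilon>]] by metis
  obtain U' K' where U': "openin W U'" "w \<in> U'" "compactin Z K'"
    "\<And>z. z \<in> topspace Z \<Longrightarrow> p z \<in> U' \<Longrightarrow> z \<notin> K' \<Longrightarrow> nrm (fib F z) (?\<xi> z) < \<epsilon> / 2"
    using locally_vanishingD[OF pullback_section0(2)[OF \<xi>(1)] w half_gt_zero[OF \<epsilon>]] by metis
  \<comment> \<open>The points with error at least \<epsilon>. Outside \<open>K\<close> and
    \<open>K'\<close> both sections are below \<epsilon>/2, so over \<open>U \<inter> U'\<close> all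
    such points lie in the compact union.\<close>
  let ?C = "topspace Z - {z \<in> topspace Z. nrm (fib F z) (\<eta> z \<ominus>\<^bsub>fib F z\<^esub> ?\<xi> z) < \<epsilon>}"
  have "closedin Z ?C"
    using F.sec_usc_diff[OF \<eta>(1) pullback_section0(1)[OF \<xi>(1)], of \<epsilon>] by blast
  then have "closedin W (p ` (?C \<inter> (K \<union> K')))"
    using compactin_imp_closedin[OF hausW image_compactin[OF closed_Int_compactin[OF _ compactin_Un[OF U(3) U'(3)]] cont_p]]
    by blast
  then have o: "openin W (U \<inter> U' - p ` (?C \<inter> (K \<union> K')))" (is "openin W ?U")
    using U(1) U'(1) by blast
  have em: "\<eta> z \<in> carrier (fib F z)" "?\<xi> z \<in> carrier (fib F z)" if "z \<in> topspace Z" for z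
    using F.sec_mem[OF \<eta>(1) that] F.sec_mem[OF pullback_section0(1)[OF \<xi>(1)] that] .
  have "w \<in> ?U"
  proof (intro DiffI IntI U(2) U'(2) notI)
    assume "w \<in> p ` (?C \<inter> (K \<union> K'))"
    then obtain z where z: "z \<in> topspace Z" "p z = w" "\<not> nrm (fib F z) (\<eta> z \<ominus>\<^bsub>fib F z\<^esub> ?\<xi> z) < \<epsilon>"
      by (elim imageE IntE DiffE UnE) blast+
    have "nrm (fib E (q z)) (\<eta> (j w (q z)) \<ominus>\<^bsub>fib E (q z)\<^esub> \<xi> (q z)) \<le> \<epsilon> / 2"
      using \<xi>(2)[of "q z"] q_fibre[OF z(1)] z(2) by simp
    then show False
      using z \<epsilon> j_pq[OF z(1)] by (simp add: fib_F)
  qed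
  moreover have "nrm (fib E y) ((\<lambda>w\<in>topspace W. \<lambda>y\<in>Yf (f w). \<eta> (j w y)) w' y \<ominus>\<^bsub>fib E y\<^esub> \<xi> y) \<le> \<epsilon>"
    if w': "w' \<in> ?U" and y: "y \<in> Yf (f w')" for w' y
  proof -
    have w'W: "w' \<in> topspace W"
      using w' openin_subset[OF U(1)] by blast
    define z where "z = j w' y"
    have z: "z \<in> topspace Z" "p z = w'" "q z = y"
      using j[OF w'W y] by (simp_all add: z_def)
    have "nrm (fib F z) (\<eta> z \<ominus>\<^bsub>fib F z\<^esub> ?\<xi> z) \<le> \<epsilon>"
    proof (cases "z \<in> K \<union> K'")
      case True
      then show ?thesis
        using w' z by fastforce
    next
      case False
      then have "nrm (fib F z) (\<eta> z) < \<epsilon> / 2" "nrm (fib F z) (?\<xi> z) < \<epsilon> / 2"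
        using U(4)[of z] U'(4)[of z] z w' by auto
      then show ?thesis
        using normed.nrm_diff_le[OF F.normed[OF z(1)] em[OF z(1)]] by simp
    qed
    then show ?thesis
      using w'W y z by (simp add: fib_F z_def)
  qed
  ultimately show "\<exists>U \<xi>0. openin W U \<and> w \<in> U \<and> \<xi>0 \<in> \<Gamma>0 E \<and> (\<forall>w'\<in>U. \<forall>y\<in>Yf (f w').
      nrm (fib E y) ((\<lambda>w\<in>topspace W. \<lambda>y\<in>Yf (f w). \<eta> (j w y)) w' y \<ominus>\<^bsub>fib E y\<^esub> \<xi>0 y) \<le> \<epsilon>)"
    using o \<xi>(1) by (intro exI[of _ ?U] exI[of _ \<xi>]) blast
qed

text \<open>Off the compact image p(K) every point of the fibre avoids \<open>K\<close>. The bound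
  \<epsilon>/2 there leaves room for a strict inequality after passing to the supremum.\<close>

lemma curry_section0:
  assumes \<eta>: "\<eta> \<in> sections0 Z F"
  shows "(\<lambda>w\<in>topspace W. \<lambda>y\<in>Yf (f w). \<eta> (j w y)) \<in> sections0 W H" (is "?\<zeta> \<in> _")
  unfolding sections0_def
proof (intro CollectI conjI allI impI)
  have "locally_vanishing W Z p F \<eta>"
    unfolding locally_vanishing_def
  proof (intro ballI allI impI)
    fix w \<epsilon> assume "w \<in> topspace W" "(0::real) < \<epsilon>"
    then show "\<exists>U K. openin W U \<and> w \<in> U \<and> compactin Z K \<and>
        (\<forall>z\<in>topspace Z. p z \<in> U \<and> z \<notin> K \<longrightarrow> nrm (fib F z) (\<eta> z) < \<epsilon>)"
      using F.sections0_vanish[OF \<eta>, of \<epsilon>] by (metis openin_topspace)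
  qed
  then show "?\<zeta> \<in> sec H"
    by (rule curry_section[OF F.sections0_sec[OF \<eta>]])
  fix \<epsilon> :: real assume \<epsilon>: "\<epsilon> > 0"
  obtain K where K: "compactin Z K" "\<And>z. z \<in> topspace Z \<Longrightarrow> z \<notin> K \<Longrightarrow> nrm (fib F z) (\<eta> z) < \<epsilon> / 2"
    using F.sections0_vanish[OF \<eta> half_gt_zero[OF \<epsilon>]] by metis
  have "nrm (fib H w) (?\<zeta> w) < \<epsilon>" if w: "w \<in> topspace W - p ` K" for w
  proof -
    have "nrm (push_fibre Y E (f w)) (?\<zeta> w) \<le> \<epsilon> / 2"
    proof (rule push_nrm_le)
      fix y assume y: "y \<in> Yf (f w)"
      then have z: "j w y \<in> topspace Z" "p (j w y) = w" "q (j w y) = y"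
        using j[of w y] w by auto
      then have "j w y \<notin> K"
        using w by (metis DiffD2 image_eqI)
      then show "nrm (fib E y) (?\<zeta> w y) \<le> \<epsilon> / 2"
        using K(2)[OF z(1)] z w y by (simp add: fib_F)
    qed (use \<epsilon> in simp)
    then show ?thesis
      using \<epsilon> w by (simp add: fib_H)
  qed
  then show "\<exists>K. compactin W K \<and> (\<forall>w\<in>topspace W - K. nrm (fib H w) (?\<zeta> w) < \<epsilon>)"
    using image_compactin[OF K(1) cont_p] by blast
qed

text \<open>Off a compact \<open>L\<close> in W the supremum norm is already small. Over
  \<open>L\<close>, finitely many neighbourhoods from local vanishing suffice, and the union of
  their exceptional sets is compact.\<close>

lemma uncurry_section0:
  assumes \<zeta>: "\<zeta> \<in> sections0 W H"
  shows "(\<lambda>z\<in>topspace Z. \<zeta> (p z) (q z)) \<in> sections0 Z F" (is "?\<eta> \<in> _")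
  unfolding sections0_def
proof (intro CollectI conjI allI impI)
  note us = uncurry_section[OF H.sections0_sec[OF \<zeta>]]
  show "?\<eta> \<in> sec F"
    by (rule us(1))
  fix \<epsilon> :: real assume \<epsilon>: "\<epsilon> > 0"
  obtain L where L: "compactin W L" "\<And>w. w \<in> topspace W \<Longrightarrow> w \<notin> L \<Longrightarrow> nrm (fib H w) (\<zeta> w) < \<epsilon>"
    using H.sections0_vanish[OF \<zeta> \<epsilon>] by metis
  define P where "P w U K \<longleftrightarrow> openin W U \<and> w \<in> U \<and> compactin Z K \<and>
    (\<forall>z\<in>topspace Z. p z \<in> U \<and> z \<notin> K \<longrightarrow> nrm (fib F z) (?\<eta> z) < \<epsilon>)" for w U K
  have "\<exists>U K. P w U K" if "w \<in> L" for w
    using us(2) \<epsilon> that compactin_subset_topspace[OF L(1)] unfolding locally_vanishing_def P_def by blast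
  then obtain U K where "\<And>w. w \<in> L \<Longrightarrow> P w (U w) (K w)"
    by metis
  note sel = this[unfolded P_def]
  obtain \<F> where \<F>: "finite \<F>" "\<F> \<subseteq> U ` L" "L \<subseteq> \<Union>\<F>"
    using compactinD[OF L(1), of "U ` L"] sel by blast
  then obtain N where N: "finite N" "N \<subseteq> L" "\<F> = U ` N"
    by (meson finite_subset_image)
  have "compactin Z (\<Union>(K ` N))"
    by (rule compactin_Union) (use N sel in auto)
  moreover have "nrm (fib F z) (?\<eta> z) < \<epsilon>" if z: "z \<in> topspace Z" "z \<notin> \<Union>(K ` N)" for z
  proof (cases "p z \<in> L")
    case True
    then obtain w where "w \<in> N" "p z \<in> U w"
      using \<F>(3) N(3) by blast
    then show ?thesis
      using sel[of w] z N(2) by blast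
  next
    case False
    have "nrm (fib F z) (?\<eta> z) \<le> nrm (fib H (p z)) (\<zeta> (p z))"
      using push_nrm_ge[OF E H_mem[OF H.sections0_sec[OF \<zeta>] p_mem[OF z(1)]] q_fibre[OF z(1)]] z(1)
      by (simp add: fib_F fib_H p_mem)
    then show ?thesis
      using L(2)[OF p_mem[OF z(1)] False] by simp
  qed
  ultimately show "\<exists>K. compactin Z K \<and> (\<forall>z\<in>topspace Z - K. nrm (fib F z) (?\<eta> z) < \<epsilon>)"
    by (intro exI[of _ "\<Union>(K ` N)"]) blast
qed

end

end

section \<open>Transfer of fields of maps\<close>

lemma locally_vanishing_le:
  assumes \<eta>: "locally_vanishing W Z p F \<eta>"
    and nonneg: "\<And>z. z \<in> topspace Z \<Longrightarrow> 0 \<le> nrm (fib F z) (\<eta> z)"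
    and le: "\<And>z. z \<in> topspace Z \<Longrightarrow> nrm (fib F' z) (\<zeta> z) \<le> C * nrm (fib F z) (\<eta> z)"
  shows "locally_vanishing W Z p F' \<zeta>"
  unfolding locally_vanishing_def
proof (intro ballI allI impI)
  fix w \<epsilon> assume w: "w \<in> topspace W" and \<epsilon>: "(0::real) < \<epsilon>"
  have "\<epsilon> / (\<bar>C\<bar> + 1) > 0"
    using \<epsilon> by (intro divide_pos_pos) auto
  then obtain U K where U: "openin W U" "w \<in> U" "compactin Z K"
    "\<And>z. z \<in> topspace Z \<Longrightarrow> p z \<in> U \<Longrightarrow> z \<notin> K \<Longrightarrow> nrm (fib F z) (\<eta> z) < \<epsilon> / (\<bar>C\<bar> + 1)"
    using locally_vanishingD[OF \<eta> w] by metis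
  have "nrm (fib F' z) (\<zeta> z) < \<epsilon>" if z: "z \<in> topspace Z" "p z \<in> U" "z \<notin> K" for z
  proof -
    have "C * nrm (fib F z) (\<eta> z) \<le> (\<bar>C\<bar> + 1) * nrm (fib F z) (\<eta> z)"
      using nonneg[OF z(1)] by (intro mult_right_mono) auto
    also have "\<dots> < (\<bar>C\<bar> + 1) * (\<epsilon> / (\<bar>C\<bar> + 1))"
      using U(4)[OF z] by (intro mult_strict_left_mono) auto
    also have "\<dots> = \<epsilon>"
      by simp
    finally show ?thesis
      using le[OF z(1)] by simp
  qed
  then show "\<exists>U K. openin W U \<and> w \<in> U \<and> compactin Z K \<and>
      (\<forall>z\<in>topspace Z. p z \<in> U \<and> z \<notin> K \<longrightarrow> nrm (fib F' z) (\<zeta> z) < \<epsilon>)"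
    using U(1-3) by (intro exI[of _ U] exI[of _ K]) auto
qed

text \<open>Two presentations of \<open>Z\<close> as a fibre product over the same \<open>W\<close> are allowed, since the
  groupoid action is a field from the pullback along the source to the pullback along the range.\<close>

lemma bounded_linear_transfer:
  assumes b1: "base_change G Y W f1 Z p q1 j1" and b2: "base_change G Y W f2 Z p q2 j2"
    and E1: "usc_field (spc Y) E1" and F1: "usc_field Z F1" "is_pullback Z q1 E1 F1"
    and H1: "usc_field W H1" "is_pullback W f1 (push_field G Y E1) H1"
    and E2: "usc_field (spc Y) E2" and F2: "usc_field Z F2" "is_pullback Z q2 E2 F2"
    and H2: "usc_field W H2" "is_pullback W f2 (push_field G Y E2) H2"
    and T: "bounded_linear_field Z F1 F2 T"
    and T': "\<And>w \<zeta>. w \<in> topspace W \<Longrightarrow> \<zeta> \<in> carrier (push_fibre Y E1 (f1 w)) \<Longrightarrow>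
      T' w \<zeta> = (\<lambda>y\<in>anchor_fibre Y (f2 w). T (j2 w y) (\<zeta> (q1 (j2 w y))))"
  shows "bounded_linear_field W H1 H2 T'"
proof -
  interpret b1: base_change G Y W f1 Z p q1 j1 by (rule b1)
  interpret b2: base_change G Y W f2 Z p q2 j2 by (rule b2)
  interpret E1: field_over "spc Y" E1 by unfold_locales (rule E1)
  interpret E2: field_over "spc Y" E2 by unfold_locales (rule E2)
  interpret F1: field_over Z F1 by unfold_locales (rule F1)
  interpret F2: field_over Z F2 by unfold_locales (rule F2)
  interpret H1: field_over W H1 by unfold_locales (rule H1)
  interpret H2: field_over W H2 by unfold_locales (rule H2)
  note ctx1 = E1 F1 H1 and ctx2 = E2 F2 H2
  note fibF1 = b1.fib_F[OF ctx1] and fibF2 = b2.fib_F[OF ctx2]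
  note fibH1 = b1.fib_H[OF ctx1] and fibH2 = b2.fib_H[OF ctx2]
  have Tlin: "linear_map (fib F1 z) (fib F2 z) (T z)" if "z \<in> topspace Z" for z
    using T that by (simp add: bounded_linear_field_def linear_field_def bounded_linear_map_def)
  have Tsec: "(\<lambda>z\<in>topspace Z. T z (\<xi> z)) \<in> sec F2" if "\<xi> \<in> sec F1" for \<xi>
    using T that by (simp add: bounded_linear_field_def linear_field_def)
  obtain C0 where C0: "norm_le Z F1 F2 T C0"
    using T by (auto simp: bounded_linear_field_def)
  \<comment> \<open>\<open>norm_le\<close> does not force its constant to be non-negative, for
    instance when all fibres are zero.\<close>
  define C where "C = max C0 0"
  have C: "0 \<le> C" "\<And>z e. z \<in> topspace Z \<Longrightarrow> e \<in> carrier (fib F1 z) \<Longrightarrow> nrm (fib F2 z) (T z e) \<le> C * nrm (fib F1 z) e"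
  proof -
    fix z e assume z: "z \<in> topspace Z" and e: "e \<in> carrier (fib F1 z)"
    have "nrm (fib F2 z) (T z e) \<le> C0 * nrm (fib F1 z) e"
      using C0 z e by (simp add: norm_le_def)
    also have "\<dots> \<le> C * nrm (fib F1 z) e"
      using normed.nrm_ge0[OF F1.normed[OF z] e] by (intro mult_right_mono) (auto simp: C_def)
    finally show "nrm (fib F2 z) (T z e) \<le> C * nrm (fib F1 z) e" .
  qed (simp add: C_def)
  have pt: "j2 w y \<in> topspace Z" "p (j2 w y) = w" "q2 (j2 w y) = y" "q1 (j2 w y) \<in> anchor_fibre Y (f1 w)"
    if "w \<in> topspace W" "y \<in> anchor_fibre Y (f2 w)" for w y
    using b2.j[OF that] b1.q_fibre[of "j2 w y"] by auto
  have val: "\<zeta> (q1 (j2 w y)) \<in> carrier (fib F1 (j2 w y))"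
    if "w \<in> topspace W" "y \<in> anchor_fibre Y (f2 w)" "\<zeta> \<in> carrier (push_fibre Y E1 (f1 w))" for w y \<zeta>
    using b1.push_mem[OF E1 that(3) pt(4)[OF that(1,2)]] fibF1[OF pt(1)[OF that(1,2)]] by simp
  have vanish: "locally_vanishing W Z p F2 (\<lambda>z\<in>topspace Z. T z (\<xi> z))"
    if "\<xi> \<in> sec F1" "locally_vanishing W Z p F1 \<xi>" for \<xi>
    by (rule locally_vanishing_le[OF that(2), where C = C])
      (use C(2) F1.sec_mem[OF that(1)] normed.nrm_ge0[OF F1.normed] in auto)
  \<comment> \<open>The vector \<zeta> is not known to be the value of a section, so continuity of
    \<open>T\<close> does not apply to it directly. It is a uniform limit of restrictions from
    \<Gamma>_0(Y,E1), whose images do lie in the target, and the bound \<open>C\<close> carries the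
    limit through \<open>T\<close>.\<close>
  have T'_carrier: "T' w \<zeta> \<in> carrier (push_fibre Y E2 (f2 w))"
    if w: "w \<in> topspace W" and \<zeta>: "\<zeta> \<in> carrier (push_fibre Y E1 (f1 w))" for w \<zeta>
  proof -
    interpret R: field_over "subtopology (spc Y) (anchor_fibre Y (f2 w))" "restrict_field (spc Y) (anchor_fibre Y (f2 w)) E2"
      by (rule b1.restricted_field(1)[OF E2])
    show ?thesis
      unfolding push_fibre_simps
    proof (rule R.sections0_uniform_limit)
      show "T' w \<zeta> \<in> all_sections (subtopology (spc Y) (anchor_fibre Y (f2 w))) (fib (restrict_field (spc Y) (anchor_fibre Y (f2 w)) E2))"
        using linear_map_mem[OF Tlin[OF pt(1)[OF w]] val[OF w _ \<zeta>]] fibF2[OF pt(1)[OF w]] pt(3)[OF w]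
        by (auto simp: T'[OF w \<zeta>] all_sections_def b1.restricted_field(3)[OF E2])
      fix \<epsilon> :: real assume \<epsilon>: "\<epsilon> > 0"
      have "\<epsilon> / (C + 1) > 0"
        using \<epsilon> C(1) by (intro divide_pos_pos) auto
      then obtain \<xi> where \<xi>: "\<xi> \<in> sections0 (spc Y) E1"
        "\<And>y. y \<in> anchor_fibre Y (f1 w) \<Longrightarrow> nrm (fib E1 y) (\<zeta> y \<ominus>\<^bsub>fib E1 y\<^esub> \<xi> y) \<le> \<epsilon> / (C + 1)"
        using b1.push_dense[OF E1 b1.f_mem[OF w] \<zeta>] by metis
      note ps = b1.pullback_section0[OF ctx1 \<xi>(1)]
      let ?\<eta> = "\<lambda>z\<in>topspace Z. T z ((\<lambda>z\<in>topspace Z. \<xi> (q1 z)) z)"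
      have "(\<lambda>y\<in>anchor_fibre Y (f2 w). ?\<eta> (j2 w y)) \<in> carrier (push_fibre Y E2 (f2 w))"
        by (rule b2.restrict_to_fibre[OF ctx2 Tsec[OF ps(1)] vanish[OF ps(1,2)] w])
      moreover have "nrm (fib E2 y) (T' w \<zeta> y \<ominus>\<^bsub>fib E2 y\<^esub> ?\<eta> (j2 w y)) \<le> \<epsilon>" if y: "y \<in> anchor_fibre Y (f2 w)" for y
      proof -
        define z where "z = j2 w y"
        note z = pt[OF w y, folded z_def]
        have m: "\<zeta> (q1 z) \<in> carrier (fib F1 z)" "\<xi> (q1 z) \<in> carrier (fib F1 z)"
          using val[OF w y \<zeta>] F1.sec_mem[OF ps(1) z(1)] z(1) by (simp_all add: z_def)
        have "T' w \<zeta> y \<ominus>\<^bsub>fib E2 y\<^esub> ?\<eta> (j2 w y) = T z (\<zeta> (q1 z) \<ominus>\<^bsub>fib F1 z\<^esub> \<xi> (q1 z))"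
          using linear_map_diff[OF F1.normed[OF z(1)] F2.normed[OF z(1)] Tlin[OF z(1)] m] z y fibF2[OF z(1)]
          by (simp add: T'[OF w \<zeta>] z_def)
        then have "nrm (fib E2 y) (T' w \<zeta> y \<ominus>\<^bsub>fib E2 y\<^esub> ?\<eta> (j2 w y)) \<le> C * nrm (fib F1 z) (\<zeta> (q1 z) \<ominus>\<^bsub>fib F1 z\<^esub> \<xi> (q1 z))"
          using C(2)[OF z(1) normed.diff_mem[OF F1.normed[OF z(1)] m]] fibF2[OF z(1)] z(3) by simp
        also have "\<dots> \<le> (C + 1) * (\<epsilon> / (C + 1))"
          using \<xi>(2)[OF z(4)] fibF1[OF z(1)] C(1) normed.nrm_ge0[OF F1.normed[OF z(1)] normed.diff_mem[OF F1.normed[OF z(1)] m]]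
          by (intro mult_mono) auto
        also have "\<dots> = \<epsilon>"
          using C(1) by simp
        finally show ?thesis .
      qed
      ultimately show "\<exists>\<xi>'\<in>sections0 (subtopology (spc Y) (anchor_fibre Y (f2 w))) (restrict_field (spc Y) (anchor_fibre Y (f2 w)) E2).
        \<forall>y\<in>topspace (subtopology (spc Y) (anchor_fibre Y (f2 w))).
          nrm (fib (restrict_field (spc Y) (anchor_fibre Y (f2 w)) E2) y)
            (T' w \<zeta> y \<ominus>\<^bsub>fib (restrict_field (spc Y) (anchor_fibre Y (f2 w)) E2) y\<^esub> \<xi>' y) \<le> \<epsilon>"
        by (intro bexI[of _ "\<lambda>y\<in>anchor_fibre Y (f2 w). ?\<eta> (j2 w y)"])
          (auto simp: push_fibre_simps(1) b1.restricted_field(3)[OF E2] restrict_apply' simp del: restrict_apply)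
    qed
  qed
  have T'_le: "nrm (push_fibre Y E2 (f2 w)) (T' w \<zeta>) \<le> C * nrm (push_fibre Y E1 (f1 w)) \<zeta>"
    if w: "w \<in> topspace W" and \<zeta>: "\<zeta> \<in> carrier (push_fibre Y E1 (f1 w))" for w \<zeta>
  proof (rule push_nrm_le)
    show "0 \<le> C * nrm (push_fibre Y E1 (f1 w)) \<zeta>"
      using C(1) b1.push_nrm_ge0[OF E1 \<zeta>] by simp
    fix y assume y: "y \<in> anchor_fibre Y (f2 w)"
    have "nrm (fib E2 y) (T' w \<zeta> y) \<le> C * nrm (fib F1 (j2 w y)) (\<zeta> (q1 (j2 w y)))"
      using C(2)[OF pt(1)[OF w y] val[OF w y \<zeta>]] y fibF2[OF pt(1)[OF w y]] pt(3)[OF w y] by (simp add: T'[OF w \<zeta>])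
    also have "\<dots> \<le> C * nrm (push_fibre Y E1 (f1 w)) \<zeta>"
      using b1.push_nrm_ge[OF E1 \<zeta> pt(4)[OF w y]] C(1) fibF1[OF pt(1)[OF w y]] by (simp add: mult_left_mono)
    finally show "nrm (fib E2 y) (T' w \<zeta> y) \<le> C * nrm (push_fibre Y E1 (f1 w)) \<zeta>" .
  qed
  have Tpt: "T (j2 w y) (a \<oplus>\<^bsub>fib E1 (q1 (j2 w y))\<^esub> b) = T (j2 w y) a \<oplus>\<^bsub>fib E2 y\<^esub> T (j2 w y) b"
    if "w \<in> topspace W" "y \<in> anchor_fibre Y (f2 w)" "a \<in> carrier (fib E1 (q1 (j2 w y)))" "b \<in> carrier (fib E1 (q1 (j2 w y)))"
    for w y a b
    using Tlin[OF pt(1)[OF that(1,2)]] fibF1[OF pt(1)[OF that(1,2)]] fibF2[OF pt(1)[OF that(1,2)]] pt(3)[OF that(1,2)] that(3,4)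
    by (simp add: linear_map_def)
  have Tpt': "T (j2 w y) (c \<odot>\<^bsub>fib E1 (q1 (j2 w y))\<^esub> a) = c \<odot>\<^bsub>fib E2 y\<^esub> T (j2 w y) a"
    if "w \<in> topspace W" "y \<in> anchor_fibre Y (f2 w)" "a \<in> carrier (fib E1 (q1 (j2 w y)))" for w y a c
    using Tlin[OF pt(1)[OF that(1,2)]] fibF1[OF pt(1)[OF that(1,2)]] fibF2[OF pt(1)[OF that(1,2)]] pt(3)[OF that(1,2)] that(3)
    by (simp add: linear_map_def)
  have T'_lin: "linear_map (push_fibre Y E1 (f1 w)) (push_fibre Y E2 (f2 w)) (T' w)" if w: "w \<in> topspace W" for w
    unfolding linear_map_def
  proof (intro conjI ballI allI funcsetI)
    fix \<zeta> assume \<zeta>: "\<zeta> \<in> carrier (push_fibre Y E1 (f1 w))"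
    show "T' w \<zeta> \<in> carrier (push_fibre Y E2 (f2 w))"
      by (rule T'_carrier[OF w \<zeta>])
    note n1 = b1.normed_push[OF E1, of "f1 w"]
    show "T' w (c \<odot>\<^bsub>push_fibre Y E1 (f1 w)\<^esub> \<zeta>) = c \<odot>\<^bsub>push_fibre Y E2 (f2 w)\<^esub> T' w \<zeta>" for c
      unfolding T'[OF w \<zeta>] T'[OF w normed.smult_mem[OF n1 \<zeta>]]
      using Tpt'[OF w] pt[OF w] val[OF w _ \<zeta>] fibF1[OF pt(1)[OF w]]
      by (auto simp: push_fibre_simps intro!: restrict_ext)
    fix \<omega> assume \<omega>: "\<omega> \<in> carrier (push_fibre Y E1 (f1 w))"
    have add: "\<zeta> \<oplus>\<^bsub>push_fibre Y E1 (f1 w)\<^esub> \<omega> \<in> carrier (push_fibre Y E1 (f1 w))"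
      using normed.module[OF n1] \<zeta> \<omega> by (meson abelian_group.axioms(1) abelian_monoid.a_closed module.axioms(2))
    show "T' w (\<zeta> \<oplus>\<^bsub>push_fibre Y E1 (f1 w)\<^esub> \<omega>) = T' w \<zeta> \<oplus>\<^bsub>push_fibre Y E2 (f2 w)\<^esub> T' w \<omega>"
      unfolding T'[OF w \<zeta>] T'[OF w \<omega>] T'[OF w add]
      using Tpt[OF w] pt[OF w] val[OF w _ \<zeta>] val[OF w _ \<omega>] fibF1[OF pt(1)[OF w]]
      by (auto simp: push_fibre_simps intro!: restrict_ext)
  qed
  have T'_sec: "(\<lambda>w\<in>topspace W. T' w (\<zeta> w)) \<in> sec H2" if \<zeta>: "\<zeta> \<in> sec H1" for \<zeta>
  proof -
    \<comment> \<open>Uncurry through the first square, apply \<open>T\<close> over Z, and curry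
      through the second.\<close>
    note us = b1.uncurry_section[OF ctx1 \<zeta>]
    note cs = b2.curry_section[OF ctx2 Tsec[OF us(1)] vanish[OF us(1,2)]]
    also have "(\<lambda>w\<in>topspace W. \<lambda>y\<in>anchor_fibre Y (f2 w).
        (\<lambda>z\<in>topspace Z. T z ((\<lambda>z\<in>topspace Z. \<zeta> (p z) (q1 z)) z)) (j2 w y)) = (\<lambda>w\<in>topspace W. T' w (\<zeta> w))"
      using pt by (intro restrict_ext) (auto simp: T' b1.H_mem[OF ctx1 \<zeta>] intro!: restrict_ext)
    finally show ?thesis .
  qed
  show ?thesis
    unfolding bounded_linear_field_def linear_field_def bounded_linear_map_def norm_le_def
    using T'_lin T'_le T'_sec fibH1 fibH2 by (intro conjI ballI exI[of _ C]) auto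
qed

context base_change
begin

text \<open>As for linear fields, but the first argument supplies the vanishing at infinity and the
  second only a local bound.\<close>

lemma contractive_bilinear_transfer:
  assumes E1: "usc_field (spc Y) E1" and F1: "usc_field Z F1" "is_pullback Z q E1 F1"
    and H1: "usc_field W H1" "is_pullback W f (push_field G Y E1) H1"
    and E2: "usc_field (spc Y) E2" and F2: "usc_field Z F2" "is_pullback Z q E2 F2"
    and H2: "usc_field W H2" "is_pullback W f (push_field G Y E2) H2"
    and E3: "usc_field (spc Y) E3" and F3: "usc_field Z F3" "is_pullback Z q E3 F3"
    and H3: "usc_field W H3" "is_pullback W f (push_field G Y E3) H3"
    and \<mu>: "contractive_bilinear_field Z F1 F2 F3 \<mu>"
    and \<mu>': "\<And>w \<zeta> \<omega>. w \<in> topspace W \<Longrightarrow> \<mu>' w \<zeta> \<omega> = (\<lambda>y\<in>Yf (f w). \<mu> (j w y) (\<zeta> y) (\<omega> y))"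
  shows "contractive_bilinear_field W H1 H2 H3 \<mu>'"
proof -
  interpret F1: field_over Z F1 by unfold_locales (rule F1)
  interpret F2: field_over Z F2 by unfold_locales (rule F2)
  interpret F3: field_over Z F3 by unfold_locales (rule F3)
  note ctx1 = E1 F1 H1 and ctx2 = E2 F2 H2 and ctx3 = E3 F3 H3
  note fibF = fib_F[OF ctx1] fib_F[OF ctx2] fib_F[OF ctx3]
  note fibH = fib_H[OF ctx1] fib_H[OF ctx2] fib_H[OF ctx3]
  have lin1: "linear_map (fib F2 z) (fib F3 z) (\<mu> z e)" if "z \<in> topspace Z" "e \<in> carrier (fib F1 z)" for z e
    using \<mu> that by (simp add: contractive_bilinear_field_def)
  have lin2: "linear_map (fib F1 z) (fib F3 z) (\<lambda>e. \<mu> z e g)" if "z \<in> topspace Z" "g \<in> carrier (fib F2 z)" for z g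
    using \<mu> that by (simp add: contractive_bilinear_field_def)
  have le: "nrm (fib F3 z) (\<mu> z e g) \<le> nrm (fib F1 z) e * nrm (fib F2 z) g"
    if "z \<in> topspace Z" "e \<in> carrier (fib F1 z)" "g \<in> carrier (fib F2 z)" for z e g
    using \<mu> that by (auto simp: contractive_bilinear_field_def)
  have mem: "\<mu> z e g \<in> carrier (fib F3 z)"
    if "z \<in> topspace Z" "e \<in> carrier (fib F1 z)" "g \<in> carrier (fib F2 z)" for z e g
    using linear_map_mem[OF lin1[OF that(1,2)] that(3)] .
  have \<mu>sec: "(\<lambda>z\<in>topspace Z. \<mu> z (\<xi> z) (\<eta> z)) \<in> sec F3" if "\<xi> \<in> sec F1" "\<eta> \<in> sec F2" for \<xi> \<eta>
    using \<mu> that by (simp add: contractive_bilinear_field_def)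
  have vanish: "locally_vanishing W Z p F3 (\<lambda>z\<in>topspace Z. \<mu> z (\<xi> z) (\<eta> z))"
    if "\<xi> \<in> sec F1" "\<eta> \<in> sec F2" "locally_vanishing W Z p F1 \<xi>" "locally_bounded W Z p F2 \<eta>" for \<xi> \<eta>
    by (rule locally_vanishing_mult[OF that(3,4)])
      (use le F1.sec_mem[OF that(1)] F2.sec_mem[OF that(2)] normed.nrm_ge0[OF F1.normed] normed.nrm_ge0[OF F2.normed] in auto)
  have pt: "j w y \<in> topspace Z" "p (j w y) = w" "q (j w y) = y" if "w \<in> topspace W" "y \<in> Yf (f w)" for w y
    using j[OF that] by auto
  have val: "\<zeta> y \<in> carrier (fib F1 (j w y))" if "w \<in> topspace W" "y \<in> Yf (f w)" "\<zeta> \<in> carrier (push_fibre Y E1 (f w))" for w y \<zeta>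
    using push_mem[OF E1 that(3,2)] fibF(1)[OF pt(1)[OF that(1,2)]] pt(3)[OF that(1,2)] by simp
  have val': "\<omega> y \<in> carrier (fib F2 (j w y))" if "w \<in> topspace W" "y \<in> Yf (f w)" "\<omega> \<in> carrier (push_fibre Y E2 (f w))" for w y \<omega>
    using push_mem[OF E2 that(3,2)] fibF(2)[OF pt(1)[OF that(1,2)]] pt(3)[OF that(1,2)] by simp
  have ptle: "nrm (fib E3 y) (\<mu> (j w y) e g) \<le> nrm (fib E1 y) e * nrm (fib E2 y) g"
    if w: "w \<in> topspace W" and y: "y \<in> Yf (f w)" and eg: "e \<in> carrier (fib E1 y)" "g \<in> carrier (fib E2 y)" for w y e g
    using le[OF pt(1)[OF w y], of e g] eg fibF[OF pt(1)[OF w y]] pt(3)[OF w y] by simp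
  have carrier: "\<mu>' w \<zeta> \<omega> \<in> carrier (push_fibre Y E3 (f w))"
    if w: "w \<in> topspace W" and \<zeta>: "\<zeta> \<in> carrier (push_fibre Y E1 (f w))" and \<omega>: "\<omega> \<in> carrier (push_fibre Y E2 (f w))" for w \<zeta> \<omega>
  proof -
    interpret R: field_over "Q (f w)" "R E3 (f w)"
      by (rule restricted_field(1)[OF E3])
    show ?thesis
      unfolding push_fibre_simps
    proof (rule R.sections0_uniform_limit)
      show "\<mu>' w \<zeta> \<omega> \<in> all_sections (Q (f w)) (fib (R E3 (f w)))"
        using mem[OF pt(1)[OF w] val[OF w _ \<zeta>] val'[OF w _ \<omega>]] fibF(3)[OF pt(1)[OF w]] pt(3)[OF w]
        by (auto simp: \<mu>'[OF w] all_sections_def restricted_field(3)[OF E3])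
      fix \<epsilon> :: real assume \<epsilon>: "\<epsilon> > 0"
      \<comment> \<open>The error of \<xi> is multiplied by the norm of \<omega> and the error of
        \<eta> by that of \<xi>. Hence \<xi> is fixed first, with tolerance governed by
        \<open>M\<close>; its bound \<open>N\<close> then governs the choice of \<eta>.\<close>
      define M where "M = nrm (push_fibre Y E2 (f w)) \<omega> + 1"
      have M: "M > 0" "\<And>y. y \<in> Yf (f w) \<Longrightarrow> nrm (fib E2 y) (\<omega> y) \<le> M"
        using push_nrm_ge0[OF E2 \<omega>] push_nrm_ge[OF E2 \<omega>] by (auto simp: M_def add.commute intro: add_increasing)
      obtain \<xi> where \<xi>: "\<xi> \<in> \<Gamma>0 E1"
        "\<And>y. y \<in> Yf (f w) \<Longrightarrow> nrm (fib E1 y) (\<zeta> y \<ominus>\<^bsub>fib E1 y\<^esub> \<xi> y) \<le> \<epsilon> / (2 * M)"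
        using push_dense[OF E1 f_mem[OF w] \<zeta>, of "\<epsilon> / (2 * M)"] \<epsilon> M(1) by auto
      obtain N where N: "N > 0" "\<And>y. y \<in> topspace (spc Y) \<Longrightarrow> nrm (fib E1 y) (\<xi> y) \<le> N"
        using field_over.sections0_bounded[OF field_over.intro[OF E1] \<xi>(1)] by metis
      obtain \<eta> where \<eta>: "\<eta> \<in> \<Gamma>0 E2"
        "\<And>y. y \<in> Yf (f w) \<Longrightarrow> nrm (fib E2 y) (\<omega> y \<ominus>\<^bsub>fib E2 y\<^esub> \<eta> y) \<le> \<epsilon> / (2 * N)"
        using push_dense[OF E2 f_mem[OF w] \<omega>, of "\<epsilon> / (2 * N)"] \<epsilon> N(1) by auto
      note ps = pullback_section0[OF ctx1 \<xi>(1)] and ps' = pullback_section0[OF ctx2 \<eta>(1)]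
      let ?\<theta> = "\<lambda>z\<in>topspace Z. \<mu> z ((\<lambda>z\<in>topspace Z. \<xi> (q z)) z) ((\<lambda>z\<in>topspace Z. \<eta> (q z)) z)"
      have "(\<lambda>y\<in>Yf (f w). ?\<theta> (j w y)) \<in> carrier (push_fibre Y E3 (f w))"
        by (rule restrict_to_fibre[OF ctx3 \<mu>sec[OF ps(1) ps'(1)] vanish[OF ps(1) ps'(1) ps(2) ps'(3)] w])
      moreover have "nrm (fib E3 y) (\<mu>' w \<zeta> \<omega> y \<ominus>\<^bsub>fib E3 y\<^esub> ?\<theta> (j w y)) \<le> \<epsilon>" if y: "y \<in> Yf (f w)" for y
      proof -
        define z where "z = j w y"
        note z = pt[OF w y, folded z_def]
        have yY: "y \<in> topspace (spc Y)"
          using y by (simp add: anchor_fibre_iff)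
        have fz: "fib F1 z = fib E1 y" "fib F2 z = fib E2 y" "fib F3 z = fib E3 y"
          using fibF[OF z(1)] z(3) by simp_all
        have m: "\<zeta> y \<in> carrier (fib E1 y)" "\<xi> y \<in> carrier (fib E1 y)" "\<omega> y \<in> carrier (fib E2 y)" "\<eta> y \<in> carrier (fib E2 y)"
          using push_mem[OF E1 \<zeta> y] field_over.sections0_mem[OF field_over.intro[OF E1] \<xi>(1) yY]
            push_mem[OF E2 \<omega> y] field_over.sections0_mem[OF field_over.intro[OF E2] \<eta>(1) yY] .
        note n = normed_fib[OF E1 y] normed_fib[OF E2 y] normed_fib[OF E3 y]
        have "nrm (fib E3 y) (\<mu> z (\<zeta> y) (\<omega> y) \<ominus>\<^bsub>fib E3 y\<^esub> \<mu> z (\<xi> y) (\<eta> y)) \<le>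
          nrm (fib E1 y) (\<zeta> y \<ominus>\<^bsub>fib E1 y\<^esub> \<xi> y) * nrm (fib E2 y) (\<omega> y) +
          nrm (fib E1 y) (\<xi> y) * nrm (fib E2 y) (\<omega> y \<ominus>\<^bsub>fib E2 y\<^esub> \<eta> y)"
          by (rule bilinear_estimate[OF n lin1[OF z(1), unfolded fz] lin2[OF z(1), unfolded fz] le[OF z(1), unfolded fz] m])
        also have "\<dots> \<le> \<epsilon> / (2 * M) * M + N * (\<epsilon> / (2 * N))"
          using \<xi>(2)[OF y] M N(1) N(2)[OF yY] \<eta>(2)[OF y] y \<epsilon> normed.nrm_ge0[OF n(2) m(3)]
            normed.nrm_ge0[OF n(2) normed.diff_mem[OF n(2) m(3,4)]]
          by (intro add_mono mult_mono) auto
        also have "\<dots> = \<epsilon>"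
          using M(1) N(1) by simp
        finally have "nrm (fib E3 y) (\<mu> z (\<zeta> y) (\<omega> y) \<ominus>\<^bsub>fib E3 y\<^esub> \<mu> z (\<xi> y) (\<eta> y)) \<le> \<epsilon>" .
        then show ?thesis
          using y z by (simp add: \<mu>'[OF w] flip: z_def)
      qed
      ultimately show "\<exists>\<xi>'\<in>sections0 (Q (f w)) (R E3 (f w)). \<forall>y\<in>topspace (Q (f w)).
          nrm (fib (R E3 (f w)) y) (\<mu>' w \<zeta> \<omega> y \<ominus>\<^bsub>fib (R E3 (f w)) y\<^esub> \<xi>' y) \<le> \<epsilon>"
        by (intro bexI[of _ "\<lambda>y\<in>Yf (f w). ?\<theta> (j w y)"])
          (auto simp: push_fibre_simps(1) restricted_field(3)[OF E3] restrict_apply' simp del: restrict_apply)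
    qed
  qed
  have le': "nrm (push_fibre Y E3 (f w)) (\<mu>' w \<zeta> \<omega>) \<le> nrm (push_fibre Y E1 (f w)) \<zeta> * nrm (push_fibre Y E2 (f w)) \<omega>"
    if w: "w \<in> topspace W" and \<zeta>: "\<zeta> \<in> carrier (push_fibre Y E1 (f w))" and \<omega>: "\<omega> \<in> carrier (push_fibre Y E2 (f w))" for w \<zeta> \<omega>
  proof (rule push_nrm_le)
    show "0 \<le> nrm (push_fibre Y E1 (f w)) \<zeta> * nrm (push_fibre Y E2 (f w)) \<omega>"
      using push_nrm_ge0[OF E1 \<zeta>] push_nrm_ge0[OF E2 \<omega>] by simp
    fix y assume y: "y \<in> Yf (f w)"
    have "nrm (fib E3 y) (\<mu>' w \<zeta> \<omega> y) \<le> nrm (fib E1 y) (\<zeta> y) * nrm (fib E2 y) (\<omega> y)"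
      using ptle[OF w y push_mem[OF E1 \<zeta> y] push_mem[OF E2 \<omega> y]] y by (simp add: \<mu>'[OF w])
    also have "\<dots> \<le> nrm (push_fibre Y E1 (f w)) \<zeta> * nrm (push_fibre Y E2 (f w)) \<omega>"
      using push_nrm_ge[OF E1 \<zeta> y] push_nrm_ge[OF E2 \<omega> y] push_nrm_ge0[OF E1 \<zeta>]
        normed.nrm_ge0[OF normed_fib[OF E2 y] push_mem[OF E2 \<omega> y]] by (intro mult_mono)
    finally show "nrm (fib E3 y) (\<mu>' w \<zeta> \<omega> y) \<le> nrm (push_fibre Y E1 (f w)) \<zeta> * nrm (push_fibre Y E2 (f w)) \<omega>" .
  qed
  have lin\<mu>: "linear_map (fib E2 y) (fib E3 y) (\<mu> (j w y) e)"
    if "w \<in> topspace W" "y \<in> Yf (f w)" "e \<in> carrier (fib E1 y)" for w y e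
    using lin1[OF pt(1)[OF that(1,2)], of e] pt[OF that(1,2)] fibF[OF pt(1)[OF that(1,2)]] that(3) by simp
  have lin\<mu>': "linear_map (fib E1 y) (fib E3 y) (\<lambda>e. \<mu> (j w y) e g)"
    if "w \<in> topspace W" "y \<in> Yf (f w)" "g \<in> carrier (fib E2 y)" for w y g
    using lin2[OF pt(1)[OF that(1,2)], of g] pt[OF that(1,2)] fibF[OF pt(1)[OF that(1,2)]] that(3) by simp
  have linear: "linear_map (push_fibre Y E2 (f w)) (push_fibre Y E3 (f w)) (\<mu>' w \<zeta>)"
    if w: "w \<in> topspace W" and \<zeta>: "\<zeta> \<in> carrier (push_fibre Y E1 (f w))" for w \<zeta>
    unfolding linear_map_def
    using carrier[OF w \<zeta>] lin\<mu>[OF w _ push_mem[OF E1 \<zeta>], unfolded linear_map_def] push_mem[OF E2, where x = "f w"]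
    by (auto simp: \<mu>'[OF w] push_fibre_simps(4,5) intro!: restrict_ext)
  have linear': "linear_map (push_fibre Y E1 (f w)) (push_fibre Y E3 (f w)) (\<lambda>\<zeta>. \<mu>' w \<zeta> \<omega>)"
    if w: "w \<in> topspace W" and \<omega>: "\<omega> \<in> carrier (push_fibre Y E2 (f w))" for w \<omega>
    unfolding linear_map_def
    using carrier[OF w _ \<omega>] lin\<mu>'[OF w _ push_mem[OF E2 \<omega>], unfolded linear_map_def] push_mem[OF E1, where x = "f w"]
    by (auto simp: \<mu>'[OF w] push_fibre_simps(4,5) intro!: restrict_ext)
  have "(\<lambda>w\<in>topspace W. \<mu>' w (\<zeta> w) (\<omega> w)) \<in> sec H3" if \<zeta>: "\<zeta> \<in> sec H1" and \<omega>: "\<omega> \<in> sec H2" for \<zeta> \<omega>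
  proof -
    note us = uncurry_section[OF ctx1 \<zeta>] and us' = uncurry_section[OF ctx2 \<omega>]
    note cs = curry_section[OF ctx3 \<mu>sec[OF us(1) us'(1)] vanish[OF us(1) us'(1) us(2) us'(3)]]
    also have "(\<lambda>w\<in>topspace W. \<lambda>y\<in>Yf (f w). (\<lambda>z\<in>topspace Z. \<mu> z ((\<lambda>z\<in>topspace Z. \<zeta> (p z) (q z)) z)
        ((\<lambda>z\<in>topspace Z. \<omega> (p z) (q z)) z)) (j w y)) = (\<lambda>w\<in>topspace W. \<mu>' w (\<zeta> w) (\<omega> w))"
      using pt by (intro restrict_ext) (auto simp: \<mu>' intro!: restrict_ext)
    finally show ?thesis .
  qed
  then show ?thesis
    unfolding contractive_bilinear_field_def using linear linear' le' fibH by auto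
qed

end

section \<open>Transfer of adjointable and compact operators\<close>

lemma L_op_iff:
  "T \<in> L_op X B E F \<longleftrightarrow>
    bounded_linear_field X (lft F) (lft E) (fst T) \<and> bounded_linear_field X (rgt E) (rgt F) (snd T) \<and>
    (\<forall>x\<in>topspace X. \<forall>b\<in>carrier (fib B x).
      (\<forall>\<eta>\<in>carrier (fib (lft F) x). fst T x (lB F x b \<eta>) = lB E x b (fst T x \<eta>)) \<and>
      (\<forall>\<xi>\<in>carrier (fib (rgt E) x). snd T x (rB E x \<xi> b) = rB F x (snd T x \<xi>) b)) \<and>
    (\<forall>x\<in>topspace X. \<forall>\<eta>\<in>carrier (fib (lft F) x). \<forall>\<xi>\<in>carrier (fib (rgt E) x).
      brk E x (fst T x \<eta>) \<xi> = brk F x \<eta> (snd T x \<xi>))"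
  by (cases T) (simp add: L_op_def)

text \<open>One setting for both uses: the identity of the base, for operators over Y, and the range
  map, for operators over the arrows. The algebras over Z and W are constrained only fibrewise,
  because \<open>L_op\<close> and \<open>K_op\<close> see them only through their fibres.\<close>

locale pair_base_change = base_change G Y W f Z p q j
  for G :: "('g, 'x) groupoid" and Y :: "('g, 'x, 'y) gspace"
    and W :: "'w topology" and f :: "'w \<Rightarrow> 'x"
    and Z :: "'z topology" and p :: "'z \<Rightarrow> 'w" and q :: "'z \<Rightarrow> 'y" and j :: "'w \<Rightarrow> 'y \<Rightarrow> 'z" +
  fixes B :: "('y, 'b, 'm1) bfield_scheme" and E :: "('y, 'b, 'l, 'r, 'm2) bpair_scheme"
    and BZ :: "('z, 'b, 'm3) bfield_scheme" and EZ :: "('z, 'b, 'l, 'r, 'm4) bpair_scheme"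
    and BW :: "('w, 'y \<Rightarrow> 'b, 'm5) bfield_scheme" and EW :: "('w, 'y \<Rightarrow> 'b, 'y \<Rightarrow> 'l, 'y \<Rightarrow> 'r, 'm6) bpair_scheme"
  assumes uscB: "usc_field (spc Y) B"
    and uscl: "usc_field (spc Y) (lft E)" and uscr: "usc_field (spc Y) (rgt E)"
    and lZ: "usc_field Z (lft EZ)" "is_pullback Z q (lft E) (lft EZ)"
    and rZ: "usc_field Z (rgt EZ)" "is_pullback Z q (rgt E) (rgt EZ)"
    and lW: "usc_field W (lft EW)" "is_pullback W f (push_field G Y (lft E)) (lft EW)"
    and rW: "usc_field W (rgt EW)" "is_pullback W f (push_field G Y (rgt E)) (rgt EW)"
    and fibBZ: "z \<in> topspace Z \<Longrightarrow> fib BZ z = fib B (q z)"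
    and fibBW: "w \<in> topspace W \<Longrightarrow> fib BW w = push_fibre Y B (f w)"
    and opsZ: "z \<in> topspace Z \<Longrightarrow> brk EZ z = brk E (q z)" "z \<in> topspace Z \<Longrightarrow> lB EZ z = lB E (q z)"
      "z \<in> topspace Z \<Longrightarrow> rB EZ z = rB E (q z)"
    and opsW: "w \<in> topspace W \<Longrightarrow> brk EW w = push_bilinear Y (brk E) (f w)"
      "w \<in> topspace W \<Longrightarrow> lB EW w = push_bilinear Y (lB E) (f w)"
      "w \<in> topspace W \<Longrightarrow> rB EW w = push_bilinear Y (rB E) (f w)"
    and push_ops_mem: "\<And>x \<eta> \<xi>. x \<in> topspace (obj G) \<Longrightarrow> \<eta> \<in> carrier (push_fibre Y (lft E) x) \<Longrightarrow>
        \<xi> \<in> carrier (push_fibre Y (rgt E) x) \<Longrightarrow> push_bilinear Y (brk E) x \<eta> \<xi> \<in> carrier (push_fibre Y B x)"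
      "\<And>x b \<eta>. x \<in> topspace (obj G) \<Longrightarrow> b \<in> carrier (push_fibre Y B x) \<Longrightarrow>
        \<eta> \<in> carrier (push_fibre Y (lft E) x) \<Longrightarrow> push_bilinear Y (lB E) x b \<eta> \<in> carrier (push_fibre Y (lft E) x)"
      "\<And>x \<xi> b. x \<in> topspace (obj G) \<Longrightarrow> \<xi> \<in> carrier (push_fibre Y (rgt E) x) \<Longrightarrow>
        b \<in> carrier (push_fibre Y B x) \<Longrightarrow> push_bilinear Y (rB E) x \<xi> b \<in> carrier (push_fibre Y (rgt E) x)"
begin

text \<open>The operator over W acts as the operator over Z at the points \<open>j w y\<close>. The
  comparison is confined to carriers, since differences of elements of a pushed fibre are pointwise
  only there.\<close>

definition lifts :: "('z, 'l, 'r, 'l, 'r) bop \<Rightarrow> ('w, 'y \<Rightarrow> 'l, 'y \<Rightarrow> 'r, 'y \<Rightarrow> 'l, 'y \<Rightarrow> 'r) bop \<Rightarrow> bool" where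
  "lifts T T' \<longleftrightarrow> (\<forall>w\<in>topspace W.
    (\<forall>\<eta>\<in>carrier (push_fibre Y (lft E) (f w)). fst T' w \<eta> = (\<lambda>y\<in>Yf (f w). fst T (j w y) (\<eta> y))) \<and>
    (\<forall>\<xi>\<in>carrier (push_fibre Y (rgt E) (f w)). snd T' w \<xi> = (\<lambda>y\<in>Yf (f w). snd T (j w y) (\<xi> y))))"

lemma liftsD:
  assumes "lifts T T'" "w \<in> topspace W"
  shows "\<eta> \<in> carrier (push_fibre Y (lft E) (f w)) \<Longrightarrow> fst T' w \<eta> = (\<lambda>y\<in>Yf (f w). fst T (j w y) (\<eta> y))"
    and "\<xi> \<in> carrier (push_fibre Y (rgt E) (f w)) \<Longrightarrow> snd T' w \<xi> = (\<lambda>y\<in>Yf (f w). snd T (j w y) (\<xi> y))"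
  using assms by (simp_all add: lifts_def)

lemmas ctxl = uscl lZ lW and ctxr = uscr rZ rW
lemmas fibs = fib_F[OF ctxl] fib_F[OF ctxr] fib_H[OF ctxl] fib_H[OF ctxr] fibBZ fibBW

lemma pt:
  assumes "w \<in> topspace W" "y \<in> Yf (f w)"
  shows "j w y \<in> topspace Z" "p (j w y) = w" "q (j w y) = y" "y \<in> topspace (spc Y)"
  using j[OF assms] assms(2) by (auto simp: anchor_fibre_iff)

text \<open>Continuity and boundedness come from the transfer of linear fields. Linearity over the
  algebra and adjointness are checked at the points \<open>j w y\<close>, whose fibres are those of
  the original pair at y.\<close>

lemma L_op_transfer:
  assumes T: "T \<in> L_op Z BZ EZ EZ" and T': "lifts T T'"
  shows "T' \<in> L_op W BW EW EW"
  unfolding L_op_iff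
proof (intro conjI ballI)
  note T = T[unfolded L_op_iff]
  note lD = liftsD[OF T']

  show bl: "bounded_linear_field W (lft EW) (lft EW) (fst T')"
    by (rule bounded_linear_transfer[OF base_change_axioms base_change_axioms ctxl ctxl, of "fst T"])
      (use T in \<open>auto simp: lD(1) pt(3) intro!: restrict_ext\<close>)
  show br: "bounded_linear_field W (rgt EW) (rgt EW) (snd T')"
    by (rule bounded_linear_transfer[OF base_change_axioms base_change_axioms ctxr ctxr, of "snd T"])
      (use T in \<open>auto simp: lD(2) pt(3) intro!: restrict_ext\<close>)
  fix w assume w: "w \<in> topspace W"
  note fw = f_mem[OF w]
  show "fst T' w (lB EW w b \<eta>) = lB EW w b (fst T' w \<eta>)"
    if b: "b \<in> carrier (fib BW w)" and \<eta>: "\<eta> \<in> carrier (fib (lft EW) w)" for b \<eta>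
  proof -
    have m: "b \<in> carrier (push_fibre Y B (f w))" "\<eta> \<in> carrier (push_fibre Y (lft E) (f w))"
      using b \<eta> w by (simp_all add: fibs)
    have "fst T (j w y) (lB E y (b y) (\<eta> y)) = lB E y (b y) (fst T (j w y) (\<eta> y))" if y: "y \<in> Yf (f w)" for y
      using T pt[OF w y] push_mem[OF uscB m(1) y] push_mem[OF uscl m(2) y] by (auto simp: fibs opsZ)
    then show ?thesis
      unfolding opsW(2)[OF w] lD(1)[OF w push_ops_mem(2)[OF fw m]] lD(1)[OF w m(2)]
      by (auto simp: push_bilinear_def intro!: restrict_ext)
  qed
  show "snd T' w (rB EW w \<xi> b) = rB EW w (snd T' w \<xi>) b"
    if b: "b \<in> carrier (fib BW w)" and \<xi>: "\<xi> \<in> carrier (fib (rgt EW) w)" for b \<xi>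
  proof -
    have m: "\<xi> \<in> carrier (push_fibre Y (rgt E) (f w))" "b \<in> carrier (push_fibre Y B (f w))"
      using b \<xi> w by (simp_all add: fibs)
    have "snd T (j w y) (rB E y (\<xi> y) (b y)) = rB E y (snd T (j w y) (\<xi> y)) (b y)" if y: "y \<in> Yf (f w)" for y
      using T pt[OF w y] push_mem[OF uscB m(2) y] push_mem[OF uscr m(1) y] by (auto simp: fibs opsZ)
    then show ?thesis
      unfolding opsW(3)[OF w] lD(2)[OF w push_ops_mem(3)[OF fw m]] lD(2)[OF w m(1)]
      by (auto simp: push_bilinear_def intro!: restrict_ext)
  qed
  show "brk EW w (fst T' w \<eta>) \<xi> = brk EW w \<eta> (snd T' w \<xi>)"
    if \<eta>: "\<eta> \<in> carrier (fib (lft EW) w)" and \<xi>: "\<xi> \<in> carrier (fib (rgt EW) w)" for \<eta> \<xi>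
  proof -
    have m: "\<eta> \<in> carrier (push_fibre Y (lft E) (f w))" "\<xi> \<in> carrier (push_fibre Y (rgt E) (f w))"
      using \<eta> \<xi> w by (simp_all add: fibs)
    have "brk E y (fst T (j w y) (\<eta> y)) (\<xi> y) = brk E y (\<eta> y) (snd T (j w y) (\<xi> y))" if y: "y \<in> Yf (f w)" for y
      using T pt[OF w y] push_mem[OF uscl m(1) y] push_mem[OF uscr m(2) y] by (auto simp: fibs opsZ)
    then show ?thesis
      unfolding opsW(1)[OF w] lD(1)[OF w m(1)] lD(2)[OF w m(2)]
      by (auto simp: push_bilinear_def intro!: restrict_ext)
  qed
qed

text \<open>Currying takes sections vanishing at infinity over Z to such sections over W, and the
  rank one operator of the curried sections acts pointwise as the original one. Sums and scalars
  follow by induction.\<close>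

lemma finite_rank_lift:
  assumes "S \<in> finite_rank Z EZ EZ"
  obtains S' where "S' \<in> finite_rank W EW EW" "lifts S S'"
    "\<And>w \<eta>. w \<in> topspace W \<Longrightarrow> \<eta> \<in> carrier (push_fibre Y (lft E) (f w)) \<Longrightarrow> fst S' w \<eta> \<in> carrier (push_fibre Y (lft E) (f w))"
    "\<And>w \<xi>. w \<in> topspace W \<Longrightarrow> \<xi> \<in> carrier (push_fibre Y (rgt E) (f w)) \<Longrightarrow> snd S' w \<xi> \<in> carrier (push_fibre Y (rgt E) (f w))"
proof -
  \<comment> \<open>Preservation of carriers is part of the invariant: without it the difference to
    the lifted operator could not be evaluated pointwise.\<close>
  define good where "good S S' \<longleftrightarrow> S' \<in> finite_rank W EW EW \<and> lifts S S' \<and>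
    (\<forall>w\<in>topspace W. (\<forall>\<eta>\<in>carrier (push_fibre Y (lft E) (f w)). fst S' w \<eta> \<in> carrier (push_fibre Y (lft E) (f w))) \<and>
      (\<forall>\<xi>\<in>carrier (push_fibre Y (rgt E) (f w)). snd S' w \<xi> \<in> carrier (push_fibre Y (rgt E) (f w))))" for S S'
  have pl: "abelian_monoid (push_fibre Y (lft E) x)" and pr: "abelian_monoid (push_fibre Y (rgt E) x)" for x
    using normed.module[OF normed_push[OF uscl]] normed.module[OF normed_push[OF uscr]]
    by (auto simp: module_def intro: abelian_group.axioms(1))
  from assms have "\<exists>S'. good S S'"
  proof induction
    case zero
    have "good (op_zero EZ EZ) (op_zero EW EW)"
      unfolding good_def lifts_def
      using finite_rank.zero[of EW EW W] pt
      by (auto simp: op_zero_def fibs push_fibre_simps(3) q_mem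
          abelian_monoid.zero_closed[OF pl, unfolded push_fibre_simps(3)]
          abelian_monoid.zero_closed[OF pr, unfolded push_fibre_simps(3)] intro!: restrict_ext)
    then show ?case
      by blast
  next
    case (add S \<eta> \<xi> c)
    then obtain S' where S': "good S S'"
      by blast
    let ?\<eta> = "\<lambda>w\<in>topspace W. \<lambda>y\<in>Yf (f w). \<eta> (j w y)" and ?\<xi> = "\<lambda>w\<in>topspace W. \<lambda>y\<in>Yf (f w). \<xi> (j w y)"
    let ?S = "op_add EZ EZ S (op_smult EZ EZ c (rank_one EZ EZ \<eta> \<xi>))"
    let ?S' = "op_add EW EW S' (op_smult EW EW c (rank_one EW EW ?\<eta> ?\<xi>))"
    have \<eta>0: "?\<eta> \<in> sections0 W (rgt EW)" and \<xi>0: "?\<xi> \<in> sections0 W (lft EW)"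
      using curry_section0[OF ctxr add.hyps(2)] curry_section0[OF ctxl add.hyps(3)] .
    have M: "?\<eta> w \<in> carrier (push_fibre Y (rgt E) (f w))" "?\<xi> w \<in> carrier (push_fibre Y (lft E) (f w))" if "w \<in> topspace W" for w
      using H_mem[OF ctxr field_over.sections0_sec[OF field_over.intro[OF rW(1)] \<eta>0] that]
        H_mem[OF ctxl field_over.sections0_sec[OF field_over.intro[OF lW(1)] \<xi>0] that] .
    have "good ?S ?S'"
      unfolding good_def
    proof (intro conjI ballI)
      show "?S' \<in> finite_rank W EW EW"
        using S' \<eta>0 \<xi>0 by (intro finite_rank.add) (auto simp: good_def)
      show "lifts ?S ?S'"
        using S' pt unfolding lifts_def good_def
        by (auto simp: op_add_def op_smult_def rank_one_def fibs opsZ opsW push_bilinear_def push_fibre_simps(4,5)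
            intro!: restrict_ext)
    next
      fix w \<zeta> assume w: "w \<in> topspace W" and \<zeta>: "\<zeta> \<in> carrier (push_fibre Y (lft E) (f w))"
      have "push_bilinear Y (lB E) (f w) (push_bilinear Y (brk E) (f w) \<zeta> (?\<eta> w)) (?\<xi> w) \<in> carrier (push_fibre Y (lft E) (f w))"
        using M[OF w] \<zeta> f_mem[OF w] by (intro push_ops_mem)
      then show "fst ?S' w \<zeta> \<in> carrier (push_fibre Y (lft E) (f w))"
        using S' w \<zeta> abelian_monoid.a_closed[OF pl] normed.smult_mem[OF normed_push[OF uscl]]
        by (auto simp: good_def op_add_def op_smult_def rank_one_def fibs opsW simp del: restrict_apply)
    next
      fix w \<zeta> assume w: "w \<in> topspace W" and \<zeta>: "\<zeta> \<in> carrier (push_fibre Y (rgt E) (f w))"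
      have "push_bilinear Y (rB E) (f w) (?\<eta> w) (push_bilinear Y (brk E) (f w) (?\<xi> w) \<zeta>) \<in> carrier (push_fibre Y (rgt E) (f w))"
        using M[OF w] \<zeta> f_mem[OF w] by (intro push_ops_mem)
      then show "snd ?S' w \<zeta> \<in> carrier (push_fibre Y (rgt E) (f w))"
        using S' w \<zeta> abelian_monoid.a_closed[OF pr] normed.smult_mem[OF normed_push[OF uscr]]
        by (auto simp: good_def op_add_def op_smult_def rank_one_def fibs opsW simp del: restrict_apply)
    qed
    then show ?case
      by blast
  qed
  then obtain S' where S': "good S S'"
    by blast
  show ?thesis
    by (rule that[of S']) (use S' in \<open>auto simp: good_def\<close>)
qed

text \<open>The same \<epsilon> survives, because a norm in a pushed fibre is the supremum of the
  norms at its points.\<close>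

lemma norm_le_lift:
  assumes n: "norm_le Z FZ FZ (\<lambda>z e. t z e \<ominus>\<^bsub>fib FZ z\<^esub> s z e) \<epsilon>" and \<epsilon>: "\<epsilon> > 0"
    and F: "usc_field (spc Y) F"
    and fZ: "\<And>z. z \<in> topspace Z \<Longrightarrow> fib FZ z = fib F (q z)"
    and fW: "\<And>w. w \<in> topspace W \<Longrightarrow> fib FW w = push_fibre Y F (f w)"
    and mem: "\<And>w e. w \<in> topspace W \<Longrightarrow> e \<in> carrier (push_fibre Y F (f w)) \<Longrightarrow> t' w e \<in> carrier (push_fibre Y F (f w))"
      "\<And>w e. w \<in> topspace W \<Longrightarrow> e \<in> carrier (push_fibre Y F (f w)) \<Longrightarrow> s' w e \<in> carrier (push_fibre Y F (f w))"
    and lift: "\<And>w e. w \<in> topspace W \<Longrightarrow> e \<in> carrier (push_fibre Y F (f w)) \<Longrightarrow> t' w e = (\<lambda>y\<in>Yf (f w). t (j w y) (e y))"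
      "\<And>w e. w \<in> topspace W \<Longrightarrow> e \<in> carrier (push_fibre Y F (f w)) \<Longrightarrow> s' w e = (\<lambda>y\<in>Yf (f w). s (j w y) (e y))"
  shows "norm_le W FW FW (\<lambda>w e. t' w e \<ominus>\<^bsub>fib FW w\<^esub> s' w e) \<epsilon>"
  unfolding norm_le_def
proof (intro ballI)
  fix w e assume w: "w \<in> topspace W" and "e \<in> carrier (fib FW w)"
  then have e: "e \<in> carrier (push_fibre Y F (f w))"
    by (simp add: fW)
  have "nrm (push_fibre Y F (f w)) (t' w e \<ominus>\<^bsub>push_fibre Y F (f w)\<^esub> s' w e) \<le> \<epsilon> * nrm (push_fibre Y F (f w)) e"
  proof (subst push_nrm_diff_le_iff[OF F mem[OF w e]], intro mult_nonneg_nonneg)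
    show "\<forall>y\<in>Yf (f w). nrm (fib F y) (t' w e y \<ominus>\<^bsub>fib F y\<^esub> s' w e y) \<le> \<epsilon> * nrm (push_fibre Y F (f w)) e"
    proof
      fix y assume y: "y \<in> Yf (f w)"
      have "nrm (fib F y) (t' w e y \<ominus>\<^bsub>fib F y\<^esub> s' w e y) \<le> \<epsilon> * nrm (fib F y) (e y)"
        using n pt[OF w y] push_mem[OF F e y] y by (auto simp: norm_le_def fZ lift[OF w e])
      also have "\<dots> \<le> \<epsilon> * nrm (push_fibre Y F (f w)) e"
        using push_nrm_ge[OF F e y] \<epsilon> by (intro mult_left_mono) auto
      finally show "nrm (fib F y) (t' w e y \<ominus>\<^bsub>fib F y\<^esub> s' w e y) \<le> \<epsilon> * nrm (push_fibre Y F (f w)) e" .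
    qed
  qed (use \<epsilon> push_nrm_ge0[OF F e] in auto)
  then show "nrm (fib FW w) (t' w e \<ominus>\<^bsub>fib FW w\<^esub> s' w e) \<le> \<epsilon> * nrm (fib FW w) e"
    by (simp add: fW w)
qed

text \<open>A finite rank approximant over Z lifts to one over W with the same error, so compactness
  passes to any operator related by \<open>lifts\<close>.\<close>

lemma K_op_transfer:
  assumes T: "T \<in> K_op Z BZ EZ EZ" and T': "lifts T T'"
  shows "T' \<in> K_op W BW EW EW"
  unfolding K_op_def
proof (intro CollectI conjI allI impI)
  show L: "T' \<in> L_op W BW EW EW"
    using T T' by (auto simp: K_op_def intro: L_op_transfer)
  have lin: "linear_map (fib (lft EW) w) (fib (lft EW) w) (fst T' w)" "linear_map (fib (rgt EW) w) (fib (rgt EW) w) (snd T' w)"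
    if "w \<in> topspace W" for w
    using L that by (simp_all add: L_op_iff bounded_linear_field_def linear_field_def bounded_linear_map_def)
  have L_mem: "\<eta> \<in> carrier (push_fibre Y (lft E) (f w)) \<Longrightarrow> fst T' w \<eta> \<in> carrier (push_fibre Y (lft E) (f w))"
    "\<xi> \<in> carrier (push_fibre Y (rgt E) (f w)) \<Longrightarrow> snd T' w \<xi> \<in> carrier (push_fibre Y (rgt E) (f w))"
    if w: "w \<in> topspace W" for w \<eta> \<xi>
    using linear_map_mem[OF lin(1)[OF w]] linear_map_mem[OF lin(2)[OF w]] w by (simp_all add: fibs)
  fix \<epsilon> :: real assume \<epsilon>: "\<epsilon> > 0"
  obtain S where S: "S \<in> finite_rank Z EZ EZ" "norm_le Z (lft EZ) (lft EZ) (fst (op_diff EZ EZ T S)) \<epsilon>"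
    "norm_le Z (rgt EZ) (rgt EZ) (snd (op_diff EZ EZ T S)) \<epsilon>"
    using T \<epsilon> by (auto simp: K_op_def)
  obtain S' where S': "S' \<in> finite_rank W EW EW" "lifts S S'"
    "\<And>w \<eta>. w \<in> topspace W \<Longrightarrow> \<eta> \<in> carrier (push_fibre Y (lft E) (f w)) \<Longrightarrow> fst S' w \<eta> \<in> carrier (push_fibre Y (lft E) (f w))"
    "\<And>w \<xi>. w \<in> topspace W \<Longrightarrow> \<xi> \<in> carrier (push_fibre Y (rgt E) (f w)) \<Longrightarrow> snd S' w \<xi> \<in> carrier (push_fibre Y (rgt E) (f w))"
    using finite_rank_lift[OF S(1)] by metis
  have "norm_le W (lft EW) (lft EW) (fst (op_diff EW EW T' S')) \<epsilon>"
    unfolding op_diff_def fst_conv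
    by (rule norm_le_lift[OF S(2)[unfolded op_diff_def fst_conv] \<epsilon> uscl fibs(1,3) L_mem(1) S'(3)
        liftsD(1)[OF T'] liftsD(1)[OF S'(2)]])
  moreover have "norm_le W (rgt EW) (rgt EW) (snd (op_diff EW EW T' S')) \<epsilon>"
    unfolding op_diff_def snd_conv
    by (rule norm_le_lift[OF S(3)[unfolded op_diff_def snd_conv] \<epsilon> uscr fibs(2,4) L_mem(2) S'(4)
        liftsD(2)[OF T'] liftsD(2)[OF S'(2)]])
  ultimately show "\<exists>S\<in>finite_rank W EW EW. norm_le W (lft EW) (lft EW) (fst (op_diff EW EW T' S)) \<epsilon> \<and>
      norm_le W (rgt EW) (rgt EW) (snd (op_diff EW EW T' S)) \<epsilon>"
    using S'(1) by blast
qed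

end

section \<open>The transformation groupoid\<close>

context gspace_over
begin

abbreviation "TG \<equiv> transformation_groupoid G Y"

section \<open>Groupoid identities and the action on Y\<close>

lemma rng_mem: "\<gamma> \<in> topspace (arr G) \<Longrightarrow> rng G \<gamma> \<in> topspace (obj G)"
  and src_mem: "\<gamma> \<in> topspace (arr G) \<Longrightarrow> src G \<gamma> \<in> topspace (obj G)"
  and ginv_mem: "\<gamma> \<in> topspace (arr G) \<Longrightarrow> ginv G \<gamma> \<in> topspace (arr G)"
  and unt_mem: "x \<in> topspace (obj G) \<Longrightarrow> unt G x \<in> topspace (arr G)"
  using G by (simp_all add: lch_groupoid_def continuous_map_def Pi_iff)

lemma rng_ginv: "\<gamma> \<in> topspace (arr G) \<Longrightarrow> rng G (ginv G \<gamma>) = src G \<gamma>"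
  and src_ginv: "\<gamma> \<in> topspace (arr G) \<Longrightarrow> src G (ginv G \<gamma>) = rng G \<gamma>"
  and gmult_ginv: "\<gamma> \<in> topspace (arr G) \<Longrightarrow> gmult G \<gamma> (ginv G \<gamma>) = unt G (rng G \<gamma>)"
  and ginv_gmult: "\<gamma> \<in> topspace (arr G) \<Longrightarrow> gmult G (ginv G \<gamma>) \<gamma> = unt G (src G \<gamma>)"
  and unt_gmult: "\<gamma> \<in> topspace (arr G) \<Longrightarrow> gmult G (unt G (rng G \<gamma>)) \<gamma> = \<gamma>"
  and gmult_unt: "\<gamma> \<in> topspace (arr G) \<Longrightarrow> gmult G \<gamma> (unt G (src G \<gamma>)) = \<gamma>"
  using G by (simp_all add: lch_groupoid_def)

lemma rng_unt: "x \<in> topspace (obj G) \<Longrightarrow> rng G (unt G x) = x"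
  and src_unt: "x \<in> topspace (obj G) \<Longrightarrow> src G (unt G x) = x"
  using G by (simp_all add: lch_groupoid_def)

lemma composable_iff:
  "(\<gamma>, \<gamma>') \<in> composable G \<longleftrightarrow> \<gamma> \<in> topspace (arr G) \<and> \<gamma>' \<in> topspace (arr G) \<and> src G \<gamma> = rng G \<gamma>'"
  by (auto simp: composable_def)

lemma gmult_assoc:
  "(\<gamma>, \<gamma>') \<in> composable G \<Longrightarrow> (\<gamma>', \<gamma>'') \<in> composable G \<Longrightarrow>
    gmult G (gmult G \<gamma> \<gamma>') \<gamma>'' = gmult G \<gamma> (gmult G \<gamma>' \<gamma>'')"
  using G by (simp add: lch_groupoid_def)

lemma rng_gmult: "(\<gamma>, \<gamma>') \<in> composable G \<Longrightarrow> rng G (gmult G \<gamma> \<gamma>') = rng G \<gamma>"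
  and src_gmult: "(\<gamma>, \<gamma>') \<in> composable G \<Longrightarrow> src G (gmult G \<gamma> \<gamma>') = src G \<gamma>'"
  using G by (auto simp: lch_groupoid_def)

lemma gmult_mem:
  assumes "(\<gamma>, \<gamma>') \<in> composable G"
  shows "gmult G \<gamma> \<gamma>' \<in> topspace (arr G)"
proof -
  have "continuous_map (subtopology (prod_topology (arr G) (arr G)) (composable G)) (arr G) (\<lambda>(\<gamma>, \<gamma>'). gmult G \<gamma> \<gamma>')"
    using G by (simp add: lch_groupoid_def)
  moreover have "(\<gamma>, \<gamma>') \<in> topspace (subtopology (prod_topology (arr G) (arr G)) (composable G))"
    using assms by (simp add: composable_iff)
  ultimately show ?thesis
    using funcset_mem[OF continuous_map_funspace] by fastforce
qed

lemma ginv_ginv: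
  assumes "\<gamma> \<in> topspace (arr G)"
  shows "ginv G (ginv G \<gamma>) = \<gamma>"
proof -
  note m = assms ginv_mem[OF assms] ginv_mem[OF ginv_mem[OF assms]]
  have "ginv G (ginv G \<gamma>) = gmult G (ginv G (ginv G \<gamma>)) (gmult G (ginv G \<gamma>) \<gamma>)"
    using gmult_unt[OF m(3)] by (simp add: m ginv_gmult src_ginv rng_ginv)
  also have "\<dots> = gmult G (gmult G (ginv G (ginv G \<gamma>)) (ginv G \<gamma>)) \<gamma>"
    by (rule gmult_assoc[symmetric]) (simp_all add: composable_iff m src_ginv)
  also have "\<dots> = \<gamma>"
    by (simp add: ginv_gmult m src_ginv unt_gmult)
  finally show ?thesis .
qed

lemma ginv_unt:
  assumes "x \<in> topspace (obj G)"
  shows "ginv G (unt G x) = unt G x"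
  using gmult_ginv[OF unt_mem[OF assms]] unt_gmult[OF ginv_mem[OF unt_mem[OF assms]]] assms
  by (simp add: rng_unt rng_ginv unt_mem src_unt)

lemma act_continuous:
  "continuous_map (subtopology (prod_topology (arr G) (spc Y)) {(\<gamma>, y). src G \<gamma> = anchor Y y}) (spc Y)
    (\<lambda>(\<gamma>, y). act Y \<gamma> y)"
  using Y by (simp add: lch_gspace_def)

lemma act_mem:
  assumes "\<gamma> \<in> topspace (arr G)" "y \<in> Yf (src G \<gamma>)"
  shows "act Y \<gamma> y \<in> Yf (rng G \<gamma>)"
proof -
  have "act Y \<gamma> y \<in> topspace (spc Y)"
  proof -
    have "(\<gamma>, y) \<in> topspace (subtopology (prod_topology (arr G) (spc Y)) {(\<gamma>, y). src G \<gamma> = anchor Y y})"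
      using assms by (simp add: anchor_fibre_iff)
    then show ?thesis
      using funcset_mem[OF continuous_map_funspace[OF act_continuous]] by fastforce
  qed
  then show ?thesis
    using Y assms by (simp add: lch_gspace_def anchor_fibre_iff)
qed

lemma act_unt: "y \<in> topspace (spc Y) \<Longrightarrow> act Y (unt G (anchor Y y)) y = y"
  using Y by (simp add: lch_gspace_def)

lemma act_gmult:
  "(\<gamma>, \<gamma>') \<in> composable G \<Longrightarrow> y \<in> Yf (src G \<gamma>') \<Longrightarrow> act Y (gmult G \<gamma> \<gamma>') y = act Y \<gamma> (act Y \<gamma>' y)"
  using Y by (auto simp: lch_gspace_def anchor_fibre_iff)

lemma act_ginv_mem:
  assumes "\<gamma> \<in> topspace (arr G)" "y \<in> Yf (rng G \<gamma>)"
  shows "act Y (ginv G \<gamma>) y \<in> Yf (src G \<gamma>)"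
  using act_mem[OF ginv_mem[OF assms(1)]] assms by (simp add: src_ginv rng_ginv)

lemma act_act_ginv:
  assumes "\<gamma> \<in> topspace (arr G)" "y \<in> Yf (rng G \<gamma>)"
  shows "act Y \<gamma> (act Y (ginv G \<gamma>) y) = y"
  using act_gmult[of \<gamma> "ginv G \<gamma>" y] assms act_unt[of y]
  by (auto simp: composable_iff ginv_mem src_ginv rng_ginv gmult_ginv anchor_fibre_iff)

lemma act_ginv_act:
  assumes "\<gamma> \<in> topspace (arr G)" "y \<in> Yf (src G \<gamma>)"
  shows "act Y (ginv G \<gamma>) (act Y \<gamma> y) = y"
  using act_gmult[of "ginv G \<gamma>" \<gamma> y] assms act_unt[of y]
  by (auto simp: composable_iff ginv_mem src_ginv rng_ginv ginv_gmult anchor_fibre_iff)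

text \<open>The inverse of a product is bypassed: \<gamma>\<gamma>' sends the right-hand side to y,
  and applying the inverse action of \<gamma>\<gamma>' to this identity gives the claim.\<close>

lemma act_ginv_gmult:
  assumes c: "(\<gamma>, \<gamma>') \<in> composable G" and y: "y \<in> Yf (rng G \<gamma>)"
  shows "act Y (ginv G (gmult G \<gamma> \<gamma>')) y = act Y (ginv G \<gamma>') (act Y (ginv G \<gamma>) y)" (is "_ = ?y'")
proof -
  have m: "\<gamma> \<in> topspace (arr G)" "\<gamma>' \<in> topspace (arr G)" "src G \<gamma> = rng G \<gamma>'"
    using c by (auto simp: composable_iff)
  have y': "?y' \<in> Yf (src G \<gamma>')"
    using act_ginv_mem[OF m(1) y] act_ginv_mem[OF m(2)] m(3) by simp
  have "act Y (gmult G \<gamma> \<gamma>') ?y' = y"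
    using act_gmult[OF c y'] act_act_ginv[OF m(2)] act_ginv_mem[OF m(1) y] act_act_ginv[OF m(1) y] m(3) by simp
  then show ?thesis
    using act_ginv_act[OF gmult_mem[OF c], of ?y'] y' by (simp add: src_gmult[OF c])
qed

lemma TG_simps [simp]:
  "obj TG = spc Y" "rng TG (\<gamma>, y) = y" "src TG (\<gamma>, y) = act Y (ginv G \<gamma>) y"
  "gmult TG (\<gamma>, y) (\<gamma>', y') = (gmult G \<gamma> \<gamma>', y)" "ginv TG (\<gamma>, y) = (ginv G \<gamma>, act Y (ginv G \<gamma>) y)"
  by (simp_all add: transformation_groupoid_def)

lemma arr_TG: "arr TG = subtopology (prod_topology (arr G) (spc Y)) {(\<gamma>, y). rng G \<gamma> = anchor Y y}"
  by (simp add: transformation_groupoid_def)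

lemma TG_mem [simp]: "(\<gamma>, y) \<in> topspace (arr TG) \<longleftrightarrow> \<gamma> \<in> topspace (arr G) \<and> y \<in> Yf (rng G \<gamma>)"
  by (auto simp: arr_TG anchor_fibre_iff)

lemma composable_TG:
  "((\<gamma>, y), (\<gamma>', y')) \<in> composable TG \<longleftrightarrow>
    \<gamma> \<in> topspace (arr G) \<and> y \<in> Yf (rng G \<gamma>) \<and> \<gamma>' \<in> topspace (arr G) \<and> y' \<in> Yf (rng G \<gamma>') \<and>
    act Y (ginv G \<gamma>) y = y'"
  by (auto simp: composable_def)

section \<open>The fibre products for the identity, range and source\<close>

lemma lc_arr: "locally_compact_space (arr G)" and haus_arr: "Hausdorff_space (arr G)"
  and cont_rng: "continuous_map (arr G) (obj G) (rng G)" and cont_src: "continuous_map (arr G) (obj G) (src G)"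
  and cont_ginv: "continuous_map (arr G) (arr G) (ginv G)"
  using G by (simp_all add: lch_groupoid_def)

text \<open>Y is the fibre product of the unit space with Y. Properness holds because the preimage
  of a compact, hence closed, set meets a compact set in a compact set.\<close>

lemma base_change_id: "base_change G Y (obj G) id (spc Y) (anchor Y) id (\<lambda>x y. y)"
proof
  fix L K assume "compactin (obj G) L" and K: "compactin (spc Y) K"
  then have "closedin (spc Y) {y \<in> topspace (spc Y). anchor Y y \<in> L}"
    using closedin_continuous_map_preimage[OF anchor] compactin_imp_closedin[OF hausX] by blast
  then have "compactin (spc Y) ({y \<in> topspace (spc Y). anchor Y y \<in> L} \<inter> K)"
    using K by (rule closed_Int_compactin)
  moreover have "{y \<in> topspace (spc Y). anchor Y y \<in> L} \<inter> K = {y \<in> topspace (spc Y). anchor Y y \<in> L \<and> id y \<in> K}"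
    by auto
  ultimately show "compactin (spc Y) {y \<in> topspace (spc Y). anchor Y y \<in> L \<and> id y \<in> K}"
    by simp
qed (auto simp: hausX lcX anchor anchor_fibre_iff continuous_map_from_subtopology)

lemma cont_fst: "continuous_map (arr TG) (arr G) fst" and cont_snd: "continuous_map (arr TG) (spc Y) snd"
  unfolding arr_TG by (simp_all add: continuous_map_from_subtopology continuous_map_fst continuous_map_snd)

lemma cont_rng_TG: "continuous_map (arr TG) (obj TG) (rng TG)"
proof -
  have "rng TG = snd"
    by (auto simp: transformation_groupoid_def)
  then show ?thesis
    using cont_snd by simp
qed

lemma cont_src_TG: "continuous_map (arr TG) (obj TG) (src TG)"
proof -
  let ?h = "\<lambda>z. (ginv G (fst z), snd z)"
  have "continuous_map (arr TG) (prod_topology (arr G) (spc Y)) ?h"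
    using continuous_map_compose[OF cont_fst cont_ginv] cont_snd
    by (intro continuous_map_pairedI) (simp_all add: o_def)
  then have "continuous_map (arr TG) (subtopology (prod_topology (arr G) (spc Y)) {(\<gamma>, y). src G \<gamma> = anchor Y y}) ?h"
    by (rule continuous_map_into_subtopology) (auto simp: src_ginv anchor_fibre_iff)
  from continuous_map_compose[OF this act_continuous] have "continuous_map (arr TG) (spc Y) (\<lambda>z. act Y (ginv G (fst z)) (snd z))"
    by (simp add: o_def)
  moreover have "src TG = (\<lambda>z. act Y (ginv G (fst z)) (snd z))"
    by (auto simp: transformation_groupoid_def)
  ultimately show ?thesis
    by simp
qed

text \<open>The arrows (\<gamma>,y) of the transformation groupoid are by definition the pairs with
  r(\<gamma>) equal to the anchor of y. This condition is closed in the product, as the unit space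
  is Hausdorff, so it cuts a compact set out of \<open>L \<times> K\<close>.\<close>

lemma base_change_rng: "base_change G Y (arr G) (rng G) (arr TG) fst (rng TG) (\<lambda>\<gamma> y. (\<gamma>, y))"
proof
  show "continuous_map (arr TG) (spc Y) (rng TG)"
    using cont_rng_TG by simp
  show "continuous_map (Q (rng G \<gamma>)) (arr TG) (\<lambda>y. (\<gamma>, y))" if "\<gamma> \<in> topspace (arr G)" for \<gamma>
    unfolding arr_TG using that incl[of "rng G \<gamma>"]
    by (intro continuous_map_into_subtopology continuous_map_pairedI) (auto simp: anchor_fibre_iff id_def)
  fix L K assume LK: "compactin (arr G) L" "compactin (spc Y) K"
  let ?P = "prod_topology (arr G) (spc Y)"
  have "closedin ?P {z \<in> topspace ?P. rng G (fst z) = anchor Y (snd z)}"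
    using continuous_map_compose[OF continuous_map_fst cont_rng] continuous_map_compose[OF continuous_map_snd anchor]
    by (intro closedin_continuous_maps_eq[OF hausX]) (simp_all add: o_def)
  then have "compactin ?P ({z \<in> topspace ?P. rng G (fst z) = anchor Y (snd z)} \<inter> L \<times> K)"
    using LK by (intro closed_Int_compactin) (auto simp: compactin_Times)
  moreover have "{z \<in> topspace ?P. rng G (fst z) = anchor Y (snd z)} \<inter> L \<times> K
    = {z \<in> topspace (arr TG). fst z \<in> L \<and> rng TG z \<in> K}"
    by (auto simp: anchor_fibre_iff)
  moreover have "\<dots> \<subseteq> {(\<gamma>, y). rng G \<gamma> = anchor Y y}"
    by (auto simp: anchor_fibre_iff)
  ultimately show "compactin (arr TG) {z \<in> topspace (arr TG). fst z \<in> L \<and> rng TG z \<in> K}"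
    by (subst (1) arr_TG) (simp add: compactin_subtopology)
qed (auto simp: haus_arr lc_arr cont_rng cont_fst anchor_fibre_iff)

text \<open>The fibre product along the source consists of the pairs with s(\<gamma>) equal to the
  anchor of y, and (\<gamma>,y) \<mapsto> (\<gamma>,\<gamma>y) identifies it with the arrows of the
  transformation groupoid. Properness is established for the pairs and transported along this
  continuous map.\<close>

lemma base_change_src: "base_change G Y (arr G) (src G) (arr TG) fst (src TG) (\<lambda>\<gamma> y. (\<gamma>, act Y \<gamma> y))"
proof
  let ?P = "prod_topology (arr G) (spc Y)"
  let ?S = "{(\<gamma>, y). src G \<gamma> = anchor Y y}"
  let ?h = "\<lambda>z. (fst z, act Y (fst z) (snd z))"
  have "continuous_map (subtopology ?P ?S) ?P ?h"
    using act_continuous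
    by (intro continuous_map_pairedI) (simp_all add: continuous_map_from_subtopology continuous_map_fst case_prod_unfold)
  then have h: "continuous_map (subtopology ?P ?S) (arr TG) ?h"
    unfolding arr_TG
  proof (rule continuous_map_into_subtopology)
    show "?h \<in> topspace (subtopology ?P ?S) \<rightarrow> {(\<gamma>, y). rng G \<gamma> = anchor Y y}"
      using act_mem by (auto simp: anchor_fibre_iff)
  qed
  show "continuous_map (arr TG) (spc Y) (src TG)"
    using cont_src_TG by simp
  show "continuous_map (Q (src G \<gamma>)) (arr TG) (\<lambda>y. (\<gamma>, act Y \<gamma> y))" if \<gamma>: "\<gamma> \<in> topspace (arr G)" for \<gamma>
  proof -
    have "continuous_map (Q (src G \<gamma>)) (subtopology ?P ?S) (\<lambda>y. (\<gamma>, y))"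
      using \<gamma> incl[of "src G \<gamma>"]
      by (intro continuous_map_into_subtopology continuous_map_pairedI) (auto simp: anchor_fibre_iff id_def)
    from continuous_map_compose[OF this h] show ?thesis
      by (simp add: o_def)
  qed
  fix L K assume LK: "compactin (arr G) L" "compactin (spc Y) K"
  have "closedin ?P {z \<in> topspace ?P. src G (fst z) = anchor Y (snd z)}"
    using continuous_map_compose[OF continuous_map_fst cont_src] continuous_map_compose[OF continuous_map_snd anchor]
    by (intro closedin_continuous_maps_eq[OF hausX]) (simp_all add: o_def)
  then have "compactin ?P ({z \<in> topspace ?P. src G (fst z) = anchor Y (snd z)} \<inter> L \<times> K)" (is "compactin _ ?C")
    using LK by (intro closed_Int_compactin) (auto simp: compactin_Times)
  then have "compactin (subtopology ?P ?S) ?C"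
    by (auto simp: compactin_subtopology)
  then have "compactin (arr TG) (?h ` ?C)"
    by (rule image_compactin[OF _ h])
  moreover have "?h ` ?C = {z \<in> topspace (arr TG). fst z \<in> L \<and> src TG z \<in> K}"
  proof (intro equalityI subsetI)
    fix z assume "z \<in> ?h ` ?C"
    then obtain \<gamma> y where "\<gamma> \<in> topspace (arr G)" "y \<in> Yf (src G \<gamma>)" "\<gamma> \<in> L" "y \<in> K" "z = (\<gamma>, act Y \<gamma> y)"
      by (auto simp: anchor_fibre_iff)
    then show "z \<in> {z \<in> topspace (arr TG). fst z \<in> L \<and> src TG z \<in> K}"
      by (simp add: act_mem act_ginv_act)
  next
    fix z assume z: "z \<in> {z \<in> topspace (arr TG). fst z \<in> L \<and> src TG z \<in> K}"
    obtain \<gamma> y where zz: "z = (\<gamma>, y)"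
      by (cases z)
    then have *: "\<gamma> \<in> topspace (arr G)" "y \<in> Yf (rng G \<gamma>)" "\<gamma> \<in> L" "act Y (ginv G \<gamma>) y \<in> K"
      using z by auto
    show "z \<in> ?h ` ?C"
      using * act_ginv_mem[OF *(1,2)] act_act_ginv[OF *(1,2)]
      by (intro image_eqI[of _ _ "(\<gamma>, act Y (ginv G \<gamma>) y)"]) (auto simp: zz anchor_fibre_iff)
  qed
  ultimately show "compactin (arr TG) {z \<in> topspace (arr TG). fst z \<in> L \<and> src TG z \<in> K}"
    by simp
next
  fix z assume "z \<in> topspace (arr TG)"
  then show "anchor Y (src TG z) = src G (fst z)" "(fst z, act Y (fst z) (src TG z)) = z"
    using act_ginv_mem act_act_ginv by (cases z; auto simp: anchor_fibre_iff)+
next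
  fix \<gamma> y assume "\<gamma> \<in> topspace (arr G)" "y \<in> Yf (src G \<gamma>)"
  then show "(\<gamma>, act Y \<gamma> y) \<in> topspace (arr TG) \<and> fst (\<gamma>, act Y \<gamma> y) = \<gamma> \<and> src TG (\<gamma>, act Y \<gamma> y) = y"
    by (simp add: act_mem act_ginv_act)
qed (auto simp: haus_arr lc_arr cont_src cont_fst)

subsection \<open>Equivariance of the pushforward\<close>

text \<open>The action of the transformation groupoid is an isometric field over its arrows, from
  the pullback along the source to that along the range. Both are fibre products over the arrows of
  \<open>G\<close>, so transfer gives continuity. The action of the inverse arrow inverts the pushed
  action.\<close>

lemma push_g_banach_space:
  assumes E: "g_banach_space TG E \<alpha>"
  shows "g_banach_space G (push_field G Y E) (push_action G Y \<alpha>)"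
proof -
  let ?P = "push_field G Y E" and ?\<beta> = "push_action G Y \<alpha>"
  have usc: "usc_field (spc Y) E"
    and lin: "linear_field (arr TG) (pullback (arr TG) (src TG) E) (pullback (arr TG) (rng TG) E) \<alpha>"
    using E by (simp_all add: g_banach_space_def)
  have bij: "bij_betw (\<alpha> (\<gamma>, y)) (carrier (fib E (act Y (ginv G \<gamma>) y))) (carrier (fib E y))"
    and iso: "e \<in> carrier (fib E (act Y (ginv G \<gamma>) y)) \<Longrightarrow> nrm (fib E y) (\<alpha> (\<gamma>, y) e) = nrm (fib E (act Y (ginv G \<gamma>) y)) e"
    if "\<gamma> \<in> topspace (arr G)" "y \<in> Yf (rng G \<gamma>)" for \<gamma> y e
  proof -
    have "(\<gamma>, y) \<in> topspace (arr TG)"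
      using that by simp
    then have "bij_betw (\<alpha> (\<gamma>, y)) (carrier (fib E (src TG (\<gamma>, y)))) (carrier (fib E (rng TG (\<gamma>, y)))) \<and>
      (\<forall>e\<in>carrier (fib E (src TG (\<gamma>, y))). nrm (fib E (rng TG (\<gamma>, y))) (\<alpha> (\<gamma>, y) e) = nrm (fib E (src TG (\<gamma>, y))) e)"
      using E unfolding g_banach_space_def by blast
    then show "bij_betw (\<alpha> (\<gamma>, y)) (carrier (fib E (act Y (ginv G \<gamma>) y))) (carrier (fib E y))"
      "e \<in> carrier (fib E (act Y (ginv G \<gamma>) y)) \<Longrightarrow> nrm (fib E y) (\<alpha> (\<gamma>, y) e) = nrm (fib E (act Y (ginv G \<gamma>) y)) e"
      by simp_all
  qed
  have comp: "\<alpha> (gmult G \<gamma> \<gamma>', y) e = \<alpha> (\<gamma>, y) (\<alpha> (\<gamma>', act Y (ginv G \<gamma>) y) e)"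
    if c: "(\<gamma>, \<gamma>') \<in> composable G" and y: "y \<in> Yf (rng G \<gamma>)"
      and e: "e \<in> carrier (fib E (act Y (ginv G \<gamma>') (act Y (ginv G \<gamma>) y)))" for \<gamma> \<gamma>' y e
  proof -
    have "((\<gamma>, y), (\<gamma>', act Y (ginv G \<gamma>) y)) \<in> composable TG"
      using c y act_ginv_mem[of \<gamma> y] by (auto simp: composable_TG composable_iff)
    moreover have "\<forall>(\<gamma>, \<gamma>')\<in>composable TG. \<forall>e\<in>carrier (fib E (src TG \<gamma>')). \<alpha> (gmult TG \<gamma> \<gamma>') e = \<alpha> \<gamma> (\<alpha> \<gamma>' e)"
      using E by (simp add: g_banach_space_def)
    ultimately show ?thesis
      using e by fastforce
  qed
  \<comment> \<open>The axioms do not say that units act trivially. The action of a unit is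
    idempotent and injective, hence the identity.\<close>
  have unit: "\<alpha> (unt G x, y) e = e" if x: "x \<in> topspace (obj G)" and y: "y \<in> Yf x" and e: "e \<in> carrier (fib E y)" for x y e
  proof -
    have m: "unt G x \<in> topspace (arr G)" "y \<in> Yf (rng G (unt G x))"
      using x y by (simp_all add: unt_mem rng_unt)
    have a: "act Y (ginv G (unt G x)) y = y"
      using act_unt[of y] y x by (simp add: ginv_unt anchor_fibre_iff)
    have "\<alpha> (unt G x, y) e \<in> carrier (fib E y)"
      using bij[OF m] e by (auto simp: a bij_betw_def)
    moreover have "\<alpha> (unt G x, y) (\<alpha> (unt G x, y) e) = \<alpha> (unt G x, y) e"
      using comp[of "unt G x" "unt G x" y e] m unt_gmult[OF m(1)] e x
      by (simp add: composable_iff src_unt rng_unt a)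
    ultimately show ?thesis
      using bij_betw_imp_inj_on[OF bij[OF m]] e by (auto simp: a dest: inj_onD)
  qed
  \<comment> \<open>With the source square first and the range square second, the transferred map
    evaluates its argument at the source \<gamma>^{-1}y of the arrow (\<gamma>,y), which is the
    formula of \<open>push_action\<close>.\<close>
  note bl = bounded_linear_transfer[OF base_change_src base_change_rng
      usc field_over.pullback[OF field_over.intro[OF usc] cont_src_TG[simplified]]
      field_over.pullback[OF field_over.intro[OF usc_push[OF usc]] cont_src]
      usc field_over.pullback[OF field_over.intro[OF usc] cont_rng_TG[simplified]]
      field_over.pullback[OF field_over.intro[OF usc_push[OF usc]] cont_rng]]
  have "bounded_linear_field (arr TG) (pullback (arr TG) (src TG) E) (pullback (arr TG) (rng TG) E) \<alpha>"
    unfolding bounded_linear_field_def norm_le_def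
    using lin iso by (intro conjI exI[of _ 1]) (auto simp: pullback_def)
  from bl[OF this] have blin: "linear_field (arr G) (pullback (arr G) (src G) ?P) (pullback (arr G) (rng G) ?P) ?\<beta>"
    by (simp add: bounded_linear_field_def push_action_def)
  have carr: "?\<beta> \<gamma> \<zeta> \<in> carrier (push_fibre Y E (rng G \<gamma>))"
    if "\<gamma> \<in> topspace (arr G)" "\<zeta> \<in> carrier (push_fibre Y E (src G \<gamma>))" for \<gamma> \<zeta>
    using blin that linear_map_mem unfolding linear_field_def bounded_linear_map_def by (fastforce simp: pullback_def)
  have val: "\<zeta> (act Y (ginv G \<gamma>) y) \<in> carrier (fib E (act Y (ginv G \<gamma>) y))"
    if "\<gamma> \<in> topspace (arr G)" "\<zeta> \<in> carrier (push_fibre Y E (src G \<gamma>))" "y \<in> Yf (rng G \<gamma>)" for \<gamma> \<zeta> y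
    using push_mem[OF usc that(2) act_ginv_mem[OF that(1,3)]] .
  have comp': "?\<beta> (gmult G \<gamma> \<gamma>') \<zeta> = ?\<beta> \<gamma> (?\<beta> \<gamma>' \<zeta>)"
    if c: "(\<gamma>, \<gamma>') \<in> composable G" and \<zeta>: "\<zeta> \<in> carrier (push_fibre Y E (src G \<gamma>'))" for \<gamma> \<gamma>' \<zeta>
  proof -
    have m: "\<gamma> \<in> topspace (arr G)" "\<gamma>' \<in> topspace (arr G)" "src G \<gamma> = rng G \<gamma>'"
      using c by (auto simp: composable_iff)
    have "\<alpha> (gmult G \<gamma> \<gamma>', y) (\<zeta> (act Y (ginv G (gmult G \<gamma> \<gamma>')) y)) =
      \<alpha> (\<gamma>, y) (\<alpha> (\<gamma>', act Y (ginv G \<gamma>) y) (\<zeta> (act Y (ginv G \<gamma>') (act Y (ginv G \<gamma>) y))))" if y: "y \<in> Yf (rng G \<gamma>)" for y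
      using comp[OF c y val[OF m(2) \<zeta>]] act_ginv_mem[OF m(1) y] m(3) act_ginv_gmult[OF c y] by simp
    then show ?thesis
      unfolding push_action_def rng_gmult[OF c] using act_ginv_mem[OF m(1)] m(3) by (auto intro!: restrict_ext)
  qed
  have unit': "?\<beta> (unt G x) \<zeta> = \<zeta>" if x: "x \<in> topspace (obj G)" and \<zeta>: "\<zeta> \<in> carrier (push_fibre Y E x)" for x \<zeta>
  proof (rule push_eqI[OF usc _ push_ext[OF usc \<zeta>]])
    show "?\<beta> (unt G x) \<zeta> \<in> extensional (Yf x)"
      using x by (simp add: push_action_def rng_unt)
    fix y assume y: "y \<in> Yf x"
    have "act Y (ginv G (unt G x)) y = y"
      using act_unt[of y] y x by (simp add: ginv_unt anchor_fibre_iff)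
    then show "?\<beta> (unt G x) \<zeta> y = \<zeta> y"
      using unit[OF x y push_mem[OF usc \<zeta> y]] x y by (simp add: push_action_def rng_unt)
  qed
  have "bij_betw (?\<beta> \<gamma>) (carrier (push_fibre Y E (src G \<gamma>))) (carrier (push_fibre Y E (rng G \<gamma>)))"
    if \<gamma>: "\<gamma> \<in> topspace (arr G)" for \<gamma>
  proof (rule bij_betwI[where g = "?\<beta> (ginv G \<gamma>)"])
    note inv = carr[OF ginv_mem[OF \<gamma>], unfolded src_ginv[OF \<gamma>] rng_ginv[OF \<gamma>]]
    show "?\<beta> \<gamma> \<in> carrier (push_fibre Y E (src G \<gamma>)) \<rightarrow> carrier (push_fibre Y E (rng G \<gamma>))"
      using carr[OF \<gamma>] by blast
    show "?\<beta> (ginv G \<gamma>) \<in> carrier (push_fibre Y E (rng G \<gamma>)) \<rightarrow> carrier (push_fibre Y E (src G \<gamma>))"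
      using inv by blast
    show "?\<beta> (ginv G \<gamma>) (?\<beta> \<gamma> \<zeta>) = \<zeta>" if "\<zeta> \<in> carrier (push_fibre Y E (src G \<gamma>))" for \<zeta>
      using comp'[of "ginv G \<gamma>" \<gamma> \<zeta>] unit'[OF src_mem[OF \<gamma>] that] that \<gamma>
      by (simp add: composable_iff ginv_mem src_ginv ginv_gmult)
    show "?\<beta> \<gamma> (?\<beta> (ginv G \<gamma>) \<zeta>) = \<zeta>" if "\<zeta> \<in> carrier (push_fibre Y E (rng G \<gamma>))" for \<zeta>
      using comp'[of \<gamma> "ginv G \<gamma>" \<zeta>] unit'[OF rng_mem[OF \<gamma>] that] that \<gamma>
      by (simp add: composable_iff ginv_mem src_ginv rng_ginv gmult_ginv)
  qed
  moreover have "nrm (push_fibre Y E (rng G \<gamma>)) (?\<beta> \<gamma> \<zeta>) = nrm (push_fibre Y E (src G \<gamma>)) \<zeta>"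
    if \<gamma>: "\<gamma> \<in> topspace (arr G)" and \<zeta>: "\<zeta> \<in> carrier (push_fibre Y E (src G \<gamma>))" for \<gamma> \<zeta>
  proof (rule antisym)
    have at: "nrm (fib E y) (?\<beta> \<gamma> \<zeta> y) = nrm (fib E (act Y (ginv G \<gamma>) y)) (\<zeta> (act Y (ginv G \<gamma>) y))" if "y \<in> Yf (rng G \<gamma>)" for y
      using iso[OF \<gamma> that val[OF \<gamma> \<zeta> that]] that by (simp add: push_action_def)
    show "nrm (push_fibre Y E (rng G \<gamma>)) (?\<beta> \<gamma> \<zeta>) \<le> nrm (push_fibre Y E (src G \<gamma>)) \<zeta>"
      using at push_nrm_ge[OF usc \<zeta> act_ginv_mem[OF \<gamma>]] push_nrm_ge0[OF usc \<zeta>] by (intro push_nrm_le) auto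
    show "nrm (push_fibre Y E (src G \<gamma>)) \<zeta> \<le> nrm (push_fibre Y E (rng G \<gamma>)) (?\<beta> \<gamma> \<zeta>)"
    proof (rule push_nrm_le[OF push_nrm_ge0[OF usc carr[OF \<gamma> \<zeta>]]])
      fix y assume y: "y \<in> Yf (src G \<gamma>)"
      show "nrm (fib E y) (\<zeta> y) \<le> nrm (push_fibre Y E (rng G \<gamma>)) (?\<beta> \<gamma> \<zeta>)"
        using at[OF act_mem[OF \<gamma> y]] push_nrm_ge[OF usc carr[OF \<gamma> \<zeta>] act_mem[OF \<gamma> y]] act_ginv_act[OF \<gamma> y] by simp
    qed
  qed
  ultimately show ?thesis
    unfolding g_banach_space_def using usc_push[OF usc] blin comp' by auto
qed

lemma push_equivariant_linear:
  assumes T: "equivariant_linear TG E \<alpha> \<beta> T" and E: "usc_field (spc Y) E"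
  shows "equivariant_linear G (push_field G Y E) (push_action G Y \<alpha>) (push_action G Y \<beta>) (push_linear Y T)"
  unfolding equivariant_linear_def
proof (intro ballI)
  fix \<gamma> \<zeta> assume \<gamma>: "\<gamma> \<in> topspace (arr G)" and "\<zeta> \<in> carrier (fib (push_field G Y E) (src G \<gamma>))"
  then have \<zeta>: "\<zeta> \<in> carrier (push_fibre Y E (src G \<gamma>))"
    by simp
  have "\<beta> (\<gamma>, y) (T (act Y (ginv G \<gamma>) y) (\<zeta> (act Y (ginv G \<gamma>) y))) = T y (\<alpha> (\<gamma>, y) (\<zeta> (act Y (ginv G \<gamma>) y)))"
    if y: "y \<in> Yf (rng G \<gamma>)" for y
    using T[unfolded equivariant_linear_def, THEN bspec, of "(\<gamma>, y)"] push_mem[OF E \<zeta> act_ginv_mem[OF \<gamma> y]] \<gamma> y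
    by simp
  then show "push_action G Y \<beta> \<gamma> (push_linear Y T (src G \<gamma>) \<zeta>) = push_linear Y T (rng G \<gamma>) (push_action G Y \<alpha> \<gamma> \<zeta>)"
    using act_ginv_mem[OF \<gamma>] by (auto simp: push_action_def push_linear_def intro!: restrict_ext)
qed

lemma push_equivariant_bilinear:
  assumes \<mu>: "equivariant_bilinear TG E \<alpha> F \<beta> \<delta> \<mu>" and E: "usc_field (spc Y) E" and F: "usc_field (spc Y) F"
  shows "equivariant_bilinear G (push_field G Y E) (push_action G Y \<alpha>) (push_field G Y F) (push_action G Y \<beta>)
    (push_action G Y \<delta>) (push_bilinear Y \<mu>)"
  unfolding equivariant_bilinear_def
proof (intro ballI)
  fix \<gamma> \<zeta> \<omega> assume \<gamma>: "\<gamma> \<in> topspace (arr G)"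
    and "\<zeta> \<in> carrier (fib (push_field G Y E) (src G \<gamma>))" "\<omega> \<in> carrier (fib (push_field G Y F) (src G \<gamma>))"
  then have m: "\<zeta> \<in> carrier (push_fibre Y E (src G \<gamma>))" "\<omega> \<in> carrier (push_fibre Y F (src G \<gamma>))"
    by simp_all
  have "\<delta> (\<gamma>, y) (\<mu> (act Y (ginv G \<gamma>) y) (\<zeta> (act Y (ginv G \<gamma>) y)) (\<omega> (act Y (ginv G \<gamma>) y))) =
    \<mu> y (\<alpha> (\<gamma>, y) (\<zeta> (act Y (ginv G \<gamma>) y))) (\<beta> (\<gamma>, y) (\<omega> (act Y (ginv G \<gamma>) y)))"
    if y: "y \<in> Yf (rng G \<gamma>)" for y
    using \<mu>[unfolded equivariant_bilinear_def, THEN bspec, of "(\<gamma>, y)"]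
      push_mem[OF E m(1) act_ginv_mem[OF \<gamma> y]] push_mem[OF F m(2) act_ginv_mem[OF \<gamma> y]] \<gamma> y
    by simp
  then show "push_action G Y \<delta> \<gamma> (push_bilinear Y \<mu> (src G \<gamma>) \<zeta> \<omega>) =
    push_bilinear Y \<mu> (rng G \<gamma>) (push_action G Y \<alpha> \<gamma> \<zeta>) (push_action G Y \<beta> \<gamma> \<omega>)"
    using act_ginv_mem[OF \<gamma>] by (auto simp: push_action_def push_bilinear_def intro!: restrict_ext)
qed

lemma push_bounded_linear:
  assumes T: "bounded_linear_field (spc Y) E F T" and E: "usc_field (spc Y) E" and F: "usc_field (spc Y) F"
  shows "bounded_linear_field (obj G) (push_field G Y E) (push_field G Y F) (push_linear Y T)"
  by (rule bounded_linear_transfer[OF base_change_id base_change_id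
      E E field_over.is_pullback_id[OF field_over.intro[OF E]] usc_push[OF E]
      field_over.is_pullback_id[OF field_over.intro[OF usc_push[OF E]]]
      F F field_over.is_pullback_id[OF field_over.intro[OF F]] usc_push[OF F]
      field_over.is_pullback_id[OF field_over.intro[OF usc_push[OF F]]] T])
    (simp add: push_linear_def)

lemma push_contractive_bilinear:
  assumes \<mu>: "contractive_bilinear_field (spc Y) E F H \<mu>"
    and E: "usc_field (spc Y) E" and F: "usc_field (spc Y) F" and H: "usc_field (spc Y) H"
  shows "contractive_bilinear_field (obj G) (push_field G Y E) (push_field G Y F) (push_field G Y H) (push_bilinear Y \<mu>)"
  by (rule base_change.contractive_bilinear_transfer[OF base_change_id
      E E field_over.is_pullback_id[OF field_over.intro[OF E]] usc_push[OF E]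
      field_over.is_pullback_id[OF field_over.intro[OF usc_push[OF E]]]
      F F field_over.is_pullback_id[OF field_over.intro[OF F]] usc_push[OF F]
      field_over.is_pullback_id[OF field_over.intro[OF usc_push[OF F]]]
      H H field_over.is_pullback_id[OF field_over.intro[OF H]] usc_push[OF H]
      field_over.is_pullback_id[OF field_over.intro[OF usc_push[OF H]]] \<mu>])
    (simp add: push_bilinear_def)

end

section \<open>Non-degeneracy\<close>

context gspace_over
begin

lemma push_real_mult:
  assumes E: "usc_field (spc Y) E" and \<xi>: "\<xi> \<in> carrier (push_fibre Y E x)"
    and \<phi>: "continuous_map (spc Y) euclideanreal \<phi>" "\<And>y. y \<in> topspace (spc Y) \<Longrightarrow> \<bar>\<phi> y\<bar> \<le> 1"
  shows "(\<lambda>y\<in>Yf x. complex_of_real (\<phi> y) \<odot>\<^bsub>fib E y\<^esub> \<xi> y) \<in> carrier (push_fibre Y E x)"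
  using field_over.sections0_real_mult[OF restricted_field(1)[OF E], of \<xi> x \<phi>] \<xi> \<phi>
  by (simp add: push_fibre_simps restricted_field(3)[OF E] continuous_map_from_subtopology anchor_fibre_iff)

text \<open>The patching argument is applied to the span of products in the pushed fibre. It is
  stable under cut-offs because a function can be moved into the first factor of a product, and its
  values are dense at each y by non-degeneracy over Y.\<close>

lemma push_nondegenerate:
  assumes \<mu>: "contractive_bilinear_field (spc Y) E F H \<mu>"
    and E: "usc_field (spc Y) E" and F: "usc_field (spc Y) F" and H: "usc_field (spc Y) H"
    and nd: "nondegenerate (spc Y) E F H \<mu>"
  shows "nondegenerate (obj G) (push_field G Y E) (push_field G Y F) (push_field G Y H) (push_bilinear Y \<mu>)"
  unfolding nondegenerate_def fib_push_field
proof
  fix x assume x: "x \<in> topspace (obj G)"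
  let ?V = "push_fibre Y H x"
  let ?P = "{push_bilinear Y \<mu> x e f |e f. e \<in> carrier (push_fibre Y E x) \<and> f \<in> carrier (push_fibre Y F x)}"
  let ?L = "lspan ?V ?P"
  let ?\<Phi> = "{\<phi>. continuous_map (spc Y) euclideanreal \<phi> \<and> (\<forall>y\<in>topspace (spc Y). 0 \<le> \<phi> y \<and> \<phi> y \<le> 1)}"
  interpret V: normed ?V
    by (rule normed_push[OF H])
  interpret RH: field_over "Q x" "R H x"
    by (rule restricted_field(1)[OF H])
  have top: "y \<in> topspace (spc Y)" if "y \<in> Yf x" for y
    using that by (simp add: anchor_fibre_iff)
  have \<mu>1: "\<And>e. e \<in> carrier (fib E y) \<Longrightarrow> linear_map (fib F y) (fib H y) (\<mu> y e)"
    and \<mu>2: "\<And>g. g \<in> carrier (fib F y) \<Longrightarrow> linear_map (fib E y) (fib H y) (\<lambda>e. \<mu> y e g)"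
    and \<mu>3: "\<And>e g. e \<in> carrier (fib E y) \<Longrightarrow> g \<in> carrier (fib F y) \<Longrightarrow> nrm (fib H y) (\<mu> y e g) \<le> nrm (fib E y) e * nrm (fib F y) g"
    if "y \<in> Yf x" for y
    using \<mu> top[OF that] by (simp_all add: contractive_bilinear_field_def)
  have P: "?P \<subseteq> carrier ?V"
    using push_contractive_bilinear[OF \<mu> E F H] x linear_map_mem unfolding contractive_bilinear_field_def
    by fastforce
  have LV: "?L \<subseteq> carrier ?V"
    by (rule V.lspan_subset[OF P])
  have at: "(u \<oplus>\<^bsub>?V\<^esub> v) y = u y \<oplus>\<^bsub>fib H y\<^esub> v y" "(c \<odot>\<^bsub>?V\<^esub> u) y = c \<odot>\<^bsub>fib H y\<^esub> u y" "\<zero>\<^bsub>?V\<^esub> y = \<zero>\<^bsub>fib H y\<^esub>"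
    if "y \<in> Yf x" for u v c y
    using that by (simp_all add: push_fibre_simps)
  have zero: "\<zero>\<^bsub>?V\<^esub> = (\<lambda>y\<in>Yf x. \<zero>\<^bsub>fib H y\<^esub>)"
    by (simp add: push_fibre_simps)
  have mult: "(\<lambda>y\<in>Yf x. complex_of_real (\<phi> y) \<odot>\<^bsub>fib H y\<^esub> g y) \<in> ?L"
    if g: "g \<in> ?L" and \<phi>: "continuous_map (spc Y) euclideanreal \<phi>" "\<And>y. y \<in> topspace (spc Y) \<Longrightarrow> \<bar>\<phi> y\<bar> \<le> 1" for \<phi> g
  proof -
    let ?m = "\<lambda>g. \<lambda>y\<in>Yf x. complex_of_real (\<phi> y) \<odot>\<^bsub>fib H y\<^esub> g y"
    \<comment> \<open>Span induction: the vectors whose product with \<phi> stays in the span form a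
      linear subspace containing the generators.\<close>
    have "?L \<subseteq> {g \<in> carrier ?V. ?m g \<in> ?L}"
    proof (rule V.lspan_subsetI)
      show "?P \<subseteq> {g \<in> carrier ?V. ?m g \<in> ?L}"
      proof
        fix g assume g: "g \<in> ?P"
        then obtain e f where ef: "g = push_bilinear Y \<mu> x e f" "e \<in> carrier (push_fibre Y E x)" "f \<in> carrier (push_fibre Y F x)"
          by blast
        have "?m g = push_bilinear Y \<mu> x (\<lambda>y\<in>Yf x. complex_of_real (\<phi> y) \<odot>\<^bsub>fib E y\<^esub> e y) f"
          using \<mu>2[unfolded linear_map_def] push_mem[OF E ef(2)] push_mem[OF F ef(3)]
          by (auto simp: ef(1) push_bilinear_def intro!: restrict_ext)
        then have "?m g \<in> ?P"
          using push_real_mult[OF E ef(2) \<phi>] ef(3) by blast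
        then show "g \<in> {g \<in> carrier ?V. ?m g \<in> ?L}"
          using P g unfolding lspan_def by (auto intro: hull_inc)
      qed
      have "?m \<zero>\<^bsub>?V\<^esub> = \<zero>\<^bsub>?V\<^esub>"
        unfolding zero using normed_fib[OF H, of _ x]
        by (auto intro!: restrict_ext module.smult_r_null[of complex_ring] normed.module)
      then show "\<zero>\<^bsub>?V\<^esub> \<in> {g \<in> carrier ?V. ?m g \<in> ?L}"
        using V.lspan_zero by simp
      fix u assume u: "u \<in> {g \<in> carrier ?V. ?m g \<in> ?L}"
      have "?m (c \<odot>\<^bsub>?V\<^esub> u) = c \<odot>\<^bsub>?V\<^esub> ?m u" for c
        unfolding push_fibre_simps(5) using u push_mem[OF H, of u x]
        by (auto simp: normed.smult_mult[OF normed_fib[OF H], symmetric] mult.commute intro!: restrict_ext)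
      then show "c \<odot>\<^bsub>?V\<^esub> u \<in> {g \<in> carrier ?V. ?m g \<in> ?L}" for c
        using u V.lspan_smult by simp
      fix v assume v: "v \<in> {g \<in> carrier ?V. ?m g \<in> ?L}"
      have "?m (u \<oplus>\<^bsub>?V\<^esub> v) = ?m u \<oplus>\<^bsub>?V\<^esub> ?m v"
        unfolding push_fibre_simps(4) using u v push_mem[OF H, of u x] push_mem[OF H, of v x]
        by (auto simp: normed.smult_add_right[OF normed_fib[OF H]] intro!: restrict_ext)
      then show "u \<oplus>\<^bsub>?V\<^esub> v \<in> {g \<in> carrier ?V. ?m g \<in> ?L}"
        using u v V.lspan_add by simp
    qed auto
    then show ?thesis
      using g by blast
  qed
  have "\<exists>g\<in>?L. \<forall>y\<in>topspace (Q x). nrm (fib (R H x) y) (h y \<ominus>\<^bsub>fib (R H x) y\<^esub> g y) \<le> \<epsilon>"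
    if h: "h \<in> carrier ?V" and \<epsilon>: "\<epsilon> > 0" for h \<epsilon>
  proof (rule RH.sections0_dense[where \<Phi> = ?\<Phi>])
    show "?L \<subseteq> sections0 (Q x) (R H x)"
      using LV by (simp add: push_fibre_simps)
    show "(\<lambda>y\<in>topspace (Q x). \<zero>\<^bsub>fib (R H x) y\<^esub>) \<in> ?L"
      using V.lspan_zero[of ?P] by (simp add: restricted_field(3)[OF H] zero)
    show "h \<in> sections0 (Q x) (R H x)"
      using h by (simp add: push_fibre_simps)
    show "ccomb (Q x) (R H x) \<phi> g s \<in> ?L" if g: "g \<in> ?L" and s: "s \<in> ?L" and \<phi>: "\<phi> \<in> ?\<Phi>" for g s \<phi>
    proof -
      have "continuous_map (spc Y) euclideanreal (\<lambda>y. 1 - \<phi> y)"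
        using \<phi> by (intro continuous_intros) auto
      then have "(\<lambda>y\<in>Yf x. complex_of_real (1 - \<phi> y) \<odot>\<^bsub>fib H y\<^esub> g y) \<oplus>\<^bsub>?V\<^esub> (\<lambda>y\<in>Yf x. complex_of_real (\<phi> y) \<odot>\<^bsub>fib H y\<^esub> s y) \<in> ?L"
        using \<phi> by (intro V.lspan_add mult g s) auto
      also have "(\<lambda>y\<in>Yf x. complex_of_real (1 - \<phi> y) \<odot>\<^bsub>fib H y\<^esub> g y) \<oplus>\<^bsub>?V\<^esub> (\<lambda>y\<in>Yf x. complex_of_real (\<phi> y) \<odot>\<^bsub>fib H y\<^esub> s y)
        = ccomb (Q x) (R H x) \<phi> g s"
        by (auto simp: ccomb_def push_fibre_simps restricted_field(3)[OF H] intro!: restrict_ext)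
      finally show ?thesis .
    qed
    show "\<exists>s\<in>?L. nrm (fib (R H x) y) (e \<ominus>\<^bsub>fib (R H x) y\<^esub> s y) < \<epsilon>"
      if "y \<in> topspace (Q x)" and "e \<in> carrier (fib (R H x) y)" and \<epsilon>: "\<epsilon> > 0" for y e \<epsilon>
    proof -
      have y: "y \<in> Yf x" and e: "e \<in> carrier (fib H y)"
        using that by (simp_all add: restricted_field(3)[OF H])
      note nE = normed_fib[OF E y] and nF = normed_fib[OF F y]
      interpret N: normed "fib H y"
        by (rule normed_fib[OF H y])
      let ?S = "{\<mu> y a b |a b. a \<in> carrier (fib E y) \<and> b \<in> carrier (fib F y)}"
      \<comment> \<open>The vectors at y that are limits of values of the span. As a linear subspace
        containing all products at y, this set contains their span, which is dense by non-degeneracy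
        at y.\<close>
      let ?N = "{v \<in> carrier (fib H y). \<forall>\<epsilon>>0. \<exists>g\<in>?L. nrm (fib H y) (v \<ominus>\<^bsub>fib H y\<^esub> g y) < \<epsilon>}"
      have gm: "g y \<in> carrier (fib H y)" if "g \<in> ?L" for g
        using push_mem[OF H _ y] LV that by blast
      have S: "?S \<subseteq> carrier (fib H y)"
        using \<mu>1[OF y] linear_map_mem by fastforce
      have "lspan (fib H y) ?S \<subseteq> ?N"
      proof (rule N.lspan_subsetI)
        show "?S \<subseteq> ?N"
        proof
          fix v assume v: "v \<in> ?S"
          then obtain a b where ab: "v = \<mu> y a b" "a \<in> carrier (fib E y)" "b \<in> carrier (fib F y)"
            by blast
          have "\<exists>g\<in>?L. nrm (fib H y) (v \<ominus>\<^bsub>fib H y\<^esub> g y) < \<delta>" if \<delta>: "\<delta> > 0" for \<delta>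
          proof -
            \<comment> \<open>As \<open>bilinear_estimate\<close> requires, \<alpha> is chosen with
              a tolerance depending on b, and afterwards \<beta> with one depending on \<alpha>.
              Both come from sections over Y, so their restrictions yield a product in the pushed
              fibre.\<close>
            define M where "M = nrm (fib F y) b + 1"
            have M: "M > 0" "nrm (fib F y) b \<le> M"
              using normed.nrm_ge0[OF nF ab(3)] by (simp_all add: M_def)
            obtain \<alpha> where \<alpha>: "\<alpha> \<in> \<Gamma>0 E" "nrm (fib E y) (a \<ominus>\<^bsub>fib E y\<^esub> \<alpha> y) < \<delta> / (2 * M)"
              using field_over.sections0_pointwise_dense[OF field_over.intro[OF E] lcY hausY top[OF y] ab(2), of "\<delta> / (2 * M)"] \<delta> M(1)
              by auto
            have \<alpha>y: "\<alpha> y \<in> carrier (fib E y)"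
              using field_over.sections0_mem[OF field_over.intro[OF E] \<alpha>(1) top[OF y]] .
            define K where "K = nrm (fib E y) (\<alpha> y) + 1"
            have K: "K > 0" "nrm (fib E y) (\<alpha> y) \<le> K"
              using normed.nrm_ge0[OF nE \<alpha>y] by (simp_all add: K_def)
            obtain \<beta> where \<beta>: "\<beta> \<in> \<Gamma>0 F" "nrm (fib F y) (b \<ominus>\<^bsub>fib F y\<^esub> \<beta> y) < \<delta> / (2 * K)"
              using field_over.sections0_pointwise_dense[OF field_over.intro[OF F] lcY hausY top[OF y] ab(3), of "\<delta> / (2 * K)"] \<delta> K(1)
              by auto
            have \<beta>y: "\<beta> y \<in> carrier (fib F y)"
              using field_over.sections0_mem[OF field_over.intro[OF F] \<beta>(1) top[OF y]] .
            let ?g = "push_bilinear Y \<mu> x (restrict \<alpha> (Yf x)) (restrict \<beta> (Yf x))"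
            have "?g \<in> ?P"
              using push_restrict[OF E x \<alpha>(1)] push_restrict[OF F x \<beta>(1)] by blast
            then have "?g \<in> ?L"
              unfolding lspan_def by (rule hull_inc)
            have "nrm (fib H y) (v \<ominus>\<^bsub>fib H y\<^esub> ?g y) \<le>
              nrm (fib E y) (a \<ominus>\<^bsub>fib E y\<^esub> \<alpha> y) * nrm (fib F y) b + nrm (fib E y) (\<alpha> y) * nrm (fib F y) (b \<ominus>\<^bsub>fib F y\<^esub> \<beta> y)"
              using bilinear_estimate[OF nE nF N.normed_axioms \<mu>1[OF y] \<mu>2[OF y] \<mu>3[OF y] ab(2) \<alpha>y ab(3) \<beta>y] y
              by (simp add: ab(1) push_bilinear_def)
            also have "nrm (fib E y) (a \<ominus>\<^bsub>fib E y\<^esub> \<alpha> y) * nrm (fib F y) b \<le> nrm (fib E y) (a \<ominus>\<^bsub>fib E y\<^esub> \<alpha> y) * M"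
              using M(2) normed.nrm_ge0[OF nE normed.diff_mem[OF nE ab(2) \<alpha>y]] by (intro mult_left_mono)
            also have "nrm (fib E y) (a \<ominus>\<^bsub>fib E y\<^esub> \<alpha> y) * M < \<delta> / 2"
              using \<alpha>(2) M(1) by (simp add: field_simps)
            also have "nrm (fib E y) (\<alpha> y) * nrm (fib F y) (b \<ominus>\<^bsub>fib F y\<^esub> \<beta> y) \<le> K * nrm (fib F y) (b \<ominus>\<^bsub>fib F y\<^esub> \<beta> y)"
              using K(2) normed.nrm_ge0[OF nF normed.diff_mem[OF nF ab(3) \<beta>y]] by (intro mult_right_mono)
            also have "K * nrm (fib F y) (b \<ominus>\<^bsub>fib F y\<^esub> \<beta> y) < \<delta> / 2"
              using \<beta>(2) K(1) by (simp add: field_simps)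
            finally show ?thesis
              using \<open>?g \<in> ?L\<close> by (intro bexI[of _ ?g]) simp
          qed
          then show "v \<in> ?N"
            using v S by blast
        qed
        show "\<zero>\<^bsub>fib H y\<^esub> \<in> ?N"
          using at(3)[OF y] V.lspan_zero[of ?P] by (auto intro!: bexI[of _ "\<zero>\<^bsub>?V\<^esub>"])
        fix u assume u: "u \<in> ?N"
        show "c \<odot>\<^bsub>fib H y\<^esub> u \<in> ?N" for c
        proof (intro CollectI conjI allI impI)
          show "c \<odot>\<^bsub>fib H y\<^esub> u \<in> carrier (fib H y)"
            using u by simp
          fix \<delta> :: real assume \<delta>: "\<delta> > 0"
          have "\<delta> / (cmod c + 1) > 0"
            using \<delta> by (intro divide_pos_pos) (auto intro: add_nonneg_pos)
          then obtain g where g: "g \<in> ?L" "nrm (fib H y) (u \<ominus>\<^bsub>fib H y\<^esub> g y) < \<delta> / (cmod c + 1)"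
            using u by blast
          have "nrm (fib H y) (c \<odot>\<^bsub>fib H y\<^esub> u \<ominus>\<^bsub>fib H y\<^esub> c \<odot>\<^bsub>fib H y\<^esub> g y) = cmod c * nrm (fib H y) (u \<ominus>\<^bsub>fib H y\<^esub> g y)"
            using u gm[OF g(1)] by (simp add: N.smult_diff_right[symmetric] N.nrm_smult)
          also have "\<dots> \<le> (cmod c + 1) * nrm (fib H y) (u \<ominus>\<^bsub>fib H y\<^esub> g y)"
            using u gm[OF g(1)] N.nrm_ge0 by (intro mult_right_mono) auto
          also have "\<dots> < (cmod c + 1) * (\<delta> / (cmod c + 1))"
            using g(2) by (intro mult_strict_left_mono) (auto intro: add_nonneg_pos)
          also have "\<dots> = \<delta>"
            using norm_ge_zero[of c] by (simp add: add_nonneg_eq_0_iff)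
          finally show "\<exists>g\<in>?L. nrm (fib H y) (c \<odot>\<^bsub>fib H y\<^esub> u \<ominus>\<^bsub>fib H y\<^esub> g y) < \<delta>"
            using V.lspan_smult[OF g(1), of c] by (intro bexI[of _ "c \<odot>\<^bsub>?V\<^esub> g"]) (simp_all add: at(2)[OF y])
        qed
        fix v assume v: "v \<in> ?N"
        show "u \<oplus>\<^bsub>fib H y\<^esub> v \<in> ?N"
        proof (intro CollectI conjI allI impI)
          show "u \<oplus>\<^bsub>fib H y\<^esub> v \<in> carrier (fib H y)"
            using u v by simp
          fix \<delta> :: real assume \<delta>: "\<delta> > 0"
          obtain g h where g: "g \<in> ?L" "nrm (fib H y) (u \<ominus>\<^bsub>fib H y\<^esub> g y) < \<delta> / 2"
            and h: "h \<in> ?L" "nrm (fib H y) (v \<ominus>\<^bsub>fib H y\<^esub> h y) < \<delta> / 2"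
            using u v half_gt_zero[OF \<delta>] by blast
          have "nrm (fib H y) ((u \<oplus>\<^bsub>fib H y\<^esub> v) \<ominus>\<^bsub>fib H y\<^esub> (g y \<oplus>\<^bsub>fib H y\<^esub> h y)) < \<delta>"
            using N.nrm_add_diff_add[of u v "g y" "h y"] u v gm g h by fastforce
          then show "\<exists>g\<in>?L. nrm (fib H y) ((u \<oplus>\<^bsub>fib H y\<^esub> v) \<ominus>\<^bsub>fib H y\<^esub> g y) < \<delta>"
            using V.lspan_add[OF g(1) h(1)] by (intro bexI[of _ "g \<oplus>\<^bsub>?V\<^esub> h"]) (simp_all add: at(1)[OF y])
        qed
      qed auto
      moreover obtain v where v: "v \<in> lspan (fib H y) ?S" "nrm (fib H y) (e \<ominus>\<^bsub>fib H y\<^esub> v) < \<epsilon> / 2"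
        using nd[unfolded nondegenerate_def, THEN bspec, OF top[OF y], unfolded N.dense_iff[OF N.lspan_subset[OF S]]] e half_gt_zero[OF \<epsilon>]
        by blast
      ultimately obtain g where g: "g \<in> ?L" "nrm (fib H y) (v \<ominus>\<^bsub>fib H y\<^esub> g y) < \<epsilon> / 2"
        using half_gt_zero[OF \<epsilon>] by blast
      have "v \<in> carrier (fib H y)"
        using v(1) N.lspan_subset[OF S] by blast
      then have "nrm (fib H y) (e \<ominus>\<^bsub>fib H y\<^esub> g y) < \<epsilon>"
        using N.nrm_triangle[OF e gm[OF g(1)], of v] v(2) g(2) by simp
      then show ?thesis
        using g(1) by (auto simp: restricted_field(3)[OF H])
    qed
  qed (use fibre_bump[OF H] top \<epsilon> in auto)
  then have dense: "\<exists>g\<in>?L. \<forall>y\<in>Yf x. nrm (fib H y) (h y \<ominus>\<^bsub>fib H y\<^esub> g y) \<le> \<epsilon>"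
    if "h \<in> carrier ?V" "\<epsilon> > 0" for h \<epsilon>
    using that by (simp add: restricted_field(3)[OF H])
  show "ntop ?V closure_of ?L = carrier ?V"
    unfolding V.dense_iff[OF LV]
  proof (intro ballI allI impI)
    fix h \<epsilon> assume h: "h \<in> carrier ?V" and \<epsilon>: "(0::real) < \<epsilon>"
    obtain g where g: "g \<in> ?L" "\<forall>y\<in>Yf x. nrm (fib H y) (h y \<ominus>\<^bsub>fib H y\<^esub> g y) \<le> \<epsilon> / 2"
      using dense[OF h half_gt_zero[OF \<epsilon>]] by blast
    then have "nrm ?V (h \<ominus>\<^bsub>?V\<^esub> g) \<le> \<epsilon> / 2"
      using push_nrm_diff_le_iff[OF H h subsetD[OF LV g(1)], of "\<epsilon> / 2"] \<epsilon> by simp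
    then show "\<exists>s\<in>?L. nrm ?V (h \<ominus>\<^bsub>?V\<^esub> s) < \<epsilon>"
      using g(1) \<epsilon> by (intro bexI[of _ g]) auto
  qed
qed

end

section \<open>Pushforward of algebras, modules, pairs and cycles\<close>

lemma push_algebra_simps [simp]:
  "fib (push_algebra G Y A) = push_fibre Y A" "sec (push_algebra G Y A) = sec (push_field G Y A)"
  "gact (push_algebra G Y A) = push_action G Y (gact A)"
  by (simp_all add: push_algebra_def)

lemma push_pair_simps [simp]:
  "lft (push_pair G Y E) = push_field G Y (lft E)" "rgt (push_pair G Y E) = push_field G Y (rgt E)"
  "brk (push_pair G Y E) = push_bilinear Y (brk E)" "lB (push_pair G Y E) = push_bilinear Y (lB E)"
  "rB (push_pair G Y E) = push_bilinear Y (rB E)" "lact (push_pair G Y E) = push_action G Y (lact E)"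
  "ract (push_pair G Y E) = push_action G Y (ract E)" "lA (push_pair G Y E) = push_bilinear Y (lA E)"
  "rA (push_pair G Y E) = push_bilinear Y (rA E)" "lgr (push_pair G Y E) = push_linear Y (lgr E)"
  "rgr (push_pair G Y E) = push_linear Y (rgr E)"
  by (simp_all add: push_pair_def)

text \<open>The product of the pushed fibre is itself a pushed bilinear field, so the results on
  bilinear fields cover algebras.\<close>

lemma push_bilinear_mult: "(\<lambda>x a b. a \<otimes>\<^bsub>push_fibre Y A x\<^esub> b) = push_bilinear Y (\<lambda>y a b. a \<otimes>\<^bsub>fib A y\<^esub> b)"
  by (intro ext) (simp add: push_fibre_simps(2) push_bilinear_def)

text \<open>\<open>push_algebra\<close> and \<open>push_field\<close> are records of different types
  with the same fibres and sections, and \<open>pullback\<close> reads nothing else.\<close>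

lemma pullback_push_algebra: "pullback W f (push_algebra G Y A) = pullback W f (push_field G Y A)"
  by (simp add: pullback_def)

context gspace_over
begin

lemma push_g_banach_algebra:
  assumes A: "g_banach_algebra TG A"
  shows "g_banach_algebra G (push_algebra G Y A)"
proof -
  have gA: "g_banach_space TG A (gact A)" and cA: "contractive_bilinear_field (spc Y) A A A (\<lambda>x a b. a \<otimes>\<^bsub>fib A x\<^esub> b)"
    and eA: "equivariant_bilinear TG A (gact A) A (gact A) (gact A) (\<lambda>x a b. a \<otimes>\<^bsub>fib A x\<^esub> b)"
    and assoc: "\<And>y a b c. y \<in> topspace (spc Y) \<Longrightarrow> a \<in> carrier (fib A y) \<Longrightarrow> b \<in> carrier (fib A y) \<Longrightarrow> c \<in> carrier (fib A y) \<Longrightarrow>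
      (a \<otimes>\<^bsub>fib A y\<^esub> b) \<otimes>\<^bsub>fib A y\<^esub> c = a \<otimes>\<^bsub>fib A y\<^esub> (b \<otimes>\<^bsub>fib A y\<^esub> c)"
    using A by (simp_all add: g_banach_algebra_def)
  have usc: "usc_field (spc Y) A"
    using gA by (simp add: g_banach_space_def)
  show ?thesis
    unfolding g_banach_algebra_def
  proof (intro conjI ballI)
    show "g_banach_space G (push_algebra G Y A) (gact (push_algebra G Y A))"
      using push_g_banach_space[OF gA] by (simp add: g_banach_space_def usc_field_def pullback_push_algebra)
    show "contractive_bilinear_field (obj G) (push_algebra G Y A) (push_algebra G Y A) (push_algebra G Y A)
        (\<lambda>x a b. a \<otimes>\<^bsub>fib (push_algebra G Y A) x\<^esub> b)"
      using push_contractive_bilinear[OF cA usc usc usc]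
      by (simp add: push_bilinear_mult contractive_bilinear_field_def)
    show "equivariant_bilinear G (push_algebra G Y A) (gact (push_algebra G Y A)) (push_algebra G Y A)
        (gact (push_algebra G Y A)) (gact (push_algebra G Y A)) (\<lambda>x a b. a \<otimes>\<^bsub>fib (push_algebra G Y A) x\<^esub> b)"
      using push_equivariant_bilinear[OF eA usc usc]
      by (simp add: push_bilinear_mult equivariant_bilinear_def)
    fix x a b c assume "a \<in> carrier (fib (push_algebra G Y A) x)" "b \<in> carrier (fib (push_algebra G Y A) x)"
      "c \<in> carrier (fib (push_algebra G Y A) x)"
    then have m: "a y \<in> carrier (fib A y)" "b y \<in> carrier (fib A y)" "c y \<in> carrier (fib A y)" if "y \<in> Yf x" for y
      using push_mem[OF usc _ that] by simp_all
    show "a \<otimes>\<^bsub>fib (push_algebra G Y A) x\<^esub> b \<otimes>\<^bsub>fib (push_algebra G Y A) x\<^esub> c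
      = a \<otimes>\<^bsub>fib (push_algebra G Y A) x\<^esub> (b \<otimes>\<^bsub>fib (push_algebra G Y A) x\<^esub> c)"
      using m assoc by (auto simp: push_fibre_simps(2) anchor_fibre_iff intro!: restrict_ext)
  qed
qed

lemma push_left_g_module:
  assumes E: "left_g_module TG A E \<alpha> \<mu>" and A: "usc_field (spc Y) A"
  shows "left_g_module G (push_algebra G Y A) (push_field G Y E) (push_action G Y \<alpha>) (push_bilinear Y \<mu>)"
proof -
  have gE: "g_banach_space TG E \<alpha>" and c: "contractive_bilinear_field (spc Y) A E E \<mu>"
    and e: "equivariant_bilinear TG A (gact A) E \<alpha> \<alpha> \<mu>"
    and assoc: "\<And>y a b e. y \<in> topspace (spc Y) \<Longrightarrow> a \<in> carrier (fib A y) \<Longrightarrow> b \<in> carrier (fib A y) \<Longrightarrow> e \<in> carrier (fib E y) \<Longrightarrow>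
      \<mu> y (a \<otimes>\<^bsub>fib A y\<^esub> b) e = \<mu> y a (\<mu> y b e)"
    using E by (simp_all add: left_g_module_def)
  have usc: "usc_field (spc Y) E"
    using gE by (simp add: g_banach_space_def)
  show ?thesis
    unfolding left_g_module_def
  proof (intro conjI ballI)
    show "g_banach_space G (push_field G Y E) (push_action G Y \<alpha>)"
      by (rule push_g_banach_space[OF gE])
    show "contractive_bilinear_field (obj G) (push_algebra G Y A) (push_field G Y E) (push_field G Y E) (push_bilinear Y \<mu>)"
      using push_contractive_bilinear[OF c A usc usc] by (simp add: contractive_bilinear_field_def)
    show "equivariant_bilinear G (push_algebra G Y A) (gact (push_algebra G Y A)) (push_field G Y E) (push_action G Y \<alpha>)
        (push_action G Y \<alpha>) (push_bilinear Y \<mu>)"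
      using push_equivariant_bilinear[OF e A usc] by (simp add: equivariant_bilinear_def)
    fix x a b e assume "a \<in> carrier (fib (push_algebra G Y A) x)" "b \<in> carrier (fib (push_algebra G Y A) x)"
      "e \<in> carrier (fib (push_field G Y E) x)"
    then have m: "a y \<in> carrier (fib A y)" "b y \<in> carrier (fib A y)" "e y \<in> carrier (fib E y)" if "y \<in> Yf x" for y
      using push_mem[OF A _ that] push_mem[OF usc _ that] by simp_all
    show "push_bilinear Y \<mu> x (a \<otimes>\<^bsub>fib (push_algebra G Y A) x\<^esub> b) e = push_bilinear Y \<mu> x a (push_bilinear Y \<mu> x b e)"
      using m assoc by (auto simp: push_fibre_simps(2) push_bilinear_def anchor_fibre_iff intro!: restrict_ext)
  qed
qed

lemma push_right_g_module:
  assumes E: "right_g_module TG A E \<alpha> \<mu>" and A: "usc_field (spc Y) A"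
  shows "right_g_module G (push_algebra G Y A) (push_field G Y E) (push_action G Y \<alpha>) (push_bilinear Y \<mu>)"
proof -
  have gE: "g_banach_space TG E \<alpha>" and c: "contractive_bilinear_field (spc Y) E A E \<mu>"
    and e: "equivariant_bilinear TG E \<alpha> A (gact A) \<alpha> \<mu>"
    and assoc: "\<And>y a b e. y \<in> topspace (spc Y) \<Longrightarrow> a \<in> carrier (fib A y) \<Longrightarrow> b \<in> carrier (fib A y) \<Longrightarrow> e \<in> carrier (fib E y) \<Longrightarrow>
      \<mu> y e (a \<otimes>\<^bsub>fib A y\<^esub> b) = \<mu> y (\<mu> y e a) b"
    using E by (simp_all add: right_g_module_def)
  have usc: "usc_field (spc Y) E"
    using gE by (simp add: g_banach_space_def)
  show ?thesis
    unfolding right_g_module_def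
  proof (intro conjI ballI)
    show "g_banach_space G (push_field G Y E) (push_action G Y \<alpha>)"
      by (rule push_g_banach_space[OF gE])
    show "contractive_bilinear_field (obj G) (push_field G Y E) (push_algebra G Y A) (push_field G Y E) (push_bilinear Y \<mu>)"
      using push_contractive_bilinear[OF c usc A usc] by (simp add: contractive_bilinear_field_def)
    show "equivariant_bilinear G (push_field G Y E) (push_action G Y \<alpha>) (push_algebra G Y A) (gact (push_algebra G Y A))
        (push_action G Y \<alpha>) (push_bilinear Y \<mu>)"
      using push_equivariant_bilinear[OF e usc A] by (simp add: equivariant_bilinear_def)
    fix x a b e assume "a \<in> carrier (fib (push_algebra G Y A) x)" "b \<in> carrier (fib (push_algebra G Y A) x)"
      "e \<in> carrier (fib (push_field G Y E) x)"
    then have m: "a y \<in> carrier (fib A y)" "b y \<in> carrier (fib A y)" "e y \<in> carrier (fib E y)" if "y \<in> Yf x" for y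
      using push_mem[OF A _ that] push_mem[OF usc _ that] by simp_all
    show "push_bilinear Y \<mu> x e (a \<otimes>\<^bsub>fib (push_algebra G Y A) x\<^esub> b) = push_bilinear Y \<mu> x (push_bilinear Y \<mu> x e a) b"
      using m assoc by (auto simp: push_fibre_simps(2) push_bilinear_def anchor_fibre_iff intro!: restrict_ext)
  qed
qed

end

lemma g_banach_algebra_usc: "g_banach_algebra G A \<Longrightarrow> usc_field (obj G) A"
  by (simp add: g_banach_algebra_def g_banach_space_def)

lemma left_g_module_usc: "left_g_module G A E \<alpha> \<mu> \<Longrightarrow> usc_field (obj G) E"
  by (simp add: left_g_module_def g_banach_space_def)

lemma right_g_module_usc: "right_g_module G A E \<alpha> \<mu> \<Longrightarrow> usc_field (obj G) E"
  by (simp add: right_g_module_def g_banach_space_def)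

lemma contractive_bilinear_mem:
  assumes "contractive_bilinear_field X E F H \<mu>" "x \<in> topspace X" "e \<in> carrier (fib E x)" "g \<in> carrier (fib F x)"
  shows "\<mu> x e g \<in> carrier (fib H x)"
proof -
  have "linear_map (fib F x) (fib H x) (\<mu> x e)"
    using assms(1-3) by (simp add: contractive_bilinear_field_def)
  then show ?thesis
    using assms(4) by (rule linear_map_mem)
qed

locale ab_pair_over = gspace_over G Y
  for G :: "('g, 'x) groupoid" and Y :: "('g, 'x, 'y) gspace" +
  fixes A :: "('g \<times> 'y, 'y, 'a) gfield" and B :: "('g \<times> 'y, 'y, 'b) gfield"
    and E :: "('g \<times> 'y, 'y, 'a, 'b, 'l, 'r) abpair"
  assumes A: "g_banach_algebra TG A" and B: "g_banach_algebra TG B" and E: "g_banach_ab_pair TG A B E"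
begin

abbreviation "PA \<equiv> push_algebra G Y A"
abbreviation "PB \<equiv> push_algebra G Y B"
abbreviation "PE \<equiv> push_pair G Y E"

lemma modules:
  "left_g_module TG B (lft E) (lact E) (lB E)" "right_g_module TG B (rgt E) (ract E) (rB E)"
  "right_g_module TG A (lft E) (lact E) (lA E)" "left_g_module TG A (rgt E) (ract E) (rA E)"
  using E by (simp_all add: g_banach_ab_pair_def g_banach_pair_def)

lemma bracket: "contractive_bilinear_field (spc Y) (lft E) (rgt E) B (brk E)"
  "equivariant_bilinear TG (lft E) (lact E) (rgt E) (ract E) (gact B) (brk E)"
  using E by (simp_all add: g_banach_ab_pair_def g_banach_pair_def)

lemma uscs: "usc_field (spc Y) A" "usc_field (spc Y) B" "usc_field (spc Y) (lft E)" "usc_field (spc Y) (rgt E)"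
  using g_banach_algebra_usc[OF A] g_banach_algebra_usc[OF B] left_g_module_usc[OF modules(1)] right_g_module_usc[OF modules(2)]
  by simp_all

lemma contr:
  "contractive_bilinear_field (spc Y) B (lft E) (lft E) (lB E)" "contractive_bilinear_field (spc Y) (rgt E) B (rgt E) (rB E)"
  "contractive_bilinear_field (spc Y) (lft E) A (lft E) (lA E)" "contractive_bilinear_field (spc Y) A (rgt E) (rgt E) (rA E)"
  using modules by (simp_all add: left_g_module_def right_g_module_def)

lemmas push_contr =
  push_contractive_bilinear[OF contr(1) uscs(2,3,3)] push_contractive_bilinear[OF contr(2) uscs(4,2,4)]
  push_contractive_bilinear[OF contr(3) uscs(3,1,3)] push_contractive_bilinear[OF contr(4) uscs(1,4,4)]
  push_contractive_bilinear[OF bracket(1) uscs(3,4,2)]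

text \<open>Closure of the pushed fibres under the operations, in the order \<open>lB\<close>,
  \<open>rB\<close>, \<open>lA\<close>, \<open>rA\<close>, \<open>brk\<close>.\<close>

lemmas push_ops_closed = push_contr[THEN contractive_bilinear_mem, simplified fib_push_field]

lemma push_ab_pair: "g_banach_ab_pair G PA PB PE"
proof -
  note m = push_mem[OF uscs(1)] push_mem[OF uscs(2)] push_mem[OF uscs(3)] push_mem[OF uscs(4)]
  have pw: "\<And>y b \<eta> \<xi>. y \<in> Yf x \<Longrightarrow> b \<in> carrier (fib B y) \<Longrightarrow> \<eta> \<in> carrier (fib (lft E) y) \<Longrightarrow> \<xi> \<in> carrier (fib (rgt E) y) \<Longrightarrow>
      brk E y (lB E y b \<eta>) \<xi> = b \<otimes>\<^bsub>fib B y\<^esub> brk E y \<eta> \<xi> \<and> brk E y \<eta> (rB E y \<xi> b) = brk E y \<eta> \<xi> \<otimes>\<^bsub>fib B y\<^esub> b"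
    "\<And>y a b \<eta>. y \<in> Yf x \<Longrightarrow> a \<in> carrier (fib A y) \<Longrightarrow> b \<in> carrier (fib B y) \<Longrightarrow> \<eta> \<in> carrier (fib (lft E) y) \<Longrightarrow>
      lA E y (lB E y b \<eta>) a = lB E y b (lA E y \<eta> a)"
    "\<And>y a b \<xi>. y \<in> Yf x \<Longrightarrow> a \<in> carrier (fib A y) \<Longrightarrow> b \<in> carrier (fib B y) \<Longrightarrow> \<xi> \<in> carrier (fib (rgt E) y) \<Longrightarrow>
      rB E y (rA E y a \<xi>) b = rA E y a (rB E y \<xi> b)"
    "\<And>y a \<eta> \<xi>. y \<in> Yf x \<Longrightarrow> a \<in> carrier (fib A y) \<Longrightarrow> \<eta> \<in> carrier (fib (lft E) y) \<Longrightarrow> \<xi> \<in> carrier (fib (rgt E) y) \<Longrightarrow>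
      brk E y (lA E y \<eta> a) \<xi> = brk E y \<eta> (rA E y a \<xi>)" for x
    using E by (simp_all add: g_banach_ab_pair_def g_banach_pair_def anchor_fibre_iff)
  have "g_banach_pair G PB PE"
    unfolding g_banach_pair_def push_pair_simps push_algebra_simps fib_push_field
  proof (intro conjI ballI)
    show "left_g_module G PB (push_field G Y (lft E)) (push_action G Y (lact E)) (push_bilinear Y (lB E))"
      by (rule push_left_g_module[OF modules(1) uscs(2)])
    show "right_g_module G PB (push_field G Y (rgt E)) (push_action G Y (ract E)) (push_bilinear Y (rB E))"
      by (rule push_right_g_module[OF modules(2) uscs(2)])
    show "contractive_bilinear_field (obj G) (push_field G Y (lft E)) (push_field G Y (rgt E)) PB (push_bilinear Y (brk E))"
      using push_contr(5) by (simp add: contractive_bilinear_field_def)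
    show "equivariant_bilinear G (push_field G Y (lft E)) (push_action G Y (lact E)) (push_field G Y (rgt E))
        (push_action G Y (ract E)) (push_action G Y (gact B)) (push_bilinear Y (brk E))"
      by (rule push_equivariant_bilinear[OF bracket(2) uscs(3,4)])
    fix x b \<eta> \<xi> assume h: "b \<in> carrier (push_fibre Y B x)" "\<eta> \<in> carrier (push_fibre Y (lft E) x)" "\<xi> \<in> carrier (push_fibre Y (rgt E) x)"
    show "push_bilinear Y (brk E) x (push_bilinear Y (lB E) x b \<eta>) \<xi> = b \<otimes>\<^bsub>push_fibre Y B x\<^esub> push_bilinear Y (brk E) x \<eta> \<xi>"
      "push_bilinear Y (brk E) x \<eta> (push_bilinear Y (rB E) x \<xi> b) = push_bilinear Y (brk E) x \<eta> \<xi> \<otimes>\<^bsub>push_fibre Y B x\<^esub> b"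
      using pw(1) m(2)[OF h(1)] m(3)[OF h(2)] m(4)[OF h(3)]
      by (auto simp: push_bilinear_def push_fibre_simps(2) intro!: restrict_ext)
  qed
  then show ?thesis
    unfolding g_banach_ab_pair_def push_pair_simps push_algebra_simps fib_push_field
  proof (intro conjI ballI)
    show "right_g_module G PA (push_field G Y (lft E)) (push_action G Y (lact E)) (push_bilinear Y (lA E))"
      by (rule push_right_g_module[OF modules(3) uscs(1)])
    show "left_g_module G PA (push_field G Y (rgt E)) (push_action G Y (ract E)) (push_bilinear Y (rA E))"
      by (rule push_left_g_module[OF modules(4) uscs(1)])
    fix x a assume a: "a \<in> carrier (push_fibre Y A x)"
    show "push_bilinear Y (lA E) x (push_bilinear Y (lB E) x b \<eta>) a = push_bilinear Y (lB E) x b (push_bilinear Y (lA E) x \<eta> a)"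
      if b: "b \<in> carrier (push_fibre Y B x)" and \<eta>: "\<eta> \<in> carrier (push_fibre Y (lft E) x)" for b \<eta>
      using pw(2) m(1)[OF a] m(2)[OF b] m(3)[OF \<eta>] by (auto simp: push_bilinear_def intro!: restrict_ext)
    show "push_bilinear Y (rB E) x (push_bilinear Y (rA E) x a \<xi>) b = push_bilinear Y (rA E) x a (push_bilinear Y (rB E) x \<xi> b)"
      if b: "b \<in> carrier (push_fibre Y B x)" and \<xi>: "\<xi> \<in> carrier (push_fibre Y (rgt E) x)" for b \<xi>
      using pw(3) m(1)[OF a] m(2)[OF b] m(4)[OF \<xi>] by (auto simp: push_bilinear_def intro!: restrict_ext)
    show "push_bilinear Y (brk E) x (push_bilinear Y (lA E) x \<eta> a) \<xi> = push_bilinear Y (brk E) x \<eta> (push_bilinear Y (rA E) x a \<xi>)"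
      if \<eta>: "\<eta> \<in> carrier (push_fibre Y (lft E) x)" and \<xi>: "\<xi> \<in> carrier (push_fibre Y (rgt E) x)" for \<eta> \<xi>
      using pw(4) m(1)[OF a] m(3)[OF \<eta>] m(4)[OF \<xi>] by (auto simp: push_bilinear_def intro!: restrict_ext)
  qed
qed

lemma push_nondegenerate_pair:
  assumes "nondegenerate_pair ndA TG A B E"
  shows "nondegenerate_pair ndA G PA PB PE"
proof -
  note nd = assms[unfolded nondegenerate_pair_def, simplified TG_simps]
  note pnd = push_nondegenerate[OF contr(1) uscs(2,3,3)] push_nondegenerate[OF contr(2) uscs(4,2,4)]
    push_nondegenerate[OF contr(3) uscs(3,1,3)] push_nondegenerate[OF contr(4) uscs(1,4,4)]
  show ?thesis
    using nd pnd unfolding nondegenerate_pair_def by (simp add: nondegenerate_def)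
qed

lemma push_graded_field:
  assumes \<sigma>: "graded_field TG F \<alpha> \<sigma>" and F: "usc_field (spc Y) F"
  shows "graded_field G (push_field G Y F) (push_action G Y \<alpha>) (push_linear Y \<sigma>)"
  unfolding graded_field_def
proof (intro conjI ballI)
  show "bounded_linear_field (obj G) (push_field G Y F) (push_field G Y F) (push_linear Y \<sigma>)"
    using \<sigma> by (intro push_bounded_linear F) (simp add: graded_field_def)
  show "equivariant_linear G (push_field G Y F) (push_action G Y \<alpha>) (push_action G Y \<alpha>) (push_linear Y \<sigma>)"
    using \<sigma> by (intro push_equivariant_linear F) (simp add: graded_field_def)
  fix x e assume "e \<in> carrier (fib (push_field G Y F) x)"
  then have e: "e \<in> carrier (push_fibre Y F x)"
    by simp
  have "\<sigma> y (\<sigma> y (e y)) = e y" if "y \<in> Yf x" for y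
    using \<sigma> push_mem[OF F e that] that by (simp add: graded_field_def anchor_fibre_iff)
  then show "push_linear Y \<sigma> x (push_linear Y \<sigma> x e) = e"
    using push_ext[OF F e] by (intro push_eqI[OF F, of _ x]) (simp_all add: push_linear_def)
qed

lemma push_graded_pair:
  assumes gr: "graded_pair TG A B E"
  shows "graded_pair G PA PB PE"
  unfolding graded_pair_def push_pair_simps push_algebra_simps fib_push_field
proof (intro conjI ballI)
  note m = push_mem[OF uscs(1)] push_mem[OF uscs(2)] push_mem[OF uscs(3)] push_mem[OF uscs(4)]
  show "graded_field G (push_field G Y (lft E)) (push_action G Y (lact E)) (push_linear Y (lgr E))"
    using gr by (intro push_graded_field uscs) (simp add: graded_pair_def)
  show "graded_field G (push_field G Y (rgt E)) (push_action G Y (ract E)) (push_linear Y (rgr E))"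
    using gr by (intro push_graded_field uscs) (simp add: graded_pair_def)
  have pw: "\<And>y \<eta> a. y \<in> Yf x \<Longrightarrow> \<eta> \<in> carrier (fib (lft E) y) \<Longrightarrow> a \<in> carrier (fib A y) \<Longrightarrow> lgr E y (lA E y \<eta> a) = lA E y (lgr E y \<eta>) a"
    "\<And>y \<eta> b. y \<in> Yf x \<Longrightarrow> \<eta> \<in> carrier (fib (lft E) y) \<Longrightarrow> b \<in> carrier (fib B y) \<Longrightarrow> lgr E y (lB E y b \<eta>) = lB E y b (lgr E y \<eta>)"
    "\<And>y \<xi> a. y \<in> Yf x \<Longrightarrow> \<xi> \<in> carrier (fib (rgt E) y) \<Longrightarrow> a \<in> carrier (fib A y) \<Longrightarrow> rgr E y (rA E y a \<xi>) = rA E y a (rgr E y \<xi>)"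
    "\<And>y \<xi> b. y \<in> Yf x \<Longrightarrow> \<xi> \<in> carrier (fib (rgt E) y) \<Longrightarrow> b \<in> carrier (fib B y) \<Longrightarrow> rgr E y (rB E y \<xi> b) = rB E y (rgr E y \<xi>) b"
    "\<And>y \<eta> \<xi>. y \<in> Yf x \<Longrightarrow> \<eta> \<in> carrier (fib (lft E) y) \<Longrightarrow> \<xi> \<in> carrier (fib (rgt E) y) \<Longrightarrow>
      brk E y (lgr E y \<eta>) (rgr E y \<xi>) = brk E y \<eta> \<xi>" for x
    using gr by (simp_all add: graded_pair_def anchor_fibre_iff)
  fix x
  show "push_linear Y (lgr E) x (push_bilinear Y (lA E) x \<eta> a) = push_bilinear Y (lA E) x (push_linear Y (lgr E) x \<eta>) a"
    if "\<eta> \<in> carrier (push_fibre Y (lft E) x)" "a \<in> carrier (push_fibre Y A x)" for \<eta> a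
    using pw(1) m(3)[OF that(1)] m(1)[OF that(2)] by (auto simp: push_bilinear_def push_linear_def intro!: restrict_ext)
  show "push_linear Y (lgr E) x (push_bilinear Y (lB E) x b \<eta>) = push_bilinear Y (lB E) x b (push_linear Y (lgr E) x \<eta>)"
    if "\<eta> \<in> carrier (push_fibre Y (lft E) x)" "b \<in> carrier (push_fibre Y B x)" for \<eta> b
    using pw(2) m(3)[OF that(1)] m(2)[OF that(2)] by (auto simp: push_bilinear_def push_linear_def intro!: restrict_ext)
  show "push_linear Y (rgr E) x (push_bilinear Y (rA E) x a \<xi>) = push_bilinear Y (rA E) x a (push_linear Y (rgr E) x \<xi>)"
    if "\<xi> \<in> carrier (push_fibre Y (rgt E) x)" "a \<in> carrier (push_fibre Y A x)" for \<xi> a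
    using pw(3) m(4)[OF that(1)] m(1)[OF that(2)] by (auto simp: push_bilinear_def push_linear_def intro!: restrict_ext)
  show "push_linear Y (rgr E) x (push_bilinear Y (rB E) x \<xi> b) = push_bilinear Y (rB E) x (push_linear Y (rgr E) x \<xi>) b"
    if "\<xi> \<in> carrier (push_fibre Y (rgt E) x)" "b \<in> carrier (push_fibre Y B x)" for \<xi> b
    using pw(4) m(4)[OF that(1)] m(2)[OF that(2)] by (auto simp: push_bilinear_def push_linear_def intro!: restrict_ext)
  show "push_bilinear Y (brk E) x (push_linear Y (lgr E) x \<eta>) (push_linear Y (rgr E) x \<xi>) = push_bilinear Y (brk E) x \<eta> \<xi>"
    if "\<eta> \<in> carrier (push_fibre Y (lft E) x)" "\<xi> \<in> carrier (push_fibre Y (rgt E) x)" for \<eta> \<xi>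
    using pw(5) m(3)[OF that(1)] m(4)[OF that(2)] by (auto simp: push_bilinear_def push_linear_def intro!: restrict_ext)
qed

text \<open>Over the identity of the unit space, \<open>E\<close> is its own pullback and its
  pushforward plays the part of the pair over the base.\<close>

lemma pair_base_change_id:
  "pair_base_change G Y (obj G) id (spc Y) (anchor Y) id (\<lambda>x y. y) B E B E PB PE"
  by (intro pair_base_change.intro base_change_id pair_base_change_axioms.intro)
    (simp_all add: uscs usc_push field_over.is_pullback_id field_over.intro push_ops_closed)

text \<open>Here the pair over the arrows of the transformation groupoid is the pullback of
  \<open>E\<close> along its range, and the pair over the arrows of \<open>G\<close> is the pullback
  of the pushforward along the range of \<open>G\<close>.\<close>

lemma pair_base_change_rng:
  "pair_base_change G Y (arr G) (rng G) (arr TG) fst (rng TG) (\<lambda>\<gamma> y. (\<gamma>, y)) B E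
    (pullback (arr TG) (rng TG) B) (pullback_pair (arr TG) (rng TG) E)
    (pullback (arr G) (rng G) PB) (pullback_pair (arr G) (rng G) PE)"
proof -
  note c = cont_rng_TG[simplified TG_simps]
  have "usc_field (arr TG) (pullback (arr TG) (rng TG) F)" "is_pullback (arr TG) (rng TG) F (pullback (arr TG) (rng TG) F)"
    "usc_field (arr G) (pullback (arr G) (rng G) (push_field G Y F))"
    "is_pullback (arr G) (rng G) (push_field G Y F) (pullback (arr G) (rng G) (push_field G Y F))"
    if "usc_field (spc Y) F" for F :: "('y, 'e) bfield"
    using field_over.pullback[OF field_over.intro[OF that] c] field_over.pullback[OF field_over.intro[OF usc_push[OF that]] cont_rng] .
  note pb = this[OF uscs(3)] this[OF uscs(4)]
  show ?thesis
    by (intro pair_base_change.intro base_change_rng pair_base_change_axioms.intro)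
      (simp_all add: uscs pb push_ops_closed pullback_pair_def, simp_all add: pullback_def)
qed

end

section \<open>Operators and cycles\<close>

context ab_pair_over
begin

lemma push_diff_eq:
  assumes F: "usc_field (spc Y) F" and \<xi>: "\<xi> \<in> carrier (push_fibre Y F x)" and \<eta>: "\<eta> \<in> carrier (push_fibre Y F x)"
  shows "\<xi> \<ominus>\<^bsub>push_fibre Y F x\<^esub> \<eta> = (\<lambda>y\<in>Yf x. \<xi> y \<ominus>\<^bsub>fib F y\<^esub> \<eta> y)"
  by (rule push_eqI[OF F push_ext[OF F normed.diff_mem[OF normed_push[OF F] \<xi> \<eta>]]])
    (simp_all add: push_diff[OF F \<xi> \<eta>])

lemma push_linear_map:
  assumes t: "bounded_linear_field (spc Y) F H t" and F: "usc_field (spc Y) F" and H: "usc_field (spc Y) H"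
    and x: "x \<in> topspace (obj G)"
  shows "linear_map (push_fibre Y F x) (push_fibre Y H x) (push_linear Y t x)"
  using push_bounded_linear[OF t F H] x
  by (simp add: bounded_linear_field_def linear_field_def bounded_linear_map_def)

text \<open>Used for oddness. Negation in the pushed fibre is pointwise only on its carrier, so the
  image under both maps must first be shown to lie there.\<close>

lemma push_anticommute:
  assumes t: "bounded_linear_field (spc Y) F F t" and s: "bounded_linear_field (spc Y) F F s"
    and F: "usc_field (spc Y) F"
    and ts: "\<And>y e. y \<in> topspace (spc Y) \<Longrightarrow> e \<in> carrier (fib F y) \<Longrightarrow> t y (s y e) = \<ominus>\<^bsub>fib F y\<^esub> s y (t y e)"
    and x: "x \<in> topspace (obj G)" and e: "e \<in> carrier (push_fibre Y F x)"
  shows "push_linear Y t x (push_linear Y s x e) = \<ominus>\<^bsub>push_fibre Y F x\<^esub> push_linear Y s x (push_linear Y t x e)"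
proof (rule push_eqI[OF F, of _ x])
  let ?u = "push_linear Y s x (push_linear Y t x e)"
  have u: "?u \<in> carrier (push_fibre Y F x)"
    using linear_map_mem[OF push_linear_map[OF s F F x] linear_map_mem[OF push_linear_map[OF t F F x] e]] .
  show "\<ominus>\<^bsub>push_fibre Y F x\<^esub> ?u \<in> extensional (Yf x)"
    using push_ext[OF F normed.smult_mem[OF normed_push[OF F] u]] normed.neg_eq_smult[OF normed_push[OF F] u] by simp
  show "push_linear Y t x (push_linear Y s x e) y = (\<ominus>\<^bsub>push_fibre Y F x\<^esub> ?u) y" if y: "y \<in> Yf x" for y
    unfolding push_neg[OF F u y] using ts push_mem[OF F e y] y by (simp add: push_linear_def anchor_fibre_iff)
qed (simp add: push_linear_def)

text \<open>Each compactness condition is reduced in the same way: a section of the pushed algebra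
  is uncurried to a section over Y or over the arrows of the transformation groupoid, the hypothesis
  gives a compact operator there, and the required operator is shown to be its lift.\<close>

lemma push_KK_cycle:
  assumes cycle: "(E, T) \<in> KK_cycles ndA TG A B"
  shows "(PE, push_op Y T) \<in> KK_cycles ndA G PA PB"
proof -
  let ?T = "push_op Y T"
  have TL: "T \<in> L_op (spc Y) B E E" and odd: "odd_op (spc Y) E T"
    and comm: "\<And>a. a \<in> sections0 (spc Y) A \<Longrightarrow>
      op_diff E E (op_comp (op_of E id a) T) (op_comp T (op_of E id a)) \<in> K_op (spc Y) B E E"
    and sq: "\<And>a. a \<in> sections0 (spc Y) A \<Longrightarrow>
      op_comp (op_of E id a) (op_diff E E (op_comp T T) op_id) \<in> K_op (spc Y) B E E"
    and inv: "\<And>a. a \<in> sections0 (arr TG) (pullback (arr TG) (rng TG) A) \<Longrightarrow>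
      op_comp (op_of E (rng TG) a) (op_diff (pullback_pair (arr TG) (rng TG) E) (pullback_pair (arr TG) (rng TG) E)
        (op_conj TG E T) (op_pullback (rng TG) T))
      \<in> K_op (arr TG) (pullback (arr TG) (rng TG) B) (pullback_pair (arr TG) (rng TG) E) (pullback_pair (arr TG) (rng TG) E)"
    and nd: "nondegenerate_pair ndA TG A B E" and gr: "graded_pair TG A B E"
    using cycle by (simp_all add: KK_cycles_def)
  interpret I: pair_base_change G Y "obj G" id "spc Y" "anchor Y" id "\<lambda>x y. y" B E B E PB PE
    by (rule pair_base_change_id)
  interpret J: pair_base_change G Y "arr G" "rng G" "arr TG" fst "rng TG" "\<lambda>\<gamma> y. (\<gamma>, y)" B E
    "pullback (arr TG) (rng TG) B" "pullback_pair (arr TG) (rng TG) E"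
    "pullback (arr G) (rng G) PB" "pullback_pair (arr G) (rng G) PE"
    by (rule pair_base_change_rng)
  have Tb: "bounded_linear_field (spc Y) (lft E) (lft E) (fst T)" "bounded_linear_field (spc Y) (rgt E) (rgt E) (snd T)"
    using TL by (simp_all add: L_op_iff)
  note Tc = push_linear_map[OF Tb(1) uscs(3,3), THEN linear_map_mem] push_linear_map[OF Tb(2) uscs(4,4), THEN linear_map_mem]
  note diff_eq = push_diff_eq[OF uscs(3)] push_diff_eq[OF uscs(4)]

  have TL': "?T \<in> L_op (obj G) PB PE PE"
    by (rule I.L_op_transfer[OF TL]) (simp add: I.lifts_def push_op_def push_linear_def)

  have gb: "bounded_linear_field (spc Y) (lft E) (lft E) (lgr E)" "bounded_linear_field (spc Y) (rgt E) (rgt E) (rgr E)"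
    using gr by (simp_all add: graded_pair_def graded_field_def)
  have odd': "odd_op (obj G) PE ?T"
    unfolding odd_op_def push_op_def fst_conv snd_conv push_pair_simps fib_push_field
    using odd by (intro ballI conjI push_anticommute Tb gb uscs) (simp_all add: odd_op_def)

  have K: "op_diff PE PE (op_comp (op_of PE id a) ?T) (op_comp ?T (op_of PE id a)) \<in> K_op (obj G) PB PE PE \<and>
      op_comp (op_of PE id a) (op_diff PE PE (op_comp ?T ?T) op_id) \<in> K_op (obj G) PB PE PE"
    if a: "a \<in> sections0 (obj G) PA" for a
  proof -
    have a0: "a \<in> sections0 (obj G) (push_field G Y A)"
      using a by (simp add: sections0_def)
    \<comment> \<open>The section of \<open>A\<close> corresponding to \<open>a\<close>. As b(y) is
      the value at y of \<open>a\<close> at the anchor of y, acting by \<open>a\<close> is the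
      pushforward of acting by \<open>b\<close>.\<close>
    define b where "b = (\<lambda>y\<in>topspace (spc Y). a (anchor Y y) y)"
    have b: "b \<in> sections0 (spc Y) A"
      using I.uncurry_section0[OF uscs(1) uscs(1) field_over.is_pullback_id[OF field_over.intro[OF uscs(1)]]
          usc_push[OF uscs(1)] field_over.is_pullback_id[OF field_over.intro[OF usc_push[OF uscs(1)]]] a0]
      by (simp add: b_def)
    have ba: "b y = a x y" if "y \<in> Yf x" for x y
      using that by (auto simp: b_def anchor_fibre_iff)
    have am: "a x \<in> carrier (push_fibre Y A x)" if "x \<in> topspace (obj G)" for x
      using field_over.sections0_mem[OF field_over.intro[OF usc_push[OF uscs(1)]] a0 that] by simp
    have "I.lifts (op_diff E E (op_comp (op_of E id b) T) (op_comp T (op_of E id b)))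
      (op_diff PE PE (op_comp (op_of PE id a) ?T) (op_comp ?T (op_of PE id a)))"
      unfolding I.lifts_def
    proof (intro ballI conjI)
      fix x assume x: "x \<in> topspace (obj G)"
      show "fst (op_diff PE PE (op_comp (op_of PE id a) ?T) (op_comp ?T (op_of PE id a))) x \<eta> =
        (\<lambda>y\<in>Yf (id x). fst (op_diff E E (op_comp (op_of E id b) T) (op_comp T (op_of E id b))) y (\<eta> y))"
        if "\<eta> \<in> carrier (push_fibre Y (lft E) (id x))" for \<eta>
      proof -
        have \<eta>: "\<eta> \<in> carrier (push_fibre Y (lft E) x)"
          using that by simp
        show ?thesis
          by (simp add: op_diff_def op_comp_def op_of_def push_op_def
              diff_eq(1)[OF Tc(1)[OF x push_ops_closed(3)[OF x \<eta> am[OF x]]] push_ops_closed(3)[OF x Tc(1)[OF x \<eta>] am[OF x]]])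
            (auto simp: push_linear_def push_bilinear_def ba intro!: restrict_ext)
      qed
      show "snd (op_diff PE PE (op_comp (op_of PE id a) ?T) (op_comp ?T (op_of PE id a))) x \<xi> =
        (\<lambda>y\<in>Yf (id x). snd (op_diff E E (op_comp (op_of E id b) T) (op_comp T (op_of E id b))) y (\<xi> y))"
        if "\<xi> \<in> carrier (push_fibre Y (rgt E) (id x))" for \<xi>
      proof -
        have \<xi>: "\<xi> \<in> carrier (push_fibre Y (rgt E) x)"
          using that by simp
        show ?thesis
          by (simp add: op_diff_def op_comp_def op_of_def push_op_def
              diff_eq(2)[OF push_ops_closed(4)[OF x am[OF x] Tc(2)[OF x \<xi>]] Tc(2)[OF x push_ops_closed(4)[OF x am[OF x] \<xi>]]])
            (auto simp: push_linear_def push_bilinear_def ba intro!: restrict_ext)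
      qed
    qed
    moreover have "I.lifts (op_comp (op_of E id b) (op_diff E E (op_comp T T) op_id))
      (op_comp (op_of PE id a) (op_diff PE PE (op_comp ?T ?T) op_id))"
      unfolding I.lifts_def
    proof (intro ballI conjI)
      fix x assume x: "x \<in> topspace (obj G)"
      show "fst (op_comp (op_of PE id a) (op_diff PE PE (op_comp ?T ?T) op_id)) x \<eta> =
        (\<lambda>y\<in>Yf (id x). fst (op_comp (op_of E id b) (op_diff E E (op_comp T T) op_id)) y (\<eta> y))"
        if "\<eta> \<in> carrier (push_fibre Y (lft E) (id x))" for \<eta>
      proof -
        have \<eta>: "\<eta> \<in> carrier (push_fibre Y (lft E) x)"
          using that by simp
        note m = push_ops_closed(3)[OF x \<eta> am[OF x]]
        show ?thesis
          by (simp add: op_diff_def op_comp_def op_of_def push_op_def op_id_def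
              diff_eq(1)[OF Tc(1)[OF x Tc(1)[OF x m]] m])
            (auto simp: push_linear_def push_bilinear_def ba intro!: restrict_ext)
      qed
      show "snd (op_comp (op_of PE id a) (op_diff PE PE (op_comp ?T ?T) op_id)) x \<xi> =
        (\<lambda>y\<in>Yf (id x). snd (op_comp (op_of E id b) (op_diff E E (op_comp T T) op_id)) y (\<xi> y))"
        if "\<xi> \<in> carrier (push_fibre Y (rgt E) (id x))" for \<xi>
      proof -
        have \<xi>: "\<xi> \<in> carrier (push_fibre Y (rgt E) x)"
          using that by simp
        show ?thesis
          by (simp add: op_diff_def op_comp_def op_of_def push_op_def op_id_def
              diff_eq(2)[OF Tc(2)[OF x Tc(2)[OF x \<xi>]] \<xi>])
            (auto simp: push_linear_def push_bilinear_def ba intro!: restrict_ext)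
      qed
    qed
    ultimately show ?thesis
      using I.K_op_transfer comm[OF b] sq[OF b] by blast
  qed

  have "op_comp (op_of PE (rng G) a) (op_diff (pullback_pair (arr G) (rng G) PE) (pullback_pair (arr G) (rng G) PE)
        (op_conj G PE ?T) (op_pullback (rng G) ?T))
      \<in> K_op (arr G) (pullback (arr G) (rng G) PB) (pullback_pair (arr G) (rng G) PE) (pullback_pair (arr G) (rng G) PE)"
    if a: "a \<in> sections0 (arr G) (pullback (arr G) (rng G) PA)" for a
  proof -
    let ?EZ = "pullback_pair (arr TG) (rng TG) E" and ?EW = "pullback_pair (arr G) (rng G) PE"
    note c = cont_rng_TG[simplified TG_simps]
    note pbA = field_over.pullback[OF field_over.intro[OF uscs(1)] c]
    note pbPA = field_over.pullback[OF field_over.intro[OF usc_push[OF uscs(1)]] cont_rng]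
    have a0: "a \<in> sections0 (arr G) (pullback (arr G) (rng G) (push_field G Y A))"
      using a by (simp add: pullback_push_algebra)
    \<comment> \<open>The same correspondence over the arrows: b(\<gamma>,y) is the value at y of
      the element a(\<gamma>) of the fibre over r(\<gamma>).\<close>
    define b where "b = (\<lambda>z\<in>topspace (arr TG). a (fst z) (rng TG z))"
    have b: "b \<in> sections0 (arr TG) (pullback (arr TG) (rng TG) A)"
      using J.uncurry_section0[OF uscs(1) pbA pbPA a0] by (simp add: b_def)
    have ba: "b (\<gamma>, y) = a \<gamma> y" if "\<gamma> \<in> topspace (arr G)" "y \<in> Yf (rng G \<gamma>)" for \<gamma> y
      using that by (simp add: b_def)
    have am: "a \<gamma> \<in> carrier (push_fibre Y A (rng G \<gamma>))" if "\<gamma> \<in> topspace (arr G)" for \<gamma>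
      using J.H_mem[OF uscs(1) pbA pbPA field_over.sections0_sec[OF field_over.intro[OF pbPA(1)] a0] that] .
    \<comment> \<open>Both operands of the difference \<gamma>T\<gamma>^{-1} - T must lie in the
      carrier before it can be evaluated pointwise.\<close>
    have act_closed: "push_action G Y \<alpha> \<gamma> \<zeta> \<in> carrier (push_fibre Y F (rng G \<gamma>))"
      if "g_banach_space TG F \<alpha>" "\<gamma> \<in> topspace (arr G)" "\<zeta> \<in> carrier (push_fibre Y F (src G \<gamma>))"
      for F :: "('y, 'c) bfield" and \<alpha> \<gamma> \<zeta>
    proof -
      have "bij_betw (push_action G Y \<alpha> \<gamma>) (carrier (push_fibre Y F (src G \<gamma>))) (carrier (push_fibre Y F (rng G \<gamma>)))"
        using push_g_banach_space[OF that(1)] that(2) by (simp add: g_banach_space_def)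
      then show ?thesis
        using that(3) by (auto simp: bij_betw_def)
    qed
    have gl: "g_banach_space TG (lft E) (lact E)" and grt: "g_banach_space TG (rgt E) (ract E)"
      using modules by (simp_all add: left_g_module_def right_g_module_def)
    have conj_closed: "push_action G Y (lact E) \<gamma> (push_linear Y (fst T) (src G \<gamma>) (push_action G Y (lact E) (ginv G \<gamma>) \<eta>))
        \<in> carrier (push_fibre Y (lft E) (rng G \<gamma>))"
      if "\<gamma> \<in> topspace (arr G)" "\<eta> \<in> carrier (push_fibre Y (lft E) (rng G \<gamma>))" for \<gamma> \<eta>
      using act_closed[OF gl ginv_mem[OF that(1)], of \<eta>] that
      by (intro act_closed[OF gl that(1)] Tc(1) src_mem) (simp_all add: src_ginv rng_ginv)
    have conj_closed': "push_action G Y (ract E) \<gamma> (push_linear Y (snd T) (src G \<gamma>) (push_action G Y (ract E) (ginv G \<gamma>) \<xi>))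
        \<in> carrier (push_fibre Y (rgt E) (rng G \<gamma>))"
      if "\<gamma> \<in> topspace (arr G)" "\<xi> \<in> carrier (push_fibre Y (rgt E) (rng G \<gamma>))" for \<gamma> \<xi>
      using act_closed[OF grt ginv_mem[OF that(1)], of \<xi>] that
      by (intro act_closed[OF grt that(1)] Tc(2) src_mem) (simp_all add: src_ginv rng_ginv)
    \<comment> \<open>At y the outer action calls for the value at \<gamma>^{-1}y, where the inner
      one acts by (\<gamma>^{-1}, \<gamma>^{-1}y) on the value of \<eta> at \<gamma>\<gamma>^{-1}y =
      y. That arrow is the inverse of (\<gamma>,y), so conjugation by \<gamma> is pointwise
      conjugation by (\<gamma>,y).\<close>
    have conj_at: "push_action G Y \<alpha> \<gamma> (push_linear Y t (src G \<gamma>) (push_action G Y \<alpha> (ginv G \<gamma>) \<eta>)) y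
        = \<alpha> (\<gamma>, y) (t (act Y (ginv G \<gamma>) y) (\<alpha> (ginv G \<gamma>, act Y (ginv G \<gamma>) y) (\<eta> y)))"
      if "\<gamma> \<in> topspace (arr G)" "y \<in> Yf (rng G \<gamma>)" for \<alpha> :: "'g \<times> 'y \<Rightarrow> 'c \<Rightarrow> 'c" and t \<gamma> \<eta> y
      using that act_ginv_mem[OF that] act_act_ginv[OF that]
      by (simp add: push_action_def push_linear_def rng_ginv ginv_ginv)
    have "J.lifts (op_comp (op_of E (rng TG) b) (op_diff ?EZ ?EZ (op_conj TG E T) (op_pullback (rng TG) T)))
      (op_comp (op_of PE (rng G) a) (op_diff ?EW ?EW (op_conj G PE ?T) (op_pullback (rng G) ?T)))"
      unfolding J.lifts_def
    proof (intro ballI conjI)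
      fix \<gamma> assume \<gamma>: "\<gamma> \<in> topspace (arr G)"
      note x = rng_mem[OF \<gamma>]
      have fibW: "fib (lft ?EW) \<gamma> = push_fibre Y (lft E) (rng G \<gamma>)" "fib (rgt ?EW) \<gamma> = push_fibre Y (rgt E) (rng G \<gamma>)"
        and fibZ: "fib (lft ?EZ) (\<gamma>, y) = fib (lft E) y" "fib (rgt ?EZ) (\<gamma>, y) = fib (rgt E) y" for y
        by (simp_all add: pullback_pair_def pullback_def)
      show "fst (op_comp (op_of PE (rng G) a) (op_diff ?EW ?EW (op_conj G PE ?T) (op_pullback (rng G) ?T))) \<gamma> \<eta> =
        (\<lambda>y\<in>Yf (rng G \<gamma>). fst (op_comp (op_of E (rng TG) b)
          (op_diff ?EZ ?EZ (op_conj TG E T) (op_pullback (rng TG) T))) (\<gamma>, y) (\<eta> y))"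
        if \<eta>: "\<eta> \<in> carrier (push_fibre Y (lft E) (rng G \<gamma>))" for \<eta>
      proof -
        note m = push_ops_closed(3)[OF x \<eta> am[OF \<gamma>]]
        show ?thesis
          unfolding op_comp_def op_of_def op_diff_def fst_conv fibW fibZ op_conj_def op_pullback_def push_op_def push_pair_simps
            diff_eq(1)[OF conj_closed[OF \<gamma> m] Tc(1)[OF x m]]
          by (rule restrict_ext) (simp add: conj_at[OF \<gamma>], simp add: push_linear_def push_bilinear_def ba[OF \<gamma>])
      qed
      show "snd (op_comp (op_of PE (rng G) a) (op_diff ?EW ?EW (op_conj G PE ?T) (op_pullback (rng G) ?T))) \<gamma> \<xi> =
        (\<lambda>y\<in>Yf (rng G \<gamma>). snd (op_comp (op_of E (rng TG) b)
          (op_diff ?EZ ?EZ (op_conj TG E T) (op_pullback (rng TG) T))) (\<gamma>, y) (\<xi> y))"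
        if \<xi>: "\<xi> \<in> carrier (push_fibre Y (rgt E) (rng G \<gamma>))" for \<xi>
        unfolding op_comp_def op_of_def op_diff_def snd_conv fibW fibZ op_conj_def op_pullback_def push_op_def push_pair_simps
          diff_eq(2)[OF conj_closed'[OF \<gamma> \<xi>] Tc(2)[OF x \<xi>]] push_bilinear_def
        by (rule restrict_ext) (simp add: conj_at[OF \<gamma>], simp add: push_linear_def ba[OF \<gamma>])
    qed
    then show ?thesis
      by (rule J.K_op_transfer[OF inv[OF b]])
  qed
  then show ?thesis
    unfolding KK_cycles_def
    using push_g_banach_algebra[OF A] push_g_banach_algebra[OF B] push_ab_pair push_nondegenerate_pair[OF nd]
      push_graded_pair[OF gr] TL' odd' K by blast
qed

end

theorem proposition1p5:
  fixes G :: "('g, 'x) groupoid"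
    and Y :: "('g, 'x, 'y) gspace"
    and A :: "('g \<times> 'y, 'y, 'a) gfield"
    and B :: "('g \<times> 'y, 'y, 'b) gfield"
    and E :: "('g \<times> 'y, 'y, 'a, 'b, 'l, 'r) abpair"
    and T :: "('y, 'l, 'r, 'l, 'r) bop"
    and ndA :: bool
  assumes "lch_groupoid G"
    and "lch_gspace G Y"
    and "g_banach_algebra (transformation_groupoid G Y) A"
    and "g_banach_algebra (transformation_groupoid G Y) B"
    and "(E, T) \<in> KK_cycles ndA (transformation_groupoid G Y) A B"
  shows "(push_pair G Y E, push_op Y T) \<in> KK_cycles ndA G (push_algebra G Y A) (push_algebra G Y B)"
proof -
  have "ab_pair_over G Y A B E"
    using assms by unfold_locales (simp_all add: KK_cycles_def)
  then show ?thesis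
    using assms(5) by (rule ab_pair_over.push_KK_cycle)
qed

end
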